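(* Let $k,\ell\in\mathbb{N}$, $T>0$, $p\ge 1$ and $\varepsilon>0$. Then the sequence $\{:\!\Psi_N^{\ell}\overline{\Psi_N}^{k}\!:\}_{N\in\mathbb{N}}$ of Wick ordered truncated monomials is a Cauchy sequence in $L^p(\Omega;C([0,T];C^{-\varepsilon}(\mathbb{T}^2)))$. Moreover, denoting its limit by $:\!\Psi^{\ell}\overline{\Psi}^{k}\!:$, one has $:\!\Psi^{\ell}\overline{\Psi}^{k}\!:\,\in C([0,T];C^{-\varepsilon}(\mathbb{T}^2))$ almost surely.
   Context: Fix $a_1,\gamma>0$ and $a_2\in\mathbb{R}$; $\mathbb{T}^2=(\mathbb{R}/2\pi\mathbb{Z})^2$. Function spaces: let $\varphi_0$ be a smooth function on $\mathbb{R}^2$ with $\varphi_0(\xi)=1$ for $|\xi|\le 5/8$ and $\varphi_0(\xi)=0$ for $|\xi|\ge 8/5$; for $j\ge1$ let $\varphi_j(\xi)=\varphi_0(\xi/2^j)-\varphi_0(\xi/2^{j-1})$, and let $\delta_j$ be the Fourier multiplier $\widehat{\delta_jf}(n)=\varphi_j(n)\widehat f(n)$, $n\in\mathbb{Z}^2$. For $s\in\mathbb{R}$ set $\|f\|_{C^s}=\sup_{j\ge0}2^{js}\|\delta_jf\|_{L^\infty(\mathbb{T}^2)}$; $C^s=C^s(\mathbb{T}^2)$ is the completion of the smooth complex-valued functions on $\mathbb{T}^2$ under this norm. Stochastic convolution: on a probability space $(\Omega,\mathcal F,\mathbb P)$ let $\{\beta_n\}_{n\in\mathbb{Z}^2}$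 be independent two-sided complex Brownian motions (real and imaginary parts independent and identically distributed, $\mathbb{E}|\beta_n(t)-\beta_n(s)|^2=|t-s|$). Let $\chi:\mathbb{R}^2\to\mathbb{R}$ be smooth with $\chi=1$ on the ball of radius $1/2$ and $\chi=0$ outside the ball of radius $1$, both centred at $0$, and let $\chi_N=\chi(\cdot/N)$. Define $$\Psi_N(x,t)=\sqrt{2\gamma}\sum_{|n|\le N}\chi_N(n)e^{in\cdot x}\int_{-\infty}^te^{-(t-t')(a_1+ia_2)(|n|^2+1)}\,d\beta_n(t'),$$ $$\sigma_N=\mathbb{E}|\Psi_N(x,t)|^2=\sum_{|n|\le N}|\chi_N(n)|^2\frac{\gamma}{a_1(|n|^2+1)}.$$ Generalized Laguerre polynomials $L_k^{(\ell)}$ are defined by $\frac{1}{(1-t)^{\ell+1}}e^{-\frac{tx}{1-t}}=\sum_{k\ge0}t^kL_k^{(\ell)}(x)$, and $L_k^{(\ell)}(x;\sigma)=\sigma^kL_k^{(\ell)}(x/\sigma)$. For $k,\ell\in\mathbb{N}$ the Wick ordered truncated monomials are $$:\!\Psi_N^k\overline{\Psi_N}^\ell\!:\;=\begin{cases}(-1)^kk!\,L_k^{(\ell-k)}(|\Psi_N|^2;\sigma_N)\,\overline{\Psi_N}^{\,\ell-k},&k<\ell,\\(-1)^\ell\ell!\,L_\ell^{(k-\ell)}(|\Psi_N|^2;\sigma_N)\,\Psi_N^{k-\ell},&\ell\le k.\end{cases}$$ *)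

theory Defs
  imports
    "HOL-Probability.Probability"
    "HOL-Computational_Algebra.Formal_Power_Series"
begin

subsection \<open>Smooth functions and Fourier series on the two-dimensional torus\<close>

fun Ck :: "nat \<Rightarrow> ('a::real_normed_vector \<Rightarrow> 'b::real_normed_vector) \<Rightarrow> bool" where
  "Ck 0 f \<longleftrightarrow> continuous_on UNIV f"
| "Ck (Suc k) f \<longleftrightarrow> (\<forall>x. f differentiable (at x)) \<and>
     (\<forall>v. Ck k (\<lambda>x. frechet_derivative f (at x) v))"

definition smooth :: "('a::real_normed_vector \<Rightarrow> 'b::real_normed_vector) \<Rightarrow> bool" where
  "smooth f \<longleftrightarrow> (\<forall>k. Ck k f)"

text \<open>Functions on the torus are functions on the plane \<^typ>\<open>real \<times> real\<close> (whose norm and inner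
  product are the Euclidean ones) that are \<open>2\<pi>\<close>-periodic in each variable.\<close>

definition smooth_torus :: "(real \<times> real \<Rightarrow> complex) \<Rightarrow> bool" where
  "smooth_torus f \<longleftrightarrow> smooth f \<and> (\<forall>x y. f (x + 2 * pi, y) = f (x, y) \<and> f (x, y + 2 * pi) = f (x, y))"

definition freq :: "int \<times> int \<Rightarrow> real \<times> real" where
  "freq n = (real_of_int (fst n), real_of_int (snd n))"

definition wave :: "int \<times> int \<Rightarrow> real \<times> real \<Rightarrow> complex" where
  "wave n x = exp (\<i> * complex_of_real (freq n \<bullet> x))"

definition fourier_coeff :: "(real \<times> real \<Rightarrow> complex) \<Rightarrow> int \<times> int \<Rightarrow> complex" where
  "fourier_coeff f n =
     (LINT x:cbox (0, 0) (2 * pi, 2 * pi)|lborel. f x * wave (- fst n, - snd n) x) / (2 * pi)\<^sup>2"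

subsection \<open>The spaces \<open>C\<^sup>s\<close>\<close>

definition LP_phi :: "(real \<times> real \<Rightarrow> real) \<Rightarrow> nat \<Rightarrow> real \<times> real \<Rightarrow> real" where
  "LP_phi \<phi>\<^sub>0 j \<xi> = (if j = 0 then \<phi>\<^sub>0 \<xi> else \<phi>\<^sub>0 (\<xi> /\<^sub>R 2 ^ j) - \<phi>\<^sub>0 (\<xi> /\<^sub>R 2 ^ (j - 1)))"

text \<open>Distributions on the torus are represented by their families \<open>u\<close> of Fourier coefficients.
  Since \<open>\<phi>\<^sub>0\<close> has compact support, \<open>\<delta>\<^sub>j u\<close> is a trigonometric polynomial for every family \<open>u\<close>: the
  index set of the sum is finite, and the essential supremum of \<open>\<delta>\<^sub>j u\<close> is its supremum.\<close>

definition LP_block ::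
  "(real \<times> real \<Rightarrow> real) \<Rightarrow> nat \<Rightarrow> (int \<times> int \<Rightarrow> complex) \<Rightarrow> real \<times> real \<Rightarrow> complex" where
  "LP_block \<phi>\<^sub>0 j u x =
     (\<Sum>n | LP_phi \<phi>\<^sub>0 j (freq n) \<noteq> 0. of_real (LP_phi \<phi>\<^sub>0 j (freq n)) * u n * wave n x)"

definition Cs_norm :: "(real \<times> real \<Rightarrow> real) \<Rightarrow> real \<Rightarrow> (int \<times> int \<Rightarrow> complex) \<Rightarrow> ennreal" where
  "Cs_norm \<phi>\<^sub>0 s u = (SUP j. ennreal (2 powr (real j * s)) * (SUP x. ennreal (cmod (LP_block \<phi>\<^sub>0 j u x))))"

text \<open>The coefficient families of finite norm form a Banach space, because \<open>\<Sum>\<^sub>j \<phi>\<^sub>j = 1\<close> lets the norm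
  control every single coefficient. The completion of the smooth functions is therefore the
  closure of (the coefficient families of) the smooth functions in it.\<close>

definition Cs :: "(real \<times> real \<Rightarrow> real) \<Rightarrow> real \<Rightarrow> (int \<times> int \<Rightarrow> complex) set" where
  "Cs \<phi>\<^sub>0 s = {u. \<exists>f. (\<forall>m::nat. smooth_torus (f m)) \<and>
      (\<lambda>m. Cs_norm \<phi>\<^sub>0 s (u - fourier_coeff (f m))) \<longlonglongrightarrow> 0}"

text \<open>Elements of \<open>C([0,T]; C\<^sup>s)\<close> are functions on the real line of which only the restriction to
  \<open>[0,T]\<close> matters: two of them are identified if the norm of their difference is 0.\<close>

definition CT_norm ::
  "(real \<times> real \<Rightarrow> real) \<Rightarrow> real \<Rightarrow> real \<Rightarrow> (real \<Rightarrow> int \<times> int \<Rightarrow> complex) \<Rightarrow> ennreal" where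
  "CT_norm \<phi>\<^sub>0 s T u = (SUP t\<in>{0..T}. Cs_norm \<phi>\<^sub>0 s (u t))"

definition CT :: "(real \<times> real \<Rightarrow> real) \<Rightarrow> real \<Rightarrow> real \<Rightarrow> (real \<Rightarrow> int \<times> int \<Rightarrow> complex) set" where
  "CT \<phi>\<^sub>0 s T = {u. \<forall>t\<in>{0..T}. u t \<in> Cs \<phi>\<^sub>0 s \<and>
      ((\<lambda>r. Cs_norm \<phi>\<^sub>0 s (u r - u t)) \<longlongrightarrow> 0) (at t within {0..T})}"

subsection \<open>Bochner \<open>L\<^sup>p\<close> spaces\<close>

text \<open>A normed space is given by a carrier \<open>B\<close> and a norm \<open>\<nu>\<close>. Elements of \<open>L\<^sup>p(\<Omega>; B)\<close> are
  represented by functions, whose values have to lie in \<open>B\<close> only almost surely.\<close>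

definition ennreal_powr :: "ennreal \<Rightarrow> real \<Rightarrow> ennreal" where
  "ennreal_powr y p = (if y = \<top> then \<top> else ennreal (enn2real y powr p))"

definition strongly_measurable ::
  "'w measure \<Rightarrow> 'b set \<Rightarrow> ('b \<Rightarrow> ennreal) \<Rightarrow> ('w \<Rightarrow> 'b::minus) \<Rightarrow> bool" where
  "strongly_measurable M B \<nu> X \<longleftrightarrow>
     (\<exists>S. (\<forall>i::nat. simple_function M (S i) \<and> S i ` space M \<subseteq> B) \<and>
          (AE \<omega> in M. (\<lambda>i. \<nu> (S i \<omega> - X \<omega>)) \<longlonglongrightarrow> 0))"

definition Lp_norm :: "'w measure \<Rightarrow> ('b \<Rightarrow> ennreal) \<Rightarrow> real \<Rightarrow> ('w \<Rightarrow> 'b) \<Rightarrow> ennreal" where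
  "Lp_norm M \<nu> p X = ennreal_powr (\<integral>\<^sup>+\<omega>. ennreal_powr (\<nu> (X \<omega>)) p \<partial>M) (1 / p)"

definition Lp :: "'w measure \<Rightarrow> 'b set \<Rightarrow> ('b \<Rightarrow> ennreal) \<Rightarrow> real \<Rightarrow> ('w \<Rightarrow> 'b::minus) set" where
  "Lp M B \<nu> p = {X. strongly_measurable M B \<nu> X \<and> (AE \<omega> in M. X \<omega> \<in> B) \<and> Lp_norm M \<nu> p X < \<top>}"

definition Lp_Cauchy ::
  "'w measure \<Rightarrow> 'b set \<Rightarrow> ('b \<Rightarrow> ennreal) \<Rightarrow> real \<Rightarrow> (nat \<Rightarrow> 'w \<Rightarrow> 'b::minus) \<Rightarrow> bool" where
  "Lp_Cauchy M B \<nu> p X \<longleftrightarrow> (\<forall>N. X N \<in> Lp M B \<nu> p) \<and>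
     (\<forall>e>0. \<exists>N\<^sub>0. \<forall>m\<ge>N\<^sub>0. \<forall>n\<ge>N\<^sub>0. Lp_norm M \<nu> p (\<lambda>\<omega>. X m \<omega> - X n \<omega>) < ennreal e)"

definition Lp_limit ::
  "'w measure \<Rightarrow> 'b set \<Rightarrow> ('b \<Rightarrow> ennreal) \<Rightarrow> real \<Rightarrow> (nat \<Rightarrow> 'w \<Rightarrow> 'b::minus) \<Rightarrow> ('w \<Rightarrow> 'b) \<Rightarrow> bool" where
  "Lp_limit M B \<nu> p X Y \<longleftrightarrow> Y \<in> Lp M B \<nu> p \<and> (\<lambda>N. Lp_norm M \<nu> p (\<lambda>\<omega>. X N \<omega> - Y \<omega>)) \<longlonglongrightarrow> 0"

subsection \<open>Brownian motions and the stochastic convolution\<close>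

definition real_BM :: "'w measure \<Rightarrow> real \<Rightarrow> (real \<Rightarrow> 'w \<Rightarrow> real) \<Rightarrow> bool" where
  "real_BM M v W \<longleftrightarrow>
     (\<forall>t. W t \<in> borel_measurable M) \<and>
     (AE \<omega> in M. W 0 \<omega> = 0) \<and>
     (\<forall>s t. s < t \<longrightarrow> distributed M lborel (\<lambda>\<omega>. W t \<omega> - W s \<omega>)
        (\<lambda>x. ennreal (normal_density 0 (sqrt (v * (t - s))) x))) \<and>
     (\<forall>m (\<tau> :: nat \<Rightarrow> real). (\<forall>i<m. \<tau> i < \<tau> (Suc i)) \<longrightarrow>
        prob_space.indep_vars M (\<lambda>_. borel) (\<lambda>i \<omega>. W (\<tau> (Suc i)) \<omega> - W (\<tau> i) \<omega>) {..<m}) \<and>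
     (AE \<omega> in M. continuous_on UNIV (\<lambda>t. W t \<omega>))"

text \<open>The variance parameter \<open>1/2\<close> of the real and imaginary parts expresses the normalization
  \<open>E|\<beta>(t) - \<beta>(s)|\<^sup>2 = |t - s|\<close>; see \<open>complex_BM_variance\<close> below.\<close>

definition complex_BM :: "'w measure \<Rightarrow> (real \<Rightarrow> 'w \<Rightarrow> complex) \<Rightarrow> bool" where
  "complex_BM M \<beta> \<longleftrightarrow>
     real_BM M (1/2) (\<lambda>t \<omega>. Re (\<beta> t \<omega>)) \<and> real_BM M (1/2) (\<lambda>t \<omega>. Im (\<beta> t \<omega>)) \<and>
     prob_space.indep_var M (PiM UNIV (\<lambda>_::real. borel)) (\<lambda>\<omega> t. Re (\<beta> t \<omega>))
                            (PiM UNIV (\<lambda>_::real. borel)) (\<lambda>\<omega> t. Im (\<beta> t \<omega>))"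

lemma real_BM_second_moment:
  assumes "prob_space M" "real_BM M v W" "v > 0" "s < t"
  shows "has_bochner_integral M (\<lambda>\<omega>. (W t \<omega> - W s \<omega>)\<^sup>2) (v * (t - s))"
proof -
  define \<sigma> where "\<sigma> = sqrt (v * (t - s))"
  have \<sigma>: "\<sigma> > 0" "\<sigma>\<^sup>2 = v * (t - s)"
    using assms by (auto simp: \<sigma>_def)
  have D: "distributed M lborel (\<lambda>\<omega>. W t \<omega> - W s \<omega>) (\<lambda>x. ennreal (normal_density 0 \<sigma> x))"
    using assms(2,4) by (auto simp: real_BM_def \<sigma>_def)
  have N: "has_bochner_integral lborel (\<lambda>x. normal_density 0 \<sigma> x * x\<^sup>2) (\<sigma>\<^sup>2)"
  proof -
    have "(fact (2 * 1) / ((2 / \<sigma>\<^sup>2) ^ 1 * fact 1) :: real) = \<sigma>\<^sup>2"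
      by (simp add: fact_numeral)
    then show ?thesis
      using normal_moment_even[OF \<sigma>(1), of 0 1] by simp
  qed
  have "integrable M (\<lambda>\<omega>. (W t \<omega> - W s \<omega>)\<^sup>2)"
    using distributed_integrable[OF D, of "\<lambda>x. x\<^sup>2"] N by (auto simp: has_bochner_integral_iff)
  moreover have "(\<integral>\<omega>. (W t \<omega> - W s \<omega>)\<^sup>2 \<partial>M) = \<sigma>\<^sup>2"
    using distributed_integral[OF D, of "\<lambda>x. x\<^sup>2"] N by (auto simp: has_bochner_integral_iff)
  ultimately show ?thesis
    using \<sigma> by (simp add: has_bochner_integral_iff)
qed

lemma complex_BM_variance:
  assumes "prob_space M" "complex_BM M \<beta>"
  shows "(\<integral>\<omega>. (cmod (\<beta> t \<omega> - \<beta> s \<omega>))\<^sup>2 \<partial>M) = \<bar>t - s\<bar>"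
proof -
  have *: "(\<integral>\<omega>. (cmod (\<beta> t \<omega> - \<beta> s \<omega>))\<^sup>2 \<partial>M) = t - s" if "s < t" for s t
  proof -
    have "has_bochner_integral M
       (\<lambda>\<omega>. (Re (\<beta> t \<omega>) - Re (\<beta> s \<omega>))\<^sup>2 + (Im (\<beta> t \<omega>) - Im (\<beta> s \<omega>))\<^sup>2)
       (1/2 * (t - s) + 1/2 * (t - s))"
      using assms that unfolding complex_BM_def
      by (intro has_bochner_integral_add real_BM_second_moment) auto
    then show ?thesis
      by (simp add: has_bochner_integral_iff cmod_power2 field_simps)
  qed
  show ?thesis
    using *[of s t] *[of t s]
    by (cases s t rule: linorder_cases) (simp_all add: norm_minus_commute)
qed

text \<open>Wiener integral of a deterministic function \<open>f \<in> L\<^sup>2\<close> of the real line: the \<open>L\<^sup>2\<close>-limit of the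
  integrals of step functions converging to \<open>f\<close> in \<open>L\<^sup>2\<close>. The list \<open>cs\<close> of triples \<open>(c, a, b)\<close>
  represents the step function with value \<open>\<Sum> c\<close> over the triples with \<open>r \<in> (a, b]\<close>. The random
  variable \<open>I\<close> is determined up to null sets.\<close>

definition step_fun :: "(complex \<times> real \<times> real) list \<Rightarrow> real \<Rightarrow> complex" where
  "step_fun cs r = (\<Sum>(c, a, b)\<leftarrow>cs. c * indicator {a<..b} r)"

definition step_integral ::
  "(complex \<times> real \<times> real) list \<Rightarrow> (real \<Rightarrow> 'w \<Rightarrow> complex) \<Rightarrow> 'w \<Rightarrow> complex" where
  "step_integral cs \<beta> \<omega> = (\<Sum>(c, a, b)\<leftarrow>cs. c * (\<beta> b \<omega> - \<beta> a \<omega>))"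

definition has_wiener_integral ::
  "'w measure \<Rightarrow> (real \<Rightarrow> 'w \<Rightarrow> complex) \<Rightarrow> (real \<Rightarrow> complex) \<Rightarrow> ('w \<Rightarrow> complex) \<Rightarrow> bool" where
  "has_wiener_integral M \<beta> f I \<longleftrightarrow> I \<in> borel_measurable M \<and>
     (\<exists>cs :: nat \<Rightarrow> (complex \<times> real \<times> real) list.
        (\<forall>m. \<forall>(c, a, b)\<in>set (cs m). a \<le> b) \<and>
        (\<lambda>m. \<integral>\<^sup>+r. ennreal ((cmod (step_fun (cs m) r - f r))\<^sup>2) \<partial>lborel) \<longlonglongrightarrow> 0 \<and>
        (\<lambda>m. \<integral>\<^sup>+\<omega>. ennreal ((cmod (step_integral (cs m) \<beta> \<omega> - I \<omega>))\<^sup>2) \<partial>M) \<longlonglongrightarrow> 0)"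

text \<open>\<open>Z\<close> is a continuous version of the process whose value at time \<open>t\<close> is the integral of
  \<open>exp (- (t - t') \<mu>) d\<beta>(t')\<close> over \<open>t' \<le> t\<close>. For each \<open>t\<close> that integral is defined only up to a null
  set, so membership in \<open>C([0,T]; C\<^sup>s)\<close> makes sense only for such a version; it is unique up to
  indistinguishability.\<close>

definition OU_process ::
  "'w measure \<Rightarrow> (real \<Rightarrow> 'w \<Rightarrow> complex) \<Rightarrow> complex \<Rightarrow> (real \<Rightarrow> 'w \<Rightarrow> complex) \<Rightarrow> bool" where
  "OU_process M \<beta> \<mu> Z \<longleftrightarrow>
     (\<forall>t. has_wiener_integral M \<beta> (\<lambda>t'. indicator {..t} t' * exp (- of_real (t - t') * \<mu>)) (Z t)) \<and>
     (AE \<omega> in M. continuous_on UNIV (\<lambda>t. Z t \<omega>))"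

definition decay_rate :: "real \<Rightarrow> real \<Rightarrow> int \<times> int \<Rightarrow> complex" where
  "decay_rate a\<^sub>1 a\<^sub>2 n = Complex a\<^sub>1 a\<^sub>2 * of_real ((norm (freq n))\<^sup>2 + 1)"

definition Psi ::
  "real \<Rightarrow> (real \<times> real \<Rightarrow> real) \<Rightarrow> (int \<times> int \<Rightarrow> real \<Rightarrow> 'w \<Rightarrow> complex) \<Rightarrow>
   nat \<Rightarrow> real \<times> real \<Rightarrow> real \<Rightarrow> 'w \<Rightarrow> complex" where
  "Psi \<gamma> \<rho> Z N x t \<omega> = of_real (sqrt (2 * \<gamma>)) *
     (\<Sum>n | norm (freq n) \<le> real N. of_real (\<rho> (freq n /\<^sub>R real N)) * wave n x * Z n t \<omega>)"

subsection \<open>Wick ordered monomials\<close>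

definition laguerre :: "nat \<Rightarrow> nat \<Rightarrow> real \<Rightarrow> real" where
  "laguerre k l x =
     fps_nth (inverse ((1 - fps_X) ^ (l + 1)) * (fps_exp (- x) oo (fps_X * inverse (1 - fps_X)))) k"

definition laguerre_scaled :: "nat \<Rightarrow> nat \<Rightarrow> real \<Rightarrow> real \<Rightarrow> real" where
  "laguerre_scaled k l x \<sigma> = \<sigma> ^ k * laguerre k l (x / \<sigma>)"

definition wick :: "nat \<Rightarrow> nat \<Rightarrow> real \<Rightarrow> complex \<Rightarrow> complex" where
  "wick k l \<sigma> z =
     (if k < l then (-1) ^ k * fact k * of_real (laguerre_scaled k (l - k) ((cmod z)\<^sup>2) \<sigma>) * cnj z ^ (l - k)
      else (-1) ^ l * fact l * of_real (laguerre_scaled l (k - l) ((cmod z)\<^sup>2) \<sigma>) * z ^ (k - l))"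

text \<open>The variance \<open>\<sigma>\<^sub>N = E|\<Psi>\<^sub>N(x,t)|\<^sup>2\<close> does not depend on \<open>(x,t)\<close>.\<close>

definition sigma_N ::
  "'w measure \<Rightarrow> real \<Rightarrow> (real \<times> real \<Rightarrow> real) \<Rightarrow> (int \<times> int \<Rightarrow> real \<Rightarrow> 'w \<Rightarrow> complex) \<Rightarrow>
   nat \<Rightarrow> real \<times> real \<Rightarrow> real \<Rightarrow> real" where
  "sigma_N M \<gamma> \<rho> Z N x t = (\<integral>\<omega>. (cmod (Psi \<gamma> \<rho> Z N x t \<omega>))\<^sup>2 \<partial>M)"

text \<open>\<open>wick_monomial \<dots> k l N \<omega> t\<close> is the family of Fourier coefficients of the \<open>N\<close>-th Wick ordered
  truncated monomial of degree \<open>k\<close> in \<open>\<Psi>\<^sub>N\<close> and \<open>l\<close> in its conjugate at time \<open>t\<close>.\<close>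

definition wick_monomial ::
  "'w measure \<Rightarrow> real \<Rightarrow> (real \<times> real \<Rightarrow> real) \<Rightarrow> (int \<times> int \<Rightarrow> real \<Rightarrow> 'w \<Rightarrow> complex) \<Rightarrow>
   nat \<Rightarrow> nat \<Rightarrow> nat \<Rightarrow> 'w \<Rightarrow> real \<Rightarrow> int \<times> int \<Rightarrow> complex" where
  "wick_monomial M \<gamma> \<rho> Z k l N \<omega> t =
     fourier_coeff (\<lambda>x. wick k l (sigma_N M \<gamma> \<rho> Z N x t) (Psi \<gamma> \<rho> Z N x t \<omega>))"

end

theory Submission imports Defs "HOL-Computational_Algebra.Polynomial"
begin

text \<open>
  Why the theorem is true. Up to lower order terms a Wick monomial of \<open>\<Psi>\<close> is a product of \<open>k\<close> factors \<open>\<Psi>\<close> and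
  \<open>l\<close> conjugated factors, and Wick ordering removes the contractions between them. This is captured by
  averaging over an independent copy \<open>\<Psi>'\<close> of the field: the Wick monomial is the conditional expectation
  of \<open>(\<Psi> + \<Psi>')\<^sup>k\<close> times the conjugate of \<open>(\<Psi> - \<Psi>')\<^sup>l\<close>, given \<open>\<Psi>\<close> (\<open>chermite_integral\<close>). The two
  factors are independent circular Gaussians, so after a conjugation of the second one everything is a
  holomorphic homogeneous polynomial in an orthonormal family of circular Gaussians. For such a polynomial \<open>F\<close> of
  degree \<open>d\<close>, integration by parts gives \<open>E|F|\<^sup>2 \<le> d! \<Sum> |c|\<^sup>2\<close> in terms of its coefficients. Since \<open>F\<^sup>q\<close>
  is again holomorphic, higher moments are second moments of powers (\<open>hypercontractivity\<close>), and Jensen's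
  inequality removes the copy (\<open>wick_chaos_moment\<close>). The Laguerre form of the Wick monomials agrees with this one
  as soon as the variance is positive (\<open>wick_eq_chermite\<close>).

  The moment bound is first obtained on finite grids of Brownian increments, where all variables are functions
  of finitely many independent Gaussians (\<open>increment_law\<close>), and then passes to the Wiener integrals by
  Fatou's lemma (\<open>increment_block_moment\<close>). What remains is a sum over tuples of frequencies of products of
  covariances \<open>1 / (1 + |n|\<^sup>2)\<close>. In two dimensions convolving such weights loses an arbitrarily small power
  (\<open>lattice_convolution\<close>), so the \<open>j\<close>-th Littlewood-Paley block at a point has moments that grow at most
  like a small power of \<open>2\<^sup>j\<close>. The same holds for time increments with a gain of a small power of the
  time difference, because the kernel of the stochastic convolution is Hoelder continuous in time
  (\<open>ou_kernel_bounds\<close>), and for the difference of two truncations with a gain of a small power of the cutoff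
  (\<open>wick_coef_cutoff_diff\<close>). A block is a trigonometric polynomial, so its spatial supremum is
  controlled by an integral (\<open>nikolskii\<close>); its supremum in time is controlled by increments over dyadic times
  (\<open>chaining_bound\<close>). For large moments the weight \<open>2 powr (- j * \<epsilon>)\<close> pays for both, and summing over \<open>j\<close>
  bounds the norm in \<open>C([0,T]; C\<^sup>-\<^sup>\<epsilon>)\<close> (\<open>sup_moment\<close>).

  The limit is found by the usual proof of completeness: a fast subsequence converges almost surely in
  the norm (\<open>Lp_limit_Y\<close>). Norms of random paths need not be measurable functions, so every estimate is
  made for a measurable majorant. Strong measurability comes from a countable family of paths that is dense among
  the continuous paths with finitely many frequencies (\<open>coded_path_dense\<close>).
\<close>

section \<open>Gaussian integration by parts and moments of homogeneous chaoses\<close>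


definition gauss :: "real \<Rightarrow> real measure" where
  "gauss s = density lborel (\<lambda>x. ennreal (normal_density 0 s x))"

lemma sets_gauss [measurable_cong, simp]: "sets (gauss s) = sets borel"
  by (simp add: gauss_def)

lemma space_gauss [simp]: "space (gauss s) = UNIV"
  by (simp add: gauss_def)

lemma prob_space_gauss: "s > 0 \<Longrightarrow> prob_space (gauss s)"
  unfolding gauss_def by (rule prob_space_normal_density)

lemma gauss_has_integralI:
  fixes f :: "real \<Rightarrow> real"
  assumes "has_bochner_integral lborel (\<lambda>x. normal_density 0 s x * f x) c" "f \<in> borel_measurable borel"
  shows "has_bochner_integral (gauss s) f c"
  unfolding gauss_def
  using assms by (intro has_bochner_integral_density) auto

lemma gauss_moment:
  assumes s: "s > 0"
  shows "has_bochner_integral (gauss s) (\<lambda>x. x ^ (2 * k)) (fact (2 * k) / ((2 / s\<^sup>2) ^ k * fact k))"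
    and "has_bochner_integral (gauss s) (\<lambda>x. x ^ (2 * k + 1)) 0"
  using normal_moment_even[OF s, of 0 k] normal_moment_odd[OF s, of 0 k]
  by (auto intro!: gauss_has_integralI)

lemma gauss_integrable_power: "s > 0 \<Longrightarrow> integrable (gauss s) (\<lambda>x. x ^ n)"
  using gauss_moment[of s "n div 2"]
  by (cases "even n") (auto simp: has_bochner_integral_iff elim!: oddE)

lemma gauss_moment_rec:
  assumes s: "s > 0"
  shows "(\<integral>x. x * x ^ n \<partial>gauss s) = s\<^sup>2 * real n * (\<integral>x. x ^ (n - 1) \<partial>gauss s)"
proof (cases "even n")
  case True
  then obtain k where k: "n = 2 * k" by blast
  have "(\<integral>x. x * x ^ n \<partial>gauss s) = 0"
    using gauss_moment(2)[OF s, of k] by (simp add: k has_bochner_integral_iff)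
  moreover have "k > 0 \<Longrightarrow> (\<integral>x. x ^ (n - 1) \<partial>gauss s) = 0"
    using gauss_moment(2)[OF s, of "k - 1"]
    by (cases k) (simp_all add: k has_bochner_integral_iff)
  ultimately show ?thesis by (cases "k = 0") (auto simp: k)
next
  case False
  then obtain k where k: "n = 2 * k + 1" using oddE by blast
  have "(\<integral>x. x * x ^ n \<partial>gauss s) = fact (2 * Suc k) / ((2 / s\<^sup>2) ^ Suc k * fact (Suc k))"
    using gauss_moment(1)[OF s, of "Suc k"] by (simp add: k has_bochner_integral_iff)
  moreover have "(\<integral>x. x ^ (n - 1) \<partial>gauss s) = fact (2 * k) / ((2 / s\<^sup>2) ^ k * fact k)"
    using gauss_moment(1)[OF s, of k] by (simp add: k has_bochner_integral_iff)
  moreover have "(fact (2 * Suc k) :: real) / ((2 / s\<^sup>2) ^ Suc k * fact (Suc k))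
      = s\<^sup>2 * real n * (fact (2 * k) / ((2 / s\<^sup>2) ^ k * fact k))"
  proof -
    have "(fact (2 * Suc k) :: real) / (D * (2 / s\<^sup>2) * (real (Suc k) * F))
      = s\<^sup>2 * real n * (fact (2 * k) / (D * F))" if "D \<noteq> 0" "F \<noteq> 0" for D F :: real
    proof -
      have "(fact (2 * Suc k) :: real) = 2 * real (Suc k) * real n * fact (2 * k)"
        by (simp add: k field_simps)
      then show ?thesis using that s by (simp add: divide_simps)
    qed
    from this[of "(2 / s\<^sup>2) ^ k" "fact k"] show ?thesis using s by (simp add: mult_ac)
  qed
  ultimately show ?thesis by simp
qed

lemma pderiv_sum: "pderiv (\<Sum>i\<in>A. f i) = (\<Sum>i\<in>A. pderiv (f i))"
  by (induction A rule: infinite_finite_induct) (auto simp: pderiv_add)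

lemma gauss_integrable_poly:
  fixes p :: "complex poly"
  assumes s: "s > 0"
  shows "integrable (gauss s) (\<lambda>x. poly p (of_real x))"
  unfolding poly_altdef of_real_power[symmetric]
  using gauss_integrable_power[OF s]
  by (intro Bochner_Integration.integrable_sum integrable_mult_right integrable_of_real) auto

text \<open>By linearity the claim reduces to monomials, for which it is the recursion between the moments.\<close>

lemma gauss_integration_by_parts:
  fixes p :: "complex poly"
  assumes s: "s > 0"
  shows "(\<integral>x. of_real x * poly p (of_real x) \<partial>gauss s)
       = of_real (s\<^sup>2) * (\<integral>x. poly (pderiv p) (of_real x) \<partial>gauss s)"
proof -
  have mon: "(\<integral>x. of_real x * poly (monom c n) (of_real x) \<partial>gauss s)
       = of_real (s\<^sup>2) * (\<integral>x. poly (pderiv (monom c n)) (of_real x) \<partial>gauss s)" for c :: complex and n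
  proof -
    have "(\<integral>x. of_real x * poly (monom c n) (of_real x) \<partial>gauss s)
        = (\<integral>x. c * complex_of_real (x * x ^ n) \<partial>gauss s)"
      by (simp add: poly_monom algebra_simps)
    also have "\<dots> = c * of_real (s\<^sup>2 * real n * (\<integral>x. x ^ (n - 1) \<partial>gauss s))"
      by (simp only: integral_mult_right_zero integral_complex_of_real gauss_moment_rec[OF s])
    also have "\<dots> = of_real (s\<^sup>2) * (\<integral>x. (of_nat n * c) * complex_of_real (x ^ (n - 1)) \<partial>gauss s)"
      by (simp only: integral_mult_right_zero integral_complex_of_real) simp
    also have "\<dots> = of_real (s\<^sup>2) * (\<integral>x. poly (pderiv (monom c n)) (of_real x) \<partial>gauss s)"
      by (simp add: pderiv_monom poly_monom)
    finally show ?thesis .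
  qed
  have eq: "p = (\<Sum>i\<le>degree p. monom (coeff p i) i)" (is "p = ?S")
    by (simp add: poly_as_sum_of_monoms)
  have int: "integrable (gauss s) (\<lambda>x. of_real x * poly q (of_real x))" for q :: "complex poly"
    using gauss_integrable_poly[OF s, of "pCons 0 q"] by simp
  have "(\<integral>x. of_real x * poly ?S (of_real x) \<partial>gauss s)
      = (\<Sum>i\<le>degree p. (\<integral>x. of_real x * poly (monom (coeff p i) i) (of_real x) \<partial>gauss s))"
    unfolding poly_sum sum_distrib_left by (intro Bochner_Integration.integral_sum int)
  also have "\<dots> = of_real (s\<^sup>2) * (\<Sum>i\<le>degree p. (\<integral>x. poly (pderiv (monom (coeff p i) i)) (of_real x) \<partial>gauss s))"
    unfolding mon sum_distrib_left ..
  also have "\<dots> = of_real (s\<^sup>2) * (\<integral>x. poly (pderiv ?S) (of_real x) \<partial>gauss s)"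
    unfolding pderiv_sum poly_sum
    by (subst Bochner_Integration.integral_sum) (auto intro!: gauss_integrable_poly[OF s])
  finally show ?thesis using eq by simp
qed

definition del :: "nat \<Rightarrow> 'a list \<Rightarrow> 'a list" where
  "del i xs = take i xs @ drop (Suc i) xs"

lemma del_Cons [simp]: "del 0 (x # xs) = xs" "del (Suc i) (x # xs) = x # del i xs"
  by (simp_all add: del_def)

lemma length_del [simp]: "i < length xs \<Longrightarrow> length (del i xs) = length xs - 1"
  by (simp add: del_def)

lemma set_del_subset: "set (del i xs) \<subseteq> set xs"
  by (auto simp: del_def dest: in_set_takeD in_set_dropD)

lemma map_del: "del i (map f xs) = map f (del i xs)"
  by (simp add: del_def take_map drop_map)

lemma del_append:
  "del i (xs @ ys) = (if i < length xs then del i xs @ ys else xs @ del (i - length xs) ys)"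
  by (auto simp: del_def Suc_diff_le)

lemma pderiv_prod_list:
  fixes ps :: "'a::{comm_semiring_1, semiring_no_zero_divisors} poly list"
  shows "pderiv (prod_list ps) = (\<Sum>i<length ps. pderiv (ps ! i) * prod_list (del i ps))"
proof (induction ps)
  case (Cons p ps)
  then show ?case
    by (simp add: sum.lessThan_Suc_shift pderiv_mult sum_distrib_left algebra_simps del: sum.lessThan_Suc)
qed (simp add: pderiv_1)

lemma prod_list_count:
  fixes f :: "'a \<Rightarrow> 'b::comm_monoid_mult"
  assumes "finite A" "set xs \<subseteq> A"
  shows "prod_list (map f xs) = (\<Prod>a\<in>A. f a ^ count_list xs a)"
  using assms(2)
proof (induction xs)
  case (Cons x xs)
  have "(\<Prod>a\<in>A. f a ^ count_list (x # xs) a) = (\<Prod>a\<in>A. (if a = x then f a else 1) * f a ^ count_list xs a)"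
    by (intro prod.cong) auto
  also have "\<dots> = (\<Prod>a\<in>A. if a = x then f a else 1) * (\<Prod>a\<in>A. f a ^ count_list xs a)"
    by (rule prod.distrib)
  also have "(\<Prod>a\<in>A. if a = x then f a else 1) = f x"
    using assms(1) Cons.prems by (subst prod.delta) auto
  finally show ?case using Cons by simp
qed simp

text \<open>Independent centred Gaussians with standard deviations \<open>s j\<close>. An affine function of them is a pair of its
  constant term and its coefficients.\<close>

locale gaussian_product =
  fixes J :: "'j set" and s :: "'j \<Rightarrow> real"
  assumes finJ: "finite J" and s_pos: "\<And>j. s j > 0"
begin

definition G :: "('j \<Rightarrow> real) measure" where "G = PiM J (\<lambda>j. gauss (s j))"

sublocale gp: product_prob_space "\<lambda>j. gauss (s j)" J
  by (intro product_prob_spaceI prob_space_gauss s_pos)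

sublocale G: prob_space G
  unfolding G_def by (intro prob_space_PiM prob_space_gauss s_pos)

definition ev :: "complex \<times> ('j \<Rightarrow> complex) \<Rightarrow> ('j \<Rightarrow> real) \<Rightarrow> complex" where
  "ev w x = fst w + (\<Sum>j\<in>J. snd w j * of_real (x j))"

text \<open>The covariance, without conjugation, of two linear functions of the coordinates.\<close>

definition BB :: "('j \<Rightarrow> complex) \<Rightarrow> ('j \<Rightarrow> complex) \<Rightarrow> complex" where
  "BB a b = (\<Sum>j\<in>J. of_real ((s j)\<^sup>2) * a j * b j)"

lemma coord_measurable [measurable]: "j \<in> J \<Longrightarrow> (\<lambda>x. x j) \<in> borel_measurable G"
  unfolding G_def by measurable

lemma ev_measurable [measurable]: "ev w \<in> borel_measurable G"
  unfolding ev_def by measurable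

lemma integrable_monomial:
  assumes "set js \<subseteq> J"
  shows "integrable G (\<lambda>x. prod_list (map (\<lambda>j. complex_of_real (x j)) js))"
proof -
  have "integrable G (\<lambda>x. \<Prod>j\<in>J. complex_of_real (x j ^ count_list js j))"
    unfolding G_def using finJ gauss_integrable_power[OF s_pos]
    by (intro gp.product_integrable_prod integrable_of_real) auto
  then show ?thesis
    by (simp add: prod_list_count[OF finJ assms])
qed

text \<open>The list of coordinates is an accumulator: expanding the factors \<open>ev w\<close> one after the other turns
  each product into monomials.\<close>

lemma integrable_prod_ev_aux:
  assumes "set js \<subseteq> J"
  shows "integrable G (\<lambda>x. prod_list (map (\<lambda>j. complex_of_real (x j)) js) * prod_list (map (\<lambda>w. ev w x) ls))"
  using assms
proof (induction ls arbitrary: js)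
  case (Cons l ls)
  let ?m = "\<lambda>js x. prod_list (map (\<lambda>j. complex_of_real (x j)) js) :: complex"
  let ?p = "\<lambda>x. prod_list (map (\<lambda>w. ev w x) ls)"
  have "integrable G (\<lambda>x. fst l * (?m js x * ?p x) + (\<Sum>j\<in>J. snd l j * (?m (j # js) x * ?p x)))"
    using Cons.prems
    by (intro Bochner_Integration.integrable_add Bochner_Integration.integrable_sum
        integrable_mult_right Cons.IH) auto
  moreover have "fst l * (?m js x * ?p x) + (\<Sum>j\<in>J. snd l j * (?m (j # js) x * ?p x))
      = ?m js x * prod_list (map (\<lambda>w. ev w x) (l # ls))" for x
    by (simp add: ev_def sum_distrib_left sum_distrib_right algebra_simps)
  ultimately show ?case by simp
qed (simp add: integrable_monomial)

lemma integrable_prod_ev: "integrable G (\<lambda>x. prod_list (map (\<lambda>w. ev w x) ls))"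
  using integrable_prod_ev_aux[of "[]" ls] by simp

text \<open>With the other coordinates frozen, the product of the affine functions is a polynomial in the
  \<open>j\<close>-th coordinate, to which one-dimensional integration by parts applies. Its derivative removes one
  factor at a time.\<close>

lemma gaussian_ibp_coordinate:
  assumes j: "j \<in> J"
  shows "(\<integral>x. of_real (x j) * prod_list (map (\<lambda>w. ev w x) ls) \<partial>G)
     = (\<Sum>i<length ls. of_real ((s j)\<^sup>2) * snd (ls ! i) j * (\<integral>x. prod_list (map (\<lambda>w. ev w x) (del i ls)) \<partial>G))"
proof -
  define J' where "J' = J - {j}"
  have J: "J = insert j J'" "finite J'" "j \<notin> J'" using j finJ by (auto simp: J'_def)
  have G: "G = PiM (insert j J') (\<lambda>j. gauss (s j))" unfolding G_def J(1)[symmetric] ..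
  define f where "f x w = [: fst w + (\<Sum>i\<in>J'. snd w i * of_real (x i)), snd w j :]"
    for x and w :: "complex \<times> ('j \<Rightarrow> complex)"
  have ev: "ev w (x(j := y)) = poly (f x w) (of_real y)" for x y w
  proof -
    have "(\<Sum>i\<in>J'. snd w i * complex_of_real ((x(j := y)) i)) = (\<Sum>i\<in>J'. snd w i * of_real (x i))"
      using J by (intro sum.cong) auto
    then show ?thesis
      unfolding ev_def unfolding J(1) using J(2,3) by (simp add: f_def algebra_simps)
  qed
  have prod_ev: "prod_list (map (\<lambda>w. ev w (x(j := y))) ls) = poly (prod_list (map (f x) ls)) (of_real y)"
    for x y ls
    by (induction ls) (simp_all add: ev del: fun_upd_apply)
  have int0: "integrable G (\<lambda>x. of_real (x j) * prod_list (map (\<lambda>w. ev w x) ls))"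
    using integrable_prod_ev_aux[of "[j]" ls] j by simp
  have int1: "integrable G (\<lambda>x. \<Sum>i<length ls. snd (ls ! i) j * prod_list (map (\<lambda>w. ev w x) (del i ls)))"
    by (intro Bochner_Integration.integrable_sum integrable_mult_right integrable_prod_ev)
  have "(\<integral>x. of_real (x j) * prod_list (map (\<lambda>w. ev w x) ls) \<partial>G)
     = (\<integral>x. \<integral>y. of_real y * poly (prod_list (map (f x) ls)) (of_real y) \<partial>gauss (s j) \<partial>PiM J' (\<lambda>j. gauss (s j)))"
    using int0 unfolding G
    by (subst gp.product_integral_insert[OF J(2,3)]) (simp_all add: prod_ev del: fun_upd_apply, simp)
  also have "\<dots> = (\<integral>x. of_real ((s j)\<^sup>2) * (\<integral>y. poly (pderiv (prod_list (map (f x) ls))) (of_real y) \<partial>gauss (s j))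
       \<partial>PiM J' (\<lambda>j. gauss (s j)))"
    by (subst gauss_integration_by_parts[OF s_pos]) simp
  also have "\<dots> = of_real ((s j)\<^sup>2) * (\<integral>x. (\<integral>y. poly (pderiv (prod_list (map (f x) ls))) (of_real y) \<partial>gauss (s j))
       \<partial>PiM J' (\<lambda>j. gauss (s j)))"
    by simp
  also have "(\<lambda>x y. poly (pderiv (prod_list (map (f x) ls))) (of_real y))
      = (\<lambda>x y. \<Sum>i<length ls. snd (ls ! i) j * prod_list (map (\<lambda>w. ev w (x(j := y))) (del i ls)))"
    by (intro ext) (simp add: pderiv_prod_list poly_sum prod_ev map_del f_def pderiv_pCons)
  also have "(\<integral>x. \<integral>y. (\<Sum>i<length ls. snd (ls ! i) j * prod_list (map (\<lambda>w. ev w (x(j := y))) (del i ls))) \<partial>gauss (s j) \<partial>PiM J' (\<lambda>j. gauss (s j)))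
     = (\<integral>x. (\<Sum>i<length ls. snd (ls ! i) j * prod_list (map (\<lambda>w. ev w x) (del i ls))) \<partial>G)"
    using int1 unfolding G
    by (subst gp.product_integral_insert[OF J(2,3)]) simp_all
  also have "\<dots> = (\<Sum>i<length ls. snd (ls ! i) j * (\<integral>x. prod_list (map (\<lambda>w. ev w x) (del i ls)) \<partial>G))"
    by (subst Bochner_Integration.integral_sum)
      (auto intro!: sum.cong integrable_mult_right integrable_prod_ev)
  finally show ?thesis by (simp add: sum_distrib_left mult.assoc)
qed

text \<open>Wick's rule: a linear factor is contracted with each of the remaining factors in turn.\<close>

lemma gaussian_ibp:
  "(\<integral>x. ev (0, a) x * prod_list (map (\<lambda>w. ev w x) ls) \<partial>G)
   = (\<Sum>i<length ls. BB a (snd (ls ! i)) * (\<integral>x. prod_list (map (\<lambda>w. ev w x) (del i ls)) \<partial>G))"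
proof -
  let ?p = "\<lambda>x. prod_list (map (\<lambda>w. ev w x) ls)"
  have "(\<integral>x. ev (0, a) x * ?p x \<partial>G) = (\<integral>x. (\<Sum>j\<in>J. a j * (of_real (x j) * ?p x)) \<partial>G)"
    by (simp add: ev_def sum_distrib_right mult.assoc)
  also have "\<dots> = (\<Sum>j\<in>J. a j * (\<integral>x. of_real (x j) * ?p x \<partial>G))"
    using integrable_prod_ev_aux[of "[j]" ls for j]
    by (subst Bochner_Integration.integral_sum) (auto intro!: integrable_mult_right)
  also have "\<dots> = (\<Sum>j\<in>J. \<Sum>i<length ls. of_real ((s j)\<^sup>2) * a j * snd (ls ! i) j *
      (\<integral>x. prod_list (map (\<lambda>w. ev w x) (del i ls)) \<partial>G))"
    by (intro sum.cong refl) (simp add: gaussian_ibp_coordinate sum_distrib_left mult_ac)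
  also have "\<dots> = (\<Sum>i<length ls. BB a (snd (ls ! i)) * (\<integral>x. prod_list (map (\<lambda>w. ev w x) (del i ls)) \<partial>G))"
    by (subst sum.swap) (simp add: BB_def sum_distrib_right)
  finally show ?thesis .
qed

end

definition tuples :: "'p set \<Rightarrow> nat \<Rightarrow> 'p list set" where
  "tuples P d = {L. set L \<subseteq> P \<and> length L = d}"

lemma finite_tuples [simp, intro]: "finite P \<Longrightarrow> finite (tuples P d)"
  unfolding tuples_def by (rule finite_lists_length_eq)

lemma tuples_0 [simp]: "tuples P 0 = {[]}"
  by (auto simp: tuples_def)

lemma sum_tuples_Suc:
  "(\<Sum>L\<in>tuples P (Suc d). f L) = (\<Sum>p\<in>P. \<Sum>L\<in>tuples P d. f (p # L))"
  unfolding sum.cartesian_product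
  by (rule sum.reindex_bij_witness[where i = "\<lambda>(p, L). p # L" and j = "\<lambda>L. (hd L, tl L)"])
     (auto simp: tuples_def length_Suc_conv)

lemma sum_tuples_add:
  "(\<Sum>L\<in>tuples P (d + d'). f L) = (\<Sum>L\<in>tuples P d. \<Sum>L'\<in>tuples P d'. f (L @ L'))"
  unfolding sum.cartesian_product
  by (rule sum.reindex_bij_witness[where i = "\<lambda>(p, L). p @ L" and j = "\<lambda>L. (take d L, drop d L)"])
     (auto simp: tuples_def dest: in_set_takeD in_set_dropD)

lemma sum_tuples_del:
  assumes "finite P" "p \<in> P" "i < Suc d"
  shows "(\<Sum>L\<in>tuples P (Suc d). if L ! i = p then h (del i L) else 0) = (\<Sum>L\<in>tuples P d. h L)"
proof -
  have "(\<Sum>L\<in>tuples P (Suc d). if L ! i = p then h (del i L) else 0)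
      = (\<Sum>L\<in>{L\<in>tuples P (Suc d). L ! i = p}. h (del i L))"
    using assms(1) by (simp add: sum.inter_filter)
  also have "\<dots> = (\<Sum>L\<in>tuples P d. h L)"
  proof (rule sum.reindex_bij_witness[where i = "\<lambda>L. take i L @ p # drop i L" and j = "del i"])
    fix L assume L: "L \<in> {L\<in>tuples P (Suc d). L ! i = p}"
    then show "take i (del i L) @ p # drop i (del i L) = L"
      using assms(3) by (auto simp: del_def tuples_def id_take_nth_drop[symmetric])
    show "del i L \<in> tuples P d" using L assms(3) set_del_subset[of i L]
      by (auto simp: tuples_def)
  next
    fix L assume L: "L \<in> tuples P d"
    then show "del i (take i L @ p # drop i L) = L" "take i L @ p # drop i L \<in> {L \<in> tuples P (Suc d). L ! i = p}"
      using assms(2,3) by (auto simp: del_def tuples_def nth_append dest: in_set_takeD in_set_dropD)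
  qed auto
  finally show ?thesis .
qed

lemma sum_lessThan_add:
  fixes f :: "nat \<Rightarrow> 'a::comm_monoid_add"
  shows "(\<Sum>i<a + b. f i) = (\<Sum>i<a. f i) + (\<Sum>i<b. f (a + i))"
  by (induction b) (auto simp: add.assoc)

text \<open>Complex Gaussians \<open>\<eta>\<^sub>p\<close> that are orthonormal and, without conjugation, uncorrelated with one another and
  with themselves. Hence only contractions of some \<open>\<eta>\<^sub>p\<close> with its own conjugate survive, and holomorphic
  polynomials in the \<open>\<eta>\<^sub>p\<close> are closed under multiplication.\<close>

locale gaussian_chaos = gaussian_product J s
  for J :: "'j set" and s +
  fixes P :: "'p set" and e :: "'p \<Rightarrow> 'j \<Rightarrow> complex"
  assumes finP: "finite P"
    and orth: "\<And>p p'. p \<in> P \<Longrightarrow> p' \<in> P \<Longrightarrow> BB (e p) (e p') = 0"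
    and orthonormal: "\<And>p p'. p \<in> P \<Longrightarrow> p' \<in> P \<Longrightarrow> BB (e p) (\<lambda>j. cnj (e p' j)) = (if p = p' then 1 else 0)"
begin

definition eta :: "'p \<Rightarrow> ('j \<Rightarrow> real) \<Rightarrow> complex" where "eta p x = ev (0, e p) x"

definition eta_prod :: "'p list \<Rightarrow> ('j \<Rightarrow> real) \<Rightarrow> complex" where "eta_prod L x = prod_list (map (\<lambda>p. eta p x) L)"

lemma eta_prod_simps [simp]: "eta_prod [] x = 1" "eta_prod (p # L) x = eta p x * eta_prod L x"
  "eta_prod (L @ L') x = eta_prod L x * eta_prod L' x"
  by (auto simp: eta_prod_def)

lemma eta_prod_cnj: "eta_prod L x * cnj (eta_prod L' x)
   = prod_list (map (\<lambda>w. ev w x) (map (\<lambda>p. (0, e p)) L @ map (\<lambda>p. (0, \<lambda>j. cnj (e p j))) L'))"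
proof -
  have "eta_prod L x = prod_list (map (\<lambda>w. ev w x) (map (\<lambda>p. (0, e p)) L))"
    by (simp add: eta_prod_def eta_def comp_def)
  moreover have "cnj (eta_prod L' x) = prod_list (map (\<lambda>w. ev w x) (map (\<lambda>p. (0, \<lambda>j. cnj (e p j))) L'))"
    by (induction L') (auto simp: eta_def ev_def)
  ultimately show ?thesis by simp
qed

lemma integrable_eta_prod: "integrable G (\<lambda>x. eta_prod L x * cnj (eta_prod L' x))"
  unfolding eta_prod_cnj by (rule integrable_prod_ev)

definition gram :: "'p list \<Rightarrow> 'p list \<Rightarrow> complex" where
  "gram L L' = (\<integral>x. eta_prod L x * cnj (eta_prod L' x) \<partial>G)"

lemma gram_Nil: "gram [] [] = 1"
  by (simp add: gram_def G.prob_space)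

text \<open>Contracting \<open>\<eta>\<^sub>p\<close> with the other unconjugated factors gives 0, so \<open>p\<close> has to be matched
  with an equal entry of the second list.\<close>

lemma gram_Cons:
  assumes "p \<in> P" "set L \<subseteq> P" "set L' \<subseteq> P"
  shows "gram (p # L) L' = (\<Sum>i<length L'. if L' ! i = p then gram L (del i L') else 0)"
proof -
  let ?l = "map (\<lambda>p. (0 :: complex, e p)) L @ map (\<lambda>p. (0, \<lambda>j. cnj (e p j))) L'"
  have "gram (p # L) L' = (\<integral>x. ev (0, e p) x * prod_list (map (\<lambda>w. ev w x) ?l) \<partial>G)"
    unfolding gram_def eta_prod_simps mult.assoc eta_prod_cnj eta_def ..
  also have "\<dots> = (\<Sum>i<length ?l. BB (e p) (snd (?l ! i)) * (\<integral>x. prod_list (map (\<lambda>w. ev w x) (del i ?l)) \<partial>G))"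
    by (rule gaussian_ibp)
  also have "\<dots> = (\<Sum>i<length L. BB (e p) (snd (?l ! i)) * (\<integral>x. prod_list (map (\<lambda>w. ev w x) (del i ?l)) \<partial>G))
     + (\<Sum>i<length L'. BB (e p) (snd (?l ! (length L + i))) * (\<integral>x. prod_list (map (\<lambda>w. ev w x) (del (length L + i) ?l)) \<partial>G))"
    by (simp only: length_append length_map sum_lessThan_add)
  also have "(\<Sum>i<length L. BB (e p) (snd (?l ! i)) * (\<integral>x. prod_list (map (\<lambda>w. ev w x) (del i ?l)) \<partial>G)) = 0"
    using assms by (intro sum.neutral) (auto simp: nth_append orth subset_iff)
  also have "(\<Sum>i<length L'. BB (e p) (snd (?l ! (length L + i))) * (\<integral>x. prod_list (map (\<lambda>w. ev w x) (del (length L + i) ?l)) \<partial>G))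
     = (\<Sum>i<length L'. if L' ! i = p then gram L (del i L') else 0)"
  proof (intro sum.cong refl)
    fix i assume "i \<in> {..<length L'}"
    then have i: "i < length L'" by simp
    then have "L' ! i \<in> P" using assms by (auto simp: subset_iff)
    moreover have "del (length L + i) ?l = map (\<lambda>p. (0, e p)) L @ map (\<lambda>p. (0, \<lambda>j. cnj (e p j))) (del i L')"
      by (subst del_append) (simp add: map_del)
    ultimately show "BB (e p) (snd (?l ! (length L + i))) * (\<integral>x. prod_list (map (\<lambda>w. ev w x) (del (length L + i) ?l)) \<partial>G)
       = (if L' ! i = p then gram L (del i L') else 0)"
      using i assms(1) by (simp add: nth_append orthonormal gram_def eta_prod_cnj[symmetric] del: map_append)
  qed
  finally show ?thesis by simp
qed

lemma gram_nonneg: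
  assumes "L \<in> tuples P d" "L' \<in> tuples P d"
  shows "\<exists>r\<ge>0. gram L L' = complex_of_real r"
  using assms
proof (induction d arbitrary: L L')
  case 0
  then show ?case by (auto simp: gram_Nil intro!: exI[of _ 1])
next
  case (Suc d)
  obtain p M where L: "L = p # M" "p \<in> P" "M \<in> tuples P d"
    using Suc.prems by (auto simp: tuples_def length_Suc_conv)
  have "\<exists>r\<ge>0. gram M (del i L') = complex_of_real r" if "i < length L'" for i
    using that Suc.prems set_del_subset[of i L']
    by (intro Suc.IH L) (auto simp: tuples_def)
  then obtain r where r: "\<And>i. i < length L' \<Longrightarrow> r i \<ge> 0 \<and> gram M (del i L') = complex_of_real (r i)"
    by metis
  have "gram L L' = of_real (\<Sum>i<length L'. if L' ! i = p then r i else 0)"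
    using L Suc.prems r by (auto simp: gram_Cons tuples_def intro!: sum.cong)
  moreover have "(\<Sum>i<length L'. if L' ! i = p then r i else 0) \<ge> 0"
    using r by (intro sum_nonneg) auto
  ultimately show ?case by blast
qed

text \<open>In total the matchings of a list with all lists of the same length are the \<open>d!\<close> bijections of
  positions.\<close>

lemma gram_sum:
  assumes "L \<in> tuples P d"
  shows "(\<Sum>L'\<in>tuples P d. gram L L') = fact d"
  using assms
proof (induction d arbitrary: L)
  case 0
  then show ?case by (auto simp: gram_Nil)
next
  case (Suc d)
  obtain p M where L: "L = p # M" "p \<in> P" "M \<in> tuples P d"
    using Suc.prems by (auto simp: tuples_def length_Suc_conv)
  have "(\<Sum>L'\<in>tuples P (Suc d). gram L L') =
      (\<Sum>L'\<in>tuples P (Suc d). \<Sum>i<Suc d. if L' ! i = p then gram M (del i L') else 0)"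
    using L by (intro sum.cong refl) (auto simp: gram_Cons tuples_def simp del: sum.lessThan_Suc)
  also have "\<dots> = (\<Sum>i<Suc d. \<Sum>L'\<in>tuples P d. gram M L')"
    by (subst sum.swap) (intro sum.cong sum_tuples_del finP L; simp)
  also have "\<dots> = fact (Suc d)"
    using Suc.IH[OF L(3)] by simp
  finally show ?case .
qed

lemma gram_cnj: "gram L' L = cnj (gram L L')"
  unfolding gram_def by (subst Bochner_Integration.integral_cnj[symmetric]) (simp add: mult.commute)

definition homog :: "nat \<Rightarrow> ('p list \<Rightarrow> complex) \<Rightarrow> ('j \<Rightarrow> real) \<Rightarrow> complex" where
  "homog d c x = (\<Sum>L\<in>tuples P d. c L * eta_prod L x)"

lemma eta_prod_measurable [measurable]: "eta_prod L \<in> borel_measurable G"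
  unfolding eta_prod_def eta_def by (induction L) auto

lemma homog_measurable [measurable]: "homog d c \<in> borel_measurable G"
  unfolding homog_def by measurable

text \<open>Schur's test: the Gram matrix is Hermitian with nonnegative entries and all its row sums are \<open>d!\<close>.\<close>

lemma homog_second_moment:
  "(\<integral>\<^sup>+x. ennreal ((cmod (homog d c x))\<^sup>2) \<partial>G) \<le> ennreal (fact d * (\<Sum>L\<in>tuples P d. (cmod (c L))\<^sup>2))"
proof -
  let ?T = "tuples P d"
  have eq: "of_real ((cmod (homog d c x))\<^sup>2) = (\<Sum>L\<in>?T. \<Sum>L'\<in>?T. (c L * cnj (c L')) * (eta_prod L x * cnj (eta_prod L' x)))" for x
    unfolding complex_norm_square homog_def cnj_sum sum_product by (simp add: mult_ac)
  have int: "integrable G (\<lambda>x. of_real ((cmod (homog d c x))\<^sup>2) :: complex)"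
    unfolding eq by (intro Bochner_Integration.integrable_sum integrable_mult_right integrable_eta_prod)
  then have int': "integrable G (\<lambda>x. (cmod (homog d c x))\<^sup>2)"
    using integrable_Re by fastforce
  have I: "(\<integral>x. of_real ((cmod (homog d c x))\<^sup>2) \<partial>G) = (\<Sum>L\<in>?T. \<Sum>L'\<in>?T. (c L * cnj (c L')) * gram L L')"
    unfolding eq gram_def
    by (subst Bochner_Integration.integral_sum, (intro Bochner_Integration.integrable_sum integrable_mult_right integrable_eta_prod)[1],
        subst Bochner_Integration.integral_sum, (intro Bochner_Integration.integrable_sum integrable_mult_right integrable_eta_prod)[1]) simp
  have re: "Re (gram L L') \<ge> 0 \<and> gram L L' = of_real (Re (gram L L')) \<and> Re (gram L' L) = Re (gram L L')"
    if "L \<in> ?T" "L' \<in> ?T" for L L'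
    using gram_nonneg[OF that] gram_cnj[of L' L] by auto
  have rsum: "(\<Sum>L'\<in>?T. Re (gram L L')) = fact d" if "L \<in> ?T" for L
  proof -
    have "Re (\<Sum>L'\<in>?T. gram L L') = fact d"
      unfolding gram_sum[OF that] by (metis Re_complex_of_real of_real_fact)
    then show ?thesis by simp
  qed
  have "(\<integral>x. (cmod (homog d c x))\<^sup>2 \<partial>G) = Re (\<integral>x. of_real ((cmod (homog d c x))\<^sup>2) \<partial>G)"
    by (simp only: integral_complex_of_real Re_complex_of_real)
  also have "\<dots> \<le> cmod (\<integral>x. of_real ((cmod (homog d c x))\<^sup>2) \<partial>G)" by (rule complex_Re_le_cmod)
  also have "\<dots> \<le> (\<Sum>L\<in>?T. \<Sum>L'\<in>?T. ((cmod (c L))\<^sup>2 / 2 + (cmod (c L'))\<^sup>2 / 2) * Re (gram L L'))"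
    unfolding I
  proof (intro sum_norm_le)
    fix L L' assume L: "L \<in> ?T" "L' \<in> ?T"
    have "norm (c L * cnj (c L') * gram L L') = cmod (c L) * cmod (c L') * Re (gram L L')"
      using re[OF L] by (metis abs_of_nonneg complex_mod_cnj norm_mult norm_of_real)
    also have "\<dots> \<le> ((cmod (c L))\<^sup>2 / 2 + (cmod (c L'))\<^sup>2 / 2) * Re (gram L L')"
      using re[OF L] sum_squares_bound[of "cmod (c L)" "cmod (c L')"]
      by (intro mult_right_mono) (auto simp: field_simps)
    finally show "norm (c L * cnj (c L') * gram L L') \<le> ((cmod (c L))\<^sup>2 / 2 + (cmod (c L'))\<^sup>2 / 2) * Re (gram L L')" .
  qed
  also have "\<dots> = (\<Sum>L\<in>?T. \<Sum>L'\<in>?T. (cmod (c L))\<^sup>2 / 2 * Re (gram L L')) + (\<Sum>L\<in>?T. \<Sum>L'\<in>?T. (cmod (c L'))\<^sup>2 / 2 * Re (gram L L'))"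
    by (simp add: sum.distrib algebra_simps)
  also have "(\<Sum>L\<in>?T. \<Sum>L'\<in>?T. (cmod (c L'))\<^sup>2 / 2 * Re (gram L L')) = (\<Sum>L\<in>?T. \<Sum>L'\<in>?T. (cmod (c L))\<^sup>2 / 2 * Re (gram L L'))"
    by (subst sum.swap) (intro sum.cong refl, use re in auto)
  also have "(\<Sum>L\<in>?T. \<Sum>L'\<in>?T. (cmod (c L))\<^sup>2 / 2 * Re (gram L L')) = (\<Sum>L\<in>?T. (cmod (c L))\<^sup>2 / 2 * fact d)"
    by (intro sum.cong refl) (simp only: sum_distrib_left[symmetric] rsum)
  also have "\<dots> + \<dots> = fact d * (\<Sum>L\<in>?T. (cmod (c L))\<^sup>2)"
    unfolding sum.distrib[symmetric] sum_distrib_left by (intro sum.cong) auto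
  finally have "(\<integral>x. (cmod (homog d c x))\<^sup>2 \<partial>G) \<le> fact d * (\<Sum>L\<in>?T. (cmod (c L))\<^sup>2)" .
  then show ?thesis
    using nn_integral_eq_integral[OF int'] by (simp add: ennreal_leI)
qed

lemma homog_mult:
  "homog d c x * homog d' c' x = homog (d + d') (\<lambda>L. c (take d L) * c' (drop d L)) x"
  and sum_homog_mult: "(\<Sum>L\<in>tuples P (d + d'). (cmod (c (take d L) * c' (drop d L)))\<^sup>2)
    = (\<Sum>L\<in>tuples P d. (cmod (c L))\<^sup>2) * (\<Sum>L\<in>tuples P d'. (cmod (c' L))\<^sup>2)"
proof -
  show "homog d c x * homog d' c' x = homog (d + d') (\<lambda>L. c (take d L) * c' (drop d L)) x"
    unfolding homog_def sum_product sum_tuples_add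
    by (intro sum.cong refl) (simp add: tuples_def mult_ac)
  show "(\<Sum>L\<in>tuples P (d + d'). (cmod (c (take d L) * c' (drop d L)))\<^sup>2)
    = (\<Sum>L\<in>tuples P d. (cmod (c L))\<^sup>2) * (\<Sum>L\<in>tuples P d'. (cmod (c' L))\<^sup>2)"
    unfolding sum_product sum_tuples_add
    by (intro sum.cong refl) (simp add: tuples_def norm_mult power_mult_distrib)
qed

text \<open>A power of a homogeneous polynomial is homogeneous, with a tensor power as coefficient family. The
  square sum of the coefficients of a tensor product is multiplicative.\<close>

lemma homog_power:
  "\<exists>c'. (\<forall>x. homog d c x ^ q = homog (q * d) c' x) \<and>
     (\<Sum>L\<in>tuples P (q * d). (cmod (c' L))\<^sup>2) = (\<Sum>L\<in>tuples P d. (cmod (c L))\<^sup>2) ^ q"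
proof (induction q)
  case 0
  show ?case by (rule exI[of _ "\<lambda>_. 1"]) (simp add: homog_def)
next
  case (Suc q)
  then obtain c' where c': "\<And>x. homog d c x ^ q = homog (q * d) c' x"
     "(\<Sum>L\<in>tuples P (q * d). (cmod (c' L))\<^sup>2) = (\<Sum>L\<in>tuples P d. (cmod (c L))\<^sup>2) ^ q" by blast
  show ?case
    by (rule exI[of _ "\<lambda>L. c (take d L) * c' (drop d L)"])
       (simp add: c' homog_mult sum_homog_mult)
qed

text \<open>The moment of order \<open>2q\<close> of a holomorphic polynomial is the second moment of its \<open>q\<close>-th power.\<close>

theorem hypercontractivity:
  "(\<integral>\<^sup>+x. ennreal (cmod (homog d c x) ^ (2 * q)) \<partial>G)
     \<le> ennreal (fact (q * d) * (\<Sum>L\<in>tuples P d. (cmod (c L))\<^sup>2) ^ q)"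
proof -
  obtain c' where c': "\<And>x. homog d c x ^ q = homog (q * d) c' x"
     "(\<Sum>L\<in>tuples P (q * d). (cmod (c' L))\<^sup>2) = (\<Sum>L\<in>tuples P d. (cmod (c L))\<^sup>2) ^ q"
    using homog_power by blast
  have "cmod (homog d c x) ^ (2 * q) = (cmod (homog (q * d) c' x))\<^sup>2" for x
    by (simp only: c'(1)[symmetric] norm_power power_even_eq)
  then show ?thesis
    using homog_second_moment[of "q * d" c'] c'(2) by simp
qed

end

section \<open>Complex Hermite polynomials as Gaussian averages\<close>


text \<open>These are the complex Hermite polynomials, the Wick powers of a circular complex Gaussian of
  variance \<open>\<sigma>\<close>. Unlike the Laguerre form, the recursion makes sense for all \<open>\<sigma>\<close>, including 0. For \<open>l = 0\<close> the
  truncated subtraction does no harm, as the second term has the factor \<open>l\<close>.\<close>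

fun chermite :: "nat \<Rightarrow> nat \<Rightarrow> real \<Rightarrow> complex \<Rightarrow> complex" where
  "chermite 0 l \<sigma> z = cnj z ^ l"
| "chermite (Suc k) l \<sigma> z = z * chermite k l \<sigma> z - of_nat l * of_real \<sigma> * chermite k (l - 1) \<sigma> z"

lemma sum_Times: "(\<Sum>p\<in>A \<times> B. h p) = (\<Sum>a\<in>A. \<Sum>b\<in>B. h (a, b))"
  by (simp add: sum.cartesian_product)

context gaussian_product
begin

lemma ev_cnj: "cnj (ev w x) = ev (cnj (fst w), \<lambda>j. cnj (snd w j)) x"
  by (simp add: ev_def)

text \<open>Both sides satisfy the same recursion in \<open>k\<close>. Integration by parts contracts a factor of the first
  kind only with factors of the second kind, because the first kind is uncorrelated with itself; the sign
  in front of \<open>\<sigma>\<close> is that of the minus in the second factor.\<close>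

lemma chermite_integral:
  assumes aa: "BB a a = 0" and ac: "BB a (\<lambda>j. cnj (a j)) = of_real \<sigma>"
  shows "(\<integral>y. (z + ev (0, a) y) ^ k * cnj (z - ev (0, a) y) ^ l \<partial>G) = chermite k l \<sigma> z"
proof -
  let ?A = "(z, a)" and ?B = "(cnj z, \<lambda>j. - cnj (a j))"
  let ?I = "\<lambda>k l. (\<integral>y. prod_list (map (\<lambda>w. ev w y) (replicate k ?A @ replicate l ?B)) \<partial>G)"
  have cc: "BB (\<lambda>j. cnj (a j)) (\<lambda>j. cnj (a j)) = 0"
  proof -
    have "BB (\<lambda>j. cnj (a j)) (\<lambda>j. cnj (a j)) = cnj (BB a a)" by (simp add: BB_def)
    then show ?thesis using aa by simp
  qed
  have BBm: "BB b (\<lambda>j. - cnj (a j)) = - BB b (\<lambda>j. cnj (a j))" for b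
    by (simp add: BB_def sum_negf)
  have del1: "del i (replicate k x @ replicate l y) = replicate k x @ replicate (l - 1) y"
    if "k \<le> i" "i < k + l" for i k l and x y :: "complex \<times> ('j \<Rightarrow> complex)"
  proof -
    have "del i (replicate l y) = replicate (l - 1) y" if "i < l" for i l
      using that by (simp add: del_def replicate_add[symmetric])
    then show ?thesis using that by (subst del_append) auto
  qed
  have intA: "integrable G (\<lambda>x. prod_list (map (\<lambda>w. ev w x) ls))" for ls by (rule integrable_prod_ev)
  have "?I k l = chermite k l \<sigma> z"
  proof (induction k arbitrary: l)
    case 0
    show ?case
    proof (induction l)
      case 0 show ?case by (simp add: G.prob_space)
    next
      case (Suc l)
      let ?p = "\<lambda>y. prod_list (map (\<lambda>w. ev w y) (replicate l ?B))"
      have "ev ?B y = cnj z + ev (0, \<lambda>j. - cnj (a j)) y" for y by (simp add: ev_def)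
      then have "?I 0 (Suc l) = (\<integral>y. cnj z * ?p y + ev (0, \<lambda>j. - cnj (a j)) y * ?p y \<partial>G)"
        by (simp add: algebra_simps)
      also have "\<dots> = cnj z * ?I 0 l + (\<integral>y. ev (0, \<lambda>j. - cnj (a j)) y * ?p y \<partial>G)"
        using intA[of "replicate l ?B"] intA[of "(0, \<lambda>j. - cnj (a j)) # replicate l ?B"]
        by (subst Bochner_Integration.integral_add) auto
      also have "(\<integral>y. ev (0, \<lambda>j. - cnj (a j)) y * ?p y \<partial>G) = 0"
        unfolding gaussian_ibp using cc by (intro sum.neutral) (auto simp: BBm, simp add: BB_def sum_negf)
      finally show ?case using Suc by simp
    qed
  next
    case (Suc k)
    let ?l = "replicate k ?A @ replicate l ?B"
    let ?p = "\<lambda>y. prod_list (map (\<lambda>w. ev w y) ?l)"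
    have "ev ?A y = z + ev (0, a) y" for y by (simp add: ev_def)
    then have "?I (Suc k) l = (\<integral>y. z * ?p y + ev (0, a) y * ?p y \<partial>G)"
      by (simp add: algebra_simps)
    also have "\<dots> = z * ?I k l + (\<integral>y. ev (0, a) y * ?p y \<partial>G)"
      using intA[of ?l] intA[of "(0, a) # ?l"]
      by (subst Bochner_Integration.integral_add) auto
    also have "(\<integral>y. ev (0, a) y * ?p y \<partial>G)
       = (\<Sum>i<k + l. BB a (snd (?l ! i)) * (\<integral>y. prod_list (map (\<lambda>w. ev w y) (del i ?l)) \<partial>G))"
      unfolding gaussian_ibp by simp
    also have "\<dots> = (\<Sum>i<l. - of_real \<sigma> * ?I k (l - 1))"
      unfolding sum_lessThan_add
      by (simp add: nth_append aa ac BBm del1 del: prod_list.append map_append)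
    finally show ?case using Suc[of l] Suc[of "l - 1"] by simp
  qed
  moreover have "(z + ev (0, a) y) ^ k * cnj (z - ev (0, a) y) ^ l
      = prod_list (map (\<lambda>w. ev w y) (replicate k ?A @ replicate l ?B))" for y
  proof -
    have "ev ?A y = z + ev (0, a) y" "ev ?B y = cnj (z - ev (0, a) y)" by (simp_all add: ev_def sum_negf)
    then show ?thesis by (simp add: prod_list_replicate)
  qed
  ultimately show ?thesis by simp
qed

end

text \<open>Jensen's inequality, for a possibly infinite right-hand side.\<close>

lemma (in prob_space) norm_integral_power_le:
  fixes f :: "'a \<Rightarrow> complex"
  assumes f: "integrable M f"
  shows "ennreal (norm (\<integral>x. f x \<partial>M) ^ (2 * q)) \<le> (\<integral>\<^sup>+x. ennreal (norm (f x) ^ (2 * q)) \<partial>M)"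
proof (cases "(\<integral>\<^sup>+x. ennreal (norm (f x) ^ (2 * q)) \<partial>M) = \<infinity>")
  case False
  have [measurable]: "f \<in> borel_measurable M" using f by auto
  have int: "integrable M (\<lambda>x. norm (f x) ^ (2 * q))"
    using False by (intro integrableI_bounded) (auto simp: top.not_eq_extremum)
  have "norm (\<integral>x. f x \<partial>M) ^ (2 * q) \<le> (\<integral>x. norm (f x) \<partial>M) ^ (2 * q)"
    by (intro power_mono integral_norm_bound) auto
  also have "\<dots> \<le> (\<integral>x. norm (f x) ^ (2 * q) \<partial>M)"
    using f int
    by (intro jensens_inequality[of _ UNIV]) (auto intro!: convex_power_even)
  finally show ?thesis
    using nn_integral_eq_integral[OF int] by (simp add: ennreal_leI)
qed simp

text \<open>Discretized white noise: real and imaginary parts of Brownian increments, indexed by a frequency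
  in \<open>T\<close> and one of \<open>R\<close> time cells. A further boolean distinguishes the noise itself (\<open>False\<close>) from an
  independent copy of it (\<open>True\<close>), over which the representation of the Wick monomials averages.\<close>

locale white_noise =
  fixes T :: "'n set" and R :: nat and s :: "nat \<Rightarrow> real"
  assumes finT: "finite T" and s_pos': "\<And>r. s r > 0"
begin

abbreviation "JJ C \<equiv> ((T \<times> {..<R}) \<times> (UNIV :: bool set)) \<times> (C :: bool set)"

definition ss :: "(('n \<times> nat) \<times> bool) \<times> bool \<Rightarrow> real" where "ss j = s (snd (fst (fst j)))"

lemma gaussian_product: "gaussian_product (JJ C) ss"
  by standard (auto simp: finT ss_def s_pos')

sublocale FF: gaussian_product "JJ {False}" ss by (rule gaussian_product)
sublocale TT: gaussian_product "JJ {True}" ss by (rule gaussian_product)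
sublocale UU: gaussian_product "JJ UNIV" ss by (rule gaussian_product)

definition PP :: "(('n \<times> bool) \<times> nat) set" where "PP = (T \<times> UNIV) \<times> {..<R}"

text \<open>The orthonormal family: noise plus copy for \<open>\<kappa>\<close>, and the conjugate of noise minus copy otherwise.
  The factor 2 normalizes, as each of them has four real parts of variance \<open>(s r)\<^sup>2\<close>. Sum and difference
  are independent, so the conjugation does not spoil the orthogonality without conjugation.\<close>

definition ee :: "('n \<times> bool) \<times> nat \<Rightarrow> (('n \<times> nat) \<times> bool) \<times> bool \<Rightarrow> complex" where
  "ee = (\<lambda>((n, \<kappa>), r) (((n', r'), part), copy). if n' = n \<and> r' = r then
     (if \<kappa> then (if part then \<i> else 1) else (if part then -\<i> else 1) * (if copy then - 1 else 1))
       / of_real (2 * s r) else 0)"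

lemma sum_JJ: "(\<Sum>j\<in>JJ C. f j) = (\<Sum>n\<in>T. \<Sum>r<R. \<Sum>c\<in>C. f (((n, r), False), c) + f (((n, r), True), c))"
proof -
  have "(\<Sum>j\<in>JJ C. f j) = (\<Sum>n\<in>T. \<Sum>r<R. \<Sum>p\<in>UNIV. \<Sum>c\<in>C. f (((n, r), p), c))"
    by (simp only: sum_Times)
  then show ?thesis by (simp add: UNIV_bool sum.distrib add.commute)
qed

lemma sum_single:
  assumes "n \<in> T" "r < R"
  shows "(\<Sum>n'\<in>T. \<Sum>r'<R. if n' = n \<and> r' = r then f n' r' else 0) = (f n r :: complex)"
proof -
  have "(\<Sum>n'\<in>T. \<Sum>r'<R. if n' = n \<and> r' = r then f n' r' else 0)
      = (\<Sum>n'\<in>T. if n' = n then (\<Sum>r'<R. if r' = r then f n' r' else 0) else 0)"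
    by (intro sum.cong refl) auto
  then show ?thesis using assms finT by simp
qed

sublocale WN: gaussian_chaos "JJ UNIV" ss PP ee
proof (unfold_locales)
  show "finite PP" using finT by (simp add: PP_def)
next
  fix p p' assume p: "p \<in> PP" "p' \<in> PP"
  obtain n \<kappa> r n' \<kappa>' r' where pp: "p = ((n, \<kappa>), r)" "p' = ((n', \<kappa>'), r')" by (metis surj_pair)
  have nr: "n \<in> T" "r < R" using p by (auto simp: pp PP_def)
  have s0: "s r \<noteq> 0" using s_pos'[of r] by simp
  let ?K = "\<lambda>f g. \<Sum>c\<in>UNIV. of_real ((s r)\<^sup>2) * f (((n, r), False), c) * g (((n, r), False), c)
                  + of_real ((s r)\<^sup>2) * f (((n, r), True), c) * (g (((n, r), True), c) :: complex)"
  have BB: "UU.BB (ee p) g = ?K (ee p) g" for g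
  proof -
    have "UU.BB (ee p) g = (\<Sum>m\<in>T. \<Sum>r'<R. if m = n \<and> r' = r then
        (\<Sum>c\<in>UNIV. of_real ((s r')\<^sup>2) * ee p (((m, r'), False), c) * g (((m, r'), False), c)
                  + of_real ((s r')\<^sup>2) * ee p (((m, r'), True), c) * (g (((m, r'), True), c) :: complex)) else 0)"
      unfolding UU.BB_def sum_JJ
      by (intro sum.cong refl) (auto simp: ee_def pp ss_def)
    also have "\<dots> = ?K (ee p) g" by (rule sum_single[OF nr])
    finally show ?thesis .
  qed
  show "UU.BB (ee p) (ee p') = 0"
    unfolding BB by (auto simp: pp ee_def UNIV_bool)
  show "UU.BB (ee p) (\<lambda>j. cnj (ee p' j)) = (if p = p' then 1 else 0)"
    unfolding BB using s0
    by (auto simp: pp ee_def UNIV_bool power2_eq_square field_simps)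
qed

definition zf :: "('n \<Rightarrow> nat \<Rightarrow> complex) \<Rightarrow> bool \<Rightarrow> 'n \<Rightarrow> ((('n \<times> nat) \<times> bool) \<times> bool \<Rightarrow> real) \<Rightarrow> complex" where
  "zf c copy n x = (\<Sum>r<R. c n r * (of_real (x (((n, r), False), copy)) + \<i> * of_real (x (((n, r), True), copy))))"

text \<open>With \<open>z\<close> the noise and \<open>z'\<close> its copy, these are \<open>z + z'\<close> and the conjugate of \<open>z - z'\<close>.\<close>

definition CC :: "('n \<Rightarrow> nat \<Rightarrow> complex) \<Rightarrow> 'n \<times> bool \<Rightarrow> ((('n \<times> nat) \<times> bool) \<times> bool \<Rightarrow> real) \<Rightarrow> complex" where
  "CC c q x = (if snd q then zf c False (fst q) x + zf c True (fst q) x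
               else cnj (zf c False (fst q) x - zf c True (fst q) x))"

definition ww :: "('n \<Rightarrow> nat \<Rightarrow> complex) \<Rightarrow> ('n \<times> bool) \<times> nat \<Rightarrow> complex" where
  "ww c = (\<lambda>((n, \<kappa>), r). (if \<kappa> then c n r else cnj (c n r)) * of_real (2 * s r))"

lemma eta_eq:
  assumes "n \<in> T" "r < R"
  shows "WN.eta ((n, \<kappa>), r) x =
    (if \<kappa> then (of_real (x (((n, r), False), False)) + \<i> * of_real (x (((n, r), True), False)))
             + (of_real (x (((n, r), False), True)) + \<i> * of_real (x (((n, r), True), True)))
     else cnj ((of_real (x (((n, r), False), False)) + \<i> * of_real (x (((n, r), True), False)))
             - (of_real (x (((n, r), False), True)) + \<i> * of_real (x (((n, r), True), True))))) / of_real (2 * s r)"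
proof -
  have "WN.eta ((n, \<kappa>), r) x = (\<Sum>m\<in>T. \<Sum>r'<R. if m = n \<and> r' = r then
      (\<Sum>c\<in>UNIV. ee ((n, \<kappa>), r) (((m, r'), False), c) * of_real (x (((m, r'), False), c))
        + ee ((n, \<kappa>), r) (((m, r'), True), c) * of_real (x (((m, r'), True), c))) else 0)"
    unfolding WN.eta_def UU.ev_def fst_conv snd_conv sum_JJ add_0
    by (intro sum.cong refl) (auto simp: ee_def)
  also have "\<dots> = (\<Sum>c\<in>UNIV. ee ((n, \<kappa>), r) (((n, r), False), c) * of_real (x (((n, r), False), c))
        + ee ((n, \<kappa>), r) (((n, r), True), c) * of_real (x (((n, r), True), c)))"
    by (rule sum_single[OF assms])
  finally show ?thesis using s_pos'[of r]
    by (simp add: ee_def UNIV_bool divide_simps)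
qed

lemma CC_eq:
  assumes "q \<in> T \<times> UNIV"
  shows "CC c q x = (\<Sum>r<R. ww c (q, r) * WN.eta (q, r) x)"
proof -
  obtain n \<kappa> where q: "q = (n, \<kappa>)" "n \<in> T" using assms by auto
  have s0: "complex_of_real (2 * s r) \<noteq> 0" for r using s_pos'[of r] by simp
  show ?thesis
    unfolding CC_def q zf_def fst_conv snd_conv if_distrib[of cnj] cnj_sum sum.distrib[symmetric] sum_subtractf[symmetric]
    using q(2) s0
    by (auto simp: ww_def eta_eq algebra_simps intro!: sum.cong)
qed

text \<open>Expanding every Wiener integral over the grid turns sums over frequencies into homogeneous
  polynomials in the orthonormal family.\<close>

lemma prod_CC_eq_homog:
  "(\<Sum>\<tau>\<in>tuples (T \<times> UNIV) d. g \<tau> * prod_list (map (\<lambda>q. CC c q x) \<tau>))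
   = WN.homog d (\<lambda>L. g (map fst L) * prod_list (map (ww c) L)) x"
proof (induction d arbitrary: g)
  case 0
  then show ?case by (simp add: WN.homog_def)
next
  case (Suc d)
  have "(\<Sum>\<tau>\<in>tuples (T \<times> UNIV) (Suc d). g \<tau> * prod_list (map (\<lambda>q. CC c q x) \<tau>))
      = (\<Sum>q\<in>T \<times> UNIV. CC c q x * (\<Sum>\<tau>\<in>tuples (T \<times> UNIV) d. g (q # \<tau>) * prod_list (map (\<lambda>q. CC c q x) \<tau>)))"
    unfolding sum_tuples_Suc sum_distrib_left by (intro sum.cong refl) (simp add: mult_ac)
  also have "\<dots> = (\<Sum>q\<in>T \<times> UNIV. \<Sum>r<R. ww c (q, r) * WN.eta (q, r) x * WN.homog d (\<lambda>L. g (q # map fst L) * prod_list (map (ww c) L)) x)"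
    unfolding Suc.IH by (intro sum.cong refl) (simp add: CC_eq sum_distrib_right)
  also have "\<dots> = (\<Sum>p\<in>PP. ww c p * WN.eta p x * WN.homog d (\<lambda>L. g (fst p # map fst L) * prod_list (map (ww c) L)) x)"
    unfolding PP_def sum.cartesian_product by (intro sum.cong refl) auto
  also have "\<dots> = WN.homog (Suc d) (\<lambda>L. g (map fst L) * prod_list (map (ww c) L)) x"
    unfolding WN.homog_def sum_tuples_Suc sum_distrib_left by (intro sum.cong refl) (simp add: mult_ac)
  finally show ?case .
qed

lemma sum_PP_Suc:
  "(\<Sum>L\<in>tuples PP (Suc d). f L) = (\<Sum>q\<in>T \<times> UNIV. \<Sum>r<R. \<Sum>L\<in>tuples PP d. f ((q, r) # L))"
  unfolding sum_tuples_Suc PP_def by (subst sum_Times) (rule refl)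

lemma grid_sum_le:
  assumes v: "\<And>q. q \<in> T \<times> UNIV \<Longrightarrow> (\<Sum>r<R. (cmod (w (q, r)))\<^sup>2) \<le> v q"
    and g: "\<And>\<tau>. g \<tau> \<ge> 0"
  shows "(\<Sum>L\<in>tuples PP d. g (map fst L) * (cmod (prod_list (map w L)))\<^sup>2)
     \<le> (\<Sum>\<tau>\<in>tuples (T \<times> UNIV) d. g \<tau> * prod_list (map v \<tau>))"
  using g
proof (induction d arbitrary: g)
  case (Suc d)
  have v0: "v q \<ge> 0" if "q \<in> T \<times> UNIV" for q
    using v[OF that] by (rule order_trans[rotated]) (auto intro: sum_nonneg)
  have "(\<Sum>L\<in>tuples PP (Suc d). g (map fst L) * (cmod (prod_list (map w L)))\<^sup>2)
     = (\<Sum>q\<in>T \<times> UNIV. (\<Sum>r<R. (cmod (w (q, r)))\<^sup>2) * (\<Sum>L\<in>tuples PP d. g (q # map fst L) * (cmod (prod_list (map w L)))\<^sup>2))"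
    unfolding sum_PP_Suc sum_product
    by (intro sum.cong refl) (simp add: norm_mult power_mult_distrib mult_ac)
  also have "\<dots> \<le> (\<Sum>q\<in>T \<times> UNIV. v q * (\<Sum>\<tau>\<in>tuples (T \<times> UNIV) d. g (q # \<tau>) * prod_list (map v \<tau>)))"
    using v v0 Suc.prems by (intro sum_mono mult_mono Suc.IH sum_nonneg mult_nonneg_nonneg) auto
  also have "\<dots> = (\<Sum>\<tau>\<in>tuples (T \<times> UNIV) (Suc d). g \<tau> * prod_list (map v \<tau>))"
    unfolding sum_tuples_Suc sum_distrib_left by (intro sum.cong refl) (simp add: mult_ac)
  finally show ?case .
qed simp

text \<open>Telescoping the difference of the products costs a factor at most 4 per step of the induction,
  by \<open>|x + y|\<^sup>2 \<le> 2|x|\<^sup>2 + 2|y|\<^sup>2\<close>.\<close>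

lemma grid_sum_diff_le:
  assumes v: "\<And>q. q \<in> T \<times> UNIV \<Longrightarrow> (\<Sum>r<R. (cmod (w (q, r)))\<^sup>2) \<le> v q"
     "\<And>q. q \<in> T \<times> UNIV \<Longrightarrow> (\<Sum>r<R. (cmod (w' (q, r)))\<^sup>2) \<le> v q"
     "\<And>q. q \<in> T \<times> UNIV \<Longrightarrow> (\<Sum>r<R. (cmod (w (q, r) - w' (q, r)))\<^sup>2) \<le> \<theta> * v q"
    and \<theta>: "\<theta> \<ge> 0" and g: "\<And>\<tau>. g \<tau> \<ge> 0"
  shows "(\<Sum>L\<in>tuples PP d. g (map fst L) * (cmod (prod_list (map w L) - prod_list (map w' L)))\<^sup>2)
     \<le> 4 ^ d * \<theta> * (\<Sum>\<tau>\<in>tuples (T \<times> UNIV) d. g \<tau> * prod_list (map v \<tau>))"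
  using g
proof (induction d arbitrary: g)
  case (Suc d)
  have v0: "v q \<ge> 0" if "q \<in> T \<times> UNIV" for q
    using v(1)[OF that] by (rule order_trans[rotated]) (auto intro: sum_nonneg)
  let ?D = "\<lambda>L. (cmod (prod_list (map w L) - prod_list (map w' L)))\<^sup>2"
  let ?E = "\<lambda>L. (cmod (prod_list (map w' L)))\<^sup>2"
  let ?S = "\<lambda>q. \<Sum>\<tau>\<in>tuples (T \<times> UNIV) d. g (q # \<tau>) * prod_list (map v \<tau>)"
  have S0: "v q * ?S q \<ge> 0" if "q \<in> T \<times> UNIV" for q
    using v0 that Suc.prems
    by (intro mult_nonneg_nonneg sum_nonneg prod_list_nonneg) (auto simp: tuples_def)
  have el: "(cmod (a * X - b * Y))\<^sup>2 \<le> 2 * (cmod a)\<^sup>2 * (cmod (X - Y))\<^sup>2 + 2 * (cmod (a - b))\<^sup>2 * (cmod Y)\<^sup>2" for a b X Y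
  proof -
    have "a * X - b * Y = a * (X - Y) + (a - b) * Y" by (simp add: algebra_simps)
    then have "cmod (a * X - b * Y) \<le> cmod a * cmod (X - Y) + cmod (a - b) * cmod Y"
      by (metis norm_mult norm_triangle_ineq)
    then have "(cmod (a * X - b * Y))\<^sup>2 \<le> (cmod a * cmod (X - Y) + cmod (a - b) * cmod Y)\<^sup>2"
      by (intro power_mono) auto
    also have "\<dots> \<le> 2 * (cmod a * cmod (X - Y))\<^sup>2 + 2 * (cmod (a - b) * cmod Y)\<^sup>2"
      using sum_squares_bound[of "cmod a * cmod (X - Y)" "cmod (a - b) * cmod Y"]
      by (simp add: power2_sum)
    finally show ?thesis by (simp add: power_mult_distrib)
  qed
  have "(\<Sum>L\<in>tuples PP (Suc d). g (map fst L) * ?D L)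
     \<le> (\<Sum>q\<in>T \<times> UNIV. \<Sum>r<R. \<Sum>L\<in>tuples PP d. g (q # map fst L) *
          (2 * (cmod (w (q, r)))\<^sup>2 * ?D L + 2 * (cmod (w (q, r) - w' (q, r)))\<^sup>2 * ?E L))"
    unfolding sum_PP_Suc using Suc.prems by (intro sum_mono) (auto intro!: mult_left_mono el)
  also have "\<dots> = (\<Sum>q\<in>T \<times> UNIV. 2 * (\<Sum>r<R. (cmod (w (q, r)))\<^sup>2) * (\<Sum>L\<in>tuples PP d. g (q # map fst L) * ?D L)
       + 2 * (\<Sum>r<R. (cmod (w (q, r) - w' (q, r)))\<^sup>2) * (\<Sum>L\<in>tuples PP d. g (q # map fst L) * ?E L))"
    unfolding mult.assoc sum_product
    by (intro sum.cong refl) (simp add: sum_distrib_left sum.distrib algebra_simps)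
  also have "\<dots> \<le> (\<Sum>q\<in>T \<times> UNIV. 2 * v q * (4 ^ d * \<theta> * ?S q) + 2 * (\<theta> * v q) * ?S q)"
    using v v0 \<theta> Suc.prems
    by (intro sum_mono add_mono mult_mono Suc.IH grid_sum_le mult_left_mono)
       (auto intro!: sum_nonneg mult_nonneg_nonneg)
  also have "\<dots> = (\<Sum>q\<in>T \<times> UNIV. (2 * 4 ^ d + 2) * \<theta> * (v q * ?S q))"
    by (intro sum.cong refl) (simp add: algebra_simps)
  also have "\<dots> \<le> (\<Sum>q\<in>T \<times> UNIV. 4 ^ Suc d * \<theta> * (v q * ?S q))"
  proof (intro sum_mono mult_right_mono S0 \<theta>)
    show "(2 * 4 ^ d + 2 :: real) \<le> 4 ^ Suc d"
      using one_le_power[of "4 :: real" d] by simp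
  qed
  also have "\<dots> = 4 ^ Suc d * \<theta> * (\<Sum>\<tau>\<in>tuples (T \<times> UNIV) (Suc d). g \<tau> * prod_list (map v \<tau>))"
    unfolding sum_tuples_Suc sum_distrib_left by (intro sum.cong refl) (simp add: mult_ac)
  finally show ?case .
qed (use \<theta> in simp)


definition zcoef :: "('n \<Rightarrow> nat \<Rightarrow> complex) \<Rightarrow> 'n \<Rightarrow> (('n \<times> nat) \<times> bool) \<times> bool \<Rightarrow> complex" where
  "zcoef c n j = (if fst (fst (fst j)) = n then c n (snd (fst (fst j))) * (if snd (fst j) then \<i> else 1) else 0)"

definition affine_CC :: "('n \<Rightarrow> nat \<Rightarrow> complex) \<Rightarrow> ((('n \<times> nat) \<times> bool) \<times> bool \<Rightarrow> real) \<Rightarrow> 'n \<times> bool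
    \<Rightarrow> complex \<times> ((('n \<times> nat) \<times> bool) \<times> bool \<Rightarrow> complex)" where
  "affine_CC c x q = (if snd q then (zf c False (fst q) x, zcoef c (fst q))
     else (cnj (zf c False (fst q) x), \<lambda>j. - cnj (zcoef c (fst q) j)))"

lemma ev_zf:
  assumes "n \<in> T"
  shows "TT.ev (0, zcoef c n) y = zf c True n y"
proof -
  have "TT.ev (0, zcoef c n) y = (\<Sum>n'\<in>T. if n' = n then zf c True n y else 0)"
    unfolding TT.ev_def fst_conv snd_conv sum_JJ add_0
  proof (intro sum.cong refl)
    fix n'
    show "(\<Sum>r<R. \<Sum>ca\<in>{True}. zcoef c n (((n', r), False), ca) * of_real (y (((n', r), False), ca)) +
        zcoef c n (((n', r), True), ca) * of_real (y (((n', r), True), ca))) = (if n' = n then zf c True n y else 0)"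
      by (cases "n' = n") (simp_all add: zcoef_def zf_def distrib_left mult.assoc)
  qed
  then show ?thesis using assms finT by simp
qed

lemma zf_merge:
  assumes "n \<in> T"
  shows "zf c False n (merge (JJ {False}) (JJ {True}) (x, y)) = zf c False n x"
    and "zf c True n (merge (JJ {False}) (JJ {True}) (x, y)) = zf c True n y"
  unfolding zf_def using assms by (intro sum.cong refl; simp add: merge_def)+

lemma ev_affine_CC:
  assumes q: "q \<in> T \<times> UNIV"
  shows "TT.ev (affine_CC c x q) y = CC c q (merge (JJ {False}) (JJ {True}) (x, y))"
proof -
  obtain n \<kappa> where q: "q = (n, \<kappa>)" "n \<in> T" using assms by auto
  have "TT.ev (z, a) y = z + TT.ev (0, a) y" "TT.ev (cnj z, \<lambda>j. - cnj (a j)) y = cnj (z - TT.ev (0, a) y)" for z a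
    by (simp_all add: TT.ev_def sum_negf)
  from this[of "zf c False n x" "zcoef c n"] show ?thesis
    unfolding ev_zf[OF q(2)]
    by (simp add: affine_CC_def CC_def q(1) zf_merge[OF q(2)])
qed

text \<open>The average over the copy, a function of the noise alone.\<close>

definition EC :: "('n \<Rightarrow> nat \<Rightarrow> complex) \<Rightarrow> ('n \<times> bool) list \<Rightarrow> ((('n \<times> nat) \<times> bool) \<times> bool \<Rightarrow> real) \<Rightarrow> complex" where
  "EC c \<tau> x = (\<integral>y. prod_list (map (\<lambda>q. CC c q (merge (JJ {False}) (JJ {True}) (x, y))) \<tau>) \<partial>TT.G)"

lemma integrable_CC:
  assumes "set \<tau> \<subseteq> T \<times> UNIV"
  shows "integrable TT.G (\<lambda>y. prod_list (map (\<lambda>q. CC c q (merge (JJ {False}) (JJ {True}) (x, y))) \<tau>))"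
proof -
  have "prod_list (map (\<lambda>q. CC c q (merge (JJ {False}) (JJ {True}) (x, y))) \<tau>)
      = prod_list (map (\<lambda>w. TT.ev w y) (map (affine_CC c x) \<tau>))" for y
    using assms by (induction \<tau>) (auto simp: ev_affine_CC)
  then show ?thesis by (simp only: TT.integrable_prod_ev)
qed

text \<open>The factor \<open>u\<close> is 0 or 1, so that a polynomial and the difference of two polynomials are treated
  at once.\<close>

definition chaos :: "nat \<Rightarrow> (('n \<times> bool) list \<Rightarrow> complex) \<Rightarrow> complex \<Rightarrow> ('n \<Rightarrow> nat \<Rightarrow> complex) \<Rightarrow> ('n \<Rightarrow> nat \<Rightarrow> complex)
     \<Rightarrow> ((('n \<times> nat) \<times> bool) \<times> bool \<Rightarrow> real) \<Rightarrow> complex" where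
  "chaos d g u c c' x = (\<Sum>\<tau>\<in>tuples (T \<times> UNIV) d. g \<tau> * (prod_list (map (\<lambda>q. CC c q x) \<tau>) - u * prod_list (map (\<lambda>q. CC c' q x) \<tau>)))"

lemma chaos_eq: "chaos d g u c c' x
   = WN.homog d (\<lambda>L. g (map fst L) * (prod_list (map (ww c) L) - u * prod_list (map (ww c') L))) x"
proof -
  have "chaos d g u c c' x = (\<Sum>\<tau>\<in>tuples (T \<times> UNIV) d. g \<tau> * prod_list (map (\<lambda>q. CC c q x) \<tau>))
      - u * (\<Sum>\<tau>\<in>tuples (T \<times> UNIV) d. g \<tau> * prod_list (map (\<lambda>q. CC c' q x) \<tau>))"
    unfolding chaos_def by (simp add: sum_subtractf sum_distrib_left algebra_simps)
  then show ?thesis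
    unfolding prod_CC_eq_homog by (simp add: WN.homog_def sum_subtractf sum_distrib_left algebra_simps)
qed

lemma chaos_moment:
  assumes v: "\<And>n. n \<in> T \<Longrightarrow> (\<Sum>r<R. (cmod (c n r))\<^sup>2 * (2 * s r)\<^sup>2) \<le> v n"
    and u: "u = 0 \<and> \<theta> = 1 \<or> u = 1 \<and>
      (\<forall>n\<in>T. (\<Sum>r<R. (cmod (c' n r))\<^sup>2 * (2 * s r)\<^sup>2) \<le> v n \<and> (\<Sum>r<R. (cmod (c n r - c' n r))\<^sup>2 * (2 * s r)\<^sup>2) \<le> \<theta> * v n)"
    and \<theta>: "\<theta> \<ge> 0"
  shows "(\<integral>\<^sup>+x. ennreal (cmod (chaos d g u c c' x) ^ (2 * q)) \<partial>UU.G)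
     \<le> ennreal (fact (q * d) * (4 ^ d * \<theta> * (\<Sum>\<tau>\<in>tuples (T \<times> UNIV) d. (cmod (g \<tau>))\<^sup>2 * prod_list (map (\<lambda>q. v (fst q)) \<tau>))) ^ q)"
proof -
  let ?c = "\<lambda>L. g (map fst L) * (prod_list (map (ww c) L) - u * prod_list (map (ww c') L))"
  let ?S = "\<Sum>\<tau>\<in>tuples (T \<times> UNIV) d. (cmod (g \<tau>))\<^sup>2 * prod_list (map (\<lambda>q. v (fst q)) \<tau>)"
  have ww: "(\<Sum>r<R. (cmod (ww c (q, r)))\<^sup>2) = (\<Sum>r<R. (cmod (c (fst q) r))\<^sup>2 * (2 * s r)\<^sup>2)" for c q
    by (intro sum.cong refl) (auto simp: ww_def norm_mult power_mult_distrib abs_mult split: prod.split)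
  have ww2: "(\<Sum>r<R. (cmod (ww c (q, r) - ww c' (q, r)))\<^sup>2) = (\<Sum>r<R. (cmod (c (fst q) r - c' (fst q) r))\<^sup>2 * (2 * s r)\<^sup>2)" for q
  proof (intro sum.cong refl)
    fix r
    have "ww c (q, r) - ww c' (q, r) = ww (\<lambda>n r. c n r - c' n r) (q, r)"
      by (auto simp: ww_def algebra_simps split: prod.split)
    then show "(cmod (ww c (q, r) - ww c' (q, r)))\<^sup>2 = (cmod (c (fst q) r - c' (fst q) r))\<^sup>2 * (2 * s r)\<^sup>2"
      by (auto simp: ww_def norm_mult power_mult_distrib abs_mult simp flip: complex_cnj_diff split: prod.split)
  qed
  have v0: "v n \<ge> 0" if "n \<in> T" for n
    using v[OF that] by (rule order_trans[rotated]) (auto intro: sum_nonneg)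
  have S0: "?S \<ge> 0"
    using v0 by (intro sum_nonneg mult_nonneg_nonneg prod_list_nonneg) (auto simp: tuples_def)
  have "(\<Sum>L\<in>tuples PP d. (cmod (?c L))\<^sup>2) \<le> 4 ^ d * \<theta> * ?S"
    using u
  proof (elim disjE conjE)
    assume u: "u = 0" "\<theta> = 1"
    have "(\<Sum>L\<in>tuples PP d. (cmod (?c L))\<^sup>2) = (\<Sum>L\<in>tuples PP d. (cmod (g (map fst L)))\<^sup>2 * (cmod (prod_list (map (ww c) L)))\<^sup>2)"
      by (simp add: u norm_mult power_mult_distrib)
    also have "\<dots> \<le> ?S"
      by (rule grid_sum_le[where g = "\<lambda>\<tau>. (cmod (g \<tau>))\<^sup>2" and v = "\<lambda>q. v (fst q)"]) (use v in \<open>auto simp: ww\<close>)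
    also have "\<dots> \<le> 4 ^ d * \<theta> * ?S"
      using S0 mult_right_mono[of 1 "4 ^ d :: real" ?S] by (simp add: u)
    finally show ?thesis .
  next
    assume u: "u = 1" and *: "\<forall>n\<in>T. (\<Sum>r<R. (cmod (c' n r))\<^sup>2 * (2 * s r)\<^sup>2) \<le> v n \<and> (\<Sum>r<R. (cmod (c n r - c' n r))\<^sup>2 * (2 * s r)\<^sup>2) \<le> \<theta> * v n"
    have "(\<Sum>L\<in>tuples PP d. (cmod (?c L))\<^sup>2) = (\<Sum>L\<in>tuples PP d. (cmod (g (map fst L)))\<^sup>2 * (cmod (prod_list (map (ww c) L) - prod_list (map (ww c') L)))\<^sup>2)"
      by (simp add: u norm_mult power_mult_distrib)
    also have "\<dots> \<le> 4 ^ d * \<theta> * ?S"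
      by (rule grid_sum_diff_le[where g = "\<lambda>\<tau>. (cmod (g \<tau>))\<^sup>2" and v = "\<lambda>q. v (fst q)"]) (use v * \<theta> in \<open>auto simp: ww ww2\<close>)
    finally show ?thesis .
  qed
  then have "fact (q * d) * (\<Sum>L\<in>tuples PP d. (cmod (?c L))\<^sup>2) ^ q \<le> fact (q * d) * (4 ^ d * \<theta> * ?S) ^ q"
    by (intro mult_left_mono power_mono sum_nonneg) auto
  then show ?thesis
    unfolding chaos_eq by (intro order_trans[OF WN.hypercontractivity] ennreal_leI)
qed

definition wick_chaos :: "nat \<Rightarrow> (('n \<times> bool) list \<Rightarrow> complex) \<Rightarrow> complex \<Rightarrow> ('n \<Rightarrow> nat \<Rightarrow> complex) \<Rightarrow> ('n \<Rightarrow> nat \<Rightarrow> complex)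
     \<Rightarrow> ((('n \<times> nat) \<times> bool) \<times> bool \<Rightarrow> real) \<Rightarrow> complex" where
  "wick_chaos d g u c c' x = (\<Sum>\<tau>\<in>tuples (T \<times> UNIV) d. g \<tau> * (EC c \<tau> x - u * EC c' \<tau> x))"

lemma wick_chaos_eq:
  "integrable TT.G (\<lambda>y. chaos d g u c c' (merge (JJ {False}) (JJ {True}) (x, y)))"
  "wick_chaos d g u c c' x = (\<integral>y. chaos d g u c c' (merge (JJ {False}) (JJ {True}) (x, y)) \<partial>TT.G)"
proof -
  let ?m = "\<lambda>y. merge (JJ {False}) (JJ {True}) (x, y)"
  let ?C = "\<lambda>c \<tau> y. prod_list (map (\<lambda>q. CC c q (?m y)) \<tau>)"
  have i: "integrable TT.G (?C c \<tau>)" if "\<tau> \<in> tuples (T \<times> UNIV) d" for c \<tau>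
    using that by (intro integrable_CC) (auto simp: tuples_def)
  show "integrable TT.G (\<lambda>y. chaos d g u c c' (?m y))"
    unfolding chaos_def
    by (intro Bochner_Integration.integrable_sum integrable_mult_right Bochner_Integration.integrable_diff i)
  show "wick_chaos d g u c c' x = (\<integral>y. chaos d g u c c' (?m y) \<partial>TT.G)"
    unfolding chaos_def wick_chaos_def EC_def
    by (subst Bochner_Integration.integral_sum)
       (auto intro!: sum.cong integrable_mult_right Bochner_Integration.integrable_diff i
         simp: i Bochner_Integration.integral_diff)
qed

text \<open>Averaging over the copy does not increase moments, by Jensen's inequality, and before the averaging
  the sum is a holomorphic polynomial in the orthonormal family.\<close>

theorem wick_chaos_moment:
  assumes v: "\<And>n. n \<in> T \<Longrightarrow> (\<Sum>r<R. (cmod (c n r))\<^sup>2 * (2 * s r)\<^sup>2) \<le> v n"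
    and u: "u = 0 \<and> \<theta> = 1 \<or> u = 1 \<and>
      (\<forall>n\<in>T. (\<Sum>r<R. (cmod (c' n r))\<^sup>2 * (2 * s r)\<^sup>2) \<le> v n \<and> (\<Sum>r<R. (cmod (c n r - c' n r))\<^sup>2 * (2 * s r)\<^sup>2) \<le> \<theta> * v n)"
    and \<theta>: "\<theta> \<ge> 0"
  shows "(\<integral>\<^sup>+x. ennreal (cmod (wick_chaos d g u c c' x) ^ (2 * q)) \<partial>FF.G)
     \<le> ennreal (fact (q * d) * (4 ^ d * \<theta> * (\<Sum>\<tau>\<in>tuples (T \<times> UNIV) d. (cmod (g \<tau>))\<^sup>2 * prod_list (map (\<lambda>q. v (fst q)) \<tau>))) ^ q)"
proof -
  let ?f = "\<lambda>x. ennreal (cmod (chaos d g u c c' x) ^ (2 * q))"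
  have JJ: "JJ {False} \<union> JJ {True} = JJ UNIV" by (auto simp: UNIV_bool)
  have "chaos d g u c c' \<in> borel_measurable UU.G"
    unfolding chaos_eq[abs_def] by measurable
  then have f: "?f \<in> borel_measurable (PiM (JJ {False} \<union> JJ {True}) (\<lambda>j. gauss (ss j)))"
    unfolding JJ UU.G_def[symmetric] by measurable
  have "(\<integral>\<^sup>+x. ennreal (cmod (wick_chaos d g u c c' x) ^ (2 * q)) \<partial>FF.G)
     \<le> (\<integral>\<^sup>+x. \<integral>\<^sup>+y. ?f (merge (JJ {False}) (JJ {True}) (x, y)) \<partial>TT.G \<partial>FF.G)"
    unfolding wick_chaos_eq(2)
    by (intro nn_integral_mono TT.G.norm_integral_power_le wick_chaos_eq(1))
  also have "\<dots> = (\<integral>\<^sup>+x. ?f x \<partial>UU.G)"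
  proof -
    have d: "JJ {False} \<inter> JJ {True} = {}" by auto
    show ?thesis
      using FF.gp.product_nn_integral_fold[OF d _ _ f] finT
      unfolding JJ UU.G_def FF.G_def TT.G_def by simp
  qed
  also have "\<dots> \<le> ennreal (fact (q * d) * (4 ^ d * \<theta> * (\<Sum>\<tau>\<in>tuples (T \<times> UNIV) d. (cmod (g \<tau>))\<^sup>2 * prod_list (map (\<lambda>q. v (fst q)) \<tau>))) ^ q)"
    by (rule chaos_moment) (use assms in auto)
  finally show ?thesis .
qed


end

definition wick_pattern :: "nat \<Rightarrow> nat \<Rightarrow> bool list" where
  "wick_pattern k l = replicate k True @ replicate l False"

lemma prod_list_sum_expand:
  fixes h :: "'m \<times> bool \<Rightarrow> 'a::comm_semiring_1"
  shows "prod_list (map (\<lambda>\<kappa>. \<Sum>n\<in>A. h (n, \<kappa>)) \<pi>)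
   = (\<Sum>\<tau>\<in>tuples (A \<times> UNIV) (length \<pi>). if map snd \<tau> = \<pi> then prod_list (map h \<tau>) else 0)"
proof (induction \<pi>)
  case (Cons \<kappa> \<pi>)
  have "(\<Sum>\<tau>\<in>tuples (A \<times> UNIV) (length (\<kappa> # \<pi>)). if map snd \<tau> = \<kappa> # \<pi> then prod_list (map h \<tau>) else 0)
     = (\<Sum>n\<in>A. \<Sum>\<kappa>'\<in>UNIV. if \<kappa>' = \<kappa> then
          h (n, \<kappa>) * (\<Sum>\<tau>\<in>tuples (A \<times> UNIV) (length \<pi>). if map snd \<tau> = \<pi> then prod_list (map h \<tau>) else 0) else 0)"
    unfolding length_Cons sum_tuples_Suc sum_Times sum_distrib_left
    by (intro sum.cong refl) (auto intro!: sum.cong)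
  then show ?case using Cons by (simp add: sum_distrib_right)
qed simp

text \<open>The boolean components of a tuple record which of the factors come from the conjugate.\<close>

lemma power_sum_expand:
  fixes h :: "'m \<times> bool \<Rightarrow> 'a::comm_semiring_1"
  shows "(\<Sum>n\<in>A. h (n, True)) ^ k * (\<Sum>n\<in>A. h (n, False)) ^ l
   = (\<Sum>\<tau>\<in>tuples (A \<times> UNIV) (k + l). if map snd \<tau> = wick_pattern k l then prod_list (map h \<tau>) else 0)"
  using prod_list_sum_expand[of h A "wick_pattern k l"]
  by (simp add: wick_pattern_def prod_list_replicate)

definition wick_coef :: "nat \<Rightarrow> nat \<Rightarrow> ('m \<Rightarrow> complex) \<Rightarrow> ('m \<times> bool) list \<Rightarrow> complex" where
  "wick_coef k l b \<tau> = (if map snd \<tau> = wick_pattern k l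
     then prod_list (map (\<lambda>q. if snd q then b (fst q) else cnj (b (fst q))) \<tau>) else 0)"

context white_noise
begin

text \<open>Expand the integrand \<open>(z + z')\<^sup>k\<close> times the conjugate of \<open>(z - z')\<^sup>l\<close> of the averaging formula for the
  complex Hermite polynomials.\<close>

theorem chermite_expand:
  assumes \<sigma>: "\<sigma> = (\<Sum>n\<in>T. (cmod (b n))\<^sup>2 * (\<Sum>r<R. (cmod (c n r))\<^sup>2 * (2 * (s r)\<^sup>2)))"
  shows "chermite k l \<sigma> (\<Sum>n\<in>T. b n * zf c False n x)
    = (\<Sum>\<tau>\<in>tuples (T \<times> UNIV) (k + l). wick_coef k l b \<tau> * EC c \<tau> x)"
proof -
  let ?m = "\<lambda>y. merge (JJ {False}) (JJ {True}) (x, y)"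
  define a where "a = (\<lambda>(((n, r), part), copy :: bool). b n * c n r * (if part then \<i> else 1))"
  define z where "z = (\<Sum>n\<in>T. b n * zf c False n x)"
  have ev_a: "TT.ev (0, a) y = (\<Sum>n\<in>T. b n * zf c True n y)" for y
    unfolding TT.ev_def fst_conv snd_conv sum_JJ add_0 zf_def sum_distrib_left
    by (intro sum.cong refl) (simp add: a_def algebra_simps)
  have el0: "u * z * z + u * (z * \<i>) * (z * \<i>) = 0" for u z
    by (simp add: complex_eq_iff algebra_simps)
  have aa: "TT.BB a a = 0"
    unfolding TT.BB_def sum_JJ by (intro sum.neutral ballI) (simp add: a_def ss_def el0)
  have el: "of_real u * z * cnj z + of_real u * (z * \<i>) * cnj (z * \<i>) = of_real (2 * u * (cmod z)\<^sup>2)" for u z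
    unfolding of_real_mult complex_norm_square by (simp add: algebra_simps)
  have ac: "TT.BB a (\<lambda>j. cnj (a j)) = of_real \<sigma>"
    unfolding TT.BB_def sum_JJ \<sigma> of_real_sum sum_distrib_left
  proof (intro sum.cong refl)
    fix n r
    show "(\<Sum>ca\<in>{True}. of_real ((ss (((n, r), False), ca))\<^sup>2) * a (((n, r), False), ca) * cnj (a (((n, r), False), ca)) +
          of_real ((ss (((n, r), True), ca))\<^sup>2) * a (((n, r), True), ca) * cnj (a (((n, r), True), ca)))
        = of_real ((cmod (b n))\<^sup>2 * ((cmod (c n r))\<^sup>2 * (2 * (s r)\<^sup>2)))"
      using el[of "(s r)\<^sup>2" "b n * c n r"]
      by (simp add: a_def ss_def norm_mult power_mult_distrib del: complex_cnj_mult complex_cnj_i)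
  qed
  define h where "h y = (\<lambda>q. (if snd q then b (fst q) else cnj (b (fst q))) * CC c q (?m y))" for y
  have "chermite k l \<sigma> z = (\<integral>y. (z + TT.ev (0, a) y) ^ k * cnj (z - TT.ev (0, a) y) ^ l \<partial>TT.G)"
    by (rule TT.chermite_integral[OF aa ac, symmetric])
  also have "\<dots> = (\<integral>y. (\<Sum>n\<in>T. h y (n, True)) ^ k * (\<Sum>n\<in>T. h y (n, False)) ^ l \<partial>TT.G)"
  proof (intro Bochner_Integration.integral_cong refl)
    fix y
    have "z + TT.ev (0, a) y = (\<Sum>n\<in>T. h y (n, True))"
      unfolding z_def ev_a sum.distrib[symmetric]
      by (intro sum.cong refl) (simp add: h_def CC_def zf_merge algebra_simps)
    moreover have "cnj (z - TT.ev (0, a) y) = (\<Sum>n\<in>T. h y (n, False))"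
      unfolding z_def ev_a sum_subtractf[symmetric] cnj_sum
      by (intro sum.cong refl) (simp add: h_def CC_def zf_merge algebra_simps)
    ultimately show "(z + TT.ev (0, a) y) ^ k * cnj (z - TT.ev (0, a) y) ^ l
      = (\<Sum>n\<in>T. h y (n, True)) ^ k * (\<Sum>n\<in>T. h y (n, False)) ^ l" by simp
  qed
  also have "\<dots> = (\<integral>y. (\<Sum>\<tau>\<in>tuples (T \<times> UNIV) (k + l). wick_coef k l b \<tau> *
        prod_list (map (\<lambda>q. CC c q (?m y)) \<tau>)) \<partial>TT.G)"
  proof -
    have "prod_list (map (h y) \<tau>) = prod_list (map (\<lambda>q. if snd q then b (fst q) else cnj (b (fst q))) \<tau>) *
        prod_list (map (\<lambda>q. CC c q (?m y)) \<tau>)" for y \<tau>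
      by (induction \<tau>) (auto simp: h_def mult_ac)
    then show ?thesis unfolding power_sum_expand wick_coef_def
      by (intro Bochner_Integration.integral_cong sum.cong refl) simp
  qed
  also have "\<dots> = (\<Sum>\<tau>\<in>tuples (T \<times> UNIV) (k + l). wick_coef k l b \<tau> * EC c \<tau> x)"
    unfolding EC_def
    by (subst Bochner_Integration.integral_sum)
       (auto intro!: sum.cong integrable_mult_right integrable_CC simp: tuples_def)
  finally show ?thesis unfolding z_def .
qed

end

section \<open>Laguerre polynomials and complex Hermite polynomials\<close>


lemma chermite_explicit:
  "chermite k l \<sigma> z = (\<Sum>a\<le>k. of_real ((-\<sigma>) ^ a * fact a * real (k choose a) * real (l choose a)) * z ^ (k - a) * cnj z ^ (l - a))"
proof (induction k arbitrary: l)
  case (Suc k)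
  let ?t = "\<lambda>K a. z ^ (Suc k - a) * cnj z ^ (l - a) * of_real ((-\<sigma>) ^ a * fact a * real K * real (l choose a))"
  have "z * chermite k l \<sigma> z = (\<Sum>a\<le>k. ?t (k choose a) a)"
    unfolding Suc.IH sum_distrib_left
    by (intro sum.cong refl) (simp add: Suc_diff_le)
  also have "\<dots> = (\<Sum>a\<le>Suc k. ?t (k choose a) a)" by simp
  also have "\<dots> = ?t 1 0 + (\<Sum>a\<le>k. ?t (k choose Suc a) (Suc a))"
    by (subst sum.atMost_Suc_shift) simp
  finally have 1: "z * chermite k l \<sigma> z = ?t 1 0 + (\<Sum>a\<le>k. ?t (k choose Suc a) (Suc a))" .
  have 2: "- (of_nat l * of_real \<sigma> * chermite k (l - 1) \<sigma> z) = (\<Sum>a\<le>k. ?t (k choose a) (Suc a))"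
  proof (cases l)
    case (Suc l')
    have "fact (Suc a) * real (l choose Suc a) = real l * (fact a * real (l' choose a))" for a
    proof -
      have "real (Suc a) * real (l choose Suc a) = real l * real (l' choose a)"
        unfolding Suc of_nat_mult[symmetric] Suc_times_binomial ..
      then have "fact a * (real (Suc a) * real (l choose Suc a)) = fact a * (real l * real (l' choose a))" by simp
      moreover have "fact (Suc a) * real (l choose Suc a) = fact a * (real (Suc a) * real (l choose Suc a))"
        by (simp only: fact_Suc mult_ac)
      ultimately show ?thesis by (simp only: mult_ac)
    qed
    then have *: "?t K (Suc a) = - (of_nat l * of_real \<sigma> * (of_real ((-\<sigma>) ^ a * fact a * real K * real (l' choose a)) * z ^ (k - a) * cnj z ^ (l' - a)))" for K a
    proof -
      have "(-\<sigma>) ^ Suc a * fact (Suc a) * real K * real (l choose Suc a) = - (real l * \<sigma> * ((-\<sigma>) ^ a * fact a * real K * real (l' choose a)))"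
        using \<open>\<And>a. fact (Suc a) * real (l choose Suc a) = real l * (fact a * real (l' choose a))\<close>[of a]
        by (simp add: algebra_simps del: fact_Suc binomial_Suc_Suc)
      moreover have "x * y * of_real (- (real l * \<sigma> * B)) = - (of_nat l * of_real \<sigma> * (of_real B * x * y))" for x y :: complex and B
        by (simp add: mult_ac)
      ultimately show ?thesis unfolding Suc diff_Suc_Suc by (simp only:)
    qed
    have "- (of_nat l * of_real \<sigma> * chermite k (l - 1) \<sigma> z) = - (of_nat l * of_real \<sigma> * chermite k l' \<sigma> z)" using Suc by simp
    also have "\<dots> = (\<Sum>a\<le>k. ?t (k choose a) (Suc a))"
      unfolding Suc.IH * sum_distrib_left sum_negf ..
    finally show ?thesis .
  qed simp
  have "chermite (Suc k) l \<sigma> z = z * chermite k l \<sigma> z + - (of_nat l * of_real \<sigma> * chermite k (l - 1) \<sigma> z)"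
    by simp
  also have "\<dots> = ?t 1 0 + (\<Sum>a\<le>k. ?t (Suc k choose Suc a) (Suc a))"
    unfolding 1 2 by (simp add: sum.distrib[symmetric] algebra_simps del: power_Suc fact_Suc)
  also have "\<dots> = (\<Sum>a\<le>Suc k. ?t (Suc k choose a) a)"
    unfolding sum.atMost_Suc_shift by simp
  finally show ?case by (simp only: mult_ac)
qed simp

lemma fps_inverse_one_minus_X: "inverse (1 - fps_X :: real fps) = Abs_fps (\<lambda>_. 1)"
  using fps_inverse_gp'[where 'a = real] fps_inverse_idempotent[of "Abs_fps (\<lambda>_. 1 :: real)"] by simp

lemma fps_inverse_one_minus_X_power:
  "fps_nth (inverse ((1 - fps_X :: real fps) ^ Suc n)) k = real ((n + k) choose k)"
proof (induction n arbitrary: k)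
  case 0
  then show ?case by (simp add: fps_inverse_one_minus_X)
next
  case (Suc n)
  have "inverse ((1 - fps_X :: real fps) ^ Suc (Suc n)) = inverse ((1 - fps_X) ^ Suc n) * Abs_fps (\<lambda>_. 1)"
    by (subst power_Suc2) (simp only: fps_inverse_mult fps_inverse_one_minus_X)
  then have "fps_nth (inverse ((1 - fps_X :: real fps) ^ Suc (Suc n))) k = (\<Sum>i\<le>k. real ((n + i) choose i))"
    by (simp add: fps_mult_nth Suc.IH atLeast0AtMost del: power_Suc)
  also have "\<dots> = real ((Suc n + k) choose k)"
    using sum_choose_lower[of n k] by (simp flip: of_nat_sum)
  finally show ?case .
qed

text \<open>The series \<open>exp (- x t / (1 - t))\<close> is expanded in powers of \<open>t / (1 - t)\<close>; the coefficients of the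
  resulting powers of \<open>1 / (1 - t)\<close> are binomial coefficients.\<close>

lemma laguerre_explicit:
  "laguerre k l x = (\<Sum>i\<le>k. (-x) ^ i / fact i * real ((k + l) choose (k - i)))"
proof -
  let ?E = "1 - fps_X :: real fps"
  let ?b = "fps_X * inverse ?E"
  let ?u = "inverse (?E ^ (l + 1))"
  have bi: "fps_nth (?u * ?b ^ i) k = real ((k + l) choose (k - i))" if "i \<le> k" for i
  proof -
    have "?u * ?b ^ i = fps_X ^ i * inverse (?E ^ Suc (l + i))"
      by (simp add: power_mult_distrib fps_inverse_mult fps_inverse_power power_add mult_ac)
    then show ?thesis using that
      by (simp only: fps_X_power_mult_nth fps_inverse_one_minus_X_power) (simp add: add.commute)
  qed
  have b0: "fps_nth (?b ^ i) m = 0" if "m < i" for i m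
    using that by (simp add: power_mult_distrib fps_X_power_mult_nth)
  have "laguerre k l x = (\<Sum>j=0..k. fps_nth ?u (k - j) * (\<Sum>i=0..j. fps_nth (fps_exp (- x)) i * fps_nth (?b ^ i) j))"
  proof -
    have "laguerre k l x = fps_nth ((fps_exp (- x) oo ?b) * ?u) k"
      by (simp only: laguerre_def mult.commute)
    also have "\<dots> = (\<Sum>j=0..k. fps_nth (fps_exp (- x) oo ?b) j * fps_nth ?u (k - j))"
      by (rule fps_mult_nth)
    finally show ?thesis by (simp only: fps_compose_nth mult.commute)
  qed
  also have "\<dots> = (\<Sum>j=0..k. fps_nth ?u (k - j) * (\<Sum>i\<le>k. fps_nth (fps_exp (- x)) i * fps_nth (?b ^ i) j))"
    by (intro sum.cong refl arg_cong2[where f = "(*)"] sum.mono_neutral_left) (auto simp: b0)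
  also have "\<dots> = (\<Sum>i\<le>k. fps_nth (fps_exp (- x)) i * (\<Sum>j=0..k. fps_nth (?b ^ i) j * fps_nth ?u (k - j)))"
    unfolding sum_distrib_left by (subst sum.swap) (simp add: mult_ac)
  also have "\<dots> = (\<Sum>i\<le>k. fps_nth (fps_exp (- x)) i * fps_nth (?b ^ i * ?u) k)"
    by (simp add: fps_mult_nth)
  also have "\<dots> = (\<Sum>i\<le>k. (-x) ^ i / fact i * real ((k + l) choose (k - i)))"
  proof (intro sum.cong refl)
    fix i assume "i \<in> {..k}"
    then have "fps_nth (?b ^ i * ?u) k = real ((k + l) choose (k - i))"
      using bi[of i] by (simp only: mult.commute atMost_iff)
    then show "fps_nth (fps_exp (- x)) i * fps_nth (?b ^ i * ?u) k = (-x) ^ i / fact i * real ((k + l) choose (k - i))"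
      by (simp only:) simp
  qed
  finally show ?thesis .
qed

text \<open>Reversing the order of summation makes the explicit Laguerre sum match the explicit Hermite sum
  term by term.\<close>

lemma laguerre_scaled_binomial_sum:
  assumes "p \<le> q" "\<sigma> > 0"
  shows "(-1) ^ p * fact p * complex_of_real (laguerre_scaled p (q - p) ((cmod z)\<^sup>2) \<sigma>)
   = (\<Sum>a\<le>p. of_real ((-\<sigma>) ^ a * fact a * real (p choose a) * real (q choose a)) * (z * cnj z) ^ (p - a))"
proof -
  let ?y = "(cmod z)\<^sup>2"
  have "(-1) ^ p * fact p * laguerre_scaled p (q - p) ?y \<sigma>
     = (\<Sum>i\<le>p. (-1) ^ p * fact p * \<sigma> ^ p * ((- (?y / \<sigma>)) ^ i / fact i * real (q choose (p - i))))"
    unfolding laguerre_scaled_def laguerre_explicit using assms(1) by (simp add: sum_distrib_left mult.assoc)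
  also have "\<dots> = (\<Sum>a\<le>p. (-1) ^ p * fact p * \<sigma> ^ p * ((- (?y / \<sigma>)) ^ (p - a) / fact (p - a) * real (q choose a)))"
    by (rule sum.reindex_bij_witness[where i = "\<lambda>a. p - a" and j = "\<lambda>a. p - a"]) auto
  also have "\<dots> = (\<Sum>a\<le>p. (-\<sigma>) ^ a * fact a * real (p choose a) * real (q choose a) * ?y ^ (p - a))"
  proof (intro sum.cong refl)
    fix a assume "a \<in> {..p}"
    then obtain b where p: "p = a + b" using le_Suc_ex by auto
    have "fact p = fact a * real (p choose a) * (fact b :: real)"
      using binomial_fact_lemma[of a p] unfolding p by (metis (no_types) add_diff_cancel_left' le_add1 mult.commute mult.assoc of_nat_fact of_nat_mult)
    then show "(-1) ^ p * fact p * \<sigma> ^ p * ((- (?y / \<sigma>)) ^ (p - a) / fact (p - a) * real (q choose a))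
       = (-\<sigma>) ^ a * fact a * real (p choose a) * real (q choose a) * ?y ^ (p - a)"
      using assms(2)
      by (simp add: p power_add power_minus[of \<sigma>] power_minus[of "?y / \<sigma>"] power_divide field_simps)
  qed
  finally have "complex_of_real ((-1) ^ p * fact p * laguerre_scaled p (q - p) ?y \<sigma>)
     = (\<Sum>a\<le>p. of_real ((-\<sigma>) ^ a * fact a * real (p choose a) * real (q choose a)) * of_real ?y ^ (p - a))"
    by simp
  then show ?thesis unfolding complex_norm_square by simp
qed

text \<open>For \<open>\<sigma> = 0\<close> the two sides differ in general, since the scaled Laguerre polynomials then divide by 0.\<close>

theorem wick_eq_chermite:
  assumes "\<sigma> > 0"
  shows "wick k l \<sigma> z = chermite k l \<sigma> z"
proof (cases "k < l")
  case True
  then have kl: "k \<le> l" by simp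
  show ?thesis
    using True unfolding wick_def chermite_explicit laguerre_scaled_binomial_sum[OF kl assms] 
    by (simp add: sum_distrib_right, intro sum.cong refl)
       (simp add: power_mult_distrib mult.assoc flip: power_add)
next
  case False
  then have lk: "l \<le> k" by simp
  have "wick k l \<sigma> z = (\<Sum>a\<le>l. of_real ((-\<sigma>) ^ a * fact a * real (k choose a) * real (l choose a)) * z ^ (k - a) * cnj z ^ (l - a))"
    using False unfolding wick_def laguerre_scaled_binomial_sum[OF lk assms]
    by (simp add: sum_distrib_right, intro sum.cong refl)
       (simp add: power_mult_distrib mult_ac flip: power_add)
  also have "\<dots> = chermite k l \<sigma> z"
    unfolding chermite_explicit using lk by (intro sum.mono_neutral_left) auto
  finally show ?thesis .
qed

section \<open>Lattice convolutions\<close>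


text \<open>The decay of the covariance of the stochastic convolution, up to a constant.\<close>

definition wt :: "int \<times> int \<Rightarrow> real" where "wt n = 1 / (1 + (norm (freq n))\<^sup>2)"

lemma wt_pos: "wt n > 0" and wt_le1: "wt n \<le> 1"
  by (auto simp: wt_def add_pos_nonneg divide_le_eq_1)

lemma wt_uminus [simp]: "wt (- n) = wt n"
  by (simp add: wt_def freq_def norm_Pair)

lemma wt_0 [simp]: "wt 0 = 1"
  by (simp add: wt_def freq_def zero_prod_def[symmetric])

lemma wt_half:
  assumes "norm (freq m) \<le> 2 * norm (freq n)"
  shows "wt n \<le> 4 * wt m"
proof -
  have "(norm (freq m))\<^sup>2 \<le> 4 * (norm (freq n))\<^sup>2"
    using power_mono[OF assms, of 2] by simp
  then have "1 + (norm (freq m))\<^sup>2 \<le> 4 * (1 + (norm (freq n))\<^sup>2)" by simp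
  moreover have "1 + (norm (freq n))\<^sup>2 > 0" "1 + (norm (freq m))\<^sup>2 > 0" by (simp_all add: add_pos_nonneg)
  ultimately show ?thesis by (simp add: wt_def divide_simps)
qed

lemma wt_prod_le: "wt (a, b) \<le> (1 + (real_of_int a)\<^sup>2) powr (-1/2) * (1 + (real_of_int b)\<^sup>2) powr (-1/2)"
proof -
  let ?x = "(real_of_int a)\<^sup>2" and ?y = "(real_of_int b)\<^sup>2"
  have n: "(norm (freq (a, b)))\<^sup>2 = ?x + ?y" by (simp add: freq_def norm_Pair)
  have "sqrt ((1 + ?x) * (1 + ?y)) \<le> 1 + (?x + ?y)"
  proof (rule real_le_lsqrt)
    have "(1 + ?x) * (1 + ?y) \<le> (1 + ?x + ?y) * (1 + ?x + ?y)"
      by (intro mult_mono) auto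
    then show "(1 + ?x) * (1 + ?y) \<le> (1 + (?x + ?y))\<^sup>2" by (simp add: power2_eq_square add.assoc)
  qed auto
  then have "1 / (1 + (?x + ?y)) \<le> 1 / (sqrt (1 + ?x) * sqrt (1 + ?y))"
    by (intro divide_left_mono) (auto simp: real_sqrt_mult intro!: mult_pos_pos add_pos_nonneg)
  also have "\<dots> = (1 + ?x) powr (-1/2) * (1 + ?y) powr (-1/2)"
    by (simp add: powr_minus powr_half_sqrt divide_simps add_pos_nonneg)
  finally show ?thesis unfolding wt_def n .
qed

lemma sum_int_powr_bound:
  assumes "\<eta> > 0"
  shows "\<exists>C\<ge>0. \<forall>F. finite F \<longrightarrow> (\<Sum>a\<in>F. (1 + (real_of_int a)\<^sup>2) powr (- (1 + \<eta>) / 2)) \<le> C"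
proof -
  let ?f = "\<lambda>n::nat. (if n = 0 then 1 else real n powr (- (1 + \<eta>)))"
  have sm: "summable ?f"
  proof -
    have "summable (\<lambda>n. real n powr (- (1 + \<eta>)))" using assms by (subst summable_real_powr_iff) auto
    then show ?thesis
      by (rule summable_cong[THEN iffD1, rotated]) (auto intro: eventually_mono[OF eventually_gt_at_top[of 0]])
  qed
  have sq_powr: "y\<^sup>2 powr e = y powr (2 * e)" if "y > 0" for y e :: real
    using that by (metis less_imp_le powr_numeral powr_powr)
  have le: "(1 + (real_of_int a)\<^sup>2) powr (- (1 + \<eta>) / 2) \<le> ?f (nat \<bar>a\<bar>)" for a
  proof (cases "a = 0")
    case False
    have "(1 + (real_of_int a)\<^sup>2) powr (- (1 + \<eta>) / 2) \<le> ((real_of_int \<bar>a\<bar>)\<^sup>2) powr (- (1 + \<eta>) / 2)"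
      using assms False by (intro powr_mono2') auto
    also have "\<dots> = real_of_int \<bar>a\<bar> powr (- (1 + \<eta>))"
    proof -
      have e: "2 * (- (1 + \<eta>) / 2) = - (1 + \<eta>)" by (simp add: field_simps)
      show ?thesis using sq_powr[of "\<bar>real_of_int a\<bar>" "- (1 + \<eta>) / 2"] False unfolding e by simp
    qed
    finally show ?thesis using False by simp
  qed (auto intro: powr_mono2')
  have "(\<Sum>a\<in>F. (1 + (real_of_int a)\<^sup>2) powr (- (1 + \<eta>) / 2)) \<le> 2 * suminf ?f" if "finite F" for F
  proof -
    have "(\<Sum>a\<in>F. (1 + (real_of_int a)\<^sup>2) powr (- (1 + \<eta>) / 2)) \<le> (\<Sum>a\<in>F. ?f (nat \<bar>a\<bar>))"
      by (intro sum_mono le)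
    also have "\<dots> = (\<Sum>a\<in>F \<inter> {0..}. ?f (nat \<bar>a\<bar>)) + (\<Sum>a\<in>F \<inter> {..<0}. ?f (nat \<bar>a\<bar>))"
      using that by (subst sum.union_disjoint[symmetric]) (auto intro!: sum.cong)
    also have "(\<Sum>a\<in>F \<inter> {0..}. ?f (nat \<bar>a\<bar>)) = (\<Sum>n\<in>(\<lambda>a. nat \<bar>a\<bar>) ` (F \<inter> {0..}). ?f n)"
      by (subst sum.reindex) (auto simp: inj_on_def)
    also have "(\<Sum>a\<in>F \<inter> {..<0}. ?f (nat \<bar>a\<bar>)) = (\<Sum>n\<in>(\<lambda>a. nat \<bar>a\<bar>) ` (F \<inter> {..<0}). ?f n)"
      by (subst sum.reindex) (auto simp: inj_on_def)
    also have "(\<Sum>n\<in>(\<lambda>a. nat \<bar>a\<bar>) ` (F \<inter> {0..}). ?f n) + (\<Sum>n\<in>(\<lambda>a. nat \<bar>a\<bar>) ` (F \<inter> {..<0}). ?f n) \<le> suminf ?f + suminf ?f"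
      using that by (intro add_mono sum_le_suminf sm) auto
    finally show ?thesis by simp
  qed
  moreover have "0 \<le> 2 * suminf ?f" using sm by (intro mult_nonneg_nonneg suminf_nonneg) auto
  ultimately show ?thesis by blast
qed

text \<open>The weight is at most the product of the one-dimensional weights to the power \<open>1/2\<close>, each of which
  is summable after raising to the power \<open>1 + \<eta>\<close>.\<close>

lemma sum_wt_bound:
  assumes "\<eta> > 0"
  shows "\<exists>C\<ge>0. \<forall>F. finite F \<longrightarrow> (\<Sum>n\<in>F. wt n powr (1 + \<eta>)) \<le> C"
proof -
  obtain C where C: "C \<ge> 0" "\<And>F. finite F \<Longrightarrow> (\<Sum>a\<in>F. (1 + (real_of_int a)\<^sup>2) powr (- (1 + \<eta>) / 2)) \<le> C"
    using sum_int_powr_bound[OF assms] by blast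
  have "(\<Sum>n\<in>F. wt n powr (1 + \<eta>)) \<le> C * C" if F: "finite F" for F
  proof -
    let ?g = "\<lambda>a::int. (1 + (real_of_int a)\<^sup>2) powr (- (1 + \<eta>) / 2)"
    have "(\<Sum>n\<in>F. wt n powr (1 + \<eta>)) \<le> (\<Sum>n\<in>F. ?g (fst n) * ?g (snd n))"
    proof (rule sum_mono)
      fix n :: "int \<times> int"
      obtain a b where n: "n = (a, b)" by (cases n)
      have "wt n powr (1 + \<eta>) \<le> ((1 + (real_of_int a)\<^sup>2) powr (-1/2) * (1 + (real_of_int b)\<^sup>2) powr (-1/2)) powr (1 + \<eta>)"
        unfolding n using wt_prod_le wt_pos assms by (intro powr_mono2) (auto simp: less_imp_le)
      also have "\<dots> = ?g a * ?g b"
      proof -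
        have e: "(-1/2) * (1 + \<eta>) = - (1 + \<eta>) / 2" by (simp add: field_simps)
        show ?thesis by (subst powr_mult) (auto simp only: powr_powr e intro: powr_ge_zero)
      qed
      finally show "wt n powr (1 + \<eta>) \<le> ?g (fst n) * ?g (snd n)" by (simp add: n)
    qed
    also have "\<dots> \<le> (\<Sum>n\<in>fst ` F \<times> snd ` F. ?g (fst n) * ?g (snd n))"
      using F by (intro sum_mono2) (auto simp: mem_Times_iff intro: rev_image_eqI)
    also have "\<dots> = (\<Sum>a\<in>fst ` F. ?g a) * (\<Sum>b\<in>snd ` F. ?g b)"
      by (simp add: sum_product sum.cartesian_product case_prod_unfold)
    also have "\<dots> \<le> C * C" using F by (intro mult_mono C sum_nonneg) auto
    finally show ?thesis .
  qed
  then show ?thesis using C(1) by (intro exI[of _ "C * C"]) auto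
qed

lemma powr_mult_le_add:
  fixes x y :: real
  assumes "0 < x" "0 < y" "p \<ge> 0" "q \<ge> 0"
  shows "x powr p * y powr q \<le> x powr (p + q) + y powr (p + q)"
proof -
  have "x powr p * y powr q \<le> max x y powr p * max x y powr q"
    using assms by (intro mult_mono powr_mono2) auto
  also have "\<dots> = max x y powr (p + q)" by (simp add: powr_add)
  also have "\<dots> \<le> x powr (p + q) + y powr (p + q)" by (auto simp: max_def)
  finally show ?thesis .
qed

text \<open>One of \<open>n\<close> and \<open>m - n\<close> has at least half the length of \<open>m\<close>. Its weight supplies the right-hand side,
  and what remains is summable. In two dimensions this costs an arbitrarily small power \<open>\<eta>\<close>.\<close>

theorem lattice_convolution:
  assumes "a \<ge> 0" "b \<ge> 0" "\<eta> > 0" "a + b + \<eta> \<le> 1"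
  shows "\<exists>C\<ge>0. \<forall>F m. finite F \<longrightarrow>
    (\<Sum>n\<in>F. wt n powr (1 - a) * wt (m - n) powr (1 - b)) \<le> C * wt m powr (1 - (a + b + \<eta>))"
proof -
  obtain C where C: "C \<ge> 0" "\<And>F. finite F \<Longrightarrow> (\<Sum>n\<in>F. wt n powr (1 + \<eta>)) \<le> C"
    using sum_wt_bound[OF assms(3)] by blast
  let ?e = "1 - (a + b + \<eta>)"
  have aux: "wt x powr (1 - a') * wt y powr (1 - b') \<le> 4 * wt m powr ?e * (wt x powr (1 + \<eta>) + wt y powr (1 + \<eta>))"
    if "norm (freq m) \<le> 2 * norm (freq x)" "a' + b' = a + b" "a' \<ge> 0" "b' \<ge> 0" for x y m a' b'
  proof -
    have "wt x powr ?e \<le> (4 * wt m) powr ?e"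
      using wt_half[OF that(1)] wt_pos assms by (intro powr_mono2) (auto simp: less_imp_le)
    also have "\<dots> = 4 powr ?e * wt m powr ?e" by (rule powr_mult)
    also have "\<dots> \<le> 4 powr 1 * wt m powr ?e"
      using assms by (intro mult_right_mono powr_mono) auto
    finally have 1: "wt x powr ?e \<le> 4 * wt m powr ?e" by simp
    have "wt x powr (1 - a') * wt y powr (1 - b') = wt x powr ?e * (wt x powr (b' + \<eta>) * wt y powr (1 - b'))"
    proof -
      have "?e + (b' + \<eta>) = 1 - a'" using that(2) by linarith
      then show ?thesis by (simp only: mult.assoc[symmetric] powr_add[symmetric])
    qed
    also have "\<dots> \<le> (4 * wt m powr ?e) * (wt x powr ((b' + \<eta>) + (1 - b')) + wt y powr ((b' + \<eta>) + (1 - b')))"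
      using that assms wt_pos by (intro mult_mono 1 powr_mult_le_add) auto
    finally show ?thesis by (simp add: add.commute)
  qed
  have "(\<Sum>n\<in>F. wt n powr (1 - a) * wt (m - n) powr (1 - b)) \<le> (8 * C) * wt m powr ?e" if F: "finite F" for F m
  proof -
    have "(\<Sum>n\<in>F. wt n powr (1 - a) * wt (m - n) powr (1 - b))
        \<le> (\<Sum>n\<in>F. 4 * wt m powr ?e * (wt n powr (1 + \<eta>) + wt (m - n) powr (1 + \<eta>)))"
    proof (rule sum_mono)
      fix n
      have "freq m = freq n + freq (m - n)" by (simp add: freq_def)
      then have "norm (freq m) \<le> norm (freq n) + norm (freq (m - n))" by (metis norm_triangle_ineq)
      then consider "norm (freq m) \<le> 2 * norm (freq n)" | "norm (freq m) \<le> 2 * norm (freq (m - n))" by linarith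
      then show "wt n powr (1 - a) * wt (m - n) powr (1 - b) \<le> 4 * wt m powr ?e * (wt n powr (1 + \<eta>) + wt (m - n) powr (1 + \<eta>))"
      proof cases
        case 1
        then show ?thesis using aux[OF 1, of a b "m - n"] assms by simp
      next
        case 2
        then show ?thesis using aux[OF 2, of b a n] assms by (simp add: mult.commute add.commute)
      qed
    qed
    also have "\<dots> = 4 * wt m powr ?e * ((\<Sum>n\<in>F. wt n powr (1 + \<eta>)) + (\<Sum>n\<in>F. wt (m - n) powr (1 + \<eta>)))"
      by (simp only: sum_distrib_left[symmetric] sum.distrib)
    also have "(\<Sum>n\<in>F. wt (m - n) powr (1 + \<eta>)) = (\<Sum>n\<in>(\<lambda>n. m - n) ` F. wt n powr (1 + \<eta>))"
      by (subst sum.reindex) (auto simp: inj_on_def)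
    also have "4 * wt m powr ?e * ((\<Sum>n\<in>F. wt n powr (1 + \<eta>)) + (\<Sum>n\<in>(\<lambda>n. m - n) ` F. wt n powr (1 + \<eta>)))
       \<le> 4 * wt m powr ?e * (C + C)"
      using F by (intro mult_left_mono add_mono C) auto
    finally show ?thesis by (simp add: mult_ac)
  qed
  then show ?thesis using C(1) by (intro exI[of _ "8 * C"]) auto
qed

section \<open>The Ornstein-Uhlenbeck kernel\<close>


definition ou_kernel :: "complex \<Rightarrow> real \<Rightarrow> real \<Rightarrow> complex" where
  "ou_kernel \<mu> t r = indicator {..t} r * exp (- of_real (t - r) * \<mu>)"

lemma ou_kernel_measurable [measurable]: "ou_kernel \<mu> t \<in> borel_measurable borel"
  unfolding ou_kernel_def[abs_def] by measurable

lemma norm_ou_kernel: "(cmod (ou_kernel \<mu> t r))\<^sup>2 = indicator {..t} r * exp (- (2 * Re \<mu>) * (t - r))"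
  by (auto simp: ou_kernel_def norm_mult indicator_def power2_eq_square exp_add[symmetric] algebra_simps)

lemma nn_integral_exp_halfline:
  assumes c: "c > 0"
  shows "(\<integral>\<^sup>+r. ennreal (indicator {..t} r * exp (- c * (t - r))) \<partial>lborel) = ennreal (1 / c)"
proof -
  have "(\<integral>\<^sup>+r. ennreal (indicator {..t} r * exp (- c * (t - r))) \<partial>lborel)
      = (\<integral>\<^sup>+x. ennreal (indicator {..t} (t + (-1) * x) * exp (- c * (t - (t + (-1) * x)))) \<partial>lborel)"
    by (subst nn_integral_real_affine[where c = "-1" and t = t]) auto
  also have "\<dots> = (\<integral>\<^sup>+x. ennreal (exp (- c * x)) * indicator {0..} x \<partial>lborel)"
    by (intro nn_integral_cong) (auto simp: indicator_def)
  also have "\<dots> = ennreal (0 - (- (exp (- c * 0) / c)))"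
  proof (rule nn_integral_FTC_atLeast)
    show "((\<lambda>x. - (exp (- c * x) / c)) \<longlongrightarrow> 0) at_top"
      using c by real_asymp
  qed (use c in \<open>auto intro!: derivative_eq_intros\<close>)
  finally show ?thesis by simp
qed

lemma ou_kernel_norm:
  assumes "Re \<mu> > 0"
  shows "(\<integral>\<^sup>+r. ennreal ((cmod (ou_kernel \<mu> t r))\<^sup>2) \<partial>lborel) = ennreal (1 / (2 * Re \<mu>))"
  unfolding norm_ou_kernel using assms by (intro nn_integral_exp_halfline) simp

lemma norm_one_minus_exp_le:
  assumes "Re w \<ge> 0"
  shows "cmod (exp (- w) - 1) \<le> cmod w" "cmod (exp (- w) - 1) \<le> 2"
proof -
  have "cmod (exp (- w) - exp 0) \<le> 1 * cmod (- w - 0)"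
  proof (rule field_differentiable_bound[of "{z. Re z \<le> 0}" exp exp])
    show "convex {z. Re z \<le> 0}" by (rule convex_halfspace_Re_le)
    show "(exp has_field_derivative exp z) (at z within {z. Re z \<le> 0})" for z
      by (rule DERIV_subset[OF DERIV_exp]) simp
  qed (use assms in auto)
  then show "cmod (exp (- w) - 1) \<le> cmod w" by simp
  have "cmod (exp (- w) - 1) \<le> cmod (exp (- w)) + 1" using norm_triangle_ineq4[of "exp (- w)" 1] by simp
  also have "cmod (exp (- w)) \<le> 1" using assms by simp
  finally show "cmod (exp (- w) - 1) \<le> 2" by simp
qed

text \<open>Before time \<open>s\<close> the difference of the kernels is a factor \<open>exp (- (t - s) \<mu>) - 1\<close>, and between the two
  times the kernel is bounded by 1. Interpolating between the trivial and the linear bound gives the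
  exponent \<open>\<alpha>\<close>.\<close>

lemma ou_kernel_diff_norm:
  assumes \<mu>: "Re \<mu> > 0" and st: "s < t" and \<alpha>: "0 < \<alpha>" "\<alpha> \<le> 1"
  shows "(\<integral>\<^sup>+r. ennreal ((cmod (ou_kernel \<mu> t r - ou_kernel \<mu> s r))\<^sup>2) \<partial>lborel)
     \<le> ennreal (3 / Re \<mu> * ((t - s) * cmod \<mu>) powr \<alpha>)"
proof -
  define h where "h = t - s"
  have h: "h > 0" using st by (simp add: h_def)
  define c where "c = 2 * Re \<mu>"
  have c: "c > 0" using \<mu> by (simp add: c_def)
  let ?E = "cmod (exp (- (of_real h * \<mu>)) - 1)"
  let ?X = "(h * cmod \<mu>) powr \<alpha>"
  have minpow: "min 1 y \<le> y powr \<alpha>" if "y > 0" for y :: real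
  proof (cases "y \<le> 1")
    case True
    have "y = y powr 1" using that by simp
    also have "\<dots> \<le> y powr \<alpha>" using that True \<alpha> by (intro powr_mono') auto
    finally show ?thesis using True by simp
  next
    case False
    then show ?thesis using \<alpha> by (simp add: ge_one_powr_ge_zero)
  qed
  have \<mu>0: "cmod \<mu> > 0" using \<mu> by auto
  have E2: "?E\<^sup>2 \<le> 4 * ?X"
  proof -
    have E: "?E \<le> h * cmod \<mu>" "?E \<le> 2"
      using norm_one_minus_exp_le[of "of_real h * \<mu>"] h \<mu> by (auto simp: norm_mult)
    have "?E\<^sup>2 \<le> 4 * min 1 (h * cmod \<mu>)"
    proof (cases "h * cmod \<mu> \<le> 1")
      case True
      have "?E * ?E \<le> 2 * (h * cmod \<mu>)" using E by (intro mult_mono) auto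
      also have "\<dots> \<le> 4 * (h * cmod \<mu>)" using h by simp
      finally show ?thesis using True by (simp add: power2_eq_square min_def)
    next
      case False
      have "?E * ?E \<le> 2 * 2" using E by (intro mult_mono) auto
      then show ?thesis using False by (simp add: power2_eq_square)
    qed
    also have "\<dots> \<le> 4 * ?X" using minpow[of "h * cmod \<mu>"] h \<mu>0 by simp
    finally show ?thesis .
  qed
  have pw: "(cmod (ou_kernel \<mu> t r - ou_kernel \<mu> s r))\<^sup>2
      = ?E\<^sup>2 * (indicator {..s} r * exp (- c * (s - r))) + indicator {s<..t} r * exp (- c * (t - r))" for r
  proof (cases "r \<le> s")
    case True
    have "ou_kernel \<mu> t r - ou_kernel \<mu> s r = ou_kernel \<mu> s r * (exp (- (of_real h * \<mu>)) - 1)"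
      using True st by (simp add: ou_kernel_def h_def algebra_simps exp_add[symmetric])
    then have "(cmod (ou_kernel \<mu> t r - ou_kernel \<mu> s r))\<^sup>2 = (cmod (ou_kernel \<mu> s r))\<^sup>2 * ?E\<^sup>2"
      by (simp add: norm_mult power_mult_distrib)
    then show ?thesis using True by (simp add: norm_ou_kernel c_def)
  next
    case False
    then have "ou_kernel \<mu> s r = 0" by (simp add: ou_kernel_def)
    then show ?thesis using False norm_ou_kernel[of \<mu> t r] by (auto simp: c_def indicator_def)
  qed
  have I2: "(\<integral>\<^sup>+r. ennreal (indicator {s<..t} r * exp (- c * (t - r))) \<partial>lborel) \<le> ennreal (1 / c * (2 * ?X))"
  proof -
    have "(\<integral>\<^sup>+r. ennreal (indicator {s<..t} r * exp (- c * (t - r))) \<partial>lborel) \<le> (\<integral>\<^sup>+r. ennreal (indicator {..t} r * exp (- c * (t - r))) \<partial>lborel)"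
      by (intro nn_integral_mono ennreal_leI) (auto simp: indicator_def)
    then have 1: "(\<integral>\<^sup>+r. ennreal (indicator {s<..t} r * exp (- c * (t - r))) \<partial>lborel) \<le> ennreal (1 / c)"
      unfolding nn_integral_exp_halfline[OF c] .
    have "(\<integral>\<^sup>+r. ennreal (indicator {s<..t} r * exp (- c * (t - r))) \<partial>lborel) \<le> (\<integral>\<^sup>+r. indicator {s<..t} r \<partial>lborel)"
      using c by (intro nn_integral_mono) (auto simp: indicator_def)
    then have 2: "(\<integral>\<^sup>+r. ennreal (indicator {s<..t} r * exp (- c * (t - r))) \<partial>lborel) \<le> ennreal h"
      using st by (simp add: h_def)
    have "min (1 / c) h = 1 / c * min 1 (c * h)"
      using c by (auto simp: min_def field_simps)
    also have "\<dots> \<le> 1 / c * (c * h) powr \<alpha>" using minpow[of "c * h"] c h by (intro mult_left_mono) auto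
    also have "(c * h) powr \<alpha> \<le> (2 * (h * cmod \<mu>)) powr \<alpha>"
      using c h \<alpha> complex_Re_le_cmod[of \<mu>] by (intro powr_mono2) (auto simp: c_def)
    also have "\<dots> = 2 powr \<alpha> * ?X" by (rule powr_mult)
    also have "\<dots> \<le> 2 powr 1 * ?X" using \<alpha> by (intro mult_right_mono powr_mono) auto
    finally have "min (1 / c) h \<le> 1 / c * (2 * ?X)" using c by (simp add: divide_right_mono)
    then show ?thesis using 1 2 by (cases "1 / c \<le> h") (auto simp: min_def intro: order_trans ennreal_leI)
  qed
  have "(\<integral>\<^sup>+r. ennreal ((cmod (ou_kernel \<mu> t r - ou_kernel \<mu> s r))\<^sup>2) \<partial>lborel)
     = (\<integral>\<^sup>+r. ennreal (?E\<^sup>2) * ennreal (indicator {..s} r * exp (- c * (s - r))) + ennreal (indicator {s<..t} r * exp (- c * (t - r))) \<partial>lborel)"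
    unfolding pw by (intro nn_integral_cong) (simp add: ennreal_plus ennreal_mult)
  also have "\<dots> = ennreal (?E\<^sup>2) * (\<integral>\<^sup>+r. ennreal (indicator {..s} r * exp (- c * (s - r))) \<partial>lborel)
       + (\<integral>\<^sup>+r. ennreal (indicator {s<..t} r * exp (- c * (t - r))) \<partial>lborel)"
    by (subst nn_integral_add, measurable, subst nn_integral_cmult, measurable)
  also have "\<dots> \<le> ennreal (4 * ?X) * ennreal (1 / c) + ennreal (1 / c * (2 * ?X))"
    unfolding nn_integral_exp_halfline[OF c]
    using E2 by (intro add_mono mult_right_mono I2 ennreal_leI) auto
  also have "\<dots> = ennreal (3 / Re \<mu> * ?X)"
    using c \<mu> by (subst ennreal_mult[symmetric]) (auto simp: ennreal_plus[symmetric] c_def field_simps simp del: ennreal_plus)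
  finally show ?thesis by (simp add: h_def)
qed

lemma Re_decay_rate: "Re (decay_rate a\<^sub>1 a\<^sub>2 n) = a\<^sub>1 / wt n"
  by (simp add: decay_rate_def wt_def add.commute)

lemma norm_decay_rate: "cmod (decay_rate a\<^sub>1 a\<^sub>2 n) = cmod (Complex a\<^sub>1 a\<^sub>2) / wt n"
  by (simp add: decay_rate_def wt_def norm_mult add.commute del: of_real_add of_real_power)

text \<open>Since \<open>|\<mu>|\<close> is proportional to the inverse of the weight, a power \<open>\<alpha>\<close> of time regularity costs a
  power \<open>\<alpha>\<close> of the weight. The strict inequalities leave room for approximating the kernels by step functions.\<close>

lemma ou_kernel_bounds:
  assumes a: "a\<^sub>1 > 0" and \<alpha>: "0 < \<alpha>" "\<alpha> \<le> 1"
  shows "\<exists>C>0. (\<forall>n t. (\<integral>\<^sup>+r. ennreal ((cmod (ou_kernel (decay_rate a\<^sub>1 a\<^sub>2 n) t r))\<^sup>2) \<partial>lborel) < ennreal (C * wt n powr (1 - \<alpha>)))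
     \<and> (\<forall>n s t. s < t \<longrightarrow> (\<integral>\<^sup>+r. ennreal ((cmod (ou_kernel (decay_rate a\<^sub>1 a\<^sub>2 n) t r - ou_kernel (decay_rate a\<^sub>1 a\<^sub>2 n) s r))\<^sup>2) \<partial>lborel)
          < ennreal (C * (t - s) powr \<alpha> * wt n powr (1 - \<alpha>)))"
proof -
  define A where "A = cmod (Complex a\<^sub>1 a\<^sub>2)"
  have A: "A > 0" using a unfolding A_def by (metis complex.sel(1) less_irrefl zero_complex.sel(1) zero_less_norm_iff)
  define C where "C = 1 / a\<^sub>1 + 4 * A powr \<alpha> / a\<^sub>1"
  have C: "C > 0" using a A by (simp add: C_def add_pos_pos)
  have w: "wt n powr (1 - \<alpha>) > 0" for n using wt_pos[of n] by simp
  have Re: "Re (decay_rate a\<^sub>1 a\<^sub>2 n) > 0" for n unfolding Re_decay_rate using a wt_pos by simp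
  show ?thesis
  proof (intro exI[of _ C] conjI allI impI C)
    fix n t
    have "wt n = wt n powr 1" using wt_pos[of n] by simp
    also have "\<dots> \<le> wt n powr (1 - \<alpha>)" using wt_pos[of n] wt_le1[of n] \<alpha> by (intro powr_mono') auto
    finally have "1 / (2 * (a\<^sub>1 / wt n)) \<le> 1 / (2 * a\<^sub>1) * wt n powr (1 - \<alpha>)"
      using a by (simp add: field_simps)
    also have "\<dots> < C * wt n powr (1 - \<alpha>)"
      using a A by (intro mult_strict_right_mono w) (simp add: C_def field_simps add_pos_pos)
    finally have *: "1 / (2 * (a\<^sub>1 / wt n)) < C * wt n powr (1 - \<alpha>)" .
    have nn: "0 \<le> 1 / (2 * (a\<^sub>1 / wt n))" using a wt_pos[of n] by simp
    show "(\<integral>\<^sup>+r. ennreal ((cmod (ou_kernel (decay_rate a\<^sub>1 a\<^sub>2 n) t r))\<^sup>2) \<partial>lborel) < ennreal (C * wt n powr (1 - \<alpha>))"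
      unfolding ou_kernel_norm[OF Re] Re_decay_rate using * nn by (simp only: ennreal_less_iff)
  next
    fix n and s t :: real assume st: "s < t"
    have "((t - s) * (A / wt n)) powr \<alpha> = A powr \<alpha> * (t - s) powr \<alpha> * wt n powr (- \<alpha>)"
    proof -
      have "(t - s) * (A / wt n) = A * (t - s) / wt n" by simp
      then show ?thesis by (simp only: powr_divide powr_mult) (simp add: powr_minus divide_inverse)
    qed
    then have "3 / (a\<^sub>1 / wt n) * ((t - s) * (A / wt n)) powr \<alpha> = 3 * A powr \<alpha> / a\<^sub>1 * (t - s) powr \<alpha> * (wt n powr 1 * wt n powr (- \<alpha>))"
      using wt_pos[of n] by simp
    also have "\<dots> = 3 * A powr \<alpha> / a\<^sub>1 * (t - s) powr \<alpha> * wt n powr (1 - \<alpha>)"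
      unfolding powr_add[symmetric] by simp
    also have "\<dots> < C * (t - s) powr \<alpha> * wt n powr (1 - \<alpha>)"
      using a A st by (intro mult_strict_right_mono w) (auto simp: C_def field_simps add_pos_pos)
    finally have *: "3 / (a\<^sub>1 / wt n) * ((t - s) * (A / wt n)) powr \<alpha> < C * (t - s) powr \<alpha> * wt n powr (1 - \<alpha>)" .
    have "(\<integral>\<^sup>+r. ennreal ((cmod (ou_kernel (decay_rate a\<^sub>1 a\<^sub>2 n) t r - ou_kernel (decay_rate a\<^sub>1 a\<^sub>2 n) s r))\<^sup>2) \<partial>lborel)
       \<le> ennreal (3 / (a\<^sub>1 / wt n) * ((t - s) * (A / wt n)) powr \<alpha>)"
      using ou_kernel_diff_norm[OF Re st \<alpha>, of n] unfolding Re_decay_rate norm_decay_rate A_def .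
    also have "\<dots> < ennreal (C * (t - s) powr \<alpha> * wt n powr (1 - \<alpha>))"
      using * a wt_pos[of n] by (subst ennreal_less_iff) auto
    finally show "(\<integral>\<^sup>+r. ennreal ((cmod (ou_kernel (decay_rate a\<^sub>1 a\<^sub>2 n) t r - ou_kernel (decay_rate a\<^sub>1 a\<^sub>2 n) s r))\<^sup>2) \<partial>lborel)
       < ennreal (C * (t - s) powr \<alpha> * wt n powr (1 - \<alpha>))" .
  qed
qed

section \<open>Trigonometric polynomials and Littlewood-Paley blocks\<close>


lemma freq_add: "freq (m + n) = freq m + freq n"
  by (simp add: freq_def)
lemma freq_uminus: "freq (- n) = - freq n"
  by (simp add: freq_def)
lemma freq_0 [simp]: "freq 0 = 0"
  by (simp add: freq_def zero_prod_def)

lemma wave_add: "wave (m + n) x = wave m x * wave n x"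
  by (simp add: wave_def freq_add inner_add_left algebra_simps exp_add)
lemma wave_0 [simp]: "wave 0 x = 1"
  by (simp add: wave_def)
lemma cnj_wave: "cnj (wave n x) = wave (- n) x"
  by (simp add: wave_def freq_uminus exp_cnj)
lemma norm_wave [simp]: "cmod (wave n x) = 1"
  by (simp add: wave_def)
lemma continuous_on_wave [continuous_intros]: "continuous_on A (wave n)"
  unfolding wave_def by (intro continuous_intros)
lemma wave_measurable [measurable]: "wave n \<in> borel_measurable borel"
  by (intro borel_measurable_continuous_onI continuous_intros)

lemma wave_Pair: "wave n (x, y) = exp (\<i> * of_real (real_of_int (fst n) * x)) * exp (\<i> * of_real (real_of_int (snd n) * y))"
  by (simp add: wave_def freq_def inner_prod_def exp_add[symmetric] algebra_simps)

lemma integral_exp_period: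
  fixes k :: int
  shows "(LBINT x. indicator {0..2 * pi} x *\<^sub>R exp (\<i> * of_real (real_of_int k * x))) = (if k = 0 then of_real (2 * pi) else 0)"
proof (cases "k = 0")
  case False
  let ?F = "\<lambda>x::real. exp (\<i> * of_real (real_of_int k * x)) / (\<i> * of_int k)"
  have "(LBINT x. indicator {0..2 * pi} x *\<^sub>R exp (\<i> * of_real (real_of_int k * x))) = ?F (2 * pi) - ?F 0"
  proof (rule integral_FTC_atLeastAtMost)
    show "continuous_on {0..2 * pi} (\<lambda>x. exp (\<i> * complex_of_real (real_of_int k * x)))"
      by (intro continuous_intros)
  next
    fix x :: real
    have "((\<lambda>z. exp (\<i> * (of_int k * z))) has_field_derivative exp (\<i> * (of_int k * of_real x)) * (\<i> * of_int k)) (at (of_real x) within UNIV)"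
      by (auto intro!: derivative_eq_intros)
    from DERIV_cdivide[OF this, of "\<i> * of_int k"]
    have "((\<lambda>z. exp (\<i> * (of_int k * z)) / (\<i> * of_int k)) has_field_derivative exp (\<i> * (of_int k * of_real x))) (at (of_real x) within UNIV)"
      using False by simp
    then have "((\<lambda>x. exp (\<i> * (of_int k * of_real x)) / (\<i> * of_int k)) has_vector_derivative exp (\<i> * (of_int k * of_real x))) (at x within {0..2 * pi})"
      by (intro has_vector_derivative_real_field) (auto intro: has_field_derivative_subset)
    then show "(?F has_vector_derivative exp (\<i> * complex_of_real (real_of_int k * x))) (at x within {0..2 * pi})"
      by simp
  qed simp
  also have "?F (2 * pi) = ?F 0"
  proof -
    have "exp (\<i> * of_real (real_of_int k * (2 * pi))) = 1"
      using exp_eq_1[of "\<i> * of_real (real_of_int k * (2 * pi))"] by (auto intro!: exI[of _ k])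
    then show ?thesis by simp
  qed
  finally show ?thesis using False by simp
qed (simp add: scaleR_conv_of_real)

lemma integral_wave:
  "(LINT x:cbox (0, 0) (2 * pi, 2 * pi)|lborel. wave n x) = (if n = 0 then of_real ((2 * pi)\<^sup>2) else 0)"
proof -
  let ?e = "\<lambda>k x. indicator {0..2 * pi} x *\<^sub>R exp (\<i> * of_real (real_of_int k * x))"
  have eq: "indicator (cbox (0, 0) (2 * pi, 2 * pi)) x *\<^sub>R wave n x = ?e (fst n) (fst x) * ?e (snd n) (snd x)" for x :: "real \<times> real"
    by (cases x) (auto simp: wave_Pair indicator_def)
  have int: "integrable lborel (\<lambda>x::real\<times>real. indicator (cbox (0, 0) (2 * pi, 2 * pi)) x *\<^sub>R wave n x)"
    using borel_integrable_compact[of "cbox (0, 0) (2 * pi, 2 * pi)" "wave n"]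
    by (simp add: continuous_on_wave)
  have "(LINT x:cbox (0, 0) (2 * pi, 2 * pi)|lborel. wave n x)
      = (\<integral>x. ?e (fst n) (fst x) * ?e (snd n) (snd x) \<partial>(lborel \<Otimes>\<^sub>M lborel))"
    unfolding set_lebesgue_integral_def eq lborel_prod ..
  also have "\<dots> = (LBINT x. LBINT y. ?e (fst n) x * ?e (snd n) y)"
    using int unfolding eq lborel_prod[symmetric]
    by (subst lborel_pair.integral_fst'[symmetric]) auto
  also have "\<dots> = (LBINT x. ?e (fst n) x) * (LBINT y. ?e (snd n) y)"
    by (subst integral_mult_right_zero, subst integral_mult_left_zero) (rule refl)
  also have "\<dots> = (if n = 0 then of_real ((2 * pi)\<^sup>2) else 0)"
    unfolding integral_exp_period by (cases n) (auto simp: power2_eq_square zero_prod_def)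
  finally show ?thesis .
qed

definition trig_poly :: "'i set \<Rightarrow> ('i \<Rightarrow> complex) \<Rightarrow> ('i \<Rightarrow> int \<times> int) \<Rightarrow> real \<times> real \<Rightarrow> complex" where
  "trig_poly I a \<nu> x = (\<Sum>i\<in>I. a i * wave (\<nu> i) x)"

lemma continuous_on_trig_poly [continuous_intros]: "continuous_on A (trig_poly I a \<nu>)"
  unfolding trig_poly_def by (intro continuous_intros)

lemma torus_integrable:
  fixes f :: "real \<times> real \<Rightarrow> 'a::{banach, second_countable_topology}"
  assumes "continuous_on UNIV f"
  shows "set_integrable lborel (cbox (0, 0) (2 * pi, 2 * pi)) f"
  unfolding set_integrable_def
  using borel_integrable_compact[of "cbox (0, 0) (2 * pi, 2 * pi)" f] assms continuous_on_subset by auto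

text \<open>The frequencies \<open>\<nu> i\<close> need not be distinct.\<close>

lemma fourier_coeff_trig_poly:
  assumes "finite I"
  shows "fourier_coeff (trig_poly I a \<nu>) n = (\<Sum>i\<in>I. if \<nu> i = n then a i else 0)"
proof -
  have n: "(- fst n, - snd n) = - n" by (cases n) auto
  have "(LINT x:cbox (0, 0) (2 * pi, 2 * pi)|lborel. trig_poly I a \<nu> x * wave (- n) x)
     = (LINT x:cbox (0, 0) (2 * pi, 2 * pi)|lborel. (\<Sum>i\<in>I. a i * wave (\<nu> i - n) x))"
    unfolding trig_poly_def sum_distrib_right mult.assoc wave_add[symmetric] by simp
  also have "\<dots> = (\<Sum>i\<in>I. (LINT x:cbox (0, 0) (2 * pi, 2 * pi)|lborel. a i * wave (\<nu> i - n) x))"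
    unfolding set_lebesgue_integral_def scaleR_sum_right
    by (intro Bochner_Integration.integral_sum)
       (auto intro!: torus_integrable[unfolded set_integrable_def] continuous_intros simp del: scaleR_scaleR)
  also have "\<dots> = (\<Sum>i\<in>I. if \<nu> i = n then a i * of_real ((2 * pi)\<^sup>2) else 0)"
    by (intro sum.cong refl) (auto simp: integral_wave)
  also have "\<dots> = (\<Sum>i\<in>I. (if \<nu> i = n then a i else 0)) * of_real ((2 * pi)\<^sup>2)"
    unfolding sum_distrib_right by (intro sum.cong refl) auto
  finally show ?thesis
    unfolding fourier_coeff_def n by simp
qed

lemma finite_freq_ball: "finite {n. norm (freq n) \<le> C}"
proof -
  let ?K = "{- \<lceil>C\<rceil>..\<lceil>C\<rceil>}"
  have "{n. norm (freq n) \<le> C} \<subseteq> ?K \<times> ?K"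
  proof safe
    fix a b assume *: "norm (freq (a, b)) \<le> C"
    have "\<bar>real_of_int a\<bar> \<le> norm (freq (a, b))" "\<bar>real_of_int b\<bar> \<le> norm (freq (a, b))"
      using norm_fst_le[of "real_of_int a" "real_of_int b"] norm_snd_le[of "real_of_int b" "real_of_int a"]
      by (auto simp: freq_def)
    with * have "\<bar>real_of_int a\<bar> \<le> C" "\<bar>real_of_int b\<bar> \<le> C" by auto
    then show "a \<in> ?K" "b \<in> ?K" by (auto simp: abs_le_iff) linarith+
  qed
  then show ?thesis by (rule finite_subset) auto
qed

locale LP =
  fixes \<phi>\<^sub>0 :: "real \<times> real \<Rightarrow> real"
  assumes smooth: "smooth \<phi>\<^sub>0"
    and one: "\<And>\<xi>. norm \<xi> \<le> 5/8 \<Longrightarrow> \<phi>\<^sub>0 \<xi> = 1" and zero: "\<And>\<xi>. norm \<xi> \<ge> 8/5 \<Longrightarrow> \<phi>\<^sub>0 \<xi> = 0"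
begin

lemma continuous: "continuous_on UNIV \<phi>\<^sub>0"
  using smooth unfolding smooth_def by (metis Ck.simps(1))

lemma bounded: "\<exists>K\<ge>1. \<forall>\<xi>. \<bar>\<phi>\<^sub>0 \<xi>\<bar> \<le> K"
proof -
  have "compact (\<phi>\<^sub>0 ` cball 0 (8/5))"
    by (intro compact_continuous_image continuous_on_subset[OF continuous]) auto
  then obtain K where K: "\<And>\<xi>. norm \<xi> \<le> 8/5 \<Longrightarrow> \<bar>\<phi>\<^sub>0 \<xi>\<bar> \<le> K"
    using bounded_iff compact_imp_bounded by (metis imageI mem_cball_0 real_norm_def)
  have "\<bar>\<phi>\<^sub>0 \<xi>\<bar> \<le> max K 1" for \<xi>
    using K[of \<xi>] zero[of \<xi>] by (cases "norm \<xi> \<le> 8/5") auto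
  then show ?thesis by (intro exI[of _ "max K 1"]) auto
qed

definition K where "K = (SOME K. K \<ge> 1 \<and> (\<forall>\<xi>. \<bar>\<phi>\<^sub>0 \<xi>\<bar> \<le> K))"

lemma K: "K \<ge> 1" "\<bar>\<phi>\<^sub>0 \<xi>\<bar> \<le> K"
proof -
  have "K \<ge> 1 \<and> (\<forall>\<xi>. \<bar>\<phi>\<^sub>0 \<xi>\<bar> \<le> K)"
    unfolding K_def by (rule someI_ex) (use bounded in blast)
  then show "K \<ge> 1" "\<bar>\<phi>\<^sub>0 \<xi>\<bar> \<le> K" by blast+
qed

lemma LP_phi_bound: "\<bar>LP_phi \<phi>\<^sub>0 j \<xi>\<bar> \<le> 2 * K"
  using K(1) K(2)[of \<xi>] K(2)[of "\<xi> /\<^sub>R 2 ^ j"] K(2)[of "\<xi> /\<^sub>R 2 ^ (j - 1)"]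
  unfolding LP_phi_def by (auto split: if_splits)

lemma LP_phi_support:
  assumes "LP_phi \<phi>\<^sub>0 j \<xi> \<noteq> 0"
  shows "norm \<xi> \<le> 2 * 2 ^ j"
proof (rule ccontr)
  assume *: "\<not> norm \<xi> \<le> 2 * 2 ^ j"
  have pos: "(0 :: real) < 2 ^ i" for i :: nat by simp
  have "norm (\<xi> /\<^sub>R 2 ^ i) \<ge> 8/5" if "i \<le> j" for i
  proof -
    have "(2 :: real) ^ i \<le> 2 ^ j" using that by (intro power_increasing) auto
    then have "8/5 * 2 ^ i \<le> norm \<xi>" using * pos[of i] by linarith
    then show ?thesis by (simp add: divide_simps mult.commute)
  qed
  then have "i \<le> j \<Longrightarrow> \<phi>\<^sub>0 (\<xi> /\<^sub>R 2 ^ i) = 0" for i using zero by blast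
  from this[of 0] this[of j] this[of "j - 1"] have "LP_phi \<phi>\<^sub>0 j \<xi> = 0"
    unfolding LP_phi_def by auto
  with assms show False by simp
qed

lemma finite_LP: "finite {n. LP_phi \<phi>\<^sub>0 j (freq n) \<noteq> 0}"
  by (rule finite_subset[OF _ finite_freq_ball[of "2 * 2 ^ j"]]) (use LP_phi_support in blast)

lemma LP_block_trig:
  assumes "finite I"
  shows "LP_block \<phi>\<^sub>0 j (fourier_coeff (trig_poly I a \<nu>)) x
    = (\<Sum>i\<in>I. of_real (LP_phi \<phi>\<^sub>0 j (freq (\<nu> i))) * a i * wave (\<nu> i) x)"
proof -
  let ?S = "{n. LP_phi \<phi>\<^sub>0 j (freq n) \<noteq> 0}"
  have "LP_block \<phi>\<^sub>0 j (fourier_coeff (trig_poly I a \<nu>)) x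
      = (\<Sum>n\<in>?S. \<Sum>i\<in>I. if n = \<nu> i then of_real (LP_phi \<phi>\<^sub>0 j (freq n)) * a i * wave n x else 0)"
    unfolding LP_block_def fourier_coeff_trig_poly[OF assms] sum_distrib_left sum_distrib_right
    by (intro sum.cong refl) auto
  also have "\<dots> = (\<Sum>i\<in>I. if \<nu> i \<in> ?S then of_real (LP_phi \<phi>\<^sub>0 j (freq (\<nu> i))) * a i * wave (\<nu> i) x else 0)"
    by (subst sum.swap) (simp add: sum.delta[OF finite_LP])
  also have "\<dots> = (\<Sum>i\<in>I. of_real (LP_phi \<phi>\<^sub>0 j (freq (\<nu> i))) * a i * wave (\<nu> i) x)"
    by (intro sum.cong refl) auto
  finally show ?thesis .
qed

lemma LP_block_diff: "LP_block \<phi>\<^sub>0 j (u - v) x = LP_block \<phi>\<^sub>0 j u x - LP_block \<phi>\<^sub>0 j v x"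
  by (simp add: LP_block_def sum_subtractf algebra_simps)

lemma LP_block_scale: "LP_block \<phi>\<^sub>0 j (\<lambda>n. c * u n) x = c * LP_block \<phi>\<^sub>0 j u x"
  by (simp add: LP_block_def sum_distrib_left algebra_simps)

end

definition lattice_box :: "nat \<Rightarrow> (int \<times> int) set" where
  "lattice_box D = {- int D..int D} \<times> {- int D..int D}"

lemma finite_lattice_box [simp]: "finite (lattice_box D)"
  by (simp add: lattice_box_def)

lemma card_lattice_box: "card (lattice_box D) = (2 * D + 1)\<^sup>2"
proof -
  have "nat (1 + int D + int D) = 2 * D + 1" by simp
  then show ?thesis by (simp add: lattice_box_def power2_eq_square add_ac)
qed

text \<open>Degrees are measured in the maximum norm, which makes them additive under products and the set of
  frequencies a square.\<close>

definition is_trig :: "nat \<Rightarrow> (real \<times> real \<Rightarrow> complex) \<Rightarrow> bool" where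
  "is_trig D f \<longleftrightarrow> (\<exists>a. f = trig_poly (lattice_box D) a (\<lambda>n. n))"

lemma is_trig_sum:
  assumes "finite I" "\<And>i. i \<in> I \<Longrightarrow> \<nu> i \<in> lattice_box D"
  shows "is_trig D (trig_poly I a \<nu>)"
proof -
  have "trig_poly I a \<nu> x = (\<Sum>n\<in>lattice_box D. \<Sum>i\<in>{i\<in>I. \<nu> i = n}. a i * wave (\<nu> i) x)" for x
    unfolding trig_poly_def using assms by (intro sum.group[symmetric]) auto
  then have "trig_poly I a \<nu> = trig_poly (lattice_box D) (\<lambda>n. \<Sum>i\<in>{i\<in>I. \<nu> i = n}. a i) (\<lambda>n. n)"
    unfolding trig_poly_def[of "lattice_box D"] by (auto simp: sum_distrib_right intro!: ext sum.cong)
  then show ?thesis unfolding is_trig_def by blast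
qed

lemma is_trig_mult:
  assumes "is_trig D f" "is_trig E g"
  shows "is_trig (D + E) (\<lambda>x. f x * g x)"
proof -
  obtain a b where f: "f = trig_poly (lattice_box D) a (\<lambda>n. n)" and g: "g = trig_poly (lattice_box E) b (\<lambda>n. n)"
    using assms unfolding is_trig_def by blast
  have "(\<lambda>x. f x * g x) = trig_poly (lattice_box D \<times> lattice_box E) (\<lambda>(m, n). a m * b n) (\<lambda>(m, n). m + n)"
    unfolding f g trig_poly_def sum_product sum.cartesian_product
    by (intro ext sum.cong refl) (simp add: case_prod_unfold wave_add mult_ac)
  then show ?thesis
    by (simp only:) (rule is_trig_sum, auto simp: lattice_box_def)
qed

lemma is_trig_power: "is_trig D f \<Longrightarrow> is_trig (m * D) (\<lambda>x. f x ^ m)"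
proof (induction m)
  case 0
  have "(\<lambda>x. 1) = trig_poly {0 :: int \<times> int} (\<lambda>_. 1) (\<lambda>n. n)" by (auto simp: trig_poly_def)
  then have "is_trig 0 (\<lambda>x. 1)"
    by (simp only:) (rule is_trig_sum, auto simp: lattice_box_def zero_prod_def)
  then show ?case by simp
next
  case (Suc m)
  then show ?case using is_trig_mult[of D f "m * D" "\<lambda>x. f x ^ m"] by simp
qed

lemma is_trig_continuous: "is_trig D f \<Longrightarrow> continuous_on UNIV f"
  unfolding is_trig_def by (auto intro: continuous_intros)

text \<open>The power \<open>f\<^sup>m\<close> is itself a trigonometric polynomial. Its coefficients are bounded by the mean of
  \<open>|f|\<^sup>m\<close>, and the factor counts them.\<close>

theorem nikolskii:
  assumes f: "is_trig D f"
  shows "cmod (f x) ^ m \<le> real ((2 * (m * D) + 1)\<^sup>2) *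
    ((LINT y:cbox (0, 0) (2 * pi, 2 * pi)|lborel. cmod (f y) ^ m) / (2 * pi)\<^sup>2)"
proof -
  obtain a where a: "(\<lambda>x. f x ^ m) = trig_poly (lattice_box (m * D)) a (\<lambda>n. n)"
    using is_trig_power[OF f, of m] unfolding is_trig_def by blast
  let ?I = "LINT y:cbox (0, 0) (2 * pi, 2 * pi)|lborel. cmod (f y) ^ m"
  have cf: "continuous_on UNIV f" by (rule is_trig_continuous[OF f])
  have coef: "cmod (a n) \<le> ?I / (2 * pi)\<^sup>2" if "n \<in> lattice_box (m * D)" for n
  proof -
    have "a n = fourier_coeff (\<lambda>x. f x ^ m) n"
      unfolding a fourier_coeff_trig_poly[OF finite_lattice_box] using that by simp
    also have "cmod \<dots> \<le> ?I / (2 * pi)\<^sup>2"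
    proof -
      have "cmod (LINT x:cbox (0, 0) (2 * pi, 2 * pi)|lborel. f x ^ m * wave (- fst n, - snd n) x)
         \<le> (LINT x:cbox (0, 0) (2 * pi, 2 * pi)|lborel. cmod (f x ^ m * wave (- fst n, - snd n) x))"
        by (rule set_integral_norm_bound)
           (intro torus_integrable continuous_intros continuous_on_subset[OF cf]; simp)
      then show ?thesis
        unfolding fourier_coeff_def by (simp add: norm_divide norm_mult norm_power divide_right_mono)
    qed
    finally show ?thesis .
  qed
  have "cmod (f x) ^ m = cmod (trig_poly (lattice_box (m * D)) a (\<lambda>n. n) x)"
    unfolding a[symmetric] by (simp add: norm_power)
  also have "\<dots> \<le> (\<Sum>n\<in>lattice_box (m * D). ?I / (2 * pi)\<^sup>2)"
    unfolding trig_poly_def by (intro sum_norm_le) (use coef in \<open>simp add: norm_mult\<close>)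
  also have "\<dots> = real ((2 * (m * D) + 1)\<^sup>2) * (?I / (2 * pi)\<^sup>2)"
    by (simp add: card_lattice_box)
  finally show ?thesis .
qed

section \<open>Dyadic chaining in time\<close>


text \<open>Every dyadic time is reached from 0 by at most one increment per level, and dyadic times are dense.\<close>

lemma dyadic_chaining:
  fixes f :: "real \<Rightarrow> complex"
  assumes cont: "continuous_on {0..T} f" and T: "T > 0" and B: "B \<ge> 0"
    and \<rho>: "0 < \<rho>" "\<rho> < 1" and f0: "cmod (f 0) \<le> B"
    and inc: "\<And>m i. i < 2 ^ m \<Longrightarrow> cmod (f (T * real (Suc i) / 2 ^ m) - f (T * real i / 2 ^ m)) \<le> B * \<rho> ^ m"
    and t: "t \<in> {0..T}"
  shows "cmod (f t) \<le> B * (1 + 1 / (1 - \<rho>))"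
proof -
  have dy: "cmod (f (T * real i / 2 ^ m)) \<le> B * (1 + (\<Sum>j\<le>m. \<rho> ^ j))" if "i \<le> 2 ^ m" for m i
    using that
  proof (induction m arbitrary: i)
    case 0
    then consider "i = 0" | "i = 1" by force
    then show ?case
    proof cases
      case 2
      have "cmod (f T) \<le> cmod (f T - f 0) + cmod (f 0)" using norm_triangle_ineq[of "f T - f 0" "f 0"] by simp
      then show ?thesis using inc[of 0 0] f0 2 by simp
    qed (use f0 B in auto)
  next
    case (Suc m)
    have mono: "B * (1 + (\<Sum>j\<le>m. \<rho> ^ j)) \<le> B * (1 + (\<Sum>j\<le>Suc m. \<rho> ^ j))"
      using B \<rho> by (intro mult_left_mono) auto
    show ?case
    proof (cases "even i")
      case True
      then obtain j where j: "i = 2 * j" by blast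
      then have "cmod (f (T * real j / 2 ^ m)) \<le> B * (1 + (\<Sum>j\<le>m. \<rho> ^ j))" using Suc by auto
      moreover have "T * real i / 2 ^ Suc m = T * real j / 2 ^ m" by (simp add: j)
      ultimately show ?thesis using mono by simp
    next
      case False
      then obtain j where j: "i = Suc (2 * j)" using oddE by fastforce
      then have *: "cmod (f (T * real j / 2 ^ m)) \<le> B * (1 + (\<Sum>j\<le>m. \<rho> ^ j))" using Suc by auto
      have e: "T * real (2 * j) / 2 ^ Suc m = T * real j / 2 ^ m" by simp
      have "cmod (f (T * real i / 2 ^ Suc m) - f (T * real j / 2 ^ m)) \<le> B * \<rho> ^ Suc m"
        using inc[of "2 * j" "Suc m"] Suc.prems unfolding e j by simp
      moreover have "cmod (f (T * real i / 2 ^ Suc m)) \<le> cmod (f (T * real i / 2 ^ Suc m) - f (T * real j / 2 ^ m)) + cmod (f (T * real j / 2 ^ m))"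
        using norm_triangle_ineq[of "f (T * real i / 2 ^ Suc m) - f (T * real j / 2 ^ m)" "f (T * real j / 2 ^ m)"] by simp
      ultimately show ?thesis using * by (simp add: algebra_simps)
    qed
  qed
  have geo: "(\<Sum>j\<le>m. \<rho> ^ j) \<le> 1 / (1 - \<rho>)" for m
  proof -
    have "(\<Sum>j\<le>m. \<rho> ^ j) \<le> suminf (\<lambda>j. \<rho> ^ j)"
      using \<rho> by (intro sum_le_suminf summable_geometric) auto
    then show ?thesis using \<rho> by (subst (asm) suminf_geometric) auto
  qed
  define i where "i m = nat \<lfloor>t / T * 2 ^ m\<rfloor>" for m
  define d where "d m = T * real (i m) / 2 ^ m" for m
  have x0: "t / T * 2 ^ m \<ge> 0" "t / T * 2 ^ m \<le> 2 ^ m" for m using t T by (auto simp: divide_simps)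
  have i: "real (i m) \<le> t / T * 2 ^ m" "t / T * 2 ^ m < real (i m) + 1" for m
    using x0(1)[of m] unfolding i_def by (auto intro: of_nat_floor)
  have i2: "i m \<le> 2 ^ m" for m
  proof -
    have "real (i m) \<le> 2 ^ m" using order_trans[OF i(1) x0(2)] .
    then show ?thesis by (metis of_nat_le_iff of_nat_numeral of_nat_power)
  qed
  have d1: "d m \<le> t" for m using i(1)[of m] T by (simp add: d_def field_simps)
  have d2: "t \<le> d m + T * (1/2) ^ m" for m
    using i(2)[of m] T by (simp add: d_def field_simps)
  have lim: "d \<longlonglongrightarrow> t"
  proof (rule tendsto_sandwich)
    show "(\<lambda>m. t - T * (1/2) ^ m) \<longlonglongrightarrow> t" by (auto intro!: tendsto_eq_intros LIMSEQ_power_zero)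
    show "\<forall>\<^sub>F m in sequentially. t - T * (1 / 2) ^ m \<le> d m" using d2 by (simp add: algebra_simps)
  qed (use d1 in auto)
  have d0: "d m \<in> {0..T}" for m using d1[of m] t T by (auto simp: d_def)
  have "(\<lambda>m. f (d m)) \<longlonglongrightarrow> f t"
    using cont t lim d0 unfolding continuous_on_sequentially by (auto simp: o_def)
  then have "(\<lambda>m. cmod (f (d m))) \<longlonglongrightarrow> cmod (f t)" by (rule tendsto_norm)
  moreover have "cmod (f (d m)) \<le> B * (1 + 1 / (1 - \<rho>))" for m
  proof -
    have "cmod (f (d m)) \<le> B * (1 + (\<Sum>j\<le>m. \<rho> ^ j))" unfolding d_def by (rule dy[OF i2])
    also have "\<dots> \<le> B * (1 + 1 / (1 - \<rho>))" using geo B by (intro mult_left_mono) auto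
    finally show ?thesis .
  qed
  ultimately show ?thesis by (intro LIMSEQ_le_const2) auto
qed

lemma power_le_imp_le_root:
  fixes x w :: real
  assumes "ennreal (x ^ n) \<le> ennreal w" "n > 0" "w \<ge> 0" "x \<ge> 0"
  shows "x \<le> root n w"
proof -
  have "x ^ n \<le> w" using assms by (simp add: ennreal_le_iff)
  then have "root n (x ^ n) \<le> root n w" using assms by (intro real_root_le_mono) auto
  then show ?thesis using assms by (simp add: real_root_power_cancel)
qed

definition chain_ratio :: "real \<Rightarrow> nat \<Rightarrow> real" where
  "chain_ratio b n = 2 powr (- (b - 1) / (2 * real n))"

lemma chain_ratio:
  assumes "b > 1" "n > 0"
  shows "0 < chain_ratio b n" "chain_ratio b n < 1" "(chain_ratio b n ^ m) ^ n = 2 powr (- (b - 1) / 2 * m)"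
proof -
  show "0 < chain_ratio b n" by (simp add: chain_ratio_def)
  have "2 powr (- (b - 1) / (2 * real n)) < 2 powr 0"
    using assms by (intro powr_less_mono) (auto simp: field_simps)
  then show "chain_ratio b n < 1" by (simp add: chain_ratio_def)
  have "(chain_ratio b n ^ m) ^ n = chain_ratio b n powr (real m * real n)"
    by (simp add: chain_ratio_def power_mult[symmetric] powr_realpow[symmetric] powr_powr)
  also have "\<dots> = 2 powr (- (b - 1) / (2 * real n) * (real m * real n))"
    by (simp add: chain_ratio_def powr_powr)
  also have "- (b - 1) / (2 * real n) * (real m * real n) = - (b - 1) / 2 * m"
    using assms by (simp add: field_simps)
  finally show "(chain_ratio b n ^ m) ^ n = 2 powr (- (b - 1) / 2 * m)" .
qed

text \<open>The weights \<open>2 powr ((b - 1) / 2 * m)\<close> turn a bound of this sum into geometric decay of the increments of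
  level \<open>m\<close>; the expectation stays finite, because level \<open>m\<close> has \<open>2\<^sup>m\<close> increments of moment
  \<open>2 powr (- b * m)\<close>, which leaves the decay \<open>2 powr (- (b - 1) * m)\<close>.\<close>

definition chain_majorant :: "real \<Rightarrow> nat \<Rightarrow> real \<Rightarrow> ennreal \<Rightarrow> (real \<Rightarrow> real \<Rightarrow> ennreal) \<Rightarrow> ennreal" where
  "chain_majorant b n T q0 q = q0 + (\<Sum>m. ennreal (2 powr ((b - 1) / 2 * m)) * (\<Sum>i<2 ^ m. q (T * real i / 2 ^ m) (T * real (Suc i) / 2 ^ m)))"

text \<open>A quantitative form of the continuity theorem of Kolmogorov, with a measurable majorant of the
  supremum in place of the supremum itself.\<close>

lemma chaining_bound:
  fixes f :: "real \<Rightarrow> complex"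
  assumes cont: "continuous_on {0..T} f" and T: "T > 0" and b: "b > 1" and n: "n > 0"
    and q0: "ennreal (cmod (f 0) ^ n) \<le> q0"
    and q: "\<And>s t. s < t \<Longrightarrow> ennreal (cmod (f t - f s) ^ n) \<le> q s t"
    and t: "t \<in> {0..T}"
  shows "ennreal (cmod (f t) ^ n) \<le> ennreal ((1 + 1 / (1 - chain_ratio b n)) ^ n) * chain_majorant b n T q0 q"
proof (cases "chain_majorant b n T q0 q = \<top>")
  case True
  have "(1 + 1 / (1 - chain_ratio b n)) > 0" using chain_ratio[OF b n] by (simp add: add_pos_pos)
  then have "ennreal ((1 + 1 / (1 - chain_ratio b n)) ^ n) \<noteq> 0" by (metis ennreal_eq_0_iff not_le zero_less_power)
  then show ?thesis using True by (simp add: ennreal_mult_top)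
next
  case False
  define w where "w = enn2real (chain_majorant b n T q0 q)"
  have w: "chain_majorant b n T q0 q = ennreal w" "w \<ge> 0" using False by (auto simp: w_def top.not_eq_extremum)
  let ?\<rho> = "chain_ratio b n"
  let ?t = "\<lambda>m. ennreal (2 powr ((b - 1) / 2 * m)) * (\<Sum>i<2 ^ m. q (T * real i / 2 ^ m) (T * real (Suc i) / 2 ^ m))"
  have q0w: "q0 \<le> ennreal w" unfolding w(1)[symmetric] chain_majorant_def by simp
  have tw: "?t m \<le> ennreal w" for m
  proof -
    have "?t m \<le> (\<Sum>m. ?t m)" using sum_le_suminf[OF summableI, of "{m}" ?t] by simp
    also have "\<dots> \<le> ennreal w" unfolding w(1)[symmetric] chain_majorant_def by simp
    finally show ?thesis .
  qed
  have "cmod (f t) \<le> root n w * (1 + 1 / (1 - ?\<rho>))"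
  proof (rule dyadic_chaining[OF cont T _ chain_ratio(1,2)[OF b n] _ _ t])
    show "root n w \<ge> 0" by (rule real_root_ge_zero[OF w(2)])
    show "cmod (f 0) \<le> root n w" using order_trans[OF q0 q0w] n w by (intro power_le_imp_le_root) auto
    fix m i :: nat assume i: "i < 2 ^ m"
    let ?s = "T * real i / 2 ^ m" and ?u = "T * real (Suc i) / 2 ^ m"
    have su: "?s < ?u" using T by (simp add: divide_simps)
    let ?r = "2 powr ((b - 1) / 2 * m)"
    have "ennreal (?r * cmod (f ?u - f ?s) ^ n) = ennreal ?r * ennreal (cmod (f ?u - f ?s) ^ n)"
      by (simp add: ennreal_mult)
    also have "\<dots> \<le> ennreal ?r * q ?s ?u"
      by (intro mult_left_mono q su) auto
    also have "\<dots> \<le> ?t m"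
      using i by (intro mult_left_mono member_le_sum[where f = "\<lambda>i. q (T * real i / 2 ^ m) (T * real (Suc i) / 2 ^ m)"]) auto
    also have "\<dots> \<le> ennreal w" by (rule tw)
    finally have "ennreal (?r * cmod (f ?u - f ?s) ^ n) \<le> ennreal w" .
    then have "?r * cmod (f ?u - f ?s) ^ n \<le> w" using w by (simp add: ennreal_le_iff)
    moreover have "r > 0 \<Longrightarrow> r * x \<le> w \<Longrightarrow> x \<le> w * inverse r" for r x :: real by (simp add: field_simps)
    ultimately have "cmod (f ?u - f ?s) ^ n \<le> w * inverse ?r" by (metis powr_gt_zero zero_neq_numeral)
    moreover have "inverse ?r = (?\<rho> ^ m) ^ n"
      unfolding chain_ratio(3)[OF b n] powr_minus[symmetric] by (simp add: minus_divide_left algebra_simps)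
    ultimately have "cmod (f ?u - f ?s) ^ n \<le> w * (?\<rho> ^ m) ^ n" by simp
    then have "root n (cmod (f ?u - f ?s) ^ n) \<le> root n (w * (?\<rho> ^ m) ^ n)"
      using n by (intro real_root_le_mono) auto
    then show "cmod (f ?u - f ?s) \<le> root n w * ?\<rho> ^ m"
      using n chain_ratio(1)[OF b n] by (simp add: real_root_mult real_root_power_cancel)
  qed
  then have "cmod (f t) ^ n \<le> (root n w * (1 + 1 / (1 - ?\<rho>))) ^ n" by (intro power_mono) auto
  also have "\<dots> = (1 + 1 / (1 - ?\<rho>)) ^ n * w" using n w by (simp add: power_mult_distrib)
  finally show ?thesis unfolding w(1) using w chain_ratio[OF b n]
    by (subst ennreal_mult[symmetric]) (auto intro: ennreal_leI)
qed

lemma chain_majorant_expectation: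
  assumes [measurable]: "q0 \<in> borel_measurable M" "\<And>s t. (\<lambda>\<omega>. q \<omega> s t) \<in> borel_measurable M"
    and T: "T > 0" and b: "b > 1" and A: "A \<ge> 0"
    and q0: "(\<integral>\<^sup>+\<omega>. q0 \<omega> \<partial>M) \<le> ennreal A"
    and q: "\<And>s t. s < t \<Longrightarrow> (\<integral>\<^sup>+\<omega>. q \<omega> s t \<partial>M) \<le> ennreal (A * (t - s) powr b)"
  shows "(\<integral>\<^sup>+\<omega>. chain_majorant b n T (q0 \<omega>) (q \<omega>) \<partial>M) \<le> ennreal (A * (1 + T powr b / (1 - 2 powr (- (b - 1) / 2))))"
proof -
  let ?r = "2 powr (- (b - 1) / 2) :: real"
  have r: "0 < ?r" "?r < 1"
    using b powr_less_mono[of "- (b - 1) / 2" 0 "2 :: real"] by auto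
  have level: "(\<integral>\<^sup>+\<omega>. ennreal (2 powr ((b - 1) / 2 * m)) * (\<Sum>i<2 ^ m. q \<omega> (T * real i / 2 ^ m) (T * real (Suc i) / 2 ^ m)) \<partial>M)
     \<le> ennreal (A * T powr b * ?r ^ m)" for m :: nat
  proof -
    have "(\<integral>\<^sup>+\<omega>. ennreal (2 powr ((b - 1) / 2 * m)) * (\<Sum>i<2 ^ m. q \<omega> (T * real i / 2 ^ m) (T * real (Suc i) / 2 ^ m)) \<partial>M)
       = ennreal (2 powr ((b - 1) / 2 * m)) * (\<Sum>i<2 ^ m. (\<integral>\<^sup>+\<omega>. q \<omega> (T * real i / 2 ^ m) (T * real (Suc i) / 2 ^ m) \<partial>M))"
      by (subst nn_integral_cmult, measurable, subst nn_integral_sum, auto)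
    also have "\<dots> \<le> ennreal (2 powr ((b - 1) / 2 * m)) * (\<Sum>i<(2 :: nat) ^ m. ennreal (A * (T / 2 ^ m) powr b))"
    proof (intro mult_left_mono sum_mono)
      fix i
      have "T * real (Suc i) / 2 ^ m - T * real i / 2 ^ m = T / 2 ^ m" by (simp add: field_simps)
      then show "(\<integral>\<^sup>+\<omega>. q \<omega> (T * real i / 2 ^ m) (T * real (Suc i) / 2 ^ m) \<partial>M) \<le> ennreal (A * (T / 2 ^ m) powr b)"
        using q[of "T * real i / 2 ^ m" "T * real (Suc i) / 2 ^ m"] T by (simp add: divide_simps)
    qed simp
    also have "\<dots> = ennreal (2 powr ((b - 1) / 2 * m) * (2 ^ m * (A * (T / 2 ^ m) powr b)))"
      using A by (simp add: ennreal_mult ennreal_power[symmetric] ennreal_of_nat_eq_real_of_nat)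
    also have "2 powr ((b - 1) / 2 * m) * (2 ^ m * (A * (T / 2 ^ m) powr b)) = A * T powr b * ?r ^ m"
    proof -
      have "(T / 2 ^ m) powr b = T powr b * 2 powr (- b * m)"
      proof -
        have "((2 :: real) ^ m) powr b = 2 powr (b * real m)" by (simp add: powr_realpow[symmetric] powr_powr mult.commute)
        moreover have "(T / 2 ^ m) powr b = T powr b / (2 ^ m) powr b" by (rule powr_divide)
        ultimately show ?thesis by (simp add: powr_minus divide_inverse)
      qed
      moreover have "2 powr ((b - 1) / 2 * m) * (2 powr m * 2 powr (- b * m)) = (?r ^ m :: real)"
        by (simp add: powr_realpow[symmetric] powr_powr powr_add[symmetric] field_simps)
      ultimately show ?thesis by (simp add: powr_realpow[symmetric] mult_ac)
    qed
    finally show ?thesis .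
  qed
  have "(\<integral>\<^sup>+\<omega>. chain_majorant b n T (q0 \<omega>) (q \<omega>) \<partial>M) = (\<integral>\<^sup>+\<omega>. q0 \<omega> \<partial>M) +
     (\<Sum>m. (\<integral>\<^sup>+\<omega>. ennreal (2 powr ((b - 1) / 2 * m)) * (\<Sum>i<2 ^ m. q \<omega> (T * real i / 2 ^ m) (T * real (Suc i) / 2 ^ m)) \<partial>M))"
    unfolding chain_majorant_def by (subst nn_integral_add, measurable, subst nn_integral_suminf, auto)
  also have "\<dots> \<le> ennreal A + (\<Sum>m. ennreal (A * T powr b * ?r ^ m))"
    by (intro add_mono q0 suminf_le level) auto
  also have "(\<Sum>m. ennreal (A * T powr b * ?r ^ m)) = ennreal (A * T powr b * (1 / (1 - ?r)))"
  proof -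
    have "(\<lambda>m. A * T powr b * ?r ^ m) sums (A * T powr b * (1 / (1 - ?r)))"
      using r by (intro sums_mult geometric_sums) auto
    then show ?thesis using A r by (intro suminf_ennreal_eq) auto
  qed
  also have "ennreal A + ennreal (A * T powr b * (1 / (1 - ?r))) = ennreal (A * (1 + T powr b / (1 - ?r)))"
    using A r by (subst ennreal_plus[symmetric]) (auto simp: algebra_simps)
  finally show ?thesis .
qed

lemma chain_majorant_measurable [measurable]:
  assumes [measurable]: "q0 \<in> borel_measurable M" "\<And>s t. (\<lambda>\<omega>. q \<omega> s t) \<in> borel_measurable M"
  shows "(\<lambda>\<omega>. chain_majorant b n T (q0 \<omega>) (q \<omega>)) \<in> borel_measurable M"
  unfolding chain_majorant_def by measurable

section \<open>Increments of independent Brownian motions\<close>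


lemma prod_Times: "(\<Prod>p\<in>A \<times> B. h p) = (\<Prod>a\<in>A. \<Prod>b\<in>B. h (a, b))"
  by (simp add: prod.cartesian_product)

context prob_space
begin

lemma prob_increment:
  assumes W: "real_BM M v W" and st: "s < t" and A: "A \<in> sets borel"
  shows "emeasure M ((\<lambda>\<omega>. W t \<omega> - W s \<omega>) -` A \<inter> space M) = emeasure (gauss (sqrt (v * (t - s)))) A"
proof -
  have D: "distributed M lborel (\<lambda>\<omega>. W t \<omega> - W s \<omega>) (\<lambda>x. ennreal (normal_density 0 (sqrt (v * (t - s))) x))"
    using W st by (auto simp: real_BM_def)
  have "emeasure M ((\<lambda>\<omega>. W t \<omega> - W s \<omega>) -` A \<inter> space M) = emeasure (distr M lborel (\<lambda>\<omega>. W t \<omega> - W s \<omega>)) A"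
    using distributed_measurable[OF D] A by (subst emeasure_distr) auto
  then show ?thesis unfolding gauss_def distributed_distr_eq_density[OF D] .
qed

lemma prob_increments:
  assumes W: "real_BM M v W" and p: "\<And>i. i < R \<Longrightarrow> p i < p (Suc i)" and A: "\<And>r. A r \<in> sets borel"
  shows "emeasure M {\<omega> \<in> space M. \<forall>r<R. W (p (Suc r)) \<omega> - W (p r) \<omega> \<in> A r}
     = (\<Prod>r<R. emeasure (gauss (sqrt (v * (p (Suc r) - p r)))) (A r))"
proof (cases "R = 0")
  case True
  then show ?thesis by (simp add: emeasure_space_1)
next
  case False
  let ?X = "\<lambda>r \<omega>. W (p (Suc r)) \<omega> - W (p r) \<omega>"
  have ind: "indep_vars (\<lambda>_. borel) ?X {..<R}"
    using W p by (auto simp: real_BM_def)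
  have "{\<omega> \<in> space M. \<forall>r<R. ?X r \<omega> \<in> A r} = (\<Inter>r\<in>{..<R}. ?X r -` A r \<inter> space M)"
    using False by auto
  then have "prob {\<omega> \<in> space M. \<forall>r<R. ?X r \<omega> \<in> A r} = (\<Prod>r<R. prob (?X r -` A r \<inter> space M))"
    using indep_varsD_finite[OF ind, of A] A False by auto
  then have "emeasure M {\<omega> \<in> space M. \<forall>r<R. ?X r \<omega> \<in> A r} = (\<Prod>r<R. emeasure M (?X r -` A r \<inter> space M))"
    unfolding emeasure_eq_measure by (simp add: prod_ennreal)
  also have "\<dots> = (\<Prod>r<R. emeasure (gauss (sqrt (v * (p (Suc r) - p r)))) (A r))"
    by (intro prod.cong refl prob_increment[OF W p A]) auto
  finally show ?thesis .
qed

lemma prob_complex_increments: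
  assumes W: "complex_BM M W" and p: "\<And>i. i < R \<Longrightarrow> p i < p (Suc i)"
    and A: "\<And>r. A r \<in> sets borel" "\<And>r. A' r \<in> sets borel"
  shows "emeasure M {\<omega> \<in> space M. \<forall>r<R. Re (W (p (Suc r)) \<omega> - W (p r) \<omega>) \<in> A r \<and> Im (W (p (Suc r)) \<omega> - W (p r) \<omega>) \<in> A' r}
     = (\<Prod>r<R. emeasure (gauss (sqrt (1/2 * (p (Suc r) - p r)))) (A r) * emeasure (gauss (sqrt (1/2 * (p (Suc r) - p r)))) (A' r))"
proof -
  let ?B = "\<lambda>A. {f \<in> space (PiM UNIV (\<lambda>_::real. borel :: real measure)). \<forall>r\<in>{..<R}. f (p (Suc r)) - f (p r) \<in> A r}"
  have B: "?B A \<in> sets (PiM UNIV (\<lambda>_::real. borel :: real measure))" if [measurable]: "\<And>r. A r \<in> sets borel" for A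
    by measurable
  have ind: "indep_var (PiM UNIV (\<lambda>_::real. borel)) (\<lambda>\<omega> t. Re (W t \<omega>)) (PiM UNIV (\<lambda>_::real. borel)) (\<lambda>\<omega> t. Im (W t \<omega>))"
    and WR: "real_BM M (1/2) (\<lambda>t \<omega>. Re (W t \<omega>))" and WI: "real_BM M (1/2) (\<lambda>t \<omega>. Im (W t \<omega>))"
    using W by (auto simp: complex_BM_def)
  have "{\<omega> \<in> space M. \<forall>r<R. Re (W (p (Suc r)) \<omega> - W (p r) \<omega>) \<in> A r \<and> Im (W (p (Suc r)) \<omega> - W (p r) \<omega>) \<in> A' r}
     = (\<lambda>\<omega>. (\<lambda>t. Re (W t \<omega>), \<lambda>t. Im (W t \<omega>))) -` (?B A \<times> ?B A') \<inter> space M"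
    by (auto simp: space_PiM)
  then have "emeasure M {\<omega> \<in> space M. \<forall>r<R. Re (W (p (Suc r)) \<omega> - W (p r) \<omega>) \<in> A r \<and> Im (W (p (Suc r)) \<omega> - W (p r) \<omega>) \<in> A' r}
     = emeasure M ((\<lambda>\<omega> t. Re (W t \<omega>)) -` ?B A \<inter> space M) * emeasure M ((\<lambda>\<omega> t. Im (W t \<omega>)) -` ?B A' \<inter> space M)"
    using indep_varD[OF ind B B, of A A'] A unfolding emeasure_eq_measure by (simp add: ennreal_mult)
  also have "(\<lambda>\<omega> t. Re (W t \<omega>)) -` ?B A \<inter> space M = {\<omega> \<in> space M. \<forall>r<R. Re (W (p (Suc r)) \<omega>) - Re (W (p r) \<omega>) \<in> A r}"
    by (auto simp: space_PiM)
  also have "(\<lambda>\<omega> t. Im (W t \<omega>)) -` ?B A' \<inter> space M = {\<omega> \<in> space M. \<forall>r<R. Im (W (p (Suc r)) \<omega>) - Im (W (p r) \<omega>) \<in> A' r}"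
    by (auto simp: space_PiM)
  finally show ?thesis
    using prob_increments[OF WR, of R p A] prob_increments[OF WI, of R p A'] A p
    by (simp add: prod.distrib)
qed

end

text \<open>The Brownian motions at the times \<open>p 0 < \<dots> < p R\<close>.\<close>

locale brownian_grid = prob_space M for M :: "'w measure" +
  fixes \<beta> :: "'n \<Rightarrow> real \<Rightarrow> 'w \<Rightarrow> complex" and T :: "'n set" and p :: "nat \<Rightarrow> real" and R :: nat
  assumes BM: "\<And>n. complex_BM M (\<beta> n)"
    and indep: "indep_vars (\<lambda>_. PiM UNIV (\<lambda>_::real. borel)) (\<lambda>n \<omega> t. \<beta> n t \<omega>) UNIV"
    and finT': "finite T"
    and p: "\<And>i. i < R \<Longrightarrow> p i < p (Suc i)"
begin

text \<open>The value 1 beyond the grid is a dummy that keeps all standard deviations positive.\<close>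

definition sp :: "nat \<Rightarrow> real" where "sp r = (if r < R then sqrt (1/2 * (p (Suc r) - p r)) else 1)"

sublocale wn: white_noise T R sp
  using finT' p by unfold_locales (auto simp: sp_def)

definition increment :: "'w \<Rightarrow> (('n \<times> nat) \<times> bool) \<times> bool \<Rightarrow> real" where
  "increment \<omega> = (\<lambda>j\<in>((T \<times> {..<R}) \<times> (UNIV :: bool set)) \<times> {False}. case j of (((n, r), ip), _) \<Rightarrow>
     if ip then Im (\<beta> n (p (Suc r)) \<omega> - \<beta> n (p r) \<omega>) else Re (\<beta> n (p (Suc r)) \<omega> - \<beta> n (p r) \<omega>))"

lemma beta_measurable [measurable]: "\<beta> n t \<in> borel_measurable M"
proof -
  have "(\<lambda>\<omega>. Re (\<beta> n t \<omega>)) \<in> borel_measurable M" "(\<lambda>\<omega>. Im (\<beta> n t \<omega>)) \<in> borel_measurable M"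
    using BM[of n] by (auto simp: complex_BM_def real_BM_def)
  then have "(\<lambda>\<omega>. Complex (Re (\<beta> n t \<omega>)) (Im (\<beta> n t \<omega>))) \<in> borel_measurable M"
    unfolding Complex_eq by measurable
  then show ?thesis by simp
qed

lemma increment_measurable [measurable]:
  "increment \<in> measurable M (PiM (((T \<times> {..<R}) \<times> (UNIV :: bool set)) \<times> {False}) (\<lambda>j. gauss (wn.ss j)))"
  unfolding increment_def by (rule measurable_restrict) (auto split: prod.split)

text \<open>A product measure is determined on boxes. There independence of the Brownian motions, of their real
  and imaginary parts, and of the increments of each part factorizes the probability.\<close>

theorem increment_law: "distr M (PiM (((T \<times> {..<R}) \<times> (UNIV :: bool set)) \<times> {False}) (\<lambda>j. gauss (wn.ss j))) increment = wn.FF.G"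
  unfolding wn.FF.G_def
proof (rule wn.FF.gp.PiM_eqI)
  show "finite (((T \<times> {..<R}) \<times> (UNIV :: bool set)) \<times> {False})" using finT' by simp
  fix A :: "(('n \<times> nat) \<times> bool) \<times> bool \<Rightarrow> real set"
  let ?J = "((T \<times> {..<R}) \<times> (UNIV :: bool set)) \<times> {False}"
  assume A: "\<And>i. i \<in> ?J \<Longrightarrow> A i \<in> sets (gauss (wn.ss i))"
  define A' where "A' i = (if i \<in> ?J then A i else {})" for i
  have A': "A' i \<in> sets borel" for i using A by (auto simp: A'_def)
  define E where "E n = {\<omega> \<in> space M. \<forall>r<R. Re (\<beta> n (p (Suc r)) \<omega> - \<beta> n (p r) \<omega>) \<in> A' (((n, r), False), False) \<and>
      Im (\<beta> n (p (Suc r)) \<omega> - \<beta> n (p r) \<omega>) \<in> A' (((n, r), True), False)}" for n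
  let ?B = "\<lambda>n. {f \<in> space (PiM UNIV (\<lambda>_::real. borel :: complex measure)). \<forall>r\<in>{..<R}.
      Re (f (p (Suc r)) - f (p r)) \<in> A' (((n, r), False), False) \<and> Im (f (p (Suc r)) - f (p r)) \<in> A' (((n, r), True), False)}"
  have B: "?B n \<in> sets (PiM UNIV (\<lambda>_::real. borel :: complex measure))" for n
    using A'[measurable] by measurable
  have E: "E n = (\<lambda>\<omega> t. \<beta> n t \<omega>) -` ?B n \<inter> space M" for n
    by (auto simp: E_def space_PiM)
  have "emeasure (distr M (PiM ?J (\<lambda>j. gauss (wn.ss j))) increment) (Pi\<^sub>E ?J A) = emeasure M (increment -` Pi\<^sub>E ?J A \<inter> space M)"
    using A finT' by (intro emeasure_distr increment_measurable sets_PiM_I_finite) auto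
  also have "increment -` Pi\<^sub>E ?J A \<inter> space M = (if T = {} then space M else (\<Inter>n\<in>T. E n))"
  proof -
    have Bt: "(\<forall>p\<in>X \<times> Y. P p) \<longleftrightarrow> (\<forall>a\<in>X. \<forall>b\<in>Y. P (a, b))" for X Y P by auto
    have iff: "increment \<omega> \<in> Pi\<^sub>E ?J A \<longleftrightarrow> (\<forall>n\<in>T. \<forall>r<R. Re (\<beta> n (p (Suc r)) \<omega> - \<beta> n (p r) \<omega>) \<in> A (((n, r), False), False) \<and>
        Im (\<beta> n (p (Suc r)) \<omega> - \<beta> n (p r) \<omega>) \<in> A (((n, r), True), False))" for \<omega>
      unfolding increment_def restrict_PiE_iff Bt ball_UNIV all_bool_eq
      by (simp only: prod.case if_True if_False lessThan_iff ball_simps Ball_def) blast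
    have E': "\<omega> \<in> E n \<longleftrightarrow> \<omega> \<in> space M \<and> (\<forall>r<R. Re (\<beta> n (p (Suc r)) \<omega> - \<beta> n (p r) \<omega>) \<in> A (((n, r), False), False) \<and>
        Im (\<beta> n (p (Suc r)) \<omega> - \<beta> n (p r) \<omega>) \<in> A (((n, r), True), False))" if "n \<in> T" for n \<omega>
      unfolding E_def A'_def using that by simp
    show ?thesis
      by (rule set_eqI) (simp only: vimage_eq Int_iff iff, use E' in \<open>auto split: if_splits\<close>)
  qed
  also have "emeasure M \<dots> = (\<Prod>n\<in>T. emeasure M (E n))"
  proof (cases "T = {}")
    case False
    have "prob (\<Inter>n\<in>T. E n) = (\<Prod>n\<in>T. prob (E n))"
      unfolding E by (rule indep_varsD[OF indep]) (use False finT' B in auto)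
    then show ?thesis using False unfolding emeasure_eq_measure by (simp add: prod_ennreal)
  qed (simp add: emeasure_space_1)
  also have "\<dots> = (\<Prod>n\<in>T. \<Prod>r<R. emeasure (gauss (sp r)) (A (((n, r), False), False)) * emeasure (gauss (sp r)) (A (((n, r), True), False)))"
  proof (intro prod.cong refl)
    fix n assume n: "n \<in> T"
    have "emeasure M (E n) = (\<Prod>r<R. emeasure (gauss (sqrt (1/2 * (p (Suc r) - p r)))) (A' (((n, r), False), False)) *
        emeasure (gauss (sqrt (1/2 * (p (Suc r) - p r)))) (A' (((n, r), True), False)))"
      unfolding E_def by (rule prob_complex_increments[OF BM]) (auto simp: A' p)
    also have "\<dots> = (\<Prod>r<R. emeasure (gauss (sp r)) (A (((n, r), False), False)) * emeasure (gauss (sp r)) (A (((n, r), True), False)))"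
      using n by (intro prod.cong refl) (simp add: sp_def A'_def)
    finally show "emeasure M (E n) = (\<Prod>r<R. emeasure (gauss (sp r)) (A (((n, r), False), False)) * emeasure (gauss (sp r)) (A (((n, r), True), False)))" .
  qed
  also have "\<dots> = (\<Prod>i\<in>?J. emeasure (gauss (wn.ss i)) (A i))"
    unfolding prod_Times by (simp add: UNIV_bool wn.ss_def mult.commute)
  finally show "emeasure (distr M (PiM ?J (\<lambda>j. gauss (wn.ss j))) increment) (Pi\<^sub>E ?J A) = (\<Prod>i\<in>?J. emeasure (gauss (wn.ss i)) (A i))" .
qed simp

lemma nn_integral_increment:
  assumes "f \<in> borel_measurable wn.FF.G"
  shows "(\<integral>\<^sup>+x. f x \<partial>wn.FF.G) = (\<integral>\<^sup>+\<omega>. f (increment \<omega>) \<partial>M)"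
  unfolding increment_law[symmetric]
  using assms unfolding wn.FF.G_def by (subst nn_integral_distr) auto

lemma zf_increment:
  assumes "n \<in> T"
  shows "wn.zf c False n (increment \<omega>) = (\<Sum>r<R. c n r * (\<beta> n (p (Suc r)) \<omega> - \<beta> n (p r) \<omega>))"
  unfolding wn.zf_def using assms
  by (intro sum.cong refl) (simp add: increment_def complex_eq_iff)

end

section \<open>Step functions and limits in the mean square\<close>


text \<open>A finite set of times, listed in increasing order. Step functions with jumps in the set are
  constant on the cells between consecutive times.\<close>

locale real_grid =
  fixes E :: "real set"
  assumes finE: "finite E"
begin

definition pt :: "nat \<Rightarrow> real" where "pt i = sorted_list_of_set E ! i"
definition N :: nat where "N = card E - 1"

lemma pt_less: "i < j \<Longrightarrow> j < card E \<Longrightarrow> pt i < pt j"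
  unfolding pt_def using sorted_list_of_set.strict_sorted_key_list_of_set[of E] finE
  by (auto intro: sorted_wrt_nth_less)

lemma pt_step: "i < N \<Longrightarrow> pt i < pt (Suc i)"
  by (rule pt_less) (auto simp: N_def)

lemma pt_less_iff: "i < card E \<Longrightarrow> j < card E \<Longrightarrow> pt i < pt j \<longleftrightarrow> i < j"
  using pt_less[of i j] pt_less[of j i] by (cases i j rule: linorder_cases) auto

lemma pt_ex: "a \<in> E \<Longrightarrow> \<exists>i<card E. a = pt i"
  using finE unfolding pt_def by (metis in_set_conv_nth length_sorted_list_of_set set_sorted_list_of_set)

text \<open>The increment of \<open>g\<close> over \<open>(a, b]\<close> is the sum of the increments over the cells in it; a cell is tested by
  its right end.\<close>

lemma telescope:
  fixes g :: "real \<Rightarrow> complex"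
  assumes "a \<in> E" "b \<in> E" "a \<le> b"
  shows "(\<Sum>r<N. indicator {a<..b} (pt (Suc r)) * (g (pt (Suc r)) - g (pt r))) = g b - g a"
proof -
  obtain i j where ij: "i < card E" "a = pt i" "j < card E" "b = pt j" using assms pt_ex by metis
  have le: "i \<le> j" using assms(3) ij pt_less[of j i] by force
  have "(\<Sum>r<N. indicator {a<..b} (pt (Suc r)) * (g (pt (Suc r)) - g (pt r)))
      = (\<Sum>r\<in>{i..<j}. g (pt (Suc r)) - g (pt r))"
  proof (rule sum.mono_neutral_cong_right)
    show "{i..<j} \<subseteq> {..<N}" using ij by (auto simp: N_def)
    have *: "pt (Suc r) \<in> {a<..b} \<longleftrightarrow> r \<in> {i..<j}" if "r < N" for r
    proof -
      have "Suc r < card E" using that by (auto simp: N_def)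
      then show ?thesis using ij pt_less_iff[of i "Suc r"] pt_less_iff[of j "Suc r"] by auto
    qed
    show "\<forall>r\<in>{..<N} - {i..<j}. indicator {a<..b} (pt (Suc r)) * (g (pt (Suc r)) - g (pt r)) = 0"
      using * by auto
    show "indicator {a<..b} (pt (Suc r)) * (g (pt (Suc r)) - g (pt r)) = g (pt (Suc r)) - g (pt r)" if "r \<in> {i..<j}" for r
      using *[of r] that ij by (auto simp: N_def)
  qed simp
  also have "\<dots> = g (pt j) - g (pt i)" using le by (rule sum_Suc_diff')
  finally show ?thesis by (simp add: ij)
qed

definition adapted :: "(complex \<times> real \<times> real) list \<Rightarrow> bool" where
  "adapted cs \<longleftrightarrow> (\<forall>(c, a, b)\<in>set cs. a \<in> E \<and> b \<in> E \<and> a \<le> b)"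

lemma step_expand:
  assumes "adapted cs"
  shows "(\<Sum>(c, a, b)\<leftarrow>cs. c * (g b - g a)) = (\<Sum>r<N. step_fun cs (pt (Suc r)) * (g (pt (Suc r)) - g (pt r)))"
  using assms
proof (induction cs)
  case (Cons x cs)
  obtain c a b where x: "x = (c, a, b)" by (cases x)
  have ab: "a \<in> E" "b \<in> E" "a \<le> b" and cs: "adapted cs" using Cons.prems by (auto simp: adapted_def x)
  have sf: "step_fun (x # cs) y = c * indicator {a<..b} y + step_fun cs y" for y by (simp add: step_fun_def x)
  have "(\<Sum>r<N. step_fun (x # cs) (pt (Suc r)) * (g (pt (Suc r)) - g (pt r)))
     = c * (\<Sum>r<N. indicator {a<..b} (pt (Suc r)) * (g (pt (Suc r)) - g (pt r)))
       + (\<Sum>r<N. step_fun cs (pt (Suc r)) * (g (pt (Suc r)) - g (pt r)))"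
    by (simp only: sf distrib_right sum.distrib sum_distrib_left mult.assoc)
  then show ?case using Cons.IH[OF cs] telescope[OF ab, of g] by (simp add: x)
qed (simp add: step_fun_def)

lemma step_integral_grid:
  assumes "adapted cs"
  shows "step_integral cs \<beta> \<omega> = (\<Sum>r<N. step_fun cs (pt (Suc r)) * (\<beta> (pt (Suc r)) \<omega> - \<beta> (pt r) \<omega>))"
  unfolding step_integral_def using step_expand[OF assms, of "\<lambda>t. \<beta> t \<omega>"] .

lemma step_fun_grid:
  assumes "adapted cs"
  shows "step_fun cs x = (\<Sum>r<N. step_fun cs (pt (Suc r)) * indicator {pt r<..pt (Suc r)} x)"
proof -
  have ind: "indicator {a<..b} x = (indicator {x..} b - indicator {x..} a :: complex)" if "a \<le> b" for a b
    using that by (auto simp: indicator_def)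
  have "step_fun cs x = (\<Sum>(c, a, b)\<leftarrow>cs. c * (indicator {x..} b - indicator {x..} a))"
    unfolding step_fun_def using assms ind
    by (intro arg_cong[where f = sum_list] map_cong) (auto simp: adapted_def)
  also have "\<dots> = (\<Sum>r<N. step_fun cs (pt (Suc r)) * (indicator {x..} (pt (Suc r)) - indicator {x..} (pt r)))"
    by (rule step_expand[OF assms])
  also have "\<dots> = (\<Sum>r<N. step_fun cs (pt (Suc r)) * indicator {pt r<..pt (Suc r)} x)"
    using ind pt_step by (intro sum.cong refl) (auto simp: less_imp_le)
  finally show ?thesis .
qed

lemma nn_integral_grid:
  "(\<integral>\<^sup>+x. ennreal ((cmod (\<Sum>r<N. c r * indicator {pt r<..pt (Suc r)} x))\<^sup>2) \<partial>lborel)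
   = ennreal (\<Sum>r<N. (cmod (c r))\<^sup>2 * (pt (Suc r) - pt r))"
proof -
  have dis: "r = r'" if "r < N" "r' < N" "x \<in> {pt r<..pt (Suc r)}" "x \<in> {pt r'<..pt (Suc r')}" for r r' x
  proof (rule ccontr)
    have lt: "r < card E" "r' < card E" using that by (auto simp: N_def)
    assume "r \<noteq> r'"
    then consider "Suc r \<le> r'" | "Suc r' \<le> r" by linarith
    then show False
    proof cases
      case 1
      then have "pt (Suc r) \<le> pt r'" using lt pt_less[of "Suc r" r'] by (cases "Suc r = r'") auto
      then show False using that by auto
    next
      case 2
      then have "pt (Suc r') \<le> pt r" using lt pt_less[of "Suc r'" r] by (cases "Suc r' = r") auto
      then show False using that by auto
    qed
  qed
  define S where "S r = {pt r<..pt (Suc r)}" for r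
  have pw: "(cmod (\<Sum>r<N. c r * indicator (S r) x))\<^sup>2 = (\<Sum>r<N. (cmod (c r))\<^sup>2 * indicator (S r) x)" for x
  proof (cases "\<exists>r<N. x \<in> S r")
    case True
    then obtain r0 where r0: "r0 < N" "x \<in> S r0" by blast
    have nr: "x \<notin> S r" if "r < N" "r \<noteq> r0" for r
      using dis[OF that(1) r0(1)] r0(2) that(2) unfolding S_def by blast
    have "(\<Sum>r<N. c r * indicator (S r) x) = (\<Sum>r<N. if r = r0 then c r else 0)"
    proof (intro sum.cong refl)
      fix r assume "r \<in> {..<N}"
      then show "c r * indicator (S r) x = (if r = r0 then c r else 0)"
        using r0(2) nr[of r] by (cases "r = r0") simp_all
    qed
    moreover have "(\<Sum>r<N. (cmod (c r))\<^sup>2 * indicator (S r) x) = (\<Sum>r<N. if r = r0 then (cmod (c r))\<^sup>2 else 0)"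
    proof (intro sum.cong refl)
      fix r assume "r \<in> {..<N}"
      then show "(cmod (c r))\<^sup>2 * indicator (S r) x = (if r = r0 then (cmod (c r))\<^sup>2 else 0)"
        using r0(2) nr[of r] by (cases "r = r0") simp_all
    qed
    ultimately show ?thesis using r0(1) by simp
  next
    case False
    then have "(\<Sum>r<N. c r * indicator (S r) x) = 0" "(\<Sum>r<N. (cmod (c r))\<^sup>2 * indicator (S r) x) = 0"
      by (auto intro!: sum.neutral)
    then show ?thesis by simp
  qed
  have "(\<integral>\<^sup>+x. ennreal ((cmod (\<Sum>r<N. c r * indicator (S r) x))\<^sup>2) \<partial>lborel)
      = (\<integral>\<^sup>+x. (\<Sum>r<N. ennreal ((cmod (c r))\<^sup>2) * indicator (S r) x) \<partial>lborel)"
  proof (intro nn_integral_cong)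
    fix x
    have "ennreal (\<Sum>r<N. (cmod (c r))\<^sup>2 * indicator (S r) x) = (\<Sum>r<N. ennreal ((cmod (c r))\<^sup>2 * indicator (S r) x))"
      by (rule sum_ennreal[symmetric]) simp
    also have "\<dots> = (\<Sum>r<N. ennreal ((cmod (c r))\<^sup>2) * indicator (S r) x)"
      by (intro sum.cong refl) (simp add: ennreal_mult' ennreal_indicator)
    finally show "ennreal ((cmod (\<Sum>r<N. c r * indicator (S r) x))\<^sup>2) = (\<Sum>r<N. ennreal ((cmod (c r))\<^sup>2) * indicator (S r) x)"
      unfolding pw .
  qed
  also have "\<dots> = (\<Sum>r<N. ennreal ((cmod (c r))\<^sup>2) * ennreal (pt (Suc r) - pt r))"
  proof (subst nn_integral_sum)
    show "(\<Sum>r<N. (\<integral>\<^sup>+x. ennreal ((cmod (c r))\<^sup>2) * indicator (S r) x \<partial>lborel)) = (\<Sum>r<N. ennreal ((cmod (c r))\<^sup>2) * ennreal (pt (Suc r) - pt r))"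
    proof (intro sum.cong refl)
      fix r assume "r \<in> {..<N}"
      then have "pt r \<le> pt (Suc r)" using pt_step[of r] by simp
      then show "(\<integral>\<^sup>+x. ennreal ((cmod (c r))\<^sup>2) * indicator (S r) x \<partial>lborel) = ennreal ((cmod (c r))\<^sup>2) * ennreal (pt (Suc r) - pt r)"
        unfolding S_def by (subst nn_integral_cmult_indicator) simp_all
    qed
  qed (simp add: S_def)
  also have "\<dots> = (\<Sum>r<N. ennreal ((cmod (c r))\<^sup>2 * (pt (Suc r) - pt r)))"
    using pt_step by (intro sum.cong refl ennreal_mult[symmetric]) (auto simp: less_imp_le)
  also have "\<dots> = ennreal (\<Sum>r<N. (cmod (c r))\<^sup>2 * (pt (Suc r) - pt r))"
    using pt_step by (intro sum_ennreal mult_nonneg_nonneg) (auto simp: less_imp_le)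
  finally show ?thesis unfolding S_def .
qed

lemma nn_integral_step_fun:
  assumes "adapted cs"
  shows "(\<integral>\<^sup>+x. ennreal ((cmod (step_fun cs x))\<^sup>2) \<partial>lborel)
   = ennreal (\<Sum>r<N. (cmod (step_fun cs (pt (Suc r))))\<^sup>2 * (pt (Suc r) - pt r))"
  using nn_integral_grid[of "\<lambda>r. step_fun cs (pt (Suc r))"] unfolding step_fun_grid[OF assms, symmetric] .

lemma nn_integral_step_fun_diff:
  assumes "adapted cs" "adapted cs'"
  shows "(\<integral>\<^sup>+x. ennreal ((cmod (step_fun cs x - step_fun cs' x))\<^sup>2) \<partial>lborel)
   = ennreal (\<Sum>r<N. (cmod (step_fun cs (pt (Suc r)) - step_fun cs' (pt (Suc r))))\<^sup>2 * (pt (Suc r) - pt r))"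
proof -
  have "step_fun cs x - step_fun cs' x = (\<Sum>r<N. (step_fun cs (pt (Suc r)) - step_fun cs' (pt (Suc r))) * indicator {pt r<..pt (Suc r)} x)" for x
    unfolding left_diff_distrib sum_subtractf step_fun_grid[OF assms(1), symmetric] step_fun_grid[OF assms(2), symmetric] ..
  then have "(\<integral>\<^sup>+x. ennreal ((cmod (step_fun cs x - step_fun cs' x))\<^sup>2) \<partial>lborel)
     = (\<integral>\<^sup>+x. ennreal ((cmod (\<Sum>r<N. (step_fun cs (pt (Suc r)) - step_fun cs' (pt (Suc r))) * indicator {pt r<..pt (Suc r)} x))\<^sup>2) \<partial>lborel)"
    by (intro nn_integral_cong arg_cong[where f = "\<lambda>z. ennreal ((cmod z)\<^sup>2)"])
  then show ?thesis by (rule trans) (rule nn_integral_grid)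
qed

end

lemma step_fun_measurable [measurable]: "step_fun cs \<in> borel_measurable borel"
proof -
  have "(\<lambda>x. step_fun cs x) \<in> borel_measurable borel"
    by (induction cs) (auto simp: step_fun_def)
  then show ?thesis by simp
qed

lemma ennreal_perturb:
  fixes b d :: ennreal
  assumes "b < d" and e: "(e \<longlongrightarrow> 0) F"
  shows "\<exists>\<eta>>0. eventually (\<lambda>m. ennreal (1 + \<eta>) * b + ennreal (1 + 1 / \<eta>) * e m < d) F"
proof -
  obtain b' where b': "b = ennreal b'" "b' \<ge> 0" using assms(1) by (cases b) auto
  obtain d' where d': "b < d'" "d' < d" using dense[OF assms(1)] by blast
  obtain d'' where d'': "d' = ennreal d''" "d'' \<ge> 0" using d'(2) by (cases d') auto
  have bd: "b' < d''" using d'(1) b' d'' by (simp add: ennreal_less_iff)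
  define \<eta> where "\<eta> = (d'' - b') / (b' + 1)"
  have \<eta>: "\<eta> > 0" using bd b' by (simp add: \<eta>_def)
  have "(1 + \<eta>) * b' \<le> d''"
  proof -
    have "\<eta> * b' \<le> \<eta> * (b' + 1)" using \<eta> by simp
    also have "\<dots> = d'' - b'" using b' by (simp add: \<eta>_def)
    finally show ?thesis by (simp add: algebra_simps)
  qed
  then have 1: "ennreal (1 + \<eta>) * b \<le> d'"
  proof -
    have "ennreal (1 + \<eta>) * b = ennreal ((1 + \<eta>) * b')"
      unfolding b'(1) using \<eta> b'(2) by (intro ennreal_mult[symmetric]) auto
    then show ?thesis using \<open>(1 + \<eta>) * b' \<le> d''\<close> d''(1) by (simp only: ennreal_leI)
  qed
  have "((\<lambda>m. ennreal (1 + \<eta>) * b + ennreal (1 + 1 / \<eta>) * e m) \<longlongrightarrow> ennreal (1 + \<eta>) * b + ennreal (1 + 1 / \<eta>) * 0) F"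
    by (intro tendsto_add tendsto_const ennreal_tendsto_cmult e) auto
  moreover have "ennreal (1 + \<eta>) * b + ennreal (1 + 1 / \<eta>) * 0 < d" using 1 d'(2) by simp
  ultimately show ?thesis using \<eta> order_tendstoD(2) by blast
qed

text \<open>\<open>|f|\<^sup>2 \<le> (1 + \<eta>) |g|\<^sup>2 + (1 + 1/\<eta>) |f - g|\<^sup>2\<close> holds pointwise.\<close>

lemma L2_perturb:
  fixes f g :: "'a \<Rightarrow> complex"
  assumes [measurable]: "f \<in> borel_measurable M" "g \<in> borel_measurable M" and \<eta>: "\<eta> > 0"
  shows "(\<integral>\<^sup>+x. ennreal ((cmod (f x))\<^sup>2) \<partial>M) \<le> ennreal (1 + \<eta>) * (\<integral>\<^sup>+x. ennreal ((cmod (g x))\<^sup>2) \<partial>M)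
     + ennreal (1 + 1 / \<eta>) * (\<integral>\<^sup>+x. ennreal ((cmod (f x - g x))\<^sup>2) \<partial>M)"
proof -
  have el: "(cmod a)\<^sup>2 \<le> (1 + \<eta>) * (cmod b)\<^sup>2 + (1 + 1 / \<eta>) * (cmod (a - b))\<^sup>2" for a b
  proof -
    let ?x = "cmod b" and ?y = "cmod (a - b)"
    have "cmod a \<le> ?x + ?y" using norm_triangle_ineq[of b "a - b"] by simp
    then have "(cmod a)\<^sup>2 \<le> (?x + ?y)\<^sup>2" by (intro power_mono) auto
    also have "\<dots> \<le> (1 + \<eta>) * ?x\<^sup>2 + (1 + 1 / \<eta>) * ?y\<^sup>2"
    proof -
      have "0 \<le> (\<eta> * ?x - ?y)\<^sup>2 / \<eta>" using \<eta> by simp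
      also have "\<dots> = \<eta> * ?x\<^sup>2 - 2 * ?x * ?y + ?y\<^sup>2 / \<eta>"
        using \<eta> by (simp add: power2_eq_square field_simps)
      finally show ?thesis by (simp add: power2_sum algebra_simps)
    qed
    finally show ?thesis .
  qed
  have "(\<integral>\<^sup>+x. ennreal ((cmod (f x))\<^sup>2) \<partial>M) \<le> (\<integral>\<^sup>+x. ennreal (1 + \<eta>) * ennreal ((cmod (g x))\<^sup>2) + ennreal (1 + 1 / \<eta>) * ennreal ((cmod (f x - g x))\<^sup>2) \<partial>M)"
  proof (rule nn_integral_mono)
    fix x
    have "ennreal ((cmod (f x))\<^sup>2) \<le> ennreal ((1 + \<eta>) * (cmod (g x))\<^sup>2 + (1 + 1 / \<eta>) * (cmod (f x - g x))\<^sup>2)"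
      by (intro ennreal_leI el)
    also have "\<dots> = ennreal (1 + \<eta>) * ennreal ((cmod (g x))\<^sup>2) + ennreal (1 + 1 / \<eta>) * ennreal ((cmod (f x - g x))\<^sup>2)"
      using \<eta> by (simp add: ennreal_plus ennreal_mult del: ennreal_plus[symmetric])
    finally show "ennreal ((cmod (f x))\<^sup>2) \<le> ennreal (1 + \<eta>) * ennreal ((cmod (g x))\<^sup>2) + ennreal (1 + 1 / \<eta>) * ennreal ((cmod (f x - g x))\<^sup>2)" .
  qed
  also have "\<dots> = ennreal (1 + \<eta>) * (\<integral>\<^sup>+x. ennreal ((cmod (g x))\<^sup>2) \<partial>M)
     + ennreal (1 + 1 / \<eta>) * (\<integral>\<^sup>+x. ennreal ((cmod (f x - g x))\<^sup>2) \<partial>M)"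
    by (simp add: nn_integral_add nn_integral_cmult)
  finally show ?thesis .
qed

lemma L2_eventually_less:
  fixes f :: "nat \<Rightarrow> 'a \<Rightarrow> complex"
  assumes [measurable]: "\<And>m. f m \<in> borel_measurable M" "g \<in> borel_measurable M"
    and lim: "(\<lambda>m. \<integral>\<^sup>+x. ennreal ((cmod (f m x - g x))\<^sup>2) \<partial>M) \<longlonglongrightarrow> 0"
    and less: "(\<integral>\<^sup>+x. ennreal ((cmod (g x))\<^sup>2) \<partial>M) < v"
  shows "eventually (\<lambda>m. (\<integral>\<^sup>+x. ennreal ((cmod (f m x))\<^sup>2) \<partial>M) < v) sequentially"
proof -
  obtain \<eta> where \<eta>: "\<eta> > 0" "eventually (\<lambda>m. ennreal (1 + \<eta>) * (\<integral>\<^sup>+x. ennreal ((cmod (g x))\<^sup>2) \<partial>M)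
      + ennreal (1 + 1 / \<eta>) * (\<integral>\<^sup>+x. ennreal ((cmod (f m x - g x))\<^sup>2) \<partial>M) < v) sequentially"
    using ennreal_perturb[OF less lim] by blast
  show ?thesis
    using \<eta>(2) by (rule eventually_mono) (rule le_less_trans[OF L2_perturb[OF _ _ \<eta>(1)]], auto)
qed

text \<open>The perturbation bound, applied once to \<open>f m\<close> and once to \<open>g\<close>, gives the two one-sided limits.\<close>

lemma L2_norm_tendsto:
  fixes f :: "nat \<Rightarrow> 'a \<Rightarrow> complex"
  assumes m[measurable]: "\<And>m. f m \<in> borel_measurable M" "g \<in> borel_measurable M"
    and lim: "(\<lambda>m. \<integral>\<^sup>+x. ennreal ((cmod (f m x - g x))\<^sup>2) \<partial>M) \<longlonglongrightarrow> 0"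
  shows "(\<lambda>m. \<integral>\<^sup>+x. ennreal ((cmod (f m x))\<^sup>2) \<partial>M) \<longlonglongrightarrow> (\<integral>\<^sup>+x. ennreal ((cmod (g x))\<^sup>2) \<partial>M)"
proof (rule order_tendstoI)
  fix v assume "(\<integral>\<^sup>+x. ennreal ((cmod (g x))\<^sup>2) \<partial>M) < v"
  then show "eventually (\<lambda>m. (\<integral>\<^sup>+x. ennreal ((cmod (f m x))\<^sup>2) \<partial>M) < v) sequentially"
    by (rule L2_eventually_less[OF m lim])
next
  fix y assume y: "y < (\<integral>\<^sup>+x. ennreal ((cmod (g x))\<^sup>2) \<partial>M)"
  obtain \<eta> where \<eta>: "\<eta> > 0" "eventually (\<lambda>m. ennreal (1 + \<eta>) * y
      + ennreal (1 + 1 / \<eta>) * (\<integral>\<^sup>+x. ennreal ((cmod (f m x - g x))\<^sup>2) \<partial>M) < (\<integral>\<^sup>+x. ennreal ((cmod (g x))\<^sup>2) \<partial>M)) sequentially"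
    using ennreal_perturb[OF y lim] by blast
  show "eventually (\<lambda>m. y < (\<integral>\<^sup>+x. ennreal ((cmod (f m x))\<^sup>2) \<partial>M)) sequentially"
    using \<eta>(2)
  proof (rule eventually_mono)
    fix m assume *: "ennreal (1 + \<eta>) * y + ennreal (1 + 1 / \<eta>) * (\<integral>\<^sup>+x. ennreal ((cmod (f m x - g x))\<^sup>2) \<partial>M) < (\<integral>\<^sup>+x. ennreal ((cmod (g x))\<^sup>2) \<partial>M)"
    show "y < (\<integral>\<^sup>+x. ennreal ((cmod (f m x))\<^sup>2) \<partial>M)"
    proof (rule ccontr)
    assume **: "\<not> y < (\<integral>\<^sup>+x. ennreal ((cmod (f m x))\<^sup>2) \<partial>M)"
    have "(\<integral>\<^sup>+x. ennreal ((cmod (g x))\<^sup>2) \<partial>M) \<le> ennreal (1 + \<eta>) * (\<integral>\<^sup>+x. ennreal ((cmod (f m x))\<^sup>2) \<partial>M)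
      + ennreal (1 + 1 / \<eta>) * (\<integral>\<^sup>+x. ennreal ((cmod (g x - f m x))\<^sup>2) \<partial>M)"
      by (rule L2_perturb[OF m(2,1) \<eta>(1)])
    also have "\<dots> \<le> ennreal (1 + \<eta>) * y + ennreal (1 + 1 / \<eta>) * (\<integral>\<^sup>+x. ennreal ((cmod (f m x - g x))\<^sup>2) \<partial>M)"
      using ** by (intro add_mono mult_left_mono) (auto simp: norm_minus_commute)
    finally show False using * by simp
    qed
  qed
qed

lemma nn_integral_tendsto_0_AE_subseq:
  fixes u :: "nat \<Rightarrow> 'a \<Rightarrow> real"
  assumes [measurable]: "\<And>m. u m \<in> borel_measurable M" and nn: "\<And>m x. u m x \<ge> 0"
    and lim: "(\<lambda>m. \<integral>\<^sup>+x. ennreal (u m x) \<partial>M) \<longlonglongrightarrow> 0"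
  obtains r where "strict_mono (r :: nat \<Rightarrow> nat)" "AE x in M. (\<lambda>m. u (r m) x) \<longlonglongrightarrow> 0"
proof -
  have "eventually (\<lambda>m. (\<integral>\<^sup>+x. ennreal (u m x) \<partial>M) < 1) sequentially"
    using order_tendstoD(2)[OF lim, of 1] by simp
  then obtain m0 where m0: "\<And>m. m \<ge> m0 \<Longrightarrow> (\<integral>\<^sup>+x. ennreal (u m x) \<partial>M) < 1"
    unfolding eventually_sequentially by blast
  have int: "integrable M (u (m + m0))" for m
  proof (rule integrableI_bounded)
    have "(\<integral>\<^sup>+x. ennreal (norm (u (m + m0) x)) \<partial>M) < 1" using m0[of "m + m0"] nn by simp
    also have "\<dots> < \<infinity>" by simp
    finally show "(\<integral>\<^sup>+x. ennreal (norm (u (m + m0) x)) \<partial>M) < \<infinity>" .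
  qed simp
  have "(\<lambda>m. ennreal (\<integral>x. norm (u (m + m0) x) \<partial>M)) \<longlonglongrightarrow> ennreal 0"
    using LIMSEQ_ignore_initial_segment[OF lim, of m0] nn
    by (subst (asm) nn_integral_eq_integral[OF int]) auto
  then have "(\<lambda>m. (\<integral>x. norm (u (m + m0) x) \<partial>M)) \<longlonglongrightarrow> 0"
    by (subst (asm) tendsto_ennreal_iff) auto
  from tendsto_L1_AE_subseq[OF int this] obtain r where r: "strict_mono r" "AE x in M. (\<lambda>m. u (r m + m0) x) \<longlonglongrightarrow> 0"
    by blast
  show ?thesis
    using r by (intro that[of "\<lambda>m. r m + m0"]) (auto simp: strict_mono_def)
qed

section \<open>Moments of the Littlewood-Paley blocks of a Wick field\<close>


context white_noise
begin

lemma wick_chaos_measurable [measurable]: "wick_chaos d g u c c' \<in> borel_measurable FF.G"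
proof -
  have JJ: "JJ {False} \<union> JJ {True} = JJ UNIV" by (auto simp: UNIV_bool)
  have "chaos d g u c c' \<in> borel_measurable UU.G"
    unfolding chaos_eq[abs_def] by measurable
  then have f: "chaos d g u c c' \<in> borel_measurable (PiM (JJ {False} \<union> JJ {True}) (\<lambda>j. gauss (ss j)))"
    unfolding JJ UU.G_def .
  have "(\<lambda>p. chaos d g u c c' (merge (JJ {False}) (JJ {True}) p)) \<in> borel_measurable (FF.G \<Otimes>\<^sub>M TT.G)"
    using measurable_compose[OF measurable_merge f] unfolding FF.G_def TT.G_def .
  then show ?thesis
    unfolding wick_chaos_eq(2)[abs_def]
    by (intro TT.G.borel_measurable_lebesgue_integral) (simp add: case_prod_beta')
qed

end

text \<open>The frequency of a product of waves, where \<open>False\<close> marks a conjugated wave.\<close>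

definition nu :: "((int \<times> int) \<times> bool) list \<Rightarrow> int \<times> int" where
  "nu \<tau> = sum_list (map (\<lambda>q. if snd q then fst q else - fst q) \<tau>)"

lemma nu_simps [simp]: "nu [] = 0" "nu (q # \<tau>) = (if snd q then fst q else - fst q) + nu \<tau>"
  by (simp_all add: nu_def)

lemma wick_coef_wave: "wick_coef k l (\<lambda>n. w n * wave n x) \<tau> = wick_coef k l w \<tau> * wave (nu \<tau>) x"
proof -
  have "prod_list (map (\<lambda>q. if snd q then w (fst q) * wave (fst q) x else cnj (w (fst q) * wave (fst q) x)) \<tau>)
     = prod_list (map (\<lambda>q. if snd q then w (fst q) else cnj (w (fst q))) \<tau>) * wave (nu \<tau>) x"
    by (induction \<tau>) (auto simp: wave_add cnj_wave mult_ac)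
  then show ?thesis by (simp add: wick_coef_def)
qed

lemma tendsto_prod_list:
  fixes f :: "'a \<Rightarrow> 'b \<Rightarrow> 'c::real_normed_field"
  assumes "\<And>q. q \<in> set \<tau> \<Longrightarrow> ((\<lambda>m. f m q) \<longlongrightarrow> g q) F"
  shows "((\<lambda>m. prod_list (map (f m) \<tau>)) \<longlongrightarrow> prod_list (map g \<tau>)) F"
  using assms by (induction \<tau>) (auto intro!: tendsto_mult)

lemma tendsto_wick_coef:
  assumes "\<And>n \<kappa>. (n, \<kappa>) \<in> set \<tau> \<Longrightarrow> ((\<lambda>m. b m n) \<longlongrightarrow> c n) F"
  shows "((\<lambda>m. wick_coef k l (b m) \<tau>) \<longlongrightarrow> wick_coef k l c \<tau>) F"
  unfolding wick_coef_def using assms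
  by (auto intro!: tendsto_prod_list tendsto_cnj)

lemma cnj_measurable [measurable]: "cnj \<in> borel_measurable borel"
  by (intro borel_measurable_continuous_onI continuous_intros)

lemma measurable_wick_coef:
  assumes "\<And>n \<kappa>. (n, \<kappa>) \<in> set \<tau> \<Longrightarrow> (\<lambda>\<omega>. b \<omega> n) \<in> borel_measurable M"
  shows "(\<lambda>\<omega>. wick_coef k l (b \<omega>) \<tau>) \<in> borel_measurable M"
proof -
  have "(\<lambda>\<omega>. prod_list (map (\<lambda>q. if snd q then b \<omega> (fst q) else cnj (b \<omega> (fst q))) \<tau>)) \<in> borel_measurable M"
    using assms
  proof (induction \<tau>)
    case (Cons q \<tau>)
    then have [measurable]: "(\<lambda>\<omega>. b \<omega> (fst q)) \<in> borel_measurable M" by (cases q) auto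
    have [measurable]: "(\<lambda>\<omega>. prod_list (map (\<lambda>q. if snd q then b \<omega> (fst q) else cnj (b \<omega> (fst q))) \<tau>)) \<in> borel_measurable M"
      by (rule Cons.IH) (use Cons.prems in auto)
    show ?case by (cases "snd q") auto
  qed simp
  then show ?thesis unfolding wick_coef_def by simp
qed

definition wick_field :: "nat \<Rightarrow> nat \<Rightarrow> (int \<times> int) set \<Rightarrow> (int \<times> int \<Rightarrow> complex) \<Rightarrow> real \<Rightarrow> (int \<times> int \<Rightarrow> complex)
    \<Rightarrow> real \<times> real \<Rightarrow> complex" where
  "wick_field k l T w \<sigma> z x = chermite k l \<sigma> (\<Sum>n\<in>T. w n * wave n x * z n)"

definition wick_index :: "nat \<Rightarrow> nat \<Rightarrow> (int \<times> int) set \<Rightarrow> (nat \<times> ((int \<times> int) \<times> bool) list) set" where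
  "wick_index k l T = (SIGMA a:{..k}. tuples (T \<times> UNIV) ((k - a) + (l - a)))"

definition wick_amp :: "nat \<Rightarrow> nat \<Rightarrow> (int \<times> int \<Rightarrow> complex) \<Rightarrow> real \<Rightarrow> (int \<times> int \<Rightarrow> complex) \<Rightarrow> nat \<times> ((int \<times> int) \<times> bool) list \<Rightarrow> complex" where
  "wick_amp k l w \<sigma> z i = of_real ((-\<sigma>) ^ fst i * fact (fst i) * real (k choose fst i) * real (l choose fst i)) *
     wick_coef (k - fst i) (l - fst i) (\<lambda>n. w n * z n) (snd i)"

lemma finite_wick_index [simp]: "finite T \<Longrightarrow> finite (wick_index k l T)"
  unfolding wick_index_def by auto

text \<open>Pathwise the Wick field is a trigonometric polynomial with a finite set of frequencies that does not
  depend on time, weight or path.\<close>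

lemma wick_field_trig:
  assumes "finite T"
  shows "wick_field k l T w \<sigma> z = trig_poly (wick_index k l T) (wick_amp k l w \<sigma> z) (\<lambda>i. nu (snd i))"
proof
  fix x
  let ?P = "\<Sum>n\<in>T. w n * wave n x * z n"
  have pw: "?P ^ a * cnj ?P ^ b = (\<Sum>\<tau>\<in>tuples (T \<times> UNIV) (a + b). wick_coef a b (\<lambda>n. w n * z n) \<tau> * wave (nu \<tau>) x)" for a b
  proof -
    let ?h = "\<lambda>q. if snd q then (w (fst q) * z (fst q)) * wave (fst q) x else cnj ((w (fst q) * z (fst q)) * wave (fst q) x)"
    have "?P = (\<Sum>n\<in>T. ?h (n, True))" "cnj ?P = (\<Sum>n\<in>T. ?h (n, False))"
      unfolding cnj_sum by (auto intro!: sum.cong simp: mult_ac)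
    then have "?P ^ a * cnj ?P ^ b = (\<Sum>\<tau>\<in>tuples (T \<times> UNIV) (a + b). if map snd \<tau> = wick_pattern a b then prod_list (map ?h \<tau>) else 0)"
      using power_sum_expand[of ?h T a b] by simp
    also have "\<dots> = (\<Sum>\<tau>\<in>tuples (T \<times> UNIV) (a + b). wick_coef a b (\<lambda>n. (w n * z n) * wave n x) \<tau>)"
      by (simp only: wick_coef_def)
    finally show ?thesis by (simp only: wick_coef_wave)
  qed
  have "trig_poly (wick_index k l T) (wick_amp k l w \<sigma> z) (\<lambda>i. nu (snd i)) x
      = (\<Sum>a\<le>k. \<Sum>\<tau>\<in>tuples (T \<times> UNIV) ((k - a) + (l - a)). wick_amp k l w \<sigma> z (a, \<tau>) * wave (nu \<tau>) x)"
    unfolding trig_poly_def wick_index_def using assms by (subst sum.Sigma) (auto simp: case_prod_unfold)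
  also have "\<dots> = (\<Sum>a\<le>k. of_real ((-\<sigma>) ^ a * fact a * real (k choose a) * real (l choose a)) * (?P ^ (k - a) * cnj ?P ^ (l - a)))"
    by (intro sum.cong refl, simp only: pw) (simp only: wick_amp_def sum_distrib_left fst_conv snd_conv mult.assoc)
  also have "\<dots> = wick_field k l T w \<sigma> z x"
    by (simp only: wick_field_def chermite_explicit mult.assoc)
  finally show "wick_field k l T w \<sigma> z x = trig_poly (wick_index k l T) (wick_amp k l w \<sigma> z) (\<lambda>i. nu (snd i)) x" ..
qed

context LP
begin

definition block :: "nat \<Rightarrow> nat \<Rightarrow> nat \<Rightarrow> (int \<times> int) set \<Rightarrow> (int \<times> int \<Rightarrow> complex) \<Rightarrow> real \<Rightarrow> (int \<times> int \<Rightarrow> complex) \<Rightarrow> real \<times> real \<Rightarrow> complex" where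
  "block j k l T w \<sigma> z x = LP_block \<phi>\<^sub>0 j (fourier_coeff (wick_field k l T w \<sigma> z)) x"

lemma block_eq:
  assumes "finite T"
  shows "block j k l T w \<sigma> z x = (\<Sum>i\<in>wick_index k l T.
     of_real (LP_phi \<phi>\<^sub>0 j (freq (nu (snd i)))) * wick_amp k l w \<sigma> z i * wave (nu (snd i)) x)"
  unfolding block_def wick_field_trig[OF assms] using assms by (intro LP_block_trig) auto

lemma tendsto_wick_amp:
  assumes "i \<in> wick_index k l T" "(\<sigma> \<longlongrightarrow> \<sigma>') F" "\<And>n. n \<in> T \<Longrightarrow> ((\<lambda>m. z m n) \<longlongrightarrow> z' n) F"
  shows "((\<lambda>m. wick_amp k l w (\<sigma> m) (z m) i) \<longlongrightarrow> wick_amp k l w \<sigma>' z' i) F"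
  unfolding wick_amp_def using assms
  by (intro tendsto_intros tendsto_wick_coef) (auto simp: wick_index_def tuples_def)

lemma tendsto_block:
  assumes T: "finite T" and "(\<sigma> \<longlongrightarrow> \<sigma>') F" "\<And>n. n \<in> T \<Longrightarrow> ((\<lambda>m. z m n) \<longlongrightarrow> z' n) F"
  shows "((\<lambda>m. block j k l T w (\<sigma> m) (z m) x) \<longlongrightarrow> block j k l T w \<sigma>' z' x) F"
  unfolding block_eq[OF T] using assms by (intro tendsto_sum tendsto_mult tendsto_const tendsto_wick_amp)

lemma measurable_wick_amp:
  assumes "i \<in> wick_index k l T" "\<And>n. n \<in> T \<Longrightarrow> (\<lambda>\<omega>. z \<omega> n) \<in> borel_measurable M"
  shows "(\<lambda>\<omega>. wick_amp k l w \<sigma> (z \<omega>) i) \<in> borel_measurable M"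
  unfolding wick_amp_def using assms
  by (intro borel_measurable_times borel_measurable_const measurable_wick_coef) (auto simp: wick_index_def tuples_def)

lemma measurable_block:
  assumes T: "finite T" and "\<And>n. n \<in> T \<Longrightarrow> (\<lambda>\<omega>. z \<omega> n) \<in> borel_measurable M"
  shows "(\<lambda>\<omega>. block j k l T w \<sigma> (z \<omega>) x) \<in> borel_measurable M"
  unfolding block_eq[OF T] using assms
  by (intro borel_measurable_sum borel_measurable_times borel_measurable_const measurable_wick_amp)

lemma measurable_block_pair:
  assumes T: "finite T" and "\<And>n. n \<in> T \<Longrightarrow> (\<lambda>\<omega>. z \<omega> n) \<in> borel_measurable M"
  shows "(\<lambda>p. block j k l T w \<sigma> (z (fst p)) (snd p)) \<in> borel_measurable (M \<Otimes>\<^sub>M borel)"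
proof -
  have "(\<lambda>p. z (fst p) n) \<in> borel_measurable (M \<Otimes>\<^sub>M (borel :: (real \<times> real) measure))" if "n \<in> T" for n
    using assms(2)[OF that] by measurable
  then show ?thesis
    unfolding block_eq[OF T] 
    by (intro borel_measurable_sum borel_measurable_times borel_measurable_const measurable_wick_amp) auto
qed

end

locale LP_noise = LP \<phi>\<^sub>0 + white_noise T R s
  for \<phi>\<^sub>0 and T :: "(int \<times> int) set" and R s
begin

text \<open>For the matching variance the expansion of the Hermite polynomial separates the dependence on \<open>x\<close> and on
  the weights from the noise.\<close>

lemma block_white_noise:
  assumes \<sigma>: "\<sigma> = (\<Sum>n\<in>T. (cmod (w n))\<^sup>2 * (\<Sum>r<R. (cmod (c n r))\<^sup>2 * (2 * (s r)\<^sup>2)))"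
    and z: "\<And>n. n \<in> T \<Longrightarrow> z n = zf c False n y"
  shows "block j k l T w \<sigma> z x = (\<Sum>\<tau>\<in>tuples (T \<times> UNIV) (k + l).
     of_real (LP_phi \<phi>\<^sub>0 j (freq (nu \<tau>))) * wick_coef k l w \<tau> * wave (nu \<tau>) x * EC c \<tau> y)"
proof -
  have "wick_field k l T w \<sigma> z x' = trig_poly (tuples (T \<times> UNIV) (k + l)) (\<lambda>\<tau>. wick_coef k l w \<tau> * EC c \<tau> y) nu x'" for x'
  proof -
    have "(\<Sum>n\<in>T. w n * wave n x' * z n) = (\<Sum>n\<in>T. (w n * wave n x') * zf c False n y)"
      by (intro sum.cong refl) (simp add: z)
    then have "wick_field k l T w \<sigma> z x' = (\<Sum>\<tau>\<in>tuples (T \<times> UNIV) (k + l). wick_coef k l (\<lambda>n. w n * wave n x') \<tau> * EC c \<tau> y)"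
      unfolding wick_field_def by (simp only:) (rule chermite_expand, simp add: \<sigma> norm_mult)
    then show ?thesis unfolding wick_coef_wave trig_poly_def by (simp add: mult_ac)
  qed
  then have "wick_field k l T w \<sigma> z = trig_poly (tuples (T \<times> UNIV) (k + l)) (\<lambda>\<tau>. wick_coef k l w \<tau> * EC c \<tau> y) nu" by blast
  then show ?thesis unfolding block_def using finT by (simp only:) (subst LP_block_trig, auto simp: mult_ac)
qed

end

locale noise = prob_space M + LP \<phi>\<^sub>0
  for M :: "'w measure" and \<phi>\<^sub>0 +
  fixes \<beta> :: "int \<times> int \<Rightarrow> real \<Rightarrow> 'w \<Rightarrow> complex"
  assumes BM: "\<And>n. complex_BM M (\<beta> n)"
    and indep: "indep_vars (\<lambda>_. PiM UNIV (\<lambda>_::real. borel)) (\<lambda>n \<omega> t. \<beta> n t \<omega>) UNIV"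
begin

lemma beta_measurable [measurable]: "\<beta> n t \<in> borel_measurable M"
proof -
  have "(\<lambda>\<omega>. Re (\<beta> n t \<omega>)) \<in> borel_measurable M" "(\<lambda>\<omega>. Im (\<beta> n t \<omega>)) \<in> borel_measurable M"
    using BM[of n] by (auto simp: complex_BM_def real_BM_def)
  then have "(\<lambda>\<omega>. Complex (Re (\<beta> n t \<omega>)) (Im (\<beta> n t \<omega>))) \<in> borel_measurable M"
    unfolding Complex_eq by measurable
  then show ?thesis by simp
qed

lemma step_integral_measurable [measurable]: "step_integral cs (\<beta> n) \<in> borel_measurable M"
proof -
  have "(\<lambda>\<omega>. step_integral cs (\<beta> n) \<omega>) \<in> borel_measurable M"
    unfolding step_integral_def by (induction cs) (auto split: prod.split)
  then show ?thesis by simp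
qed

text \<open>A mixed difference: \<open>u\<close> compares two families of weights (two truncations) and \<open>u'\<close> two families of
  coefficients (two times). The values 0 and 1 switch the comparisons off and on.\<close>

definition increment_block :: "nat \<Rightarrow> nat \<Rightarrow> nat \<Rightarrow> (int \<times> int) set \<Rightarrow> (int \<times> int \<Rightarrow> complex) \<Rightarrow> (int \<times> int \<Rightarrow> complex) \<Rightarrow> complex \<Rightarrow> complex
   \<Rightarrow> (int \<times> int \<Rightarrow> real) \<Rightarrow> (int \<times> int \<Rightarrow> real) \<Rightarrow> (int \<times> int \<Rightarrow> complex) \<Rightarrow> (int \<times> int \<Rightarrow> complex) \<Rightarrow> real \<times> real \<Rightarrow> complex" where
  "increment_block j k l T w1 w2 u u' I I' z z' x =
     (block j k l T w1 (\<Sum>n\<in>T. (cmod (w1 n))\<^sup>2 * I n) z x - u * block j k l T w2 (\<Sum>n\<in>T. (cmod (w2 n))\<^sup>2 * I n) z x)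
     - u' * (block j k l T w1 (\<Sum>n\<in>T. (cmod (w1 n))\<^sup>2 * I' n) z' x - u * block j k l T w2 (\<Sum>n\<in>T. (cmod (w2 n))\<^sup>2 * I' n) z' x)"

definition sym :: "nat \<Rightarrow> nat \<Rightarrow> nat \<Rightarrow> (int \<times> int \<Rightarrow> complex) \<Rightarrow> (int \<times> int \<Rightarrow> complex) \<Rightarrow> complex \<Rightarrow> ((int \<times> int) \<times> bool) list \<Rightarrow> real" where
  "sym j k l w1 w2 u \<tau> = (LP_phi \<phi>\<^sub>0 j (freq (nu \<tau>)))\<^sup>2 * (cmod (wick_coef k l w1 \<tau> - u * wick_coef k l w2 \<tau>))\<^sup>2"

text \<open>All the jumps of the step functions form one grid, on which the step integrals are linear in the
  Gaussian increments and the moment bound for Wick chaoses applies.\<close>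

lemma stage_moment:
  fixes cs cs' :: "int \<times> int \<Rightarrow> (complex \<times> real \<times> real) list"
  assumes T: "finite T"
    and le: "\<And>n c a b. n \<in> T \<Longrightarrow> (c, a, b) \<in> set (cs n) \<Longrightarrow> a \<le> b" "\<And>n c a b. n \<in> T \<Longrightarrow> (c, a, b) \<in> set (cs' n) \<Longrightarrow> a \<le> b"
    and v: "\<And>n. n \<in> T \<Longrightarrow> (\<integral>\<^sup>+x. ennreal ((cmod (step_fun (cs n) x))\<^sup>2) \<partial>lborel) \<le> ennreal (v n)" and v0: "\<And>n. n \<in> T \<Longrightarrow> v n \<ge> 0"
    and u': "u' = 0 \<and> \<theta> = 1 \<or> u' = 1 \<and> (\<forall>n\<in>T. (\<integral>\<^sup>+x. ennreal ((cmod (step_fun (cs' n) x))\<^sup>2) \<partial>lborel) \<le> ennreal (v n) \<and>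
        (\<integral>\<^sup>+x. ennreal ((cmod (step_fun (cs n) x - step_fun (cs' n) x))\<^sup>2) \<partial>lborel) \<le> ennreal (\<theta> * v n))"
    and \<theta>: "\<theta> \<ge> 0"
  shows "(\<integral>\<^sup>+\<omega>. ennreal (cmod (increment_block j k l T w1 w2 u u'
        (\<lambda>n. enn2real (\<integral>\<^sup>+x. ennreal ((cmod (step_fun (cs n) x))\<^sup>2) \<partial>lborel)) (\<lambda>n. enn2real (\<integral>\<^sup>+x. ennreal ((cmod (step_fun (cs' n) x))\<^sup>2) \<partial>lborel))
        (\<lambda>n. step_integral (cs n) (\<beta> n) \<omega>) (\<lambda>n. step_integral (cs' n) (\<beta> n) \<omega>) x) ^ (2 * q)) \<partial>M)
     \<le> ennreal (fact (q * (k + l)) * (4 ^ (k + l) * \<theta> * (\<Sum>\<tau>\<in>tuples (T \<times> UNIV) (k + l). sym j k l w1 w2 u \<tau> * prod_list (map (\<lambda>q. 2 * v (fst q)) \<tau>))) ^ q)"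
proof -
  define E where "E = (\<Union>n\<in>T. \<Union>(c, a, b)\<in>set (cs n) \<union> set (cs' n). {a, b})"
  have finE: "finite E" using T unfolding E_def by auto
  interpret g: real_grid E by unfold_locales (rule finE)
  interpret b: brownian_grid M \<beta> T g.pt g.N
    by unfold_locales (auto simp: BM indep T g.pt_step)
  interpret LP_noise \<phi>\<^sub>0 T g.N b.sp by unfold_locales
  have ad: "n \<in> T \<Longrightarrow> g.adapted (cs n)" "n \<in> T \<Longrightarrow> g.adapted (cs' n)" for n
  proof -
    have "n \<in> T \<Longrightarrow> (c, a, b) \<in> set (cs n) \<union> set (cs' n) \<Longrightarrow> a \<in> E \<and> b \<in> E" for c a b
      unfolding E_def by fastforce
    then show "n \<in> T \<Longrightarrow> g.adapted (cs n)" "n \<in> T \<Longrightarrow> g.adapted (cs' n)"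
      using le unfolding g.adapted_def by blast+
  qed
  define c where "c = (\<lambda>n r. step_fun (cs n) (g.pt (Suc r)))"
  define c' where "c' = (\<lambda>n r. step_fun (cs' n) (g.pt (Suc r)))"
  have sp: "2 * (b.sp r)\<^sup>2 = g.pt (Suc r) - g.pt r" if "r < g.N" for r
    using that g.pt_step[OF that] by (simp add: b.sp_def)
  have sp2: "(2 * b.sp r)\<^sup>2 = 2 * (g.pt (Suc r) - g.pt r)" if "r < g.N" for r
    using sp[OF that] by (simp add: power_mult_distrib)
  have n1: "(\<Sum>r<g.N. (cmod (d r))\<^sup>2 * (2 * (b.sp r)\<^sup>2)) = (\<Sum>r<g.N. (cmod (d r))\<^sup>2 * (g.pt (Suc r) - g.pt r))" for d :: "nat \<Rightarrow> complex"
    by (intro sum.cong refl) (simp add: sp)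
  have n2: "(\<Sum>r<g.N. (cmod (d r))\<^sup>2 * (2 * b.sp r)\<^sup>2) = 2 * (\<Sum>r<g.N. (cmod (d r))\<^sup>2 * (g.pt (Suc r) - g.pt r))" for d :: "nat \<Rightarrow> complex"
    unfolding sum_distrib_left by (intro sum.cong refl) (simp only: lessThan_iff sp2 mult_ac)
  have nn: "(\<Sum>r<g.N. (cmod (d r))\<^sup>2 * (g.pt (Suc r) - g.pt r)) \<ge> 0" for d :: "nat \<Rightarrow> complex"
    using g.pt_step by (intro sum_nonneg mult_nonneg_nonneg) (auto simp: less_imp_le)
  have I: "enn2real (\<integral>\<^sup>+x. ennreal ((cmod (step_fun (cs n) x))\<^sup>2) \<partial>lborel) = (\<Sum>r<g.N. (cmod (c n r))\<^sup>2 * (2 * (b.sp r)\<^sup>2))"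
    and I': "enn2real (\<integral>\<^sup>+x. ennreal ((cmod (step_fun (cs' n) x))\<^sup>2) \<partial>lborel) = (\<Sum>r<g.N. (cmod (c' n r))\<^sup>2 * (2 * (b.sp r)\<^sup>2))" if "n \<in> T" for n
    unfolding n1 g.nn_integral_step_fun[OF ad(1)[OF that]] g.nn_integral_step_fun[OF ad(2)[OF that]] c_def c'_def
    using nn by (auto simp: enn2real_ennreal)
  have z: "step_integral (cs n) (\<beta> n) \<omega> = b.wn.zf c False n (b.increment \<omega>)"
    and z': "step_integral (cs' n) (\<beta> n) \<omega> = b.wn.zf c' False n (b.increment \<omega>)" if "n \<in> T" for n \<omega>
    using b.zf_increment[OF that, of c \<omega>] b.zf_increment[OF that, of c' \<omega>]
      g.step_integral_grid[OF ad(1)[OF that], of "\<beta> n" \<omega>] g.step_integral_grid[OF ad(2)[OF that], of "\<beta> n" \<omega>]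
    by (simp_all add: c_def c'_def)
  define gram where "gram \<tau> = of_real (LP_phi \<phi>\<^sub>0 j (freq (nu \<tau>))) * (wick_coef k l w1 \<tau> - u * wick_coef k l w2 \<tau>) * wave (nu \<tau>) x" for \<tau>
  have blk: "block j k l T w (\<Sum>n\<in>T. (cmod (w n))\<^sup>2 * enn2real (\<integral>\<^sup>+x. ennreal ((cmod (step_fun (cs n) x))\<^sup>2) \<partial>lborel)) (\<lambda>n. step_integral (cs n) (\<beta> n) \<omega>) x
      = (\<Sum>\<tau>\<in>tuples (T \<times> UNIV) (k + l). of_real (LP_phi \<phi>\<^sub>0 j (freq (nu \<tau>))) * wick_coef k l w \<tau> * wave (nu \<tau>) x * b.wn.EC c \<tau> (b.increment \<omega>))"
    and blk': "block j k l T w (\<Sum>n\<in>T. (cmod (w n))\<^sup>2 * enn2real (\<integral>\<^sup>+x. ennreal ((cmod (step_fun (cs' n) x))\<^sup>2) \<partial>lborel)) (\<lambda>n. step_integral (cs' n) (\<beta> n) \<omega>) x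
      = (\<Sum>\<tau>\<in>tuples (T \<times> UNIV) (k + l). of_real (LP_phi \<phi>\<^sub>0 j (freq (nu \<tau>))) * wick_coef k l w \<tau> * wave (nu \<tau>) x * b.wn.EC c' \<tau> (b.increment \<omega>))" for w \<omega>
    by (intro block_white_noise; simp add: I I' z z')+
  have eq: "increment_block j k l T w1 w2 u u'
        (\<lambda>n. enn2real (\<integral>\<^sup>+x. ennreal ((cmod (step_fun (cs n) x))\<^sup>2) \<partial>lborel)) (\<lambda>n. enn2real (\<integral>\<^sup>+x. ennreal ((cmod (step_fun (cs' n) x))\<^sup>2) \<partial>lborel))
        (\<lambda>n. step_integral (cs n) (\<beta> n) \<omega>) (\<lambda>n. step_integral (cs' n) (\<beta> n) \<omega>) x
      = b.wn.wick_chaos (k + l) gram u' c c' (b.increment \<omega>)" for \<omega>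
    unfolding increment_block_def blk blk' b.wn.wick_chaos_def sum_distrib_left sum_subtractf[symmetric]
    by (intro sum.cong refl) (simp add: gram_def algebra_simps)
  have "(\<integral>\<^sup>+\<omega>. ennreal (cmod (b.wn.wick_chaos (k + l) gram u' c c' (b.increment \<omega>)) ^ (2 * q)) \<partial>M)
      = (\<integral>\<^sup>+y. ennreal (cmod (b.wn.wick_chaos (k + l) gram u' c c' y) ^ (2 * q)) \<partial>b.wn.FF.G)"
    by (rule b.nn_integral_increment[symmetric]) measurable
  also have "\<dots> \<le> ennreal (fact (q * (k + l)) * (4 ^ (k + l) * \<theta> * (\<Sum>\<tau>\<in>tuples (T \<times> UNIV) (k + l). (cmod (gram \<tau>))\<^sup>2 * prod_list (map (\<lambda>q. 2 * v (fst q)) \<tau>))) ^ q)"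
  proof (rule b.wn.wick_chaos_moment[where v = "\<lambda>n. 2 * v n"])
    show "(\<Sum>r<g.N. (cmod (c n r))\<^sup>2 * (2 * b.sp r)\<^sup>2) \<le> 2 * v n" if "n \<in> T" for n
      using v[OF that] v0[OF that] unfolding n2 g.nn_integral_step_fun[OF ad(1)[OF that]] c_def by (simp add: ennreal_le_iff)
    show "u' = 0 \<and> \<theta> = 1 \<or> u' = 1 \<and> (\<forall>n\<in>T. (\<Sum>r<g.N. (cmod (c' n r))\<^sup>2 * (2 * b.sp r)\<^sup>2) \<le> 2 * v n \<and>
       (\<Sum>r<g.N. (cmod (c n r - c' n r))\<^sup>2 * (2 * b.sp r)\<^sup>2) \<le> \<theta> * (2 * v n))"
      using u'
    proof (rule disj_forward)
      assume *: "u' = 1 \<and> (\<forall>n\<in>T. (\<integral>\<^sup>+x. ennreal ((cmod (step_fun (cs' n) x))\<^sup>2) \<partial>lborel) \<le> ennreal (v n) \<and>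
        (\<integral>\<^sup>+x. ennreal ((cmod (step_fun (cs n) x - step_fun (cs' n) x))\<^sup>2) \<partial>lborel) \<le> ennreal (\<theta> * v n))"
      have "(\<Sum>r<g.N. (cmod (c' n r))\<^sup>2 * (2 * b.sp r)\<^sup>2) \<le> 2 * v n \<and>
         (\<Sum>r<g.N. (cmod (c n r - c' n r))\<^sup>2 * (2 * b.sp r)\<^sup>2) \<le> \<theta> * (2 * v n)" if n: "n \<in> T" for n
      proof -
        from * n have "(\<integral>\<^sup>+x. ennreal ((cmod (step_fun (cs' n) x))\<^sup>2) \<partial>lborel) \<le> ennreal (v n)"
          "(\<integral>\<^sup>+x. ennreal ((cmod (step_fun (cs n) x - step_fun (cs' n) x))\<^sup>2) \<partial>lborel) \<le> ennreal (\<theta> * v n)" by auto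
        then show ?thesis
          using v0[OF n] \<theta>
          unfolding n2 g.nn_integral_step_fun[OF ad(2)[OF n]] g.nn_integral_step_fun_diff[OF ad(1)[OF n] ad(2)[OF n]] c_def c'_def
          by (simp add: ennreal_le_iff)
      qed
      then show "u' = 1 \<and> (\<forall>n\<in>T. (\<Sum>r<g.N. (cmod (c' n r))\<^sup>2 * (2 * b.sp r)\<^sup>2) \<le> 2 * v n \<and>
         (\<Sum>r<g.N. (cmod (c n r - c' n r))\<^sup>2 * (2 * b.sp r)\<^sup>2) \<le> \<theta> * (2 * v n))" using * by blast
    qed
  qed (rule \<theta>)
  also have "(\<lambda>\<tau>. (cmod (gram \<tau>))\<^sup>2) = sym j k l w1 w2 u"
    by (rule ext) (simp add: gram_def sym_def norm_mult power_mult_distrib)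
  finally show ?thesis unfolding eq .
qed


text \<open>The Wiener integrals are limits of step integrals almost surely along a subsequence, and the blocks
  depend continuously on them. Fatou's lemma passes the bound to the limit; the strict inequalities in
  the hypotheses make the step functions obey the bounds eventually.\<close>

theorem increment_block_moment:
  fixes Zt Zs :: "int \<times> int \<Rightarrow> 'w \<Rightarrow> complex" and ft fs :: "int \<times> int \<Rightarrow> real \<Rightarrow> complex"
  assumes T: "finite T"
    and Wt: "\<And>n. n \<in> T \<Longrightarrow> has_wiener_integral M (\<beta> n) (ft n) (Zt n)" and Ws: "\<And>n. n \<in> T \<Longrightarrow> has_wiener_integral M (\<beta> n) (fs n) (Zs n)"
    and m[measurable]: "\<And>n. ft n \<in> borel_measurable borel" "\<And>n. fs n \<in> borel_measurable borel"
    and It: "\<And>n. n \<in> T \<Longrightarrow> (\<integral>\<^sup>+x. ennreal ((cmod (ft n x))\<^sup>2) \<partial>lborel) = ennreal (I n)"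
    and Is: "\<And>n. n \<in> T \<Longrightarrow> (\<integral>\<^sup>+x. ennreal ((cmod (fs n x))\<^sup>2) \<partial>lborel) = ennreal (I n)"
    and I: "\<And>n. n \<in> T \<Longrightarrow> 0 \<le> I n" "\<And>n. n \<in> T \<Longrightarrow> I n < v n"
    and u': "u' = 0 \<and> \<theta> = 1 \<or> u' = 1 \<and> (\<forall>n\<in>T. (\<integral>\<^sup>+x. ennreal ((cmod (ft n x - fs n x))\<^sup>2) \<partial>lborel) < ennreal (\<theta> * v n))"
    and \<theta>: "\<theta> \<ge> 0"
  shows "(\<integral>\<^sup>+\<omega>. ennreal (cmod (increment_block j k l T w1 w2 u u' I I (\<lambda>n. Zt n \<omega>) (\<lambda>n. Zs n \<omega>) x) ^ (2 * q)) \<partial>M)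
     \<le> ennreal (fact (q * (k + l)) * (4 ^ (k + l) * \<theta> * (\<Sum>\<tau>\<in>tuples (T \<times> UNIV) (k + l). sym j k l w1 w2 u \<tau> * prod_list (map (\<lambda>q. 2 * v (fst q)) \<tau>))) ^ q)"
    (is "_ \<le> ?bound")
proof -
  let ?L2 = "\<lambda>f. (\<integral>\<^sup>+x. ennreal ((cmod (f x))\<^sup>2) \<partial>lborel)"
  obtain ct where ct: "\<And>n m c a b. n \<in> T \<Longrightarrow> (c, a, b) \<in> set (ct n m) \<Longrightarrow> a \<le> b"
      "\<And>n. n \<in> T \<Longrightarrow> (\<lambda>m. ?L2 (\<lambda>r. step_fun (ct n m) r - ft n r)) \<longlonglongrightarrow> 0"
      "\<And>n. n \<in> T \<Longrightarrow> (\<lambda>m. \<integral>\<^sup>+\<omega>. ennreal ((cmod (step_integral (ct n m) (\<beta> n) \<omega> - Zt n \<omega>))\<^sup>2) \<partial>M) \<longlonglongrightarrow> 0"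
  proof -
    have "\<forall>n\<in>T. \<exists>cs :: nat \<Rightarrow> (complex \<times> real \<times> real) list. (\<forall>m. \<forall>(c, a, b)\<in>set (cs m). a \<le> b) \<and>
        (\<lambda>m. \<integral>\<^sup>+r. ennreal ((cmod (step_fun (cs m) r - ft n r))\<^sup>2) \<partial>lborel) \<longlonglongrightarrow> 0 \<and>
        (\<lambda>m. \<integral>\<^sup>+\<omega>. ennreal ((cmod (step_integral (cs m) (\<beta> n) \<omega> - Zt n \<omega>))\<^sup>2) \<partial>M) \<longlonglongrightarrow> 0"
      using Wt unfolding has_wiener_integral_def by blast
    from bchoice[OF this] show ?thesis using that by fastforce
  qed
  obtain cs where cs: "\<And>n m c a b. n \<in> T \<Longrightarrow> (c, a, b) \<in> set (cs n m) \<Longrightarrow> a \<le> b"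
      "\<And>n. n \<in> T \<Longrightarrow> (\<lambda>m. ?L2 (\<lambda>r. step_fun (cs n m) r - fs n r)) \<longlonglongrightarrow> 0"
      "\<And>n. n \<in> T \<Longrightarrow> (\<lambda>m. \<integral>\<^sup>+\<omega>. ennreal ((cmod (step_integral (cs n m) (\<beta> n) \<omega> - Zs n \<omega>))\<^sup>2) \<partial>M) \<longlonglongrightarrow> 0"
  proof -
    have "\<forall>n\<in>T. \<exists>cs :: nat \<Rightarrow> (complex \<times> real \<times> real) list. (\<forall>m. \<forall>(c, a, b)\<in>set (cs m). a \<le> b) \<and>
        (\<lambda>m. \<integral>\<^sup>+r. ennreal ((cmod (step_fun (cs m) r - fs n r))\<^sup>2) \<partial>lborel) \<longlonglongrightarrow> 0 \<and>
        (\<lambda>m. \<integral>\<^sup>+\<omega>. ennreal ((cmod (step_integral (cs m) (\<beta> n) \<omega> - Zs n \<omega>))\<^sup>2) \<partial>M) \<longlonglongrightarrow> 0"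
      using Ws unfolding has_wiener_integral_def by blast
    from bchoice[OF this] show ?thesis using that by fastforce
  qed
  have Zm[measurable]: "\<And>n. n \<in> T \<Longrightarrow> Zt n \<in> borel_measurable M" "\<And>n. n \<in> T \<Longrightarrow> Zs n \<in> borel_measurable M"
    using Wt Ws by (auto simp: has_wiener_integral_def)
  define d where "d m \<omega> = (\<Sum>n\<in>T. (cmod (step_integral (ct n m) (\<beta> n) \<omega> - Zt n \<omega>))\<^sup>2 + (cmod (step_integral (cs n m) (\<beta> n) \<omega> - Zs n \<omega>))\<^sup>2)" for m \<omega>
  have d_meas: "d m \<in> borel_measurable M" for m unfolding d_def by measurable
  have d_nn: "d m \<omega> \<ge> 0" for m \<omega> unfolding d_def by (intro sum_nonneg) auto
  have d_int: "(\<integral>\<^sup>+\<omega>. ennreal (d m \<omega>) \<partial>M) = (\<Sum>n\<in>T. (\<integral>\<^sup>+\<omega>. ennreal ((cmod (step_integral (ct n m) (\<beta> n) \<omega> - Zt n \<omega>))\<^sup>2) \<partial>M)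
       + (\<integral>\<^sup>+\<omega>. ennreal ((cmod (step_integral (cs n m) (\<beta> n) \<omega> - Zs n \<omega>))\<^sup>2) \<partial>M))" for m
  proof -
    have "ennreal (d m \<omega>) = (\<Sum>n\<in>T. ennreal ((cmod (step_integral (ct n m) (\<beta> n) \<omega> - Zt n \<omega>))\<^sup>2) + ennreal ((cmod (step_integral (cs n m) (\<beta> n) \<omega> - Zs n \<omega>))\<^sup>2))" for \<omega>
      unfolding d_def by (subst sum_ennreal[symmetric]) (auto intro!: sum.cong)
    then show ?thesis by (simp add: nn_integral_sum nn_integral_add)
  qed
  have "(\<lambda>m. \<integral>\<^sup>+\<omega>. ennreal (d m \<omega>) \<partial>M) \<longlonglongrightarrow> (\<Sum>n\<in>T. 0 + 0)"
    unfolding d_int by (intro tendsto_sum tendsto_add ct cs)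
  then have "(\<lambda>m. \<integral>\<^sup>+\<omega>. ennreal (d m \<omega>) \<partial>M) \<longlonglongrightarrow> 0" by simp
  from nn_integral_tendsto_0_AE_subseq[OF d_meas d_nn this] obtain r where r: "strict_mono (r :: nat \<Rightarrow> nat)"
    "AE \<omega> in M. (\<lambda>m. d (r m) \<omega>) \<longlonglongrightarrow> 0" by blast
  define nt where "nt m n = enn2real (?L2 (step_fun (ct n m)))" for m n
  define ns where "ns m n = enn2real (?L2 (step_fun (cs n m)))" for m n
  define P where "P m \<omega> = increment_block j k l T w1 w2 u u' (nt m) (ns m) (\<lambda>n. step_integral (ct n m) (\<beta> n) \<omega>) (\<lambda>n. step_integral (cs n m) (\<beta> n) \<omega>) x" for m \<omega>
  define Q where "Q \<omega> = increment_block j k l T w1 w2 u u' I I (\<lambda>n. Zt n \<omega>) (\<lambda>n. Zs n \<omega>) x" for \<omega>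
  have nt: "(\<lambda>m. nt m n) \<longlonglongrightarrow> I n" and ns: "(\<lambda>m. ns m n) \<longlonglongrightarrow> I n" if n: "n \<in> T" for n
  proof -
    have "(\<lambda>m. ?L2 (step_fun (ct n m))) \<longlonglongrightarrow> ennreal (I n)" "(\<lambda>m. ?L2 (step_fun (cs n m))) \<longlonglongrightarrow> ennreal (I n)"
      unfolding It[OF n, symmetric] by (rule L2_norm_tendsto; use ct(2)[OF n] in simp)
        (unfold It[OF n] Is[OF n, symmetric], rule L2_norm_tendsto; use cs(2)[OF n] in simp)
    then show "(\<lambda>m. nt m n) \<longlonglongrightarrow> I n" "(\<lambda>m. ns m n) \<longlonglongrightarrow> I n"
      unfolding nt_def ns_def using tendsto_enn2real I(1)[OF n] by auto
  qed
  have lim: "AE \<omega> in M. (\<lambda>m. P (r m) \<omega>) \<longlonglongrightarrow> Q \<omega>"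
    using r(2)
  proof eventually_elim
    fix \<omega> assume d0: "(\<lambda>m. d (r m) \<omega>) \<longlonglongrightarrow> 0"
    have z: "(\<lambda>m. step_integral (ct n (r m)) (\<beta> n) \<omega>) \<longlonglongrightarrow> Zt n \<omega>" "(\<lambda>m. step_integral (cs n (r m)) (\<beta> n) \<omega>) \<longlonglongrightarrow> Zs n \<omega>" if n: "n \<in> T" for n
    proof -
      have le: "(cmod (step_integral (ct n m) (\<beta> n) \<omega> - Zt n \<omega>))\<^sup>2 \<le> d m \<omega>" "(cmod (step_integral (cs n m) (\<beta> n) \<omega> - Zs n \<omega>))\<^sup>2 \<le> d m \<omega>" for m
      proof -
        have "(cmod (step_integral (ct n m) (\<beta> n) \<omega> - Zt n \<omega>))\<^sup>2 + (cmod (step_integral (cs n m) (\<beta> n) \<omega> - Zs n \<omega>))\<^sup>2 \<le> d m \<omega>"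
          unfolding d_def using T n by (intro member_le_sum[where f = "\<lambda>n. (cmod (step_integral (ct n m) (\<beta> n) \<omega> - Zt n \<omega>))\<^sup>2 + (cmod (step_integral (cs n m) (\<beta> n) \<omega> - Zs n \<omega>))\<^sup>2"]) auto
        then show "(cmod (step_integral (ct n m) (\<beta> n) \<omega> - Zt n \<omega>))\<^sup>2 \<le> d m \<omega>" "(cmod (step_integral (cs n m) (\<beta> n) \<omega> - Zs n \<omega>))\<^sup>2 \<le> d m \<omega>"
          by (smt (verit) zero_le_power2)+
      qed
      have "(\<lambda>m. (cmod (step_integral (ct n (r m)) (\<beta> n) \<omega> - Zt n \<omega>))\<^sup>2) \<longlonglongrightarrow> 0"
        "(\<lambda>m. (cmod (step_integral (cs n (r m)) (\<beta> n) \<omega> - Zs n \<omega>))\<^sup>2) \<longlonglongrightarrow> 0"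
        by (rule tendsto_sandwich[OF _ _ tendsto_const d0]; use le in simp)+
      from this[THEN tendsto_real_sqrt] show "(\<lambda>m. step_integral (ct n (r m)) (\<beta> n) \<omega>) \<longlonglongrightarrow> Zt n \<omega>" "(\<lambda>m. step_integral (cs n (r m)) (\<beta> n) \<omega>) \<longlonglongrightarrow> Zs n \<omega>"
        by (auto intro: LIM_zero_cancel tendsto_norm_zero_cancel)
    qed
    have s: "(\<lambda>m. \<Sum>n\<in>T. (cmod (w n))\<^sup>2 * nt (r m) n) \<longlonglongrightarrow> (\<Sum>n\<in>T. (cmod (w n))\<^sup>2 * I n)"
      "(\<lambda>m. \<Sum>n\<in>T. (cmod (w n))\<^sup>2 * ns (r m) n) \<longlonglongrightarrow> (\<Sum>n\<in>T. (cmod (w n))\<^sup>2 * I n)" for w :: "int \<times> int \<Rightarrow> complex"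
      using LIMSEQ_subseq_LIMSEQ[OF nt r(1)] LIMSEQ_subseq_LIMSEQ[OF ns r(1)]
      by (auto intro!: tendsto_sum tendsto_mult simp: o_def)
    show "(\<lambda>m. P (r m) \<omega>) \<longlonglongrightarrow> Q \<omega>"
      unfolding P_def Q_def increment_block_def
      by (intro tendsto_diff tendsto_mult tendsto_const tendsto_block T z s)
  qed
  have P_meas: "P m \<in> borel_measurable M" for m
    unfolding P_def increment_block_def
    by (intro borel_measurable_diff borel_measurable_times borel_measurable_const measurable_block T step_integral_measurable)
  have ev: "eventually (\<lambda>m. (\<integral>\<^sup>+\<omega>. ennreal (cmod (P m \<omega>) ^ (2 * q)) \<partial>M) \<le> ?bound) sequentially"
  proof -
    have e1: "eventually (\<lambda>m. \<forall>n\<in>T. ?L2 (step_fun (ct n m)) < ennreal (v n)) sequentially"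
      unfolding eventually_ball_finite_distrib[OF T]
    proof
      fix n assume n: "n \<in> T"
      show "eventually (\<lambda>m. ?L2 (step_fun (ct n m)) < ennreal (v n)) sequentially"
        by (rule L2_eventually_less[OF _ _ ct(2)[OF n]]) (use I[OF n] It[OF n] in \<open>auto simp: ennreal_less_iff\<close>)
    qed
    have e2: "eventually (\<lambda>m. \<forall>n\<in>T. ?L2 (step_fun (cs n m)) < ennreal (v n)) sequentially"
      unfolding eventually_ball_finite_distrib[OF T]
    proof
      fix n assume n: "n \<in> T"
      show "eventually (\<lambda>m. ?L2 (step_fun (cs n m)) < ennreal (v n)) sequentially"
        by (rule L2_eventually_less[OF _ _ cs(2)[OF n]]) (use I[OF n] Is[OF n] in \<open>auto simp: ennreal_less_iff\<close>)
    qed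
    have e3: "eventually (\<lambda>m. u' = 0 \<and> \<theta> = 1 \<or> u' = 1 \<and> (\<forall>n\<in>T. ?L2 (\<lambda>x. step_fun (ct n m) x - step_fun (cs n m) x) < ennreal (\<theta> * v n))) sequentially"
      using u'
    proof (elim disjE conjE)
      assume u1: "u' = 1" and L: "\<forall>n\<in>T. ?L2 (\<lambda>x. ft n x - fs n x) < ennreal (\<theta> * v n)"
      have "eventually (\<lambda>m. \<forall>n\<in>T. ?L2 (\<lambda>x. step_fun (ct n m) x - step_fun (cs n m) x) < ennreal (\<theta> * v n)) sequentially"
        unfolding eventually_ball_finite_distrib[OF T]
      proof
        fix n assume n: "n \<in> T"
        have D: "(\<lambda>m. ?L2 (\<lambda>x. (step_fun (ct n m) x - step_fun (cs n m) x) - (ft n x - fs n x))) \<longlonglongrightarrow> 0"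
        proof (rule tendsto_sandwich[OF _ _ tendsto_const])
          let ?u = "\<lambda>m. ennreal (1 + 1) * ?L2 (\<lambda>r. step_fun (ct n m) r - ft n r) + ennreal (1 + 1 / 1) * ?L2 (\<lambda>r. step_fun (cs n m) r - fs n r)"
          have "?u \<longlonglongrightarrow> ennreal (1 + 1) * 0 + ennreal (1 + 1 / 1) * 0"
            by (intro tendsto_add ennreal_tendsto_cmult ct cs n) auto
          then show "?u \<longlonglongrightarrow> 0" by simp
          show "eventually (\<lambda>m. ?L2 (\<lambda>x. (step_fun (ct n m) x - step_fun (cs n m) x) - (ft n x - fs n x)) \<le> ?u m) sequentially"
          proof (intro always_eventually allI)
            fix m
            have "?L2 (\<lambda>x. (step_fun (ct n m) x - step_fun (cs n m) x) - (ft n x - fs n x)) \<le> ennreal (1 + 1) * ?L2 (\<lambda>r. step_fun (ct n m) r - ft n r)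
               + ennreal (1 + 1 / 1) * ?L2 (\<lambda>x. ((step_fun (ct n m) x - step_fun (cs n m) x) - (ft n x - fs n x)) - (step_fun (ct n m) x - ft n x))"
              by (rule L2_perturb) auto
            also have "?L2 (\<lambda>x. ((step_fun (ct n m) x - step_fun (cs n m) x) - (ft n x - fs n x)) - (step_fun (ct n m) x - ft n x)) = ?L2 (\<lambda>r. step_fun (cs n m) r - fs n r)"
            proof (rule nn_integral_cong)
              fix x
              have "((step_fun (ct n m) x - step_fun (cs n m) x) - (ft n x - fs n x)) - (step_fun (ct n m) x - ft n x) = - (step_fun (cs n m) x - fs n x)" by simp
              then show "ennreal ((cmod (((step_fun (ct n m) x - step_fun (cs n m) x) - (ft n x - fs n x)) - (step_fun (ct n m) x - ft n x)))\<^sup>2) = ennreal ((cmod (step_fun (cs n m) x - fs n x))\<^sup>2)"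
                by (simp only: norm_minus_cancel)
            qed
            finally show "?L2 (\<lambda>x. (step_fun (ct n m) x - step_fun (cs n m) x) - (ft n x - fs n x)) \<le> ?u m" .
          qed
        qed simp
        show "eventually (\<lambda>m. ?L2 (\<lambda>x. step_fun (ct n m) x - step_fun (cs n m) x) < ennreal (\<theta> * v n)) sequentially"
          by (rule L2_eventually_less[OF _ _ D]) (use L n in auto)
      qed
      then show ?thesis by (rule eventually_mono) (use u1 in simp)
    qed simp
    from e1 e2 e3 show ?thesis
    proof eventually_elim
      fix m assume a: "\<forall>n\<in>T. ?L2 (step_fun (ct n m)) < ennreal (v n)" "\<forall>n\<in>T. ?L2 (step_fun (cs n m)) < ennreal (v n)"
        "u' = 0 \<and> \<theta> = 1 \<or> u' = 1 \<and> (\<forall>n\<in>T. ?L2 (\<lambda>x. step_fun (ct n m) x - step_fun (cs n m) x) < ennreal (\<theta> * v n))"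
      show "(\<integral>\<^sup>+\<omega>. ennreal (cmod (P m \<omega>) ^ (2 * q)) \<partial>M) \<le> ?bound"
        unfolding P_def nt_def ns_def
      proof (rule stage_moment[OF T])
        show "v n \<ge> 0" if "n \<in> T" for n using I[OF that] by simp
        show "?L2 (step_fun (ct n m)) \<le> ennreal (v n)" if "n \<in> T" for n using a(1) that by (simp add: less_imp_le)
        show "u' = 0 \<and> \<theta> = 1 \<or> u' = 1 \<and> (\<forall>n\<in>T. ?L2 (step_fun (cs n m)) \<le> ennreal (v n) \<and> ?L2 (\<lambda>x. step_fun (ct n m) x - step_fun (cs n m) x) \<le> ennreal (\<theta> * v n))"
          using a(2,3) less_imp_le by blast
      qed (use ct(1) cs(1) \<theta> in auto)
    qed
  qed
  have "(\<integral>\<^sup>+\<omega>. ennreal (cmod (Q \<omega>) ^ (2 * q)) \<partial>M) = (\<integral>\<^sup>+\<omega>. liminf (\<lambda>m. ennreal (cmod (P (r m) \<omega>) ^ (2 * q))) \<partial>M)"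
  proof (rule nn_integral_cong_AE)
    show "AE \<omega> in M. ennreal (cmod (Q \<omega>) ^ (2 * q)) = liminf (\<lambda>m. ennreal (cmod (P (r m) \<omega>) ^ (2 * q)))"
      using lim
    proof eventually_elim
      fix \<omega> assume "(\<lambda>m. P (r m) \<omega>) \<longlonglongrightarrow> Q \<omega>"
      then have "(\<lambda>m. ennreal (cmod (P (r m) \<omega>) ^ (2 * q))) \<longlonglongrightarrow> ennreal (cmod (Q \<omega>) ^ (2 * q))"
        by (intro tendsto_ennrealI tendsto_intros)
      then show "ennreal (cmod (Q \<omega>) ^ (2 * q)) = liminf (\<lambda>m. ennreal (cmod (P (r m) \<omega>) ^ (2 * q)))"
        using lim_imp_Liminf[OF sequentially_bot] by metis
    qed
  qed
  also have "\<dots> \<le> liminf (\<lambda>m. \<integral>\<^sup>+\<omega>. ennreal (cmod (P (r m) \<omega>) ^ (2 * q)) \<partial>M)"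
    using P_meas by (intro nn_integral_liminf) auto
  also have "\<dots> \<le> limsup (\<lambda>m. \<integral>\<^sup>+\<omega>. ennreal (cmod (P (r m) \<omega>) ^ (2 * q)) \<partial>M)"
    by (rule Liminf_le_Limsup) simp
  also have "\<dots> \<le> ?bound"
    using eventually_subseq[OF r(1) ev] by (intro Limsup_bounded)
  finally show ?thesis unfolding Q_def .
qed

end

section \<open>Covariance sums\<close>


text \<open>Iterated convolution of the weights, losing \<open>a + \<eta>\<close> in the exponent per factor.\<close>

lemma tuple_lattice_sum:
  assumes a: "a \<ge> 0" "\<eta> > 0" "real d * (a + \<eta>) \<le> 1"
  shows "\<exists>C\<ge>0. \<forall>T m. finite T \<longrightarrow> (\<Sum>\<tau>\<in>tuples (T \<times> UNIV) d. if nu \<tau> = m then prod_list (map (\<lambda>q. wt (fst q) powr (1 - a)) \<tau>) else 0)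
    \<le> C * wt m powr (1 - real d * (a + \<eta>))"
  using a(3)
proof (induction d)
  case 0
  have "(\<Sum>\<tau>\<in>tuples (T \<times> UNIV) 0. if nu \<tau> = m then prod_list (map (\<lambda>q. wt (fst q) powr (1 - a)) \<tau>) else 0) \<le> 1 * wt m powr (1 - real 0 * (a + \<eta>))" for T m
    unfolding tuples_0 using wt_pos[of m] by (cases "m = 0") (auto simp: less_imp_le)
  then show ?case by (intro exI[of _ 1]) auto
next
  case (Suc d)
  let ?b = "real d * (a + \<eta>)"
  let ?w = "\<lambda>\<tau> :: ((int \<times> int) \<times> bool) list. prod_list (map (\<lambda>q. wt (fst q) powr (1 - a)) \<tau>)"
  have ab: "a + ?b + \<eta> = real (Suc d) * (a + \<eta>)" by (simp add: algebra_simps)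
  have b: "?b \<ge> 0" "a + ?b + \<eta> \<le> 1" using a Suc.prems unfolding ab by auto
  then have "real d * (a + \<eta>) \<le> 1" using a by linarith
  then obtain C where C: "C \<ge> 0" "\<And>T m. finite T \<Longrightarrow> (\<Sum>\<tau>\<in>tuples (T \<times> UNIV) d. if nu \<tau> = m then ?w \<tau> else 0) \<le> C * wt m powr (1 - ?b)"
    using Suc.IH by blast
  obtain C' where C': "C' \<ge> 0" "\<And>F m. finite F \<Longrightarrow> (\<Sum>n\<in>F. wt n powr (1 - a) * wt (m - n) powr (1 - ?b)) \<le> C' * wt m powr (1 - (a + ?b + \<eta>))"
    using lattice_convolution[OF a(1) b(1) a(2) b(2)] by blast
  have "(\<Sum>\<tau>\<in>tuples (T \<times> UNIV) (Suc d). if nu \<tau> = m then ?w \<tau> else 0) \<le> 2 * C * C' * wt m powr (1 - real (Suc d) * (a + \<eta>))" if T: "finite T" for T m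
  proof -
    have "(\<Sum>\<tau>\<in>tuples (T \<times> UNIV) (Suc d). if nu \<tau> = m then ?w \<tau> else 0)
       = (\<Sum>n\<in>T. \<Sum>\<kappa>\<in>UNIV. wt n powr (1 - a) * (\<Sum>\<tau>\<in>tuples (T \<times> UNIV) d. if nu \<tau> = (if \<kappa> then m - n else m + n) then ?w \<tau> else 0))"
      unfolding sum_tuples_Suc sum_Times sum_distrib_left
      by (intro sum.cong refl) (auto simp: algebra_simps)
    also have "\<dots> \<le> (\<Sum>n\<in>T. \<Sum>\<kappa>\<in>UNIV. wt n powr (1 - a) * (C * wt (if \<kappa> then m - n else m + n) powr (1 - ?b)))"
      by (intro sum_mono mult_left_mono C T) auto
    also have "\<dots> = C * ((\<Sum>n\<in>T. wt n powr (1 - a) * wt (m - n) powr (1 - ?b)) + (\<Sum>n\<in>T. wt n powr (1 - a) * wt (m + n) powr (1 - ?b)))"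
      by (simp add: UNIV_bool sum.distrib sum_distrib_left algebra_simps)
    also have "(\<Sum>n\<in>T. wt n powr (1 - a) * wt (m + n) powr (1 - ?b)) = (\<Sum>n\<in>uminus ` T. wt n powr (1 - a) * wt (m - n) powr (1 - ?b))"
      by (subst sum.reindex) auto
    also have "C * ((\<Sum>n\<in>T. wt n powr (1 - a) * wt (m - n) powr (1 - ?b)) + \<dots>)
       \<le> C * (C' * wt m powr (1 - (a + ?b + \<eta>)) + C' * wt m powr (1 - (a + ?b + \<eta>)))"
      using T by (intro mult_left_mono add_mono C' C) auto
    finally show ?thesis unfolding ab by (simp add: algebra_simps)
  qed
  then show ?case using C(1) C'(1) by (intro exI[of _ "2 * C * C'"]) auto
qed

text \<open>Sum the previous bound over the frequencies of a Littlewood-Paley block. In the ball the weights are at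
  least of order \<open>4 powr (- j)\<close>, so the missing powers up to the summable exponent \<open>1 + \<eta>\<close> are bought by a power of \<open>4\<^sup>j\<close>.\<close>

lemma tuple_ball_sum:
  assumes a: "a \<ge> 0" "\<eta> > 0" "real d * (a + \<eta>) + \<eta> \<le> 1"
  shows "\<exists>C\<ge>0. \<forall>T j. finite T \<longrightarrow> (\<Sum>\<tau>\<in>tuples (T \<times> UNIV) d. if norm (freq (nu \<tau>)) \<le> 2 * 2 ^ j then prod_list (map (\<lambda>q. wt (fst q) powr (1 - a)) \<tau>) else 0)
    \<le> C * 4 powr (real j * (real d * (a + \<eta>) + \<eta>))"
proof -
  let ?b = "real d * (a + \<eta>)"
  let ?w = "\<lambda>\<tau> :: ((int \<times> int) \<times> bool) list. prod_list (map (\<lambda>q. wt (fst q) powr (1 - a)) \<tau>)"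
  have "?b \<le> 1" "?b \<ge> 0" using a by auto
  obtain C where C: "C \<ge> 0" "\<And>T m. finite T \<Longrightarrow> (\<Sum>\<tau>\<in>tuples (T \<times> UNIV) d. if nu \<tau> = m then ?w \<tau> else 0) \<le> C * wt m powr (1 - ?b)"
    using tuple_lattice_sum[OF a(1,2) \<open>?b \<le> 1\<close>] by blast
  obtain C' where C': "C' \<ge> 0" "\<And>F. finite F \<Longrightarrow> (\<Sum>n\<in>F. wt n powr (1 + \<eta>)) \<le> C'"
    using sum_wt_bound[OF a(2)] by blast
  have "(\<Sum>\<tau>\<in>tuples (T \<times> UNIV) d. if norm (freq (nu \<tau>)) \<le> 2 * 2 ^ j then ?w \<tau> else 0) \<le> 5 * C * C' * 4 powr (real j * (?b + \<eta>))" if T: "finite T" for T j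
  proof -
    let ?B = "{m. norm (freq m) \<le> 2 * 2 ^ j}"
    have fB: "finite ?B" by (rule finite_freq_ball)
    have wt: "wt m powr (- (?b + \<eta>)) \<le> 5 * 4 powr (real j * (?b + \<eta>))" if "m \<in> ?B" for m
    proof -
      have "(norm (freq m))\<^sup>2 \<le> (2 * 2 ^ j)\<^sup>2" using that by (intro power_mono) auto
      also have "\<dots> = 4 * 4 ^ j" by (simp add: power_mult_distrib power_even_eq[symmetric] power_mult[symmetric] power2_eq_square flip: power_mult_distrib)
      finally have "1 + (norm (freq m))\<^sup>2 \<le> 5 * 4 ^ j" using one_le_power[of "4 :: real" j] by linarith
      have "wt m powr (- (?b + \<eta>)) = (1 + (norm (freq m))\<^sup>2) powr (?b + \<eta>)"
        by (simp only: wt_def powr_divide powr_minus) simp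
      also have "\<dots> \<le> (5 * 4 ^ j) powr (?b + \<eta>)"
        using \<open>1 + (norm (freq m))\<^sup>2 \<le> 5 * 4 ^ j\<close> a \<open>?b \<ge> 0\<close> by (intro powr_mono2) auto
      also have "\<dots> = 5 powr (?b + \<eta>) * 4 powr (real j * (?b + \<eta>))"
        by (simp add: powr_mult powr_realpow[symmetric] powr_powr)
      also have "\<dots> \<le> 5 powr 1 * 4 powr (real j * (?b + \<eta>))"
        using a by (intro mult_right_mono powr_mono) auto
      finally show ?thesis by simp
    qed
    have "(\<Sum>\<tau>\<in>tuples (T \<times> UNIV) d. if norm (freq (nu \<tau>)) \<le> 2 * 2 ^ j then ?w \<tau> else 0)
        = (\<Sum>\<tau>\<in>tuples (T \<times> UNIV) d. \<Sum>m\<in>?B. if nu \<tau> = m then ?w \<tau> else 0)"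
      using fB by (intro sum.cong refl) auto
    also have "\<dots> = (\<Sum>m\<in>?B. \<Sum>\<tau>\<in>tuples (T \<times> UNIV) d. if nu \<tau> = m then ?w \<tau> else 0)" by (rule sum.swap)
    also have "\<dots> \<le> (\<Sum>m\<in>?B. C * wt m powr (1 - ?b))" by (intro sum_mono C T)
    also have "\<dots> = (\<Sum>m\<in>?B. C * (wt m powr (1 + \<eta>) * wt m powr (- (?b + \<eta>))))"
      by (simp add: powr_add[symmetric])
    also have "\<dots> \<le> (\<Sum>m\<in>?B. C * (wt m powr (1 + \<eta>) * (5 * 4 powr (real j * (?b + \<eta>)))))"
      by (intro sum_mono mult_left_mono wt C) auto
    also have "\<dots> = C * (5 * 4 powr (real j * (?b + \<eta>))) * (\<Sum>m\<in>?B. wt m powr (1 + \<eta>))"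
      by (simp add: sum_distrib_left mult_ac)
    also have "\<dots> \<le> C * (5 * 4 powr (real j * (?b + \<eta>))) * C'"
      using C(1) fB by (intro mult_left_mono C') auto
    finally show ?thesis by (simp add: mult_ac)
  qed
  then show ?thesis using C(1) C'(1) by (intro exI[of _ "5 * C * C'"]) auto
qed

lemma (in white_noise) second_moment_zf:
  "(\<integral>\<^sup>+x. ennreal ((cmod (\<Sum>n\<in>T. b n * zf c False n x))\<^sup>2) \<partial>FF.G)
    = ennreal (\<Sum>n\<in>T. (cmod (b n))\<^sup>2 * (\<Sum>r<R. (cmod (c n r))\<^sup>2 * (2 * (s r)\<^sup>2)))"
proof -
  define a where "a = (\<lambda>(((n, r), ip), copy :: bool). b n * c n r * (if ip then \<i> else 1))"
  define \<sigma> where "\<sigma> = (\<Sum>n\<in>T. (cmod (b n))\<^sup>2 * (\<Sum>r<R. (cmod (c n r))\<^sup>2 * (2 * (s r)\<^sup>2)))"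
  have ev_a: "FF.ev (0, a) x = (\<Sum>n\<in>T. b n * zf c False n x)" for x
    unfolding FF.ev_def fst_conv snd_conv sum_JJ add_0 zf_def sum_distrib_left
    by (intro sum.cong refl) (simp add: a_def algebra_simps)
  have el: "of_real u * z * cnj z + of_real u * (z * \<i>) * cnj (z * \<i>) = of_real (2 * u * (cmod z)\<^sup>2)" for u z
    unfolding of_real_mult complex_norm_square by (simp add: algebra_simps)
  have ac: "FF.BB a (\<lambda>j. cnj (a j)) = of_real \<sigma>"
    unfolding FF.BB_def sum_JJ \<sigma>_def of_real_sum sum_distrib_left
  proof (intro sum.cong refl)
    fix n r
    show "(\<Sum>ca\<in>{False}. of_real ((ss (((n, r), False), ca))\<^sup>2) * a (((n, r), False), ca) * cnj (a (((n, r), False), ca)) +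
          of_real ((ss (((n, r), True), ca))\<^sup>2) * a (((n, r), True), ca) * cnj (a (((n, r), True), ca)))
        = of_real ((cmod (b n))\<^sup>2 * ((cmod (c n r))\<^sup>2 * (2 * (s r)\<^sup>2)))"
      using el[of "(s r)\<^sup>2" "b n * c n r"]
      by (simp add: a_def ss_def norm_mult power_mult_distrib del: complex_cnj_mult complex_cnj_i)
  qed
  have cn: "cnj (FF.ev (0, a) x) = FF.ev (0, \<lambda>j. cnj (a j)) x" for x
    using FF.ev_cnj[of "(0, a)" x] by simp
  have int: "integrable FF.G (\<lambda>x. complex_of_real ((cmod (FF.ev (0, a) x))\<^sup>2))"
    using FF.integrable_prod_ev[of "[(0, a), (0, \<lambda>j. cnj (a j))]"]
    unfolding complex_norm_square cn by simp
  have "(\<integral>x. complex_of_real ((cmod (FF.ev (0, a) x))\<^sup>2) \<partial>FF.G) = of_real \<sigma>"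
    using FF.gaussian_ibp[of a "[(0, \<lambda>j. cnj (a j))]"] unfolding complex_norm_square cn
    by (simp add: ac FF.G.prob_space)
  then have "(\<integral>x. (cmod (FF.ev (0, a) x))\<^sup>2 \<partial>FF.G) = \<sigma>"
    unfolding integral_complex_of_real by (simp only: of_real_eq_iff)
  moreover have "integrable FF.G (\<lambda>x. (cmod (FF.ev (0, a) x))\<^sup>2)"
    using int integrable_Re by fastforce
  ultimately show ?thesis
    using nn_integral_eq_integral[of FF.G "\<lambda>x. (cmod (FF.ev (0, a) x))\<^sup>2"] unfolding ev_a \<sigma>_def by simp
qed

context noise
begin

lemma stage_second_moment:
  fixes cs :: "int \<times> int \<Rightarrow> (complex \<times> real \<times> real) list"
  assumes T: "finite T"
    and le: "\<And>n c a b. n \<in> T \<Longrightarrow> (c, a, b) \<in> set (cs n) \<Longrightarrow> a \<le> b"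
  shows "(\<integral>\<^sup>+\<omega>. ennreal ((cmod (\<Sum>n\<in>T. b n * step_integral (cs n) (\<beta> n) \<omega>))\<^sup>2) \<partial>M)
    = ennreal (\<Sum>n\<in>T. (cmod (b n))\<^sup>2 * enn2real (\<integral>\<^sup>+x. ennreal ((cmod (step_fun (cs n) x))\<^sup>2) \<partial>lborel))"
proof -
  define E where "E = (\<Union>n\<in>T. \<Union>(c, a, b)\<in>set (cs n). {a, b})"
  have finE: "finite E" using T unfolding E_def by auto
  interpret g: real_grid E by unfold_locales (rule finE)
  interpret b: brownian_grid M \<beta> T g.pt g.N
    by unfold_locales (auto simp: BM indep T g.pt_step)
  have ad: "g.adapted (cs n)" if "n \<in> T" for n
  proof -
    have "(c, a, b) \<in> set (cs n) \<Longrightarrow> a \<in> E \<and> b \<in> E" for c a b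
      unfolding E_def using that by fastforce
    then show "g.adapted (cs n)"
      using le[OF that] unfolding g.adapted_def by blast
  qed
  define c where "c = (\<lambda>n r. step_fun (cs n) (g.pt (Suc r)))"
  have sp: "2 * (b.sp r)\<^sup>2 = g.pt (Suc r) - g.pt r" if "r < g.N" for r
    using that g.pt_step[OF that] by (simp add: b.sp_def)
  have n1: "(\<Sum>r<g.N. (cmod (d r))\<^sup>2 * (2 * (b.sp r)\<^sup>2)) = (\<Sum>r<g.N. (cmod (d r))\<^sup>2 * (g.pt (Suc r) - g.pt r))" for d :: "nat \<Rightarrow> complex"
    by (intro sum.cong refl) (simp add: sp)
  have nn: "(\<Sum>r<g.N. (cmod (d r))\<^sup>2 * (g.pt (Suc r) - g.pt r)) \<ge> 0" for d :: "nat \<Rightarrow> complex"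
    using g.pt_step by (intro sum_nonneg mult_nonneg_nonneg) (auto simp: less_imp_le)
  have I: "enn2real (\<integral>\<^sup>+x. ennreal ((cmod (step_fun (cs n) x))\<^sup>2) \<partial>lborel) = (\<Sum>r<g.N. (cmod (c n r))\<^sup>2 * (2 * (b.sp r)\<^sup>2))" if "n \<in> T" for n
    unfolding n1 g.nn_integral_step_fun[OF ad[OF that]] c_def
    using nn by (auto simp: enn2real_ennreal)
  have z: "(\<Sum>n\<in>T. b n * step_integral (cs n) (\<beta> n) \<omega>) = (\<Sum>n\<in>T. b n * b.wn.zf c False n (b.increment \<omega>))" for \<omega>
  proof (intro sum.cong refl)
    fix n assume n: "n \<in> T"
    show "b n * step_integral (cs n) (\<beta> n) \<omega> = b n * b.wn.zf c False n (b.increment \<omega>)"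
      using b.zf_increment[OF n, of c \<omega>] g.step_integral_grid[OF ad[OF n], of "\<beta> n" \<omega>] by (simp add: c_def)
  qed
  have [measurable]: "(\<lambda>x. b.wn.zf c False n x) \<in> borel_measurable b.wn.FF.G" if "n \<in> T" for n
    unfolding b.wn.zf_def using that
    by (intro borel_measurable_sum borel_measurable_times borel_measurable_const borel_measurable_add borel_measurable_of_real b.wn.FF.coord_measurable) auto
  have "(\<integral>\<^sup>+\<omega>. ennreal ((cmod (\<Sum>n\<in>T. b n * b.wn.zf c False n (b.increment \<omega>)))\<^sup>2) \<partial>M)
     = (\<integral>\<^sup>+x. ennreal ((cmod (\<Sum>n\<in>T. b n * b.wn.zf c False n x))\<^sup>2) \<partial>b.wn.FF.G)"
    by (rule b.nn_integral_increment[symmetric]) measurable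
  then show ?thesis unfolding z b.wn.second_moment_zf by (simp add: I)
qed

text \<open>The isometry property of the Wiener integral, jointly in all frequencies.\<close>

theorem second_moment:
  fixes Zt :: "int \<times> int \<Rightarrow> 'w \<Rightarrow> complex" and ft :: "int \<times> int \<Rightarrow> real \<Rightarrow> complex"
  assumes T: "finite T"
    and Wt: "\<And>n. n \<in> T \<Longrightarrow> has_wiener_integral M (\<beta> n) (ft n) (Zt n)"
    and m[measurable]: "\<And>n. ft n \<in> borel_measurable borel"
    and It: "\<And>n. n \<in> T \<Longrightarrow> (\<integral>\<^sup>+x. ennreal ((cmod (ft n x))\<^sup>2) \<partial>lborel) = ennreal (I n)"
    and I: "\<And>n. n \<in> T \<Longrightarrow> 0 \<le> I n"
  shows "(\<integral>\<omega>. (cmod (\<Sum>n\<in>T. b n * Zt n \<omega>))\<^sup>2 \<partial>M) = (\<Sum>n\<in>T. (cmod (b n))\<^sup>2 * I n)"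
proof -
  let ?L2 = "\<lambda>f. (\<integral>\<^sup>+x. ennreal ((cmod (f x))\<^sup>2) \<partial>lborel)"
  obtain ct where ct: "\<And>n m c a b. n \<in> T \<Longrightarrow> (c, a, b) \<in> set (ct n m) \<Longrightarrow> a \<le> b"
      "\<And>n. n \<in> T \<Longrightarrow> (\<lambda>m. ?L2 (\<lambda>r. step_fun (ct n m) r - ft n r)) \<longlonglongrightarrow> 0"
      "\<And>n. n \<in> T \<Longrightarrow> (\<lambda>m. \<integral>\<^sup>+\<omega>. ennreal ((cmod (step_integral (ct n m) (\<beta> n) \<omega> - Zt n \<omega>))\<^sup>2) \<partial>M) \<longlonglongrightarrow> 0"
  proof -
    have "\<forall>n\<in>T. \<exists>cs :: nat \<Rightarrow> (complex \<times> real \<times> real) list. (\<forall>m. \<forall>(c, a, b)\<in>set (cs m). a \<le> b) \<and>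
        (\<lambda>m. \<integral>\<^sup>+r. ennreal ((cmod (step_fun (cs m) r - ft n r))\<^sup>2) \<partial>lborel) \<longlonglongrightarrow> 0 \<and>
        (\<lambda>m. \<integral>\<^sup>+\<omega>. ennreal ((cmod (step_integral (cs m) (\<beta> n) \<omega> - Zt n \<omega>))\<^sup>2) \<partial>M) \<longlonglongrightarrow> 0"
      using Wt unfolding has_wiener_integral_def by blast
    from bchoice[OF this] show ?thesis using that by fastforce
  qed
  have Zm[measurable]: "\<And>n. n \<in> T \<Longrightarrow> Zt n \<in> borel_measurable M"
    using Wt by (auto simp: has_wiener_integral_def)
  define f where "f m \<omega> = (\<Sum>n\<in>T. b n * step_integral (ct n m) (\<beta> n) \<omega>)" for m \<omega>
  define g where "g \<omega> = (\<Sum>n\<in>T. b n * Zt n \<omega>)" for \<omega>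
  have [measurable]: "f m \<in> borel_measurable M" "g \<in> borel_measurable M" for m unfolding f_def g_def by measurable
  define B where "B = (\<Sum>n\<in>T. (cmod (b n))\<^sup>2)"
  have B: "B \<ge> 0" unfolding B_def by (intro sum_nonneg) auto
  have lim: "(\<lambda>m. \<integral>\<^sup>+\<omega>. ennreal ((cmod (f m \<omega> - g \<omega>))\<^sup>2) \<partial>M) \<longlonglongrightarrow> 0"
  proof (rule tendsto_sandwich[OF _ _ tendsto_const])
    let ?u = "\<lambda>m. ennreal B * (\<Sum>n\<in>T. \<integral>\<^sup>+\<omega>. ennreal ((cmod (step_integral (ct n m) (\<beta> n) \<omega> - Zt n \<omega>))\<^sup>2) \<partial>M)"
    have "?u \<longlonglongrightarrow> ennreal B * (\<Sum>n\<in>T. 0)" by (intro ennreal_tendsto_cmult tendsto_sum ct) auto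
    then show "?u \<longlonglongrightarrow> 0" by simp
    show "eventually (\<lambda>m. (\<integral>\<^sup>+\<omega>. ennreal ((cmod (f m \<omega> - g \<omega>))\<^sup>2) \<partial>M) \<le> ?u m) sequentially"
    proof (intro always_eventually allI)
      fix m
      have "(\<integral>\<^sup>+\<omega>. ennreal ((cmod (f m \<omega> - g \<omega>))\<^sup>2) \<partial>M) \<le> (\<integral>\<^sup>+\<omega>. ennreal B * (\<Sum>n\<in>T. ennreal ((cmod (step_integral (ct n m) (\<beta> n) \<omega> - Zt n \<omega>))\<^sup>2)) \<partial>M)"
      proof (rule nn_integral_mono)
        fix \<omega>
        let ?e = "\<lambda>n. cmod (step_integral (ct n m) (\<beta> n) \<omega> - Zt n \<omega>)"
        have "f m \<omega> - g \<omega> = (\<Sum>n\<in>T. b n * (step_integral (ct n m) (\<beta> n) \<omega> - Zt n \<omega>))"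
          by (simp add: f_def g_def sum_subtractf algebra_simps)
        then have "cmod (f m \<omega> - g \<omega>) \<le> (\<Sum>n\<in>T. cmod (b n) * ?e n)"
          by (simp only:) (rule sum_norm_le, simp add: norm_mult)
        then have "(cmod (f m \<omega> - g \<omega>))\<^sup>2 \<le> (\<Sum>n\<in>T. cmod (b n) * ?e n)\<^sup>2" by (intro power_mono) auto
        also have "\<dots> \<le> B * (\<Sum>n\<in>T. (?e n)\<^sup>2)" unfolding B_def by (rule Cauchy_Schwarz_ineq_sum)
        finally have "ennreal ((cmod (f m \<omega> - g \<omega>))\<^sup>2) \<le> ennreal (B * (\<Sum>n\<in>T. (?e n)\<^sup>2))" by (rule ennreal_leI)
        also have "\<dots> = ennreal B * (\<Sum>n\<in>T. ennreal ((?e n)\<^sup>2))"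
          using B by (subst ennreal_mult) (auto intro!: sum_nonneg)
        finally show "ennreal ((cmod (f m \<omega> - g \<omega>))\<^sup>2) \<le> ennreal B * (\<Sum>n\<in>T. ennreal ((?e n)\<^sup>2))" .
      qed
      also have "\<dots> = ?u m" by (subst nn_integral_cmult, measurable, subst nn_integral_sum, auto)
      finally show "(\<integral>\<^sup>+\<omega>. ennreal ((cmod (f m \<omega> - g \<omega>))\<^sup>2) \<partial>M) \<le> ?u m" .
    qed
  qed simp
  have "(\<lambda>m. \<integral>\<^sup>+\<omega>. ennreal ((cmod (f m \<omega>))\<^sup>2) \<partial>M) \<longlonglongrightarrow> (\<integral>\<^sup>+\<omega>. ennreal ((cmod (g \<omega>))\<^sup>2) \<partial>M)"
    by (rule L2_norm_tendsto[OF _ _ lim]) auto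
  moreover have "(\<lambda>m. \<integral>\<^sup>+\<omega>. ennreal ((cmod (f m \<omega>))\<^sup>2) \<partial>M) \<longlonglongrightarrow> ennreal (\<Sum>n\<in>T. (cmod (b n))\<^sup>2 * I n)"
  proof -
    have nt: "(\<lambda>m. enn2real (?L2 (step_fun (ct n m)))) \<longlonglongrightarrow> I n" if n: "n \<in> T" for n
    proof -
      have "(\<lambda>m. ?L2 (step_fun (ct n m))) \<longlonglongrightarrow> ennreal (I n)"
        unfolding It[OF n, symmetric] by (rule L2_norm_tendsto; use ct(2)[OF n] in simp)
      then show ?thesis using tendsto_enn2real I(1)[OF n] by auto
    qed
    have "(\<integral>\<^sup>+\<omega>. ennreal ((cmod (f m \<omega>))\<^sup>2) \<partial>M) = ennreal (\<Sum>n\<in>T. (cmod (b n))\<^sup>2 * enn2real (?L2 (step_fun (ct n m))))" for m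
      unfolding f_def by (rule stage_second_moment[OF T]) (rule ct(1))
    then show ?thesis using nt by (auto intro!: tendsto_ennrealI tendsto_sum tendsto_mult)
  qed
  ultimately have "(\<integral>\<^sup>+\<omega>. ennreal ((cmod (g \<omega>))\<^sup>2) \<partial>M) = ennreal (\<Sum>n\<in>T. (cmod (b n))\<^sup>2 * I n)"
    using LIMSEQ_unique by blast
  moreover have "(\<Sum>n\<in>T. (cmod (b n))\<^sup>2 * I n) \<ge> 0" using I by (intro sum_nonneg mult_nonneg_nonneg) auto
  ultimately show ?thesis
    unfolding g_def[symmetric] by (subst integral_eq_nn_integral) auto
qed

end

section \<open>Moments of the supremum over time and space\<close>


context LP
begin

lemma is_trig_LP_block: "is_trig (2 * 2 ^ j) (LP_block \<phi>\<^sub>0 j v)"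
proof -
  let ?S = "{n. LP_phi \<phi>\<^sub>0 j (freq n) \<noteq> 0}"
  have "LP_block \<phi>\<^sub>0 j v = trig_poly ?S (\<lambda>n. of_real (LP_phi \<phi>\<^sub>0 j (freq n)) * v n) (\<lambda>n. n)"
    by (rule ext) (simp add: LP_block_def trig_poly_def)
  moreover have "n \<in> lattice_box (2 * 2 ^ j)" if "n \<in> ?S" for n
  proof -
    have le: "norm (freq n) \<le> 2 * 2 ^ j" using that LP_phi_support by blast
    have "\<bar>real_of_int (fst n)\<bar> \<le> norm (freq n)" "\<bar>real_of_int (snd n)\<bar> \<le> norm (freq n)"
      using norm_fst_le[of "real_of_int (fst n)" "real_of_int (snd n)"] norm_snd_le[of "real_of_int (snd n)" "real_of_int (fst n)"]
      by (auto simp: freq_def)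
    then have "\<bar>real_of_int (fst n)\<bar> \<le> real_of_int (2 * 2 ^ j)" "\<bar>real_of_int (snd n)\<bar> \<le> real_of_int (2 * 2 ^ j)"
      using le by simp_all
    then have "\<bar>fst n\<bar> \<le> 2 * 2 ^ j" "\<bar>snd n\<bar> \<le> 2 * 2 ^ j"
      by (simp_all only: of_int_abs[symmetric] of_int_le_iff)
    then show ?thesis unfolding lattice_box_def mem_Times_iff by auto
  qed
  ultimately show ?thesis using is_trig_sum[OF finite_LP] by simp
qed

end

text \<open>The spatial supremum is not obviously measurable; this integral bounds it by Nikolskii's inequality, is
  measurable, and has an expectation that needs only moments at single points.\<close>

definition sup_majorant :: "nat \<Rightarrow> nat \<Rightarrow> (real \<times> real \<Rightarrow> complex) \<Rightarrow> ennreal" where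
  "sup_majorant q j f = ennreal ((8 * real q + 1)\<^sup>2 * 4 ^ j / (2 * pi)\<^sup>2) *
     (\<integral>\<^sup>+y. indicator (cbox (0, 0) (2 * pi, 2 * pi)) y * ennreal (cmod (f y) ^ (2 * q)) \<partial>lborel)"

lemma sup_majorant_bound:
  assumes f: "is_trig (2 * 2 ^ j) f"
  shows "ennreal (cmod (f x) ^ (2 * q)) \<le> sup_majorant q j f"
proof -
  let ?Q = "cbox (0, 0) (2 * pi, 2 * pi) :: (real \<times> real) set"
  let ?I = "LINT y:?Q|lborel. cmod (f y) ^ (2 * q)"
  have cf: "continuous_on UNIV f" by (rule is_trig_continuous[OF f])
  have int: "set_integrable lborel ?Q (\<lambda>y. cmod (f y) ^ (2 * q))"
    by (intro torus_integrable continuous_intros cf)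
  have I: "ennreal ?I = (\<integral>\<^sup>+y. indicator ?Q y * ennreal (cmod (f y) ^ (2 * q)) \<partial>lborel)"
    using int unfolding set_integrable_def set_lebesgue_integral_def
    by (subst nn_integral_eq_integral[symmetric]) (auto simp: ennreal_mult' ennreal_indicator)
  have I0: "?I \<ge> 0" unfolding set_lebesgue_integral_def by (intro integral_nonneg_AE) auto
  have "2 * (2 * real q * (2 * 2 ^ j)) + 1 \<le> (8 * real q + 1) * 2 ^ j"
    using one_le_power[of "2 :: real" j] by (simp add: algebra_simps)
  then have "(2 * (2 * real q * (2 * 2 ^ j)) + 1)\<^sup>2 \<le> ((8 * real q + 1) * 2 ^ j)\<^sup>2" by (intro power_mono) auto
  also have "\<dots> = (8 * real q + 1)\<^sup>2 * 4 ^ j"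
    by (simp add: power_mult_distrib power2_eq_square flip: power_mult_distrib)
  finally have "(2 * (2 * real q * (2 * 2 ^ j)) + 1)\<^sup>2 \<le> (8 * real q + 1)\<^sup>2 * 4 ^ j" .
  then have c: "real ((2 * (2 * q * (2 * 2 ^ j)) + 1)\<^sup>2) \<le> (8 * real q + 1)\<^sup>2 * 4 ^ j" by (simp add: add.commute)
  have "cmod (f x) ^ (2 * q) \<le> real ((2 * (2 * q * (2 * 2 ^ j)) + 1)\<^sup>2) * (?I / (2 * pi)\<^sup>2)"
    by (rule nikolskii[OF f])
  also have "\<dots> \<le> (8 * real q + 1)\<^sup>2 * 4 ^ j * (?I / (2 * pi)\<^sup>2)"
    using I0 by (intro mult_right_mono c) auto
  also have "\<dots> = (8 * real q + 1)\<^sup>2 * 4 ^ j / (2 * pi)\<^sup>2 * ?I" by simp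
  finally have "ennreal (cmod (f x) ^ (2 * q)) \<le> ennreal ((8 * real q + 1)\<^sup>2 * 4 ^ j / (2 * pi)\<^sup>2 * ?I)" by (rule ennreal_leI)
  also have "\<dots> = sup_majorant q j f"
    unfolding sup_majorant_def I[symmetric] using I0 by (intro ennreal_mult) auto
  finally show ?thesis .
qed

lemma sup_majorant_measurable:
  assumes f: "(\<lambda>p. f (fst p) (snd p)) \<in> borel_measurable (M \<Otimes>\<^sub>M borel)"
  shows "(\<lambda>\<omega>. sup_majorant q j (f \<omega>)) \<in> borel_measurable M"
proof -
  have s: "sets (M \<Otimes>\<^sub>M (lborel :: (real \<times> real) measure)) = sets (M \<Otimes>\<^sub>M borel)"
    by (intro sets_pair_measure_cong) auto
  have [measurable]: "(\<lambda>p. f (fst p) (snd p)) \<in> borel_measurable (M \<Otimes>\<^sub>M lborel)"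
    using f measurable_cong_sets[OF s refl] by blast
  have "(\<lambda>p. indicator (cbox (0, 0) (2 * pi, 2 * pi)) (snd p) * ennreal (cmod (f (fst p) (snd p)) ^ (2 * q))) \<in> borel_measurable (M \<Otimes>\<^sub>M lborel)"
    by measurable
  then have "(\<lambda>\<omega>. \<integral>\<^sup>+y. indicator (cbox (0, 0) (2 * pi, 2 * pi)) y * ennreal (cmod (f \<omega> y) ^ (2 * q)) \<partial>lborel) \<in> borel_measurable M"
    by (intro lborel.borel_measurable_nn_integral) (simp add: case_prod_beta')
  then show ?thesis unfolding sup_majorant_def by measurable
qed

lemma sup_majorant_expectation:
  assumes M: "prob_space M" and f: "(\<lambda>p. f (fst p) (snd p)) \<in> borel_measurable (M \<Otimes>\<^sub>M borel)"
    and B: "\<And>y. (\<integral>\<^sup>+\<omega>. ennreal (cmod (f \<omega> y) ^ (2 * q)) \<partial>M) \<le> ennreal B" "B \<ge> 0"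
  shows "(\<integral>\<^sup>+\<omega>. sup_majorant q j (f \<omega>) \<partial>M) \<le> ennreal ((8 * real q + 1)\<^sup>2 * 4 ^ j * B)"
proof -
  interpret prob_space M by fact
  interpret pair_sigma_finite M "lborel :: (real \<times> real) measure" by unfold_locales
  let ?Q = "cbox (0, 0) (2 * pi, 2 * pi) :: (real \<times> real) set"
  let ?c = "(8 * real q + 1)\<^sup>2 * 4 ^ j / (2 * pi)\<^sup>2"
  have s: "sets (M \<Otimes>\<^sub>M (lborel :: (real \<times> real) measure)) = sets (M \<Otimes>\<^sub>M borel)"
    by (intro sets_pair_measure_cong) auto
  have [measurable]: "(\<lambda>p. f (fst p) (snd p)) \<in> borel_measurable (M \<Otimes>\<^sub>M lborel)"
    using f measurable_cong_sets[OF s refl] by blast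
  have m: "(\<lambda>p. indicator ?Q (snd p) * ennreal (cmod (f (fst p) (snd p)) ^ (2 * q))) \<in> borel_measurable (M \<Otimes>\<^sub>M lborel)"
    by measurable
  have m2: "(\<lambda>\<omega>. \<integral>\<^sup>+y. indicator ?Q y * ennreal (cmod (f \<omega> y) ^ (2 * q)) \<partial>lborel) \<in> borel_measurable M"
    using m by (intro lborel.borel_measurable_nn_integral) (simp add: case_prod_beta')
  have fm: "(\<lambda>\<omega>. f \<omega> y) \<in> borel_measurable M" for y
    using measurable_Pair2'[of y lborel M] measurable_compose[OF measurable_Pair2'[of y lborel M], of "\<lambda>p. f (fst p) (snd p)" borel] by simp
  have "(\<integral>\<^sup>+\<omega>. sup_majorant q j (f \<omega>) \<partial>M) = ennreal ?c * (\<integral>\<^sup>+\<omega>. \<integral>\<^sup>+y. indicator ?Q y * ennreal (cmod (f \<omega> y) ^ (2 * q)) \<partial>lborel \<partial>M)"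
    unfolding sup_majorant_def by (rule nn_integral_cmult[OF m2])
  also have "(\<integral>\<^sup>+\<omega>. \<integral>\<^sup>+y. indicator ?Q y * ennreal (cmod (f \<omega> y) ^ (2 * q)) \<partial>lborel \<partial>M)
     = (\<integral>\<^sup>+y. \<integral>\<^sup>+\<omega>. indicator ?Q y * ennreal (cmod (f \<omega> y) ^ (2 * q)) \<partial>M \<partial>lborel)"
    using Fubini'[of "\<lambda>\<omega> y. indicator ?Q y * ennreal (cmod (f \<omega> y) ^ (2 * q))"] m by (simp add: case_prod_beta')
  also have "\<dots> \<le> (\<integral>\<^sup>+y. ennreal B * indicator ?Q y \<partial>lborel)"
  proof (rule nn_integral_mono)
    fix y
    have "(\<integral>\<^sup>+\<omega>. indicator ?Q y * ennreal (cmod (f \<omega> y) ^ (2 * q)) \<partial>M) = indicator ?Q y * (\<integral>\<^sup>+\<omega>. ennreal (cmod (f \<omega> y) ^ (2 * q)) \<partial>M)"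
      using fm by (intro nn_integral_cmult) auto
    also have "\<dots> \<le> indicator ?Q y * ennreal B" by (intro mult_left_mono B) auto
    finally show "(\<integral>\<^sup>+\<omega>. indicator ?Q y * ennreal (cmod (f \<omega> y) ^ (2 * q)) \<partial>M) \<le> ennreal B * indicator ?Q y" by (simp add: mult.commute)
  qed
  also have "\<dots> = ennreal B * ennreal ((2 * pi)\<^sup>2)"
  proof -
    have "emeasure lborel ?Q = ennreal ((2 * pi)\<^sup>2)"
      by (subst emeasure_lborel_cbox) (auto simp: Basis_prod_def power2_eq_square)
    then show ?thesis by (simp add: nn_integral_cmult_indicator)
  qed
  also have "ennreal ?c * (ennreal B * ennreal ((2 * pi)\<^sup>2)) = ennreal ((8 * real q + 1)\<^sup>2 * 4 ^ j * B)"
    using B(2) by (simp add: ennreal_mult[symmetric])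
  finally show ?thesis by (simp add: mult_left_mono)
qed

text \<open>All modes \<open>Z n\<close> are driven by the same noise, and \<open>var n\<close> is the variance of the mode at any time.\<close>

locale ou = noise M \<phi>\<^sub>0 \<beta>
  for M :: "'w measure" and \<phi>\<^sub>0 and \<beta> :: "int \<times> int \<Rightarrow> real \<Rightarrow> 'w \<Rightarrow> complex" +
  fixes a\<^sub>1 a\<^sub>2 :: real and Z :: "int \<times> int \<Rightarrow> real \<Rightarrow> 'w \<Rightarrow> complex"
  assumes a1: "a\<^sub>1 > 0" and OU: "\<And>n. OU_process M (\<beta> n) (decay_rate a\<^sub>1 a\<^sub>2 n) (Z n)"
begin

definition var :: "int \<times> int \<Rightarrow> real" where "var n = wt n / (2 * a\<^sub>1)"

definition ker :: "real \<Rightarrow> int \<times> int \<Rightarrow> real \<Rightarrow> complex" where "ker t n = ou_kernel (decay_rate a\<^sub>1 a\<^sub>2 n) t"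

lemma ker_measurable [measurable]: "ker t n \<in> borel_measurable borel"
  unfolding ker_def by measurable

lemma wiener: "has_wiener_integral M (\<beta> n) (ker t n) (Z n t)"
  using OU[of n] unfolding OU_process_def ker_def ou_kernel_def[abs_def] by blast

lemma Z_measurable [measurable]: "Z n t \<in> borel_measurable M"
  using wiener[of n t] by (simp add: has_wiener_integral_def)

lemma var_nonneg: "var n \<ge> 0" using wt_pos[of n] a1 by (simp add: var_def)

lemma ker_norm: "(\<integral>\<^sup>+x. ennreal ((cmod (ker t n x))\<^sup>2) \<partial>lborel) = ennreal (var n)"
  unfolding ker_def using wt_pos[of n] a1 by (subst ou_kernel_norm) (auto simp: Re_decay_rate var_def)

lemma Z_continuous: "AE \<omega> in M. \<forall>n. continuous_on UNIV (\<lambda>t. Z n t \<omega>)"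
  using OU unfolding OU_process_def AE_all_countable by blast

definition sig :: "(int \<times> int) set \<Rightarrow> (int \<times> int \<Rightarrow> complex) \<Rightarrow> real" where
  "sig T w = (\<Sum>n\<in>T. (cmod (w n))\<^sup>2 * var n)"

definition wcoef :: "nat \<Rightarrow> nat \<Rightarrow> (int \<times> int) set \<Rightarrow> (int \<times> int \<Rightarrow> complex) \<Rightarrow> real \<Rightarrow> 'w \<Rightarrow> int \<times> int \<Rightarrow> complex" where
  "wcoef k l T w t \<omega> = fourier_coeff (wick_field k l T w (sig T w) (\<lambda>n. Z n t \<omega>))"

text \<open>The Fourier coefficients of the difference of two truncations; with \<open>u = 0\<close> those of one.\<close>

definition dcoef :: "nat \<Rightarrow> nat \<Rightarrow> (int \<times> int) set \<Rightarrow> (int \<times> int \<Rightarrow> complex) \<Rightarrow> (int \<times> int \<Rightarrow> complex) \<Rightarrow> complex \<Rightarrow> real \<Rightarrow> 'w \<Rightarrow> int \<times> int \<Rightarrow> complex" where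
  "dcoef k l T w1 w2 u t \<omega> = wcoef k l T w1 t \<omega> - (\<lambda>n. u * wcoef k l T w2 t \<omega> n)"

lemma LP_block_dcoef:
  "LP_block \<phi>\<^sub>0 j (dcoef k l T w1 w2 u t \<omega>) x = block j k l T w1 (sig T w1) (\<lambda>n. Z n t \<omega>) x - u * block j k l T w2 (sig T w2) (\<lambda>n. Z n t \<omega>) x"
  unfolding dcoef_def LP_block_diff LP_block_scale wcoef_def block_def ..

lemma dcoef_increment: "LP_block \<phi>\<^sub>0 j (dcoef k l T w1 w2 u t \<omega>) x - u' * LP_block \<phi>\<^sub>0 j (dcoef k l T w1 w2 u s \<omega>) x
   = increment_block j k l T w1 w2 u u' var var (\<lambda>n. Z n t \<omega>) (\<lambda>n. Z n s \<omega>) x"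
  unfolding LP_block_dcoef increment_block_def sig_def ..

lemma dcoef_continuous:
  assumes "finite T" "\<forall>n. continuous_on UNIV (\<lambda>t. Z n t \<omega>)"
  shows "continuous_on S (\<lambda>t. LP_block \<phi>\<^sub>0 j (dcoef k l T w1 w2 u t \<omega>) x)"
  unfolding LP_block_dcoef continuous_on_def using assms
  by (auto intro!: tendsto_diff tendsto_mult tendsto_const tendsto_block simp: continuous_on_def intro: tendsto_within_subset)

lemma dcoef_measurable_pair:
  assumes "finite T"
  shows "(\<lambda>p. LP_block \<phi>\<^sub>0 j (dcoef k l T w1 w2 u t (fst p)) (snd p)) \<in> borel_measurable (M \<Otimes>\<^sub>M borel)"
  unfolding LP_block_dcoef
  by (intro borel_measurable_diff borel_measurable_times borel_measurable_const measurable_block_pair assms Z_measurable)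

text \<open>The condition on the weights allows a growth of order \<open>\<kappa>\<close> in each frequency. For the difference of two
  truncations at high frequencies this growth can be traded for a small factor \<open>\<Lambda>\<close>. Gaussian moment
  bounds at a fixed time and point come with the power \<open>2 powr (j * \<epsilon> * q)\<close> of the frequency, Nikolskii's
  inequality costs \<open>4\<^sup>j\<close>, and chaining in time costs a constant. The weight \<open>2 powr (- 2 * q * \<epsilon> * j)\<close> of the norm
  outweighs both once \<open>q * \<epsilon> \<ge> 3\<close>.\<close>

theorem sup_moment:
  assumes \<epsilon>: "\<epsilon> > 0" and T0: "T0 > 0"
  shows "\<exists>q C \<kappa>. 0 < q \<and> p \<le> 2 * real q \<and> 0 \<le> C \<and> 0 < \<kappa> \<and> (\<forall>T w1 w2 u \<Lambda>. finite T \<longrightarrow> 0 \<le> \<Lambda> \<longrightarrow>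
     (\<forall>\<tau>\<in>tuples (T \<times> UNIV) (k + l). (cmod (wick_coef k l w1 \<tau> - u * wick_coef k l w2 \<tau>))\<^sup>2 \<le> \<Lambda> * prod_list (map (\<lambda>q. wt (fst q) powr (- \<kappa>)) \<tau>)) \<longrightarrow>
     (\<exists>W\<in>borel_measurable M. (\<integral>\<^sup>+\<omega>. W \<omega> \<partial>M) \<le> ennreal (C * \<Lambda> ^ q) \<and>
       (AE \<omega> in M. \<forall>t\<in>{0..T0}. \<forall>j x. ennreal ((2 powr (real j * - \<epsilon>) * cmod (LP_block \<phi>\<^sub>0 j (dcoef k l T w1 w2 u t \<omega>) x)) ^ (2 * q)) \<le> W \<omega>)))"
proof -
  define d where "d = k + l"
  (* the exponent \<alpha> is spent three times per factor: on time regularity, on the growth of the weights, and on the lattice convolution; one more is spent on the sum over the block *)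
  define \<alpha> where "\<alpha> = min 1 \<epsilon> / (2 * (3 * real d + 1))"
  have \<alpha>: "0 < \<alpha>" "\<alpha> \<le> 1" and \<alpha>d: "real d * (2 * \<alpha> + \<alpha>) + \<alpha> = min 1 \<epsilon> / 2"
  proof -
    show "0 < \<alpha>" using \<epsilon> by (simp add: \<alpha>_def)
    show *: "real d * (2 * \<alpha> + \<alpha>) + \<alpha> = min 1 \<epsilon> / 2"
    proof -
      have "real d * (2 * \<alpha> + \<alpha>) + \<alpha> = (3 * real d + 1) * \<alpha>" by (simp add: algebra_simps)
      moreover have "x \<noteq> 0 \<Longrightarrow> x * (y / (2 * x)) = y / 2" for x y :: real by simp
      ultimately show ?thesis unfolding \<alpha>_def by (metis add_nonneg_eq_0_iff mult_nonneg_nonneg of_nat_0_le_iff zero_le_numeral zero_le_one zero_neq_one)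
    qed
    have "real d * (2 * \<alpha> + \<alpha>) \<ge> 0" using \<open>0 < \<alpha>\<close> by simp
    then show "\<alpha> \<le> 1" using * by linarith
  qed
  obtain Cv where Cv: "Cv > 0"
    "\<And>n t. (\<integral>\<^sup>+r. ennreal ((cmod (ker t n r))\<^sup>2) \<partial>lborel) < ennreal (Cv * wt n powr (1 - \<alpha>))"
    "\<And>n s t. s < t \<Longrightarrow> (\<integral>\<^sup>+r. ennreal ((cmod (ker t n r - ker s n r))\<^sup>2) \<partial>lborel) < ennreal (Cv * (t - s) powr \<alpha> * wt n powr (1 - \<alpha>))"
    using ou_kernel_bounds[OF a1 \<alpha>, of a\<^sub>2] unfolding ker_def by blast
  have "real d * (2 * \<alpha> + \<alpha>) + \<alpha> \<le> 1" unfolding \<alpha>d by simp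
  from tuple_ball_sum[OF _ \<alpha>(1) this] \<alpha>(1) obtain C1 where C1: "C1 \<ge> 0"
    "\<And>T j. finite T \<Longrightarrow> (\<Sum>\<tau>\<in>tuples (T \<times> UNIV) d. if norm (freq (nu \<tau>)) \<le> 2 * 2 ^ j then prod_list (map (\<lambda>q. wt (fst q) powr (1 - 2 * \<alpha>)) \<tau>) else 0)
      \<le> C1 * 4 powr (real j * (min 1 \<epsilon> / 2))"
    unfolding \<alpha>d by auto
  (* q * \<epsilon> \<ge> 3 beats the factor 4^j, and q * \<alpha> \<ge> 2 makes the exponent b of the chaining exceed 1 *)
  obtain q :: nat where "max (max 1 p) (max (3 / \<epsilon>) (2 / \<alpha>)) \<le> real q" using real_arch_simple by blast
  then have q: "1 \<le> real q" "p \<le> real q" "3 / \<epsilon> \<le> real q" "2 / \<alpha> \<le> real q" by auto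
  have q0: "q > 0" using q(1) by simp
  define b where "b = \<alpha> * real q"
  have b: "b > 1" using q(4) \<alpha> by (simp add: b_def field_simps)
  have q\<epsilon>: "3 \<le> real q * \<epsilon>" using q(3) \<epsilon> by (simp add: field_simps)
  define C2 where "C2 = 4 * K\<^sup>2 * (2 * Cv) ^ d * C1"
  have C2: "C2 \<ge> 0" using C1(1) Cv(1) by (simp add: C2_def)
  define Am where "Am = fact (q * d) * (4 ^ d * C2) ^ q"
  have Am: "Am \<ge> 0" using C2 by (simp add: Am_def)
  define c3 where "c3 = (8 * real q + 1)\<^sup>2 * Am"
  have c3: "c3 \<ge> 0" using Am by (simp add: c3_def)
  define cr where "cr = 1 + 1 / (1 - chain_ratio b (2 * q))"
  have cr: "cr \<ge> 0" using chain_ratio(1,2)[OF b, of "2 * q"] q0 by (simp add: cr_def)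
  define c4 where "c4 = 1 + T0 powr b / (1 - 2 powr (- (b - 1) / 2))"
  have c4: "c4 \<ge> 0"
  proof -
    have "2 powr (- (b - 1) / 2) < (2 :: real) powr 0" using b by (intro powr_less_mono) auto
    then show ?thesis by (simp add: c4_def)
  qed
  define C where "C = 2 * (cr ^ (2 * q) * (c3 * c4))"
  have C0: "C \<ge> 0" using cr c3 c4 by (simp add: C_def)
  show ?thesis
  proof (rule exI[of _ q], rule exI[of _ C], rule exI[of _ \<alpha>], intro conjI allI impI q0 C0 \<alpha>(1))
    show "p \<le> 2 * real q" using q by simp
    fix T :: "(int \<times> int) set" and w1 w2 :: "int \<times> int \<Rightarrow> complex" and u :: complex and \<Lambda> :: real
    assume T: "finite T" and \<Lambda>: "0 \<le> \<Lambda>"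
      and wc: "\<forall>\<tau>\<in>tuples (T \<times> UNIV) (k + l). (cmod (wick_coef k l w1 \<tau> - u * wick_coef k l w2 \<tau>))\<^sup>2 \<le> \<Lambda> * prod_list (map (\<lambda>q. wt (fst q) powr (- \<alpha>)) \<tau>)"
    define F where "F j t \<omega> x = LP_block \<phi>\<^sub>0 j (dcoef k l T w1 w2 u t \<omega>) x" for j t \<omega> x
    let ?v = "\<lambda>n. Cv * wt n powr (1 - \<alpha>)"
    have S: "(\<Sum>\<tau>\<in>tuples (T \<times> UNIV) (k + l). sym j k l w1 w2 u \<tau> * prod_list (map (\<lambda>q. 2 * ?v (fst q)) \<tau>)) \<le> \<Lambda> * C2 * 2 powr (real j * \<epsilon>)" for j
    proof -
      have pl: "prod_list (map (\<lambda>q. wt (fst q) powr (- \<alpha>)) \<tau>) * prod_list (map (\<lambda>q. 2 * ?v (fst q)) \<tau>)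
          = (2 * Cv) ^ length \<tau> * prod_list (map (\<lambda>q. wt (fst q) powr (1 - 2 * \<alpha>)) \<tau>)" for \<tau> :: "((int \<times> int) \<times> bool) list"
      proof (induction \<tau>)
        case (Cons q \<tau>)
        have "wt (fst q) powr (- \<alpha>) * (2 * ?v (fst q)) = 2 * Cv * (wt (fst q) powr (- \<alpha>) * wt (fst q) powr (1 - \<alpha>))" by simp
        also have "\<dots> = 2 * Cv * wt (fst q) powr (1 - 2 * \<alpha>)" unfolding powr_add[symmetric] by (simp add: algebra_simps)
        finally have "wt (fst q) powr (- \<alpha>) * (2 * ?v (fst q)) = 2 * Cv * wt (fst q) powr (1 - 2 * \<alpha>)" .
        then have "(wt (fst q) powr (- \<alpha>) * (2 * ?v (fst q))) * (prod_list (map (\<lambda>q. wt (fst q) powr (- \<alpha>)) \<tau>) * prod_list (map (\<lambda>q. 2 * ?v (fst q)) \<tau>))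
          = (2 * Cv * wt (fst q) powr (1 - 2 * \<alpha>)) * ((2 * Cv) ^ length \<tau> * prod_list (map (\<lambda>q. wt (fst q) powr (1 - 2 * \<alpha>)) \<tau>))"
          by (simp only: Cons.IH)
        then show ?case by (simp add: mult_ac)
      qed simp
      have "sym j k l w1 w2 u \<tau> * prod_list (map (\<lambda>q. 2 * ?v (fst q)) \<tau>)
         \<le> 4 * K\<^sup>2 * \<Lambda> * (2 * Cv) ^ d * (if norm (freq (nu \<tau>)) \<le> 2 * 2 ^ j then prod_list (map (\<lambda>q. wt (fst q) powr (1 - 2 * \<alpha>)) \<tau>) else 0)"
        if \<tau>: "\<tau> \<in> tuples (T \<times> UNIV) (k + l)" for \<tau>
      proof (cases "norm (freq (nu \<tau>)) \<le> 2 * 2 ^ j")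
        case True
        have len: "length \<tau> = d" using \<tau> by (simp add: tuples_def d_def)
        have v0: "prod_list (map (\<lambda>q. 2 * ?v (fst q)) \<tau>) \<ge> 0" using Cv(1) by (intro prod_list_nonneg) auto
        have "(LP_phi \<phi>\<^sub>0 j (freq (nu \<tau>)))\<^sup>2 \<le> (2 * K)\<^sup>2"
          using LP_phi_bound[of j "freq (nu \<tau>)"] K(1) by (intro abs_le_square_iff[THEN iffD1]) auto
        then have "sym j k l w1 w2 u \<tau> \<le> (2 * K)\<^sup>2 * (\<Lambda> * prod_list (map (\<lambda>q. wt (fst q) powr (- \<alpha>)) \<tau>))"
          unfolding sym_def using wc \<tau> by (intro mult_mono) auto
        then have "sym j k l w1 w2 u \<tau> * prod_list (map (\<lambda>q. 2 * ?v (fst q)) \<tau>)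
          \<le> (2 * K)\<^sup>2 * (\<Lambda> * prod_list (map (\<lambda>q. wt (fst q) powr (- \<alpha>)) \<tau>)) * prod_list (map (\<lambda>q. 2 * ?v (fst q)) \<tau>)"
          using v0 by (rule mult_right_mono)
        also have "\<dots> = 4 * K\<^sup>2 * \<Lambda> * (prod_list (map (\<lambda>q. wt (fst q) powr (- \<alpha>)) \<tau>) * prod_list (map (\<lambda>q. 2 * ?v (fst q)) \<tau>))"
          by (simp only: power_mult_distrib mult.assoc) simp
        finally show ?thesis unfolding pl len using True by (simp add: mult.assoc)
      next
        case False
        then have "LP_phi \<phi>\<^sub>0 j (freq (nu \<tau>)) = 0" using LP_phi_support by blast
        then show ?thesis using False by (simp add: sym_def)
      qed
      then have "(\<Sum>\<tau>\<in>tuples (T \<times> UNIV) (k + l). sym j k l w1 w2 u \<tau> * prod_list (map (\<lambda>q. 2 * ?v (fst q)) \<tau>))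
        \<le> 4 * K\<^sup>2 * \<Lambda> * (2 * Cv) ^ d * (\<Sum>\<tau>\<in>tuples (T \<times> UNIV) d. if norm (freq (nu \<tau>)) \<le> 2 * 2 ^ j then prod_list (map (\<lambda>q. wt (fst q) powr (1 - 2 * \<alpha>)) \<tau>) else 0)"
        unfolding sum_distrib_left d_def by (intro sum_mono)
      also have "\<dots> \<le> 4 * K\<^sup>2 * \<Lambda> * (2 * Cv) ^ d * (C1 * 4 powr (real j * (min 1 \<epsilon> / 2)))"
        using \<Lambda> Cv(1) by (intro mult_left_mono C1 T) auto
      also have "\<dots> = \<Lambda> * C2 * 4 powr (real j * (min 1 \<epsilon> / 2))" by (simp add: C2_def)
      also have "4 powr (real j * (min 1 \<epsilon> / 2)) \<le> 4 powr (real j * (\<epsilon> / 2))"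
        by (intro powr_mono mult_left_mono) auto
      also have "4 powr (real j * (\<epsilon> / 2)) = 2 powr (real j * \<epsilon>)"
      proof -
        have "(4 :: real) = 2 powr 2" by simp
        then show ?thesis by (simp only: powr_powr) simp
      qed
      finally show ?thesis using \<Lambda> C2 by (simp add: mult_left_mono)
    qed
    have mom: "(\<integral>\<^sup>+\<omega>. ennreal (cmod (F j t \<omega> x - u' * F j s \<omega> x) ^ (2 * q)) \<partial>M) \<le> ennreal (Am * \<Lambda> ^ q * 2 powr (real j * \<epsilon> * q) * \<theta> ^ q)"
      if u': "u' = 0 \<and> \<theta> = 1 \<or> u' = 1 \<and> s < t \<and> \<theta> = (t - s) powr \<alpha>" for j s t x u' \<theta>
    proof -
      have \<theta>: "\<theta> \<ge> 0" using u' by auto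
      have vv: "var n < ?v n" for n
        using Cv(2)[of 0 n] var_nonneg[of n] unfolding ker_norm by (simp add: ennreal_less_iff)
      have "(\<integral>\<^sup>+\<omega>. ennreal (cmod (F j t \<omega> x - u' * F j s \<omega> x) ^ (2 * q)) \<partial>M)
        \<le> ennreal (fact (q * (k + l)) * (4 ^ (k + l) * \<theta> * (\<Sum>\<tau>\<in>tuples (T \<times> UNIV) (k + l). sym j k l w1 w2 u \<tau> * prod_list (map (\<lambda>q. 2 * ?v (fst q)) \<tau>))) ^ q)"
        unfolding F_def dcoef_increment
      proof (rule increment_block_moment[where ft = "ker t" and fs = "ker s"])
        show "u' = 0 \<and> \<theta> = 1 \<or> u' = 1 \<and> (\<forall>n\<in>T. (\<integral>\<^sup>+x. ennreal ((cmod (ker t n x - ker s n x))\<^sup>2) \<partial>lborel) < ennreal (\<theta> * ?v n))"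
          using u' Cv(3)[of s t] by (auto simp: mult_ac)
      qed (use T wiener ker_norm var_nonneg vv \<theta> in auto)
      also have "\<dots> \<le> ennreal (fact (q * d) * (4 ^ d * \<theta> * (\<Lambda> * C2 * 2 powr (real j * \<epsilon>))) ^ q)"
        unfolding d_def[symmetric]
        using \<theta> S[of j] Cv(1) unfolding d_def[symmetric]
        by (intro ennreal_leI mult_left_mono power_mono)
           (auto intro!: mult_nonneg_nonneg sum_nonneg prod_list_nonneg simp: sym_def)
      also have "fact (q * d) * (4 ^ d * \<theta> * (\<Lambda> * C2 * 2 powr (real j * \<epsilon>))) ^ q = Am * \<Lambda> ^ q * 2 powr (real j * \<epsilon> * q) * \<theta> ^ q"
        by (simp add: Am_def power_mult_distrib powr_realpow[symmetric] powr_powr)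
      finally show ?thesis .
    qed
    define Q0 where "Q0 j \<omega> = sup_majorant q j (F j 0 \<omega>)" for j \<omega>
    define Q1 where "Q1 j \<omega> s t = sup_majorant q j (\<lambda>x. F j t \<omega> x - F j s \<omega> x)" for j \<omega> s t
    have Fm: "(\<lambda>p. F j t (fst p) (snd p)) \<in> borel_measurable (M \<Otimes>\<^sub>M borel)" for j t
      unfolding F_def by (rule dcoef_measurable_pair[OF T])
    have Fm2: "(\<lambda>p. F j t (fst p) (snd p) - F j s (fst p) (snd p)) \<in> borel_measurable (M \<Otimes>\<^sub>M borel)" for j s t
      by (intro borel_measurable_diff Fm)
    have Q0m[measurable]: "Q0 j \<in> borel_measurable M" for j unfolding Q0_def by (rule sup_majorant_measurable[OF Fm])
    have Q1m[measurable]: "(\<lambda>\<omega>. Q1 j \<omega> s t) \<in> borel_measurable M" for j s t unfolding Q1_def by (rule sup_majorant_measurable[OF Fm2])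
    define A where "A j = c3 * \<Lambda> ^ q * 4 ^ j * 2 powr (real j * \<epsilon> * q)" for j :: nat
    have A: "A j \<ge> 0" for j using c3 \<Lambda> by (simp add: A_def)
    have EQ0: "(\<integral>\<^sup>+\<omega>. Q0 j \<omega> \<partial>M) \<le> ennreal (A j)" for j
    proof -
      have "(\<integral>\<^sup>+\<omega>. Q0 j \<omega> \<partial>M) \<le> ennreal ((8 * real q + 1)\<^sup>2 * 4 ^ j * (Am * \<Lambda> ^ q * 2 powr (real j * \<epsilon> * q)))"
        unfolding Q0_def
        by (rule sup_majorant_expectation[OF _ Fm]) (use mom[of 0 1 0 0] Am \<Lambda> prob_space_axioms in auto)
      then show ?thesis by (simp add: A_def c3_def mult_ac)
    qed
    have EQ1: "(\<integral>\<^sup>+\<omega>. Q1 j \<omega> s t \<partial>M) \<le> ennreal (A j * (t - s) powr b)" if st: "s < t" for j s t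
    proof -
      have "(\<integral>\<^sup>+\<omega>. Q1 j \<omega> s t \<partial>M) \<le> ennreal ((8 * real q + 1)\<^sup>2 * 4 ^ j * (Am * \<Lambda> ^ q * 2 powr (real j * \<epsilon> * q) * ((t - s) powr \<alpha>) ^ q))"
        unfolding Q1_def
        by (rule sup_majorant_expectation[OF _ Fm2]) (use mom[of 1 "(t - s) powr \<alpha>" s t] st Am \<Lambda> prob_space_axioms in auto)
      also have "((t - s) powr \<alpha>) ^ q = (t - s) powr b"
        using st by (simp add: b_def powr_realpow[symmetric] powr_powr)
      finally show ?thesis by (simp add: A_def c3_def mult_ac)
    qed
    define W where "W \<omega> = (\<Sum>j. ennreal (2 powr (- 2 * real q * \<epsilon> * j)) * (ennreal (cr ^ (2 * q)) * chain_majorant b (2 * q) T0 (Q0 j \<omega>) (Q1 j \<omega>)))" for \<omega>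
    have Wm: "W \<in> borel_measurable M" unfolding W_def by measurable
    have EW: "(\<integral>\<^sup>+\<omega>. W \<omega> \<partial>M) \<le> ennreal (C * \<Lambda> ^ q)"
    proof -
      have "(\<integral>\<^sup>+\<omega>. W \<omega> \<partial>M) = (\<Sum>j. ennreal (2 powr (- 2 * real q * \<epsilon> * j)) * (ennreal (cr ^ (2 * q)) * (\<integral>\<^sup>+\<omega>. chain_majorant b (2 * q) T0 (Q0 j \<omega>) (Q1 j \<omega>) \<partial>M)))"
        unfolding W_def by (subst nn_integral_suminf, measurable) (simp add: nn_integral_cmult)
      also have "\<dots> \<le> (\<Sum>j. ennreal (cr ^ (2 * q) * (c3 * c4) * \<Lambda> ^ q * (1 / 2) ^ j))"
      proof (intro suminf_le)
        fix j
        have "(\<integral>\<^sup>+\<omega>. chain_majorant b (2 * q) T0 (Q0 j \<omega>) (Q1 j \<omega>) \<partial>M) \<le> ennreal (A j * c4)"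
          unfolding c4_def by (rule chain_majorant_expectation[OF Q0m Q1m T0 b A EQ0 EQ1])
        then have "ennreal (2 powr (- 2 * real q * \<epsilon> * j)) * (ennreal (cr ^ (2 * q)) * (\<integral>\<^sup>+\<omega>. chain_majorant b (2 * q) T0 (Q0 j \<omega>) (Q1 j \<omega>) \<partial>M))
           \<le> ennreal (2 powr (- 2 * real q * \<epsilon> * j)) * (ennreal (cr ^ (2 * q)) * ennreal (A j * c4))"
          by (intro mult_left_mono) auto
        also have "\<dots> = ennreal (2 powr (- 2 * real q * \<epsilon> * j) * (cr ^ (2 * q) * (A j * c4)))"
          using cr A[of j] c4 by (simp add: ennreal_mult)
        also have "2 powr (- 2 * real q * \<epsilon> * j) * (cr ^ (2 * q) * (A j * c4)) \<le> cr ^ (2 * q) * (c3 * c4) * \<Lambda> ^ q * (1 / 2) ^ j"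
        proof -
          have "2 powr (- 2 * real q * \<epsilon> * j) * (4 ^ j * 2 powr (real j * \<epsilon> * q)) = 2 powr (real j * (2 - real q * \<epsilon>))"
          proof -
            have "(4 :: real) ^ j = 2 powr (2 * real j)" by (simp add: powr_realpow[symmetric] powr_powr[symmetric])
            then show ?thesis by (simp only: powr_add[symmetric]) (simp add: algebra_simps)
          qed
          also have "\<dots> \<le> 2 powr (real j * (- 1))" using q\<epsilon> by (intro powr_mono mult_left_mono) auto
          also have "\<dots> = (1 / 2) ^ j" by (simp add: powr_minus powr_realpow power_one_over inverse_eq_divide)
          finally have "cr ^ (2 * q) * (c3 * c4) * \<Lambda> ^ q * (2 powr (- 2 * real q * \<epsilon> * j) * (4 ^ j * 2 powr (real j * \<epsilon> * q))) \<le> cr ^ (2 * q) * (c3 * c4) * \<Lambda> ^ q * (1 / 2) ^ j"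
            using cr c3 c4 \<Lambda> by (intro mult_left_mono) auto
          then show ?thesis by (simp add: A_def mult_ac)
        qed
        finally show "ennreal (2 powr (- 2 * real q * \<epsilon> * j)) * (ennreal (cr ^ (2 * q)) * (\<integral>\<^sup>+\<omega>. chain_majorant b (2 * q) T0 (Q0 j \<omega>) (Q1 j \<omega>) \<partial>M))
           \<le> ennreal (cr ^ (2 * q) * (c3 * c4) * \<Lambda> ^ q * (1 / 2) ^ j)" by (simp add: ennreal_leI)
      qed auto
      also have "\<dots> = ennreal (cr ^ (2 * q) * (c3 * c4) * \<Lambda> ^ q * (1 / (1 - 1 / 2)))"
      proof -
        have "(\<lambda>j. cr ^ (2 * q) * (c3 * c4) * \<Lambda> ^ q * (1 / 2) ^ j) sums (cr ^ (2 * q) * (c3 * c4) * \<Lambda> ^ q * (1 / (1 - 1 / 2)))"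
          by (intro sums_mult geometric_sums) auto
        then show ?thesis using cr c3 c4 \<Lambda> by (intro suminf_ennreal_eq) auto
      qed
      finally show ?thesis by (simp add: C_def mult_ac)
    qed
    show "\<exists>W\<in>borel_measurable M. (\<integral>\<^sup>+\<omega>. W \<omega> \<partial>M) \<le> ennreal (C * \<Lambda> ^ q) \<and>
       (AE \<omega> in M. \<forall>t\<in>{0..T0}. \<forall>j x. ennreal ((2 powr (real j * - \<epsilon>) * cmod (LP_block \<phi>\<^sub>0 j (dcoef k l T w1 w2 u t \<omega>) x)) ^ (2 * q)) \<le> W \<omega>)"
    proof (intro bexI[of _ W] conjI Wm EW)
      show "AE \<omega> in M. \<forall>t\<in>{0..T0}. \<forall>j x. ennreal ((2 powr (real j * - \<epsilon>) * cmod (LP_block \<phi>\<^sub>0 j (dcoef k l T w1 w2 u t \<omega>) x)) ^ (2 * q)) \<le> W \<omega>"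
        using Z_continuous
      proof eventually_elim
        fix \<omega> assume cont: "\<forall>n. continuous_on UNIV (\<lambda>t. Z n t \<omega>)"
        show "\<forall>t\<in>{0..T0}. \<forall>j x. ennreal ((2 powr (real j * - \<epsilon>) * cmod (LP_block \<phi>\<^sub>0 j (dcoef k l T w1 w2 u t \<omega>) x)) ^ (2 * q)) \<le> W \<omega>"
        proof (intro ballI allI)
          fix t j x assume t: "t \<in> {0..T0}"
          have tr: "is_trig (2 * 2 ^ j) (\<lambda>x. F j t \<omega> x - F j s \<omega> x)" for t s
            unfolding F_def LP_block_diff[symmetric] by (rule is_trig_LP_block)
          have "ennreal (cmod (F j t \<omega> x) ^ (2 * q)) \<le> ennreal (cr ^ (2 * q)) * chain_majorant b (2 * q) T0 (Q0 j \<omega>) (Q1 j \<omega>)"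
            unfolding cr_def
          proof (rule chaining_bound[OF _ T0 b _ _ _ t])
            show "continuous_on {0..T0} (\<lambda>t. F j t \<omega> x)" unfolding F_def by (rule dcoef_continuous[OF T cont])
            show "ennreal (cmod (F j 0 \<omega> x) ^ (2 * q)) \<le> Q0 j \<omega>"
              unfolding Q0_def by (rule sup_majorant_bound) (simp add: F_def is_trig_LP_block)
            show "ennreal (cmod (F j t \<omega> x - F j s \<omega> x) ^ (2 * q)) \<le> Q1 j \<omega> s t" for s t
              unfolding Q1_def by (rule sup_majorant_bound[OF tr])
          qed (use q0 in simp)
          then have "ennreal (2 powr (- 2 * real q * \<epsilon> * j)) * ennreal (cmod (F j t \<omega> x) ^ (2 * q))
             \<le> ennreal (2 powr (- 2 * real q * \<epsilon> * j)) * (ennreal (cr ^ (2 * q)) * chain_majorant b (2 * q) T0 (Q0 j \<omega>) (Q1 j \<omega>))"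
            by (intro mult_left_mono) auto
          also have "\<dots> \<le> W \<omega>"
            unfolding W_def using sum_le_suminf[OF summableI, of "{j}" "\<lambda>j. ennreal (2 powr (- 2 * real q * \<epsilon> * j)) * (ennreal (cr ^ (2 * q)) * chain_majorant b (2 * q) T0 (Q0 j \<omega>) (Q1 j \<omega>))"]
            by simp
          also have "ennreal (2 powr (- 2 * real q * \<epsilon> * j)) * ennreal (cmod (F j t \<omega> x) ^ (2 * q)) = ennreal ((2 powr (real j * - \<epsilon>) * cmod (F j t \<omega> x)) ^ (2 * q))"
          proof -
            have "2 powr (- 2 * real q * \<epsilon> * j) = (2 powr (real j * - \<epsilon>)) ^ (2 * q)"
              by (simp add: powr_realpow[symmetric] powr_powr mult_ac)
            then show ?thesis by (simp add: ennreal_mult[symmetric] power_mult_distrib)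
          qed
          finally show "ennreal ((2 powr (real j * - \<epsilon>) * cmod (LP_block \<phi>\<^sub>0 j (dcoef k l T w1 w2 u t \<omega>) x)) ^ (2 * q)) \<le> W \<omega>"
            unfolding F_def .
        qed
      qed
    qed
  qed
qed

end

section \<open>The spaces of distributions and of continuous paths\<close>


lemma wave_has_derivative: "(wave n has_derivative (\<lambda>v. \<i> * of_real (freq n \<bullet> v) * wave n x)) (at x)"
proof -
  have d: "((\<lambda>x. \<i> * complex_of_real (freq n \<bullet> x)) has_derivative (\<lambda>v. \<i> * complex_of_real (freq n \<bullet> v))) (at x)"
    by (intro has_derivative_mult_right has_derivative_of_real has_derivative_inner_right has_derivative_ident)
  have "((\<lambda>x. exp (\<i> * complex_of_real (freq n \<bullet> x))) has_derivative (\<lambda>v. exp (\<i> * complex_of_real (freq n \<bullet> x)) * (\<i> * of_real (freq n \<bullet> v)))) (at x)"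
    using has_derivative_compose[OF d DERIV_exp[unfolded has_field_derivative_def]] .
  then show ?thesis unfolding wave_def[abs_def] by (simp add: mult_ac)
qed

lemma trig_poly_has_derivative:
  "(trig_poly I a \<nu> has_derivative (\<lambda>v. trig_poly I (\<lambda>i. a i * (\<i> * of_real (freq (\<nu> i) \<bullet> v))) \<nu> x)) (at x)"
  unfolding trig_poly_def[abs_def]
  by (rule has_derivative_eq_rhs[OF has_derivative_sum[OF has_derivative_mult_right[OF wave_has_derivative]]])
     (simp add: mult_ac)

lemma Ck_trig_poly: "Ck k (trig_poly I a \<nu>)"
proof (induction k arbitrary: a)
  case 0
  then show ?case by (simp add: continuous_on_trig_poly)
next
  case (Suc k)
  have "frechet_derivative (trig_poly I a \<nu>) (at x) v = trig_poly I (\<lambda>i. a i * (\<i> * of_real (freq (\<nu> i) \<bullet> v))) \<nu> x" for x v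
    unfolding frechet_derivative_at[OF trig_poly_has_derivative[of I a \<nu> x], symmetric] ..
  then have "(\<lambda>x. frechet_derivative (trig_poly I a \<nu>) (at x) v) = trig_poly I (\<lambda>i. a i * (\<i> * of_real (freq (\<nu> i) \<bullet> v))) \<nu>" for v by blast
  moreover have "trig_poly I a \<nu> differentiable (at x)" for x
    by (rule differentiableI[OF trig_poly_has_derivative])
  ultimately show ?case unfolding Ck.simps using Suc.IH by presburger
qed

lemma smooth_torus_trig_poly: "smooth_torus (trig_poly I a \<nu>)"
proof -
  have e: "exp (\<i> * of_real (real_of_int k * (x + 2 * pi))) = exp (\<i> * of_real (real_of_int k * x))" for k x
  proof -
    have "exp (\<i> * of_real (real_of_int k * (2 * pi))) = 1"
      using exp_eq_1[of "\<i> * of_real (real_of_int k * (2 * pi))"] by (auto intro!: exI[of _ k])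
    moreover have "\<i> * complex_of_real (real_of_int k * (x + 2 * pi)) = \<i> * of_real (real_of_int k * x) + \<i> * of_real (real_of_int k * (2 * pi))"
      by (simp add: algebra_simps)
    ultimately show ?thesis by (simp only: exp_add) simp
  qed
  show ?thesis
    unfolding smooth_torus_def smooth_def trig_poly_def[of _ _ _ "(_, _)"] wave_Pair e using Ck_trig_poly by blast
qed

text \<open>A Fourier coefficient is a mean of the function against a wave.\<close>

lemma coeff_le_sup:
  assumes f: "\<And>x. cmod (trig_poly I a (\<lambda>n. n) x) \<le> B" and I: "finite I" "n \<in> I"
  shows "cmod (a n) \<le> B"
proof -
  let ?f = "trig_poly I a (\<lambda>n. n)" and ?Q = "cbox (0, 0) (2 * pi, 2 * pi) :: (real \<times> real) set"
  let ?J = "LINT x:?Q|lborel. ?f x * wave (- fst n, - snd n) x"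
  have "a n = fourier_coeff ?f n"
    unfolding fourier_coeff_trig_poly[OF I(1)] using I by simp
  then have "cmod (a n) = cmod ?J / (2 * pi)\<^sup>2"
    by (simp only: fourier_coeff_def norm_divide) (simp add: norm_power norm_mult)
  moreover have "cmod ?J \<le> (LINT x:?Q|lborel. cmod (?f x * wave (- fst n, - snd n) x))"
    by (rule set_integral_norm_bound) (intro torus_integrable continuous_intros)
  moreover have "(LINT x:?Q|lborel. cmod (?f x * wave (- fst n, - snd n) x)) \<le> (LINT x:?Q|lborel. B)"
    by (intro set_integral_mono torus_integrable continuous_intros) (simp_all add: norm_mult f)
  moreover have "(LINT x:?Q|lborel. B) = (2 * pi)\<^sup>2 * B"
  proof -
    have "emeasure lborel ?Q = ennreal ((2 * pi)\<^sup>2)"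
      by (subst emeasure_lborel_cbox) (auto simp: Basis_prod_def power2_eq_square)
    then show ?thesis by (simp add: set_lebesgue_integral_def measure_def del: emeasure_lborel_cbox_eq)
  qed
  ultimately have "cmod (a n) \<le> (2 * pi)\<^sup>2 * B / (2 * pi)\<^sup>2" by (simp only:) (intro divide_right_mono; simp)
  then show ?thesis by simp
qed

lemma path_diff: "(u - v) t = u t - v t" for u v :: "real \<Rightarrow> int \<times> int \<Rightarrow> complex"
  by (rule minus_apply)

lemma ennreal_halves: "e / 2 + e / 2 = (e :: ennreal)"
proof (cases e)
  case (real r)
  then have "e / 2 + e / 2 = ennreal (r / 2) + ennreal (r / 2)" by (simp add: ennreal_divide_numeral)
  also have "\<dots> = e" using real by (simp add: ennreal_plus[symmetric] del: ennreal_plus)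
  finally show ?thesis .
qed (simp add: ennreal_top_divide)

locale CT_space = LP \<phi>\<^sub>0 for \<phi>\<^sub>0 +
  fixes \<epsilon> T :: real
  assumes \<epsilon>: "\<epsilon> > 0" and T0: "T > 0"
begin

abbreviation "CN \<equiv> Cs_norm \<phi>\<^sub>0 (- \<epsilon>)"
abbreviation "TN \<equiv> CT_norm \<phi>\<^sub>0 (- \<epsilon>) T"
abbreviation "CC \<equiv> CT \<phi>\<^sub>0 (- \<epsilon>) T"

text \<open>The weighted blocks, whose suprema make up the norm. They depend linearly on the coefficients and only
  on finitely many of them.\<close>

definition wb :: "nat \<Rightarrow> (int \<times> int \<Rightarrow> complex) \<Rightarrow> real \<times> real \<Rightarrow> complex" where
  "wb j u x = of_real (2 powr (real j * - \<epsilon>)) * LP_block \<phi>\<^sub>0 j u x"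

lemma norm_wb: "cmod (wb j u x) = 2 powr (real j * - \<epsilon>) * cmod (LP_block \<phi>\<^sub>0 j u x)"
  by (simp add: wb_def norm_mult)

lemma wb_diff: "wb j (u - v) x = wb j u x - wb j v x"
  unfolding wb_def LP_block_diff by (simp add: algebra_simps)

lemma CN_le_iff: "CN u \<le> b \<longleftrightarrow> (\<forall>j x. ennreal (cmod (wb j u x)) \<le> b)"
proof -
  have "ennreal (2 powr (real j * - \<epsilon>)) * (SUP x. ennreal (cmod (LP_block \<phi>\<^sub>0 j u x))) = (SUP x. ennreal (cmod (wb j u x)))" for j
    unfolding norm_wb by (subst SUP_mult_left_ennreal) (auto simp: ennreal_mult)
  then show ?thesis unfolding Cs_norm_def by (auto simp: SUP_le_iff)
qed

lemma wb_le_CN: "ennreal (cmod (wb j u x)) \<le> CN u"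
  using CN_le_iff[of u "CN u"] by blast

lemma TN_le_iff: "TN u \<le> b \<longleftrightarrow> (\<forall>t\<in>{0..T}. CN (u t) \<le> b)"
  unfolding CT_norm_def by (auto simp: SUP_le_iff)

lemma CN_le_TN: "t \<in> {0..T} \<Longrightarrow> CN (u t) \<le> TN u"
  using TN_le_iff[of u "TN u"] by blast

lemma CN_triangle: "CN (u - w) \<le> CN (u - v) + CN (v - w)"
  unfolding CN_le_iff
proof (intro allI)
  fix j x
  have "wb j (u - w) x = wb j (u - v) x + wb j (v - w) x" by (simp add: wb_diff)
  then have "ennreal (cmod (wb j (u - w) x)) \<le> ennreal (cmod (wb j (u - v) x)) + ennreal (cmod (wb j (v - w) x))"
    using norm_triangle_ineq[of "wb j (u - v) x" "wb j (v - w) x"] by (simp add: ennreal_plus[symmetric] ennreal_leI del: ennreal_plus)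
  also have "\<dots> \<le> CN (u - v) + CN (v - w)" by (intro add_mono wb_le_CN)
  finally show "ennreal (cmod (wb j (u - w) x)) \<le> CN (u - v) + CN (v - w)" .
qed

lemma CN_commute: "CN (u - v) = CN (v - u)"
proof -
  have "CN (u - v) \<le> CN (v - u)" for u v
    unfolding CN_le_iff
  proof (intro allI)
    fix j x
    have "cmod (wb j (u - v) x) = cmod (wb j (v - u) x)" unfolding wb_diff by (rule norm_minus_commute)
    then show "ennreal (cmod (wb j (u - v) x)) \<le> CN (v - u)" using wb_le_CN[of j "v - u" x] by (simp only:)
  qed
  from this[of u v] this[of v u] show ?thesis by (rule antisym)
qed

lemma TN_triangle: "TN (u - w) \<le> TN (u - v) + TN (v - w)"
  unfolding TN_le_iff
proof
  fix t assume t: "t \<in> {0..T}"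
  have "CN ((u - w) t) \<le> CN ((u - v) t) + CN ((v - w) t)" unfolding path_diff by (rule CN_triangle)
  also have "\<dots> \<le> TN (u - v) + TN (v - w)" by (rule add_mono[OF CN_le_TN[OF t] CN_le_TN[OF t]])
  finally show "CN ((u - w) t) \<le> TN (u - v) + TN (v - w)" .
qed

lemma TN_commute: "TN (u - v) = TN (v - u)"
  unfolding CT_norm_def path_diff by (intro SUP_cong refl CN_commute)

lemma Cs_iff: "u \<in> Cs \<phi>\<^sub>0 (- \<epsilon>) \<longleftrightarrow> (\<forall>e>0. \<exists>f. smooth_torus f \<and> CN (u - fourier_coeff f) < e)"
proof
  assume "u \<in> Cs \<phi>\<^sub>0 (- \<epsilon>)"
  then obtain f where f: "\<And>m. smooth_torus (f m)" "(\<lambda>m. CN (u - fourier_coeff (f m))) \<longlonglongrightarrow> 0"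
    unfolding Cs_def by blast
  show "\<forall>e>0. \<exists>f. smooth_torus f \<and> CN (u - fourier_coeff f) < e"
  proof (intro allI impI)
    fix e :: ennreal assume "e > 0"
    from order_tendstoD(2)[OF f(2) this] show "\<exists>f. smooth_torus f \<and> CN (u - fourier_coeff f) < e"
      using f(1) unfolding eventually_sequentially by blast
  qed
next
  assume *: "\<forall>e>0. \<exists>f. smooth_torus f \<and> CN (u - fourier_coeff f) < e"
  have pos: "0 < ennreal (inverse (real (Suc m)))" for m by simp
  have "\<forall>m. \<exists>f. smooth_torus f \<and> CN (u - fourier_coeff f) < ennreal (inverse (real (Suc m)))"
    using *[THEN spec, THEN mp, OF pos] by (rule allI)
  from choice[OF this] obtain f where f: "\<And>m. smooth_torus (f m)" "\<And>m. CN (u - fourier_coeff (f m)) < ennreal (inverse (real (Suc m)))" by blast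
  have "(\<lambda>m. ennreal (inverse (real (Suc m)))) \<longlonglongrightarrow> ennreal 0"
    by (intro tendsto_ennrealI LIMSEQ_inverse_real_of_nat)
  then have lim: "(\<lambda>m. ennreal (inverse (real (Suc m)))) \<longlonglongrightarrow> 0" unfolding ennreal_0 .
  have "(\<lambda>m. CN (u - fourier_coeff (f m))) \<longlonglongrightarrow> 0"
    by (rule tendsto_sandwich[OF always_eventually always_eventually tendsto_const lim]) (intro allI zero_le less_imp_le f(2))+
  then show "u \<in> Cs \<phi>\<^sub>0 (- \<epsilon>)" using f(1) unfolding Cs_def by blast
qed

lemma Cs_closed:
  assumes "\<And>e. e > 0 \<Longrightarrow> \<exists>v\<in>Cs \<phi>\<^sub>0 (- \<epsilon>). CN (u - v) < e"
  shows "u \<in> Cs \<phi>\<^sub>0 (- \<epsilon>)"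
  unfolding Cs_iff
proof (intro allI impI)
  fix e :: ennreal assume e: "e > 0"
  have e2: "e / 2 > 0" using e by (simp add: ennreal_zero_less_divide)
  obtain v where v: "v \<in> Cs \<phi>\<^sub>0 (- \<epsilon>)" "CN (u - v) < e / 2" using assms[OF e2] by blast
  obtain f where f: "smooth_torus f" "CN (v - fourier_coeff f) < e / 2" using v(1) e2 unfolding Cs_iff by blast
  have "CN (u - fourier_coeff f) \<le> CN (u - v) + CN (v - fourier_coeff f)" by (rule CN_triangle)
  also have "\<dots> < e / 2 + e / 2" using v f by (intro add_strict_mono) auto
  also have "\<dots> = e" by (rule ennreal_halves)
  finally show "\<exists>f. smooth_torus f \<and> CN (u - fourier_coeff f) < e" using f by blast
qed

lemma CN_finite_support:
  assumes S: "finite S" "\<And>n. n \<notin> S \<Longrightarrow> u n = 0"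
  shows "CN u \<le> ennreal (2 * K * (\<Sum>n\<in>S. cmod (u n)))"
  unfolding CN_le_iff
proof (intro allI ennreal_leI)
  fix j x
  have "LP_block \<phi>\<^sub>0 j u x = (\<Sum>n\<in>S. of_real (LP_phi \<phi>\<^sub>0 j (freq n)) * u n * wave n x)"
    unfolding LP_block_def using S finite_LP by (intro sum.mono_neutral_cong) auto
  then have "cmod (LP_block \<phi>\<^sub>0 j u x) \<le> (\<Sum>n\<in>S. 2 * K * cmod (u n))"
    by (simp only:) (rule sum_norm_le, simp add: norm_mult mult_right_mono LP_phi_bound)
  moreover have "2 powr (real j * - \<epsilon>) \<le> 2 powr 0" using \<epsilon> by (intro powr_mono) auto
  ultimately have "cmod (wb j u x) \<le> 1 * (\<Sum>n\<in>S. 2 * K * cmod (u n))"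
    unfolding norm_wb by (intro mult_mono) auto
  then show "cmod (wb j u x) \<le> 2 * K * (\<Sum>n\<in>S. cmod (u n))" by (simp add: sum_distrib_left)
qed

text \<open>Trigonometric polynomials are smooth, so a constant sequence approximates.\<close>

lemma Cs_finite_support:
  assumes S: "finite S" "\<And>n. n \<notin> S \<Longrightarrow> u n = 0"
  shows "u \<in> Cs \<phi>\<^sub>0 (- \<epsilon>)"
  unfolding Cs_iff
proof (intro allI impI exI conjI)
  let ?f = "trig_poly S u (\<lambda>n. n)"
  show "smooth_torus ?f" by (rule smooth_torus_trig_poly)
  have "fourier_coeff ?f n = u n" for n
    unfolding fourier_coeff_trig_poly[OF S(1)] using S by (auto simp: sum.delta)
  then have "u - fourier_coeff ?f = (\<lambda>n. 0)" by (auto simp: fun_eq_iff)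
  then show "CN (u - fourier_coeff ?f) < e" if "e > 0" for e
    using CN_finite_support[of "{}" "\<lambda>n. 0"] that by simp
qed

lemma CT_finite_support:
  assumes S: "finite S" "\<And>t n. n \<notin> S \<Longrightarrow> u t n = 0" and c: "\<And>n. n \<in> S \<Longrightarrow> continuous_on {0..T} (\<lambda>t. u t n)"
  shows "u \<in> CC"
  unfolding CT_def
proof (intro CollectI ballI conjI)
  fix t assume t: "t \<in> {0..T}"
  show "u t \<in> Cs \<phi>\<^sub>0 (- \<epsilon>)" using S by (intro Cs_finite_support[of S]) auto
  have "((\<lambda>r. ennreal (2 * K * (\<Sum>n\<in>S. cmod (u r n - u t n)))) \<longlongrightarrow> ennreal (2 * K * (\<Sum>n\<in>S. cmod (u t n - u t n)))) (at t within {0..T})"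
    using c t unfolding continuous_on_def
    by (intro tendsto_ennrealI tendsto_mult tendsto_sum tendsto_norm tendsto_diff tendsto_const) auto
  then have lim: "((\<lambda>r. ennreal (2 * K * (\<Sum>n\<in>S. cmod (u r n - u t n)))) \<longlongrightarrow> 0) (at t within {0..T})" by simp
  show "((\<lambda>r. CN (u r - u t)) \<longlongrightarrow> 0) (at t within {0..T})"
  proof (rule tendsto_sandwich[OF _ _ tendsto_const lim])
    show "eventually (\<lambda>r. CN (u r - u t) \<le> ennreal (2 * K * (\<Sum>n\<in>S. cmod (u r n - u t n)))) (at t within {0..T})"
      using CN_finite_support[OF S(1), of "u r - u t" for r] S(2) by (intro always_eventually allI) simp
  qed simp
qed

lemma CT_closed:
  assumes u: "\<And>e. e > 0 \<Longrightarrow> \<exists>v\<in>CC. TN (u - v) < e"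
  shows "u \<in> CC"
  unfolding CT_def
proof (intro CollectI ballI conjI)
  fix t assume t: "t \<in> {0..T}"
  show "u t \<in> Cs \<phi>\<^sub>0 (- \<epsilon>)"
  proof (rule Cs_closed)
    fix e :: ennreal assume "e > 0"
    then obtain v where v: "v \<in> CC" "TN (u - v) < e" using u by blast
    have "CN (u t - v t) \<le> TN (u - v)" using CN_le_TN[OF t, of "u - v"] by simp
    then show "\<exists>v\<in>Cs \<phi>\<^sub>0 (- \<epsilon>). CN (u t - v) < e" using v t unfolding CT_def by (auto intro: le_less_trans)
  qed
  show "((\<lambda>r. CN (u r - u t)) \<longlongrightarrow> 0) (at t within {0..T})"
  proof (rule order_tendstoI)
    fix e :: ennreal assume e: "0 < e"
    have e2: "e / 2 > 0" "e / 2 / 2 > 0" using e by (simp_all add: ennreal_zero_less_divide)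
    obtain v where v: "v \<in> CC" "TN (u - v) < e / 2 / 2" using u[OF e2(2)] by blast
    have "((\<lambda>r. CN (v r - v t)) \<longlongrightarrow> 0) (at t within {0..T})" using v(1) t by (simp add: CT_def)
    from order_tendstoD(2)[OF this e2(1)]
    have "eventually (\<lambda>r. CN (v r - v t) < e / 2) (at t within {0..T})" .
    moreover have "eventually (\<lambda>r. r \<in> {0..T}) (at t within {0..T})" by (auto simp: eventually_at_filter)
    ultimately show "eventually (\<lambda>r. CN (u r - u t) < e) (at t within {0..T})"
    proof eventually_elim
      fix r assume r: "CN (v r - v t) < e / 2" "r \<in> {0..T}"
      have a: "CN (u r - v r) < e / 2 / 2" using CN_le_TN[OF r(2), of "u - v"] v(2) by simp
      have b: "CN (v t - u t) < e / 2 / 2" using CN_le_TN[OF t, of "u - v"] v(2) CN_commute[of "u t" "v t"] by simp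
      have "CN (u r - u t) \<le> CN (u r - v r) + CN (v r - u t)" by (rule CN_triangle)
      also have "\<dots> \<le> CN (u r - v r) + (CN (v r - v t) + CN (v t - u t))" by (intro add_left_mono CN_triangle)
      also have "\<dots> = CN (v r - v t) + (CN (u r - v r) + CN (v t - u t))" by (simp add: add_ac)
      also have "\<dots> < e / 2 + (e / 2 / 2 + e / 2 / 2)" using r a b by (intro add_strict_mono) auto
      also have "\<dots> = e" by (simp add: ennreal_halves)
      finally show "CN (u r - u t) < e" .
    qed
  qed simp
qed

text \<open>If all the functions \<open>\<phi>\<^sub>j\<close> vanished at \<open>\<xi>\<close>, then by telescoping \<open>\<phi>\<^sub>0 (\<xi> / 2\<^sup>j)\<close> would vanish for all \<open>j\<close>, but
  it is 1 for large \<open>j\<close>.\<close>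

lemma LP_partition: "\<exists>j. LP_phi \<phi>\<^sub>0 j \<xi> \<noteq> 0"
proof (rule ccontr)
  assume "\<not> ?thesis"
  then have z: "LP_phi \<phi>\<^sub>0 j \<xi> = 0" for j by blast
  have "\<phi>\<^sub>0 (\<xi> /\<^sub>R 2 ^ j) = 0" for j
  proof (induction j)
    case 0
    then show ?case using z[of 0] by (simp add: LP_phi_def)
  next
    case (Suc j)
    then show ?case using z[of "Suc j"] by (simp add: LP_phi_def)
  qed
  moreover obtain j where "norm \<xi> / (5/8) \<le> 2 ^ j"
    using real_arch_pow[of 2 "norm \<xi> / (5/8)"] less_imp_le by auto
  then have "norm (\<xi> /\<^sub>R 2 ^ j) \<le> 5/8" by (simp add: divide_simps mult.commute)
  ultimately show False using one[of "\<xi> /\<^sub>R 2 ^ j"] by simp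
qed

text \<open>Hence convergence in the norm implies convergence of every coefficient, which identifies limits.\<close>

lemma coeff_bound: "\<exists>c>0. \<forall>u B. (\<forall>j x. cmod (wb j u x) \<le> B) \<longrightarrow> cmod (u n) \<le> c * B"
proof -
  obtain j where j: "LP_phi \<phi>\<^sub>0 j (freq n) \<noteq> 0" using LP_partition by blast
  let ?S = "{n. LP_phi \<phi>\<^sub>0 j (freq n) \<noteq> 0}" and ?p = "\<bar>LP_phi \<phi>\<^sub>0 j (freq n)\<bar>"
  let ?w = "2 powr (real j * - \<epsilon>)"
  have "cmod (u n) \<le> 1 / (?w * ?p) * B" if B: "\<forall>j x. cmod (wb j u x) \<le> B" for u B
  proof -
    have eq: "trig_poly ?S (\<lambda>n. of_real (LP_phi \<phi>\<^sub>0 j (freq n)) * u n) (\<lambda>n. n) = LP_block \<phi>\<^sub>0 j u"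
      by (rule ext) (simp add: LP_block_def trig_poly_def)
    have "?w * cmod (LP_block \<phi>\<^sub>0 j u x) \<le> B" for x using B[THEN spec, THEN spec, of j x] unfolding norm_wb .
    then have "cmod (LP_block \<phi>\<^sub>0 j u x) \<le> B / ?w" for x by (simp add: field_simps)
    then have "cmod (of_real (LP_phi \<phi>\<^sub>0 j (freq n)) * u n) \<le> B / ?w"
      using finite_LP j by (intro coeff_le_sup[of ?S "\<lambda>n. of_real (LP_phi \<phi>\<^sub>0 j (freq n)) * u n" "B / ?w" n]) (auto simp: eq)
    then have "?p * cmod (u n) \<le> B / ?w" by (simp add: norm_mult)
    moreover have "p > 0 \<Longrightarrow> w > 0 \<Longrightarrow> p * y \<le> B / w \<Longrightarrow> y \<le> 1 / (w * p) * B" for p w y :: real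
      by (simp add: field_simps)
    ultimately show ?thesis using j by simp
  qed
  moreover have "1 / (?w * ?p) > 0" using j by simp
  ultimately show ?thesis by blast
qed

lemma wb_tendsto:
  assumes "\<And>n. (\<lambda>i. u i n) \<longlonglongrightarrow> v n"
  shows "(\<lambda>i. wb j (u i) x) \<longlonglongrightarrow> wb j v x"
  unfolding wb_def LP_block_def by (intro tendsto_intros assms)

text \<open>The supremum over times, blocks and points need not be measurable. All moment estimates are therefore
  stated for some measurable majorant of it.\<close>

definition maj :: "nat \<Rightarrow> (real \<Rightarrow> int \<times> int \<Rightarrow> complex) \<Rightarrow> ennreal \<Rightarrow> bool" where
  "maj n u w \<longleftrightarrow> (\<forall>t\<in>{0..T}. \<forall>j x. ennreal (cmod (wb j (u t) x) ^ n) \<le> w)"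

lemma maj_TN:
  assumes "maj n u (ennreal w)" "n > 0" "w \<ge> 0"
  shows "TN u \<le> ennreal (root n w)"
  unfolding TN_le_iff CN_le_iff using assms
  by (auto simp: maj_def intro!: ennreal_leI power_le_imp_le_root)

lemma maj_powr:
  assumes m: "maj n u w" and n: "n > 0"
  shows "ennreal_powr (TN u) (real n) \<le> w"
proof (cases "w = \<top>")
  case False
  then obtain r where r: "w = ennreal r" "r \<ge> 0" by (cases w) auto
  have le: "TN u \<le> ennreal (root n r)" using m n r by (intro maj_TN) auto
  then have nt: "TN u \<noteq> \<top>" by (metis ennreal_neq_top neq_top_trans)
  have "enn2real (TN u) \<le> root n r" using le r n by (intro enn2real_leI) auto
  then have "enn2real (TN u) powr real n \<le> root n r powr real n"
    by (intro powr_mono2) auto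
  also have "\<dots> = r"
    using n r by (cases "r = 0") (auto simp: powr_realpow)
  finally show ?thesis using nt r by (simp add: ennreal_powr_def ennreal_leI)
qed simp

end

text \<open>Below \<open>\<delta>\<close> the first term dominates, above it the second one. This replaces Jensen's inequality, which
  would need measurability of the norm.\<close>

lemma ennreal_powr_interpolate:
  assumes "1 \<le> p" "p \<le> n" "\<delta> > 0"
  shows "ennreal_powr y p \<le> ennreal (\<delta> powr p) + ennreal (\<delta> powr (p - n)) * ennreal_powr y n"
proof (cases "y = \<top>")
  case True
  then show ?thesis using assms by (simp add: ennreal_powr_def ennreal_mult_top)
next
  case False
  let ?r = "enn2real y"
  have "?r powr p \<le> \<delta> powr p + \<delta> powr (p - n) * ?r powr n"
  proof (cases "?r \<le> \<delta>")
    case True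
    then have "?r powr p \<le> \<delta> powr p" using assms by (intro powr_mono2) auto
    then show ?thesis by (smt (verit) mult_nonneg_nonneg powr_ge_zero)
  next
    case False
    then have r: "?r > \<delta>" "?r > 0" using assms by auto
    have "?r powr p = ?r powr (p - n) * ?r powr n" by (simp add: powr_add[symmetric])
    also have "\<dots> \<le> \<delta> powr (p - n) * ?r powr n"
      using r assms by (intro mult_right_mono powr_mono2') auto
    finally show ?thesis by (smt (verit) powr_ge_zero)
  qed
  then have "ennreal (?r powr p) \<le> ennreal (\<delta> powr p + \<delta> powr (p - n) * ?r powr n)" by (rule ennreal_leI)
  then show ?thesis using False by (simp add: ennreal_powr_def ennreal_mult)
qed

context CT_space
begin

text \<open>The choice \<open>\<delta> = B powr (1 / n)\<close> balances the two terms of the interpolation.\<close>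

lemma Lp_norm_bound:
  assumes M: "prob_space M" and p: "1 \<le> p" "p \<le> real n"
    and W: "W \<in> borel_measurable M" "AE \<omega> in M. maj n (X \<omega>) (W \<omega>)" "(\<integral>\<^sup>+\<omega>. W \<omega> \<partial>M) \<le> ennreal B" and B: "B > 0"
  shows "Lp_norm M TN p X \<le> ennreal (2 * B powr (1 / n))"
proof -
  interpret prob_space M by fact
  have n: "n > 0" using p by (cases n) auto
  define \<delta> where "\<delta> = B powr (1 / n)"
  have \<delta>: "\<delta> > 0" using B by (simp add: \<delta>_def)
  have "\<delta> powr n = B" using B n by (simp add: \<delta>_def powr_powr)
  then have \<delta>B: "\<delta> powr (p - n) * B = \<delta> powr p" by (simp add: powr_add[symmetric] flip: \<open>\<delta> powr n = B\<close>)
  have "(\<integral>\<^sup>+\<omega>. ennreal_powr (TN (X \<omega>)) p \<partial>M) \<le> (\<integral>\<^sup>+\<omega>. ennreal (\<delta> powr p) + ennreal (\<delta> powr (p - n)) * W \<omega> \<partial>M)"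
  proof (rule nn_integral_mono_AE)
    show "AE \<omega> in M. ennreal_powr (TN (X \<omega>)) p \<le> ennreal (\<delta> powr p) + ennreal (\<delta> powr (p - n)) * W \<omega>"
      using W(2)
    proof eventually_elim
      fix \<omega> assume m: "maj n (X \<omega>) (W \<omega>)"
      have "ennreal_powr (TN (X \<omega>)) p \<le> ennreal (\<delta> powr p) + ennreal (\<delta> powr (p - n)) * ennreal_powr (TN (X \<omega>)) n"
        using p \<delta> by (intro ennreal_powr_interpolate) auto
      also have "\<dots> \<le> ennreal (\<delta> powr p) + ennreal (\<delta> powr (p - n)) * W \<omega>"
        by (intro add_left_mono mult_left_mono maj_powr[OF m n]) auto
      finally show "ennreal_powr (TN (X \<omega>)) p \<le> ennreal (\<delta> powr p) + ennreal (\<delta> powr (p - n)) * W \<omega>" .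
    qed
  qed
  also have "\<dots> = ennreal (\<delta> powr p) + ennreal (\<delta> powr (p - n)) * (\<integral>\<^sup>+\<omega>. W \<omega> \<partial>M)"
    using W(1) by (simp add: nn_integral_add nn_integral_cmult emeasure_space_1)
  also have "\<dots> \<le> ennreal (\<delta> powr p) + ennreal (\<delta> powr (p - n)) * ennreal B"
    by (intro add_left_mono mult_left_mono W(3)) auto
  also have "\<dots> = ennreal (2 * \<delta> powr p)"
    using B by (simp add: ennreal_mult[symmetric] \<delta>B ennreal_plus[symmetric] del: ennreal_plus)
  finally have le: "(\<integral>\<^sup>+\<omega>. ennreal_powr (TN (X \<omega>)) p \<partial>M) \<le> ennreal (2 * \<delta> powr p)" (is "?I \<le> _") .
  then have nt: "?I \<noteq> \<top>" by (metis ennreal_neq_top neq_top_trans)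
  have "enn2real ?I \<le> 2 * \<delta> powr p" using le by (intro enn2real_leI) auto
  then have "enn2real ?I powr (1 / p) \<le> (2 * \<delta> powr p) powr (1 / p)" using p by (intro powr_mono2) auto
  also have "\<dots> = 2 powr (1 / p) * \<delta>" using p \<delta> by (simp add: powr_mult powr_powr)
  also have "\<dots> \<le> 2 powr 1 * \<delta>" using p \<delta> by (intro mult_right_mono powr_mono) auto
  finally show ?thesis using nt unfolding Lp_norm_def ennreal_powr_def[of ?I] by (simp add: ennreal_leI \<delta>_def)
qed

end

text \<open>The approximating simple function picks, at each path, the best among the first candidates from a
  countable family. The measurable bounds \<open>G\<close> select it, since the distances need not be measurable.\<close>

lemma strongly_measurableI:
  fixes G :: "nat \<Rightarrow> 'w \<Rightarrow> ennreal" and D :: "nat \<Rightarrow> 'b::minus"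
  assumes D: "\<And>i. D i \<in> B" and G[measurable]: "\<And>i. G i \<in> borel_measurable M"
    and le: "AE \<omega> in M. \<forall>i. \<nu> (D i - X \<omega>) \<le> G i \<omega>" and inf: "AE \<omega> in M. \<forall>e>0. \<exists>i. G i \<omega> < e"
  shows "strongly_measurable M B \<nu> X"
proof -
  define best where "best m \<omega> = (LEAST i. i \<le> m \<and> (\<forall>i'\<le>m. G i \<omega> \<le> G i' \<omega>))" for m :: nat and \<omega>
  have ex: "\<exists>i. i \<le> m \<and> (\<forall>i'\<le>m. G i \<omega> \<le> G i' \<omega>)" for m \<omega>
  proof -
    have "Min ((\<lambda>i. G i \<omega>) ` {..m}) \<in> (\<lambda>i. G i \<omega>) ` {..m}" by (intro Min_in) auto
    then obtain i where i: "Min ((\<lambda>i. G i \<omega>) ` {..m}) = G i \<omega>" "i \<in> {..m}" by (rule imageE)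
    have "G i \<omega> \<le> G i' \<omega>" if "i' \<le> m" for i' unfolding i(1)[symmetric] using that by (intro Min_le) auto
    then show ?thesis using i(2) by blast
  qed
  have "best m \<omega> \<le> m \<and> (\<forall>i'\<le>m. G (best m \<omega>) \<omega> \<le> G i' \<omega>)" for m \<omega>
    unfolding best_def by (rule LeastI_ex[OF ex])
  then have best: "best m \<omega> \<le> m" "i' \<le> m \<Longrightarrow> G (best m \<omega>) \<omega> \<le> G i' \<omega>" for m \<omega> i'
    by blast+
  have bm: "best m \<in> measurable M (count_space UNIV)" for m
    unfolding best_def by measurable
  have sf: "simple_function M (best m)" for m
    unfolding simple_function_def
  proof (intro conjI ballI)
    have "best m ` space M \<subseteq> {..m}" unfolding image_subset_iff atMost_iff using best(1) by blast
    then show "finite (best m ` space M)" by (rule finite_subset) (rule finite_atMost)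
    show "best m -` {i} \<inter> space M \<in> sets M" for i by (rule measurable_sets[OF bm]) simp
  qed
  show ?thesis
    unfolding strongly_measurable_def
  proof (intro exI[of _ "\<lambda>m \<omega>. D (best m \<omega>)"] conjI allI)
    show "simple_function M (\<lambda>\<omega>. D (best m \<omega>))" for m
      by (rule simple_function_compose1[OF sf])
    show "(\<lambda>\<omega>. D (best m \<omega>)) ` space M \<subseteq> B" for m using D by auto
    show "AE \<omega> in M. (\<lambda>m. \<nu> (D (best m \<omega>) - X \<omega>)) \<longlonglongrightarrow> 0"
      using le inf
    proof eventually_elim
      fix \<omega> assume le: "\<forall>i. \<nu> (D i - X \<omega>) \<le> G i \<omega>" and inf: "\<forall>e>0. \<exists>i. G i \<omega> < e"
      show "(\<lambda>m. \<nu> (D (best m \<omega>) - X \<omega>)) \<longlonglongrightarrow> 0"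
      proof (rule order_tendstoI)
        fix e :: ennreal assume "0 < e"
        then obtain i where i: "G i \<omega> < e" using inf by blast
        show "eventually (\<lambda>m. \<nu> (D (best m \<omega>) - X \<omega>) < e) sequentially"
          using eventually_ge_at_top[of i]
        proof eventually_elim
          fix m assume "i \<le> m"
          then have "G (best m \<omega>) \<omega> \<le> G i \<omega>" by (rule best(2))
          from le_less_trans[OF order_trans[OF le[THEN spec] this] i]
          show "\<nu> (D (best m \<omega>) - X \<omega>) < e" .
        qed
      qed simp
    qed
  qed
qed

section \<open>Limits of random paths\<close>


context CT_space
begin

lemma majD: "maj n u w \<Longrightarrow> t \<in> {0..T} \<Longrightarrow> ennreal (cmod (wb j (u t) x) ^ n) \<le> w"
  unfolding maj_def by blast

lemma power_add_le: "0 \<le> a \<Longrightarrow> 0 \<le> b \<Longrightarrow> (a + b) ^ n \<le> 2 ^ n * (a ^ n + b ^ n)" for a b :: real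
proof -
  assume ab: "0 \<le> a" "0 \<le> b"
  have "(a + b) ^ n \<le> (2 * max a b) ^ n" using ab by (intro power_mono) auto
  also have "\<dots> = 2 ^ n * max a b ^ n" by (simp add: power_mult_distrib)
  also have "max a b ^ n \<le> a ^ n + b ^ n" using ab by (auto simp: max_def)
  finally show ?thesis by simp
qed

lemma maj_diff:
  assumes "maj n u w" "maj n (u - v) w'"
  shows "maj n v (ennreal (2 ^ n) * (w + w'))"
  unfolding maj_def
proof (intro ballI allI)
  fix t j x assume t: "t \<in> {0..T}"
  have "wb j (v t) x = wb j (u t) x - wb j ((u - v) t) x" by (simp add: wb_diff)
  then have "cmod (wb j (v t) x) \<le> cmod (wb j (u t) x) + cmod (wb j ((u - v) t) x)" by (metis norm_triangle_ineq4)
  then have "cmod (wb j (v t) x) ^ n \<le> (cmod (wb j (u t) x) + cmod (wb j ((u - v) t) x)) ^ n" by (intro power_mono) auto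
  also have "\<dots> \<le> 2 ^ n * (cmod (wb j (u t) x) ^ n + cmod (wb j ((u - v) t) x) ^ n)" by (intro power_add_le) auto
  finally have "ennreal (cmod (wb j (v t) x) ^ n) \<le> ennreal (2 ^ n * (cmod (wb j (u t) x) ^ n + cmod (wb j ((u - v) t) x) ^ n))" by (rule ennreal_leI)
  also have "\<dots> = ennreal (2 ^ n) * (ennreal (cmod (wb j (u t) x) ^ n) + ennreal (cmod (wb j ((u - v) t) x) ^ n))"
    by (subst ennreal_mult) (auto simp: ennreal_plus)
  also have "\<dots> \<le> ennreal (2 ^ n) * (w + w')"
    by (intro mult_left_mono add_mono majD[OF assms(1) t] majD[OF assms(2) t]) simp
  finally show "ennreal (cmod (wb j (v t) x) ^ n) \<le> ennreal (2 ^ n) * (w + w')" .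
qed

end

text \<open>Random paths \<open>X N\<close> with majorants \<open>W\<close> of their mutual distances whose expectations tend to 0, and
  a countable family \<open>D\<close> of deterministic paths that approximates every \<open>X N \<omega>\<close>, with measurable bounds \<open>G\<close> of
  the distances.\<close>

locale Lp_cauchy_data = CT_space \<phi>\<^sub>0 \<epsilon> T + prob_space M
  for \<phi>\<^sub>0 \<epsilon> T and M :: "'w measure" +
  fixes X :: "nat \<Rightarrow> 'w \<Rightarrow> real \<Rightarrow> int \<times> int \<Rightarrow> complex" and n :: nat and p :: real
    and W :: "nat \<Rightarrow> nat \<Rightarrow> 'w \<Rightarrow> ennreal" and W0 :: "nat \<Rightarrow> 'w \<Rightarrow> ennreal" and e B0 :: "nat \<Rightarrow> real"
    and D :: "nat \<Rightarrow> real \<Rightarrow> int \<times> int \<Rightarrow> complex" and G :: "nat \<Rightarrow> nat \<Rightarrow> 'w \<Rightarrow> ennreal"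
  assumes p: "1 \<le> p" "p \<le> real n"
    and X: "\<And>N. AE \<omega> in M. X N \<omega> \<in> CC"
    and W_meas[measurable]: "\<And>N K. W N K \<in> borel_measurable M" and W0_meas[measurable]: "\<And>N. W0 N \<in> borel_measurable M"
    and W: "\<And>N K. AE \<omega> in M. maj n (X N \<omega> - X K \<omega>) (W N K \<omega>)"
    and EW: "\<And>N K. (\<integral>\<^sup>+\<omega>. W N K \<omega> \<partial>M) \<le> ennreal (e (min N K))"
    and e: "e \<longlonglongrightarrow> 0" and e_pos: "\<And>N. e N > 0"
    and W0: "\<And>N. AE \<omega> in M. maj n (X N \<omega>) (W0 N \<omega>)" and EW0: "\<And>N. (\<integral>\<^sup>+\<omega>. W0 N \<omega> \<partial>M) \<le> ennreal (B0 N)"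
    and D: "\<And>i. D i \<in> CC" and G_meas[measurable]: "\<And>N i. G N i \<in> borel_measurable M"
    and G: "\<And>N. AE \<omega> in M. \<forall>i. TN (D i - X N \<omega>) \<le> G N i \<omega>"
    and G_inf: "\<And>N. AE \<omega> in M. \<forall>e>0. \<exists>i. G N i \<omega> < e"
begin

lemma n: "n > 0"
  using p by (cases n) auto

lemma X_Lp: "X N \<in> Lp M CC TN p"
proof -
  have "strongly_measurable M CC TN (X N)"
    by (rule strongly_measurableI[where D = D and G = "G N"]) (fact D G_meas G G_inf)+
  moreover have "Lp_norm M TN p (X N) \<le> ennreal (2 * max 1 (B0 N) powr (1 / n))"
    using EW0[of N] by (intro Lp_norm_bound[OF _ p W0_meas W0]) (auto simp: prob_space_axioms intro: order_trans ennreal_leI)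
  then have "Lp_norm M TN p (X N) < \<top>" by (rule le_less_trans) simp
  ultimately show ?thesis using X unfolding Lp_def by blast
qed

lemma root_tendsto: "(\<lambda>N. 2 * e N powr (1 / n)) \<longlonglongrightarrow> 0"
proof -
  have "(\<lambda>N. e N powr (1 / n)) \<longlonglongrightarrow> 0 powr (1 / n)"
    using n e e_pos by (intro tendsto_powr' tendsto_const) (auto intro!: always_eventually less_imp_le)
  then show ?thesis using tendsto_mult_right_zero[of "\<lambda>N. e N powr (1 / n)" sequentially 2] n by simp
qed

lemma X_Cauchy: "Lp_Cauchy M CC TN p X"
  unfolding Lp_Cauchy_def
proof (intro conjI allI impI X_Lp)
  fix \<delta> :: real assume \<delta>: "\<delta> > 0"
  from order_tendstoD(2)[OF root_tendsto \<delta>] obtain N0 where N0: "\<And>N. N \<ge> N0 \<Longrightarrow> 2 * e N powr (1 / n) < \<delta>"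
    unfolding eventually_sequentially by blast
  show "\<exists>N0. \<forall>m\<ge>N0. \<forall>k\<ge>N0. Lp_norm M TN p (\<lambda>\<omega>. X m \<omega> - X k \<omega>) < ennreal \<delta>"
  proof (intro exI[of _ N0] allI impI)
    fix m k assume mk: "N0 \<le> m" "N0 \<le> k"
    have "Lp_norm M TN p (\<lambda>\<omega>. X m \<omega> - X k \<omega>) \<le> ennreal (2 * e (min m k) powr (1 / n))"
      by (rule Lp_norm_bound[OF prob_space_axioms p W_meas W EW e_pos])
    also have "\<dots> < ennreal \<delta>" using N0[of "min m k"] mk \<delta> by (intro ennreal_lessI) auto
    finally show "Lp_norm M TN p (\<lambda>\<omega>. X m \<omega> - X k \<omega>) < ennreal \<delta>" .
  qed
qed

text \<open>The powers of 4 leave room for the growing weights \<open>(2\<^sup>n)\<^sup>j\<close> in the sum below.\<close>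

lemma fast_subsequence: "\<exists>g. (\<forall>j. j \<le> g j) \<and> mono g \<and> (\<forall>j m. g j \<le> m \<longrightarrow> e m \<le> (1 / 4 ^ n) ^ j)"
proof -
  have "\<exists>N0. \<forall>m\<ge>N0. e m \<le> (1 / 4 ^ n) ^ j" for j
    using order_tendstoD(2)[OF e, of "(1 / 4 ^ n) ^ j"] unfolding eventually_sequentially by (force intro: less_imp_le)
  then obtain f where f: "\<And>j m. f j \<le> m \<Longrightarrow> e m \<le> (1 / 4 ^ n) ^ j" by metis
  define g where "g j = j + (\<Sum>i\<le>j. f i)" for j
  have "f j \<le> g j" for j unfolding g_def by (simp add: member_le_sum trans_le_add2)
  moreover have "mono g" unfolding g_def by (intro monoI add_mono sum_mono2) auto
  moreover have "j \<le> g j" for j by (simp add: g_def)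
  ultimately show ?thesis using f le_trans by (intro exI[of _ g]) blast
qed

definition g where "g = (SOME g. (\<forall>j. j \<le> g j) \<and> mono g \<and> (\<forall>j m. g j \<le> m \<longrightarrow> e m \<le> (1 / 4 ^ n) ^ j))"

lemma g: "j \<le> g j" "mono g" "g j \<le> m \<Longrightarrow> e m \<le> (1 / 4 ^ n) ^ j"
  using someI_ex[OF fast_subsequence] unfolding g_def[symmetric] by blast+

text \<open>Finiteness of this sum bounds the \<open>j\<close>-th step of the subsequence by a multiple of \<open>(1/2)\<^sup>j\<close>.\<close>

definition U where "U \<omega> = (\<Sum>j. ennreal ((2 ^ n) ^ j) * W (g (Suc j)) (g j) \<omega>)"

lemma U_measurable [measurable]: "U \<in> borel_measurable M"
  unfolding U_def by measurable

lemma U_finite: "AE \<omega> in M. U \<omega> \<noteq> \<top>"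
proof -
  have "(\<integral>\<^sup>+\<omega>. U \<omega> \<partial>M) = (\<Sum>j. ennreal ((2 ^ n) ^ j) * (\<integral>\<^sup>+\<omega>. W (g (Suc j)) (g j) \<omega> \<partial>M))"
    unfolding U_def by (subst nn_integral_suminf, measurable) (simp add: nn_integral_cmult)
  also have "\<dots> \<le> (\<Sum>j. ennreal ((1 / 2) ^ j))"
  proof (intro suminf_le)
    fix j
    have "min (g (Suc j)) (g j) = g j" using monoD[OF g(2), of j "Suc j"] by simp
    then have "(\<integral>\<^sup>+\<omega>. W (g (Suc j)) (g j) \<omega> \<partial>M) \<le> ennreal (e (g j))" using EW[of "g (Suc j)" "g j"] by simp
    also have "\<dots> \<le> ennreal ((1 / 4 ^ n) ^ j)" by (intro ennreal_leI g) simp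
    finally have "ennreal ((2 ^ n) ^ j) * (\<integral>\<^sup>+\<omega>. W (g (Suc j)) (g j) \<omega> \<partial>M) \<le> ennreal ((2 ^ n) ^ j) * ennreal ((1 / 4 ^ n) ^ j)"
      by (rule mult_left_mono) simp
    also have "\<dots> = ennreal ((2 ^ n) ^ j * (1 / 4 ^ n) ^ j)" by (subst ennreal_mult) auto
    also have "(2 ^ n) ^ j * (1 / 4 ^ n) ^ j = ((2 :: real) ^ n / 4 ^ n) ^ j" by (simp add: power_divide)
    also have "\<dots> = ((1 / 2) ^ n) ^ j" by (simp flip: power_divide)
    also have "\<dots> \<le> (1 / 2) ^ j"
    proof (rule power_mono)
      show "(1 / 2 :: real) ^ n \<le> 1 / 2" using power_decreasing[of 1 n "1 / 2 :: real"] n by simp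
    qed simp
    finally show "ennreal ((2 ^ n) ^ j) * (\<integral>\<^sup>+\<omega>. W (g (Suc j)) (g j) \<omega> \<partial>M) \<le> ennreal ((1 / 2) ^ j)" by (simp add: ennreal_leI)
  qed auto
  also have "\<dots> = ennreal (1 / (1 - 1 / 2))"
    by (intro suminf_ennreal_eq geometric_sums) auto
  finally have "(\<integral>\<^sup>+\<omega>. U \<omega> \<partial>M) \<noteq> \<infinity>" by (metis ennreal_neq_top infinity_ennreal_def neq_top_trans)
  then show ?thesis using nn_integral_noteq_infinite[OF U_measurable] by simp
qed

definition V where "V \<omega> = root n (enn2real (U \<omega>))"

lemma V_measurable [measurable]: "V \<in> borel_measurable M"
proof -
  have "root n \<in> borel_measurable borel" by (intro borel_measurable_continuous_onI continuous_intros)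
  then show ?thesis unfolding V_def by measurable
qed

text \<open>The limit is taken coefficient by coefficient; where it does not exist the value is irrelevant.\<close>

definition Y where "Y \<omega> t k = lim (\<lambda>j. X (g j) \<omega> t k)"

definition good where "good \<omega> \<longleftrightarrow> U \<omega> \<noteq> \<top> \<and> (\<forall>j. maj n (X (g (Suc j)) \<omega> - X (g j) \<omega>) (W (g (Suc j)) (g j) \<omega>))"

lemma good: "AE \<omega> in M. good \<omega>"
  using U_finite W unfolding good_def by (simp add: AE_all_countable)

lemma V_nonneg: "V \<omega> \<ge> 0"
  unfolding V_def by (simp add: real_root_ge_zero)

lemma good_step:
  assumes "good \<omega>" "t \<in> {0..T}"
  shows "cmod (wb i (X (g (Suc j)) \<omega> t) x - wb i (X (g j) \<omega> t) x) \<le> (1 / 2) ^ j * V \<omega>"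
proof -
  let ?c = "cmod (wb i (X (g (Suc j)) \<omega> t) x - wb i (X (g j) \<omega> t) x)"
  have U: "U \<omega> = ennreal (enn2real (U \<omega>))" using assms by (simp add: good_def less_top)
  have "ennreal (?c ^ n) \<le> W (g (Suc j)) (g j) \<omega>"
  proof -
    have "maj n (X (g (Suc j)) \<omega> - X (g j) \<omega>) (W (g (Suc j)) (g j) \<omega>)" using assms(1) unfolding good_def by blast
    from majD[OF this assms(2)] show ?thesis unfolding path_diff wb_diff .
  qed
  then have "ennreal ((2 ^ n) ^ j) * ennreal (?c ^ n) \<le> ennreal ((2 ^ n) ^ j) * W (g (Suc j)) (g j) \<omega>" by (rule mult_left_mono) simp
  also have "\<dots> \<le> U \<omega>"
    unfolding U_def using sum_le_suminf[OF summableI, of "{j}" "\<lambda>j. ennreal ((2 ^ n) ^ j) * W (g (Suc j)) (g j) \<omega>"] by simp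
  finally have "ennreal ((2 ^ j * ?c) ^ n) \<le> ennreal (enn2real (U \<omega>))"
    using U by (simp add: ennreal_mult[symmetric] power_mult_distrib power_mult[symmetric] mult.commute)
  then have "2 ^ j * ?c \<le> V \<omega>" unfolding V_def using n by (intro power_le_imp_le_root) auto
  then show ?thesis by (simp add: power_divide field_simps)
qed

lemma good_tail:
  assumes "good \<omega>" "t \<in> {0..T}" "j \<le> j'"
  shows "cmod (wb i (X (g j') \<omega> t) x - wb i (X (g j) \<omega> t) x) \<le> 2 * (1 / 2) ^ j * V \<omega>"
proof -
  have "cmod (wb i (X (g j') \<omega> t) x - wb i (X (g j) \<omega> t) x) \<le> (2 * (1 / 2) ^ j - 2 * (1 / 2) ^ j') * V \<omega>"
    using assms(3)
  proof (induction j' rule: dec_induct)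
    case (step m)
    have "cmod (wb i (X (g (Suc m)) \<omega> t) x - wb i (X (g j) \<omega> t) x)
       \<le> cmod (wb i (X (g (Suc m)) \<omega> t) x - wb i (X (g m) \<omega> t) x) + cmod (wb i (X (g m) \<omega> t) x - wb i (X (g j) \<omega> t) x)"
      using norm_triangle_ineq[of "wb i (X (g (Suc m)) \<omega> t) x - wb i (X (g m) \<omega> t) x" "wb i (X (g m) \<omega> t) x - wb i (X (g j) \<omega> t) x"] by simp
    also have "\<dots> \<le> (1 / 2) ^ m * V \<omega> + (2 * (1 / 2) ^ j - 2 * (1 / 2) ^ m) * V \<omega>"
      by (intro add_mono good_step[OF assms(1,2)] step.IH)
    finally show ?case by (simp add: algebra_simps)
  qed simp
  also have "\<dots> \<le> 2 * (1 / 2) ^ j * V \<omega>" using V_nonneg by (intro mult_right_mono) auto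
  finally show ?thesis .
qed

lemma good_converges:
  assumes \<omega>: "good \<omega>" and t: "t \<in> {0..T}"
  shows "(\<lambda>j. X (g j) \<omega> t k) \<longlonglongrightarrow> Y \<omega> t k"
proof -
  obtain c where c: "c > 0" "\<And>u B. \<forall>j x. cmod (wb j u x) \<le> B \<Longrightarrow> cmod (u k) \<le> c * B"
    using coeff_bound[of k] by blast
  have le: "cmod (X (g j') \<omega> t k - X (g j) \<omega> t k) \<le> c * (2 * (1 / 2) ^ j * V \<omega>)" if "j \<le> j'" for j j'
    using c(2)[of "X (g j') \<omega> t - X (g j) \<omega> t"] good_tail[OF \<omega> t that] by (simp add: wb_diff)
  have "Cauchy (\<lambda>j. X (g j) \<omega> t k)"
  proof (rule metric_CauchyI)
    fix \<delta> :: real assume \<delta>: "\<delta> > 0"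
    have "(\<lambda>j. c * (2 * (1 / 2) ^ j * V \<omega>)) \<longlonglongrightarrow> c * (2 * 0 * V \<omega>)"
      by (intro tendsto_intros LIMSEQ_power_zero) auto
    from order_tendstoD(2)[OF this, of "\<delta> / 2"] \<delta> obtain j0 where j0: "c * (2 * (1 / 2) ^ j0 * V \<omega>) < \<delta> / 2"
      unfolding eventually_sequentially by auto
    show "\<exists>M. \<forall>m\<ge>M. \<forall>n\<ge>M. dist (X (g m) \<omega> t k) (X (g n) \<omega> t k) < \<delta>"
    proof (intro exI[of _ j0] allI impI)
      fix m m' assume "j0 \<le> m" "j0 \<le> m'"
      then have "cmod (X (g m) \<omega> t k - X (g j0) \<omega> t k) < \<delta> / 2" "cmod (X (g m') \<omega> t k - X (g j0) \<omega> t k) < \<delta> / 2"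
        using le[of j0] j0 by (meson le_less_trans)+
      then show "dist (X (g m) \<omega> t k) (X (g m') \<omega> t k) < \<delta>"
        using dist_triangle2[of "X (g m) \<omega> t k" "X (g m') \<omega> t k" "X (g j0) \<omega> t k"] by (simp add: dist_norm)
    qed
  qed
  then show ?thesis unfolding Y_def by (simp add: Cauchy_convergent_iff convergent_LIMSEQ_iff)
qed

lemma good_TN:
  assumes \<omega>: "good \<omega>"
  shows "TN (X (g j) \<omega> - Y \<omega>) \<le> ennreal (2 * (1 / 2) ^ j * V \<omega>)"
  unfolding TN_le_iff CN_le_iff
proof (intro ballI allI ennreal_leI)
  fix t i x assume t: "t \<in> {0..T}"
  have "(\<lambda>j'. wb i (X (g j') \<omega> t) x - wb i (X (g j) \<omega> t) x) \<longlonglongrightarrow> wb i (Y \<omega> t) x - wb i (X (g j) \<omega> t) x"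
    by (intro tendsto_intros wb_tendsto good_converges[OF \<omega> t])
  then have "(\<lambda>j'. cmod (wb i (X (g j') \<omega> t) x - wb i (X (g j) \<omega> t) x)) \<longlonglongrightarrow> cmod (wb i (Y \<omega> t) x - wb i (X (g j) \<omega> t) x)"
    by (rule tendsto_norm)
  then have "cmod (wb i (Y \<omega> t) x - wb i (X (g j) \<omega> t) x) \<le> 2 * (1 / 2) ^ j * V \<omega>"
    by (rule LIMSEQ_le_const2) (auto intro!: exI[of _ j] good_tail[OF \<omega> t])
  then show "cmod (wb i ((X (g j) \<omega> - Y \<omega>) t) x) \<le> 2 * (1 / 2) ^ j * V \<omega>"
    by (simp add: wb_diff norm_minus_commute)
qed

lemma tail_tendsto: "(\<lambda>j. ennreal (2 * (1 / 2) ^ j * V \<omega>)) \<longlonglongrightarrow> 0"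
proof -
  have "(\<lambda>j. ennreal (2 * (1 / 2) ^ j * V \<omega>)) \<longlonglongrightarrow> ennreal (2 * 0 * V \<omega>)"
    by (intro tendsto_ennrealI tendsto_intros LIMSEQ_power_zero) auto
  then show ?thesis by simp
qed

text \<open>Along the subsequence the convergence holds in the norm, and the space of paths is closed.\<close>

lemma Y_CT: "AE \<omega> in M. Y \<omega> \<in> CC"
proof -
  have "AE \<omega> in M. \<forall>N. X N \<omega> \<in> CC" using X by (simp add: AE_all_countable)
  with good show ?thesis
  proof eventually_elim
    fix \<omega> assume \<omega>: "good \<omega>" and X: "\<forall>N. X N \<omega> \<in> CC"
    show "Y \<omega> \<in> CC"
    proof (rule CT_closed)
      fix \<delta> :: ennreal assume "\<delta> > 0"
      from order_tendstoD(2)[OF tail_tendsto this] obtain j where "ennreal (2 * (1 / 2) ^ j * V \<omega>) < \<delta>"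
        unfolding eventually_sequentially by blast
      then have "TN (Y \<omega> - X (g j) \<omega>) < \<delta>" unfolding TN_commute[of "Y \<omega>"] by (rule le_less_trans[OF good_TN[OF \<omega>]])
      then show "\<exists>v\<in>CC. TN (Y \<omega> - v) < \<delta>" using X by blast
    qed
  qed
qed

text \<open>Approximate \<open>Y\<close> by a late member of the subsequence, and that one by the countable family.\<close>

lemma Y_strongly_measurable: "strongly_measurable M CC TN Y"
proof (rule strongly_measurableI[where D = "\<lambda>m. D (fst (prod_decode m))"
    and G = "\<lambda>m \<omega>. G (g (snd (prod_decode m))) (fst (prod_decode m)) \<omega> + ennreal (2 * (1 / 2) ^ snd (prod_decode m) * V \<omega>)"])
  have G': "AE \<omega> in M. \<forall>N i. TN (D i - X N \<omega>) \<le> G N i \<omega>" using G[unfolded AE_all_countable] unfolding AE_all_countable by blast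
  have G_inf': "AE \<omega> in M. \<forall>N. \<forall>e>0. \<exists>i. G N i \<omega> < e" using G_inf unfolding AE_all_countable by blast
  show "AE \<omega> in M. \<forall>m. TN (D (fst (prod_decode m)) - Y \<omega>) \<le> G (g (snd (prod_decode m))) (fst (prod_decode m)) \<omega> + ennreal (2 * (1 / 2) ^ snd (prod_decode m) * V \<omega>)"
    using G' good
  proof eventually_elim
    fix \<omega> assume G: "\<forall>N i. TN (D i - X N \<omega>) \<le> G N i \<omega>" and \<omega>: "good \<omega>"
    show "\<forall>m. TN (D (fst (prod_decode m)) - Y \<omega>) \<le> G (g (snd (prod_decode m))) (fst (prod_decode m)) \<omega> + ennreal (2 * (1 / 2) ^ snd (prod_decode m) * V \<omega>)"
    proof
      fix m
      let ?j = "snd (prod_decode m)" and ?i = "fst (prod_decode m)"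
      have "TN (D ?i - Y \<omega>) \<le> TN (D ?i - X (g ?j) \<omega>) + TN (X (g ?j) \<omega> - Y \<omega>)" by (rule TN_triangle)
      also have "\<dots> \<le> G (g ?j) ?i \<omega> + ennreal (2 * (1 / 2) ^ ?j * V \<omega>)"
        by (intro add_mono good_TN[OF \<omega>] G[THEN spec, THEN spec])
      finally show "TN (D ?i - Y \<omega>) \<le> G (g ?j) ?i \<omega> + ennreal (2 * (1 / 2) ^ ?j * V \<omega>)" .
    qed
  qed
  show "AE \<omega> in M. \<forall>e>0. \<exists>m. G (g (snd (prod_decode m))) (fst (prod_decode m)) \<omega> + ennreal (2 * (1 / 2) ^ snd (prod_decode m) * V \<omega>) < e"
    using G_inf'
  proof eventually_elim
    fix \<omega> assume Gi: "\<forall>N. \<forall>e>0. \<exists>i. G N i \<omega> < e"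
    show "\<forall>e>0. \<exists>m. G (g (snd (prod_decode m))) (fst (prod_decode m)) \<omega> + ennreal (2 * (1 / 2) ^ snd (prod_decode m) * V \<omega>) < e"
    proof (intro allI impI)
      fix \<delta> :: ennreal assume "\<delta> > 0"
      then have d2: "\<delta> / 2 > 0" by (simp add: ennreal_zero_less_divide)
      from order_tendstoD(2)[OF tail_tendsto d2] obtain j where j: "ennreal (2 * (1 / 2) ^ j * V \<omega>) < \<delta> / 2"
        unfolding eventually_sequentially by blast
      obtain i where i: "G (g j) i \<omega> < \<delta> / 2" using Gi d2 by blast
      have "G (g j) i \<omega> + ennreal (2 * (1 / 2) ^ j * V \<omega>) < \<delta> / 2 + \<delta> / 2" using i j by (intro add_strict_mono)
      also have "\<dots> = \<delta>" by (rule ennreal_halves)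
      finally show "\<exists>m. G (g (snd (prod_decode m))) (fst (prod_decode m)) \<omega> + ennreal (2 * (1 / 2) ^ snd (prod_decode m) * V \<omega>) < \<delta>"
        by (intro exI[of _ "prod_encode (i, j)"]) simp
    qed
  qed
  show "D (fst (prod_decode m)) \<in> CC" for m by (rule D)
  show "(\<lambda>\<omega>. G (g (snd (prod_decode m))) (fst (prod_decode m)) \<omega> + ennreal (2 * (1 / 2) ^ snd (prod_decode m) * V \<omega>)) \<in> borel_measurable M" for m
    by measurable
qed

definition WY where "WY N \<omega> = liminf (\<lambda>i. W N (g i) \<omega>)"

lemma WY_measurable [measurable]: "WY N \<in> borel_measurable M"
  unfolding WY_def by measurable

text \<open>Majorants pass to the limit because every single block converges.\<close>

lemma WY_maj: "AE \<omega> in M. maj n (X N \<omega> - Y \<omega>) (WY N \<omega>)"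
proof -
  have "AE \<omega> in M. \<forall>i. maj n (X N \<omega> - X (g i) \<omega>) (W N (g i) \<omega>)" using W by (simp add: AE_all_countable)
  with good show ?thesis
  proof eventually_elim
    fix \<omega> assume \<omega>: "good \<omega>" and m: "\<forall>i. maj n (X N \<omega> - X (g i) \<omega>) (W N (g i) \<omega>)"
    show "maj n (X N \<omega> - Y \<omega>) (WY N \<omega>)"
      unfolding maj_def
    proof (intro ballI allI)
      fix t i x assume t: "t \<in> {0..T}"
      have "(\<lambda>j. ennreal (cmod (wb i (X N \<omega> t) x - wb i (X (g j) \<omega> t) x) ^ n)) \<longlonglongrightarrow> ennreal (cmod (wb i (X N \<omega> t) x - wb i (Y \<omega> t) x) ^ n)"
        by (intro tendsto_ennrealI tendsto_intros wb_tendsto good_converges[OF \<omega> t])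
      then have "ennreal (cmod (wb i (X N \<omega> t) x - wb i (Y \<omega> t) x) ^ n) = liminf (\<lambda>j. ennreal (cmod (wb i (X N \<omega> t) x - wb i (X (g j) \<omega> t) x) ^ n))"
        by (rule lim_imp_Liminf[OF sequentially_bot, symmetric])
      also have "\<dots> \<le> WY N \<omega>"
        unfolding WY_def
      proof (intro Liminf_mono always_eventually allI)
        fix j
        show "ennreal (cmod (wb i (X N \<omega> t) x - wb i (X (g j) \<omega> t) x) ^ n) \<le> W N (g j) \<omega>"
          using majD[OF m[THEN spec] t] unfolding path_diff wb_diff .
      qed
      finally show "ennreal (cmod (wb i ((X N \<omega> - Y \<omega>) t) x) ^ n) \<le> WY N \<omega>" unfolding path_diff wb_diff .
    qed
  qed
qed

lemma EWY: "(\<integral>\<^sup>+\<omega>. WY N \<omega> \<partial>M) \<le> ennreal (e N)"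
proof -
  have "(\<integral>\<^sup>+\<omega>. WY N \<omega> \<partial>M) \<le> liminf (\<lambda>i. \<integral>\<^sup>+\<omega>. W N (g i) \<omega> \<partial>M)"
    unfolding WY_def by (intro nn_integral_liminf) auto
  also have "\<dots> \<le> limsup (\<lambda>i. \<integral>\<^sup>+\<omega>. W N (g i) \<omega> \<partial>M)" by (rule Liminf_le_Limsup) simp
  also have "\<dots> \<le> ennreal (e N)"
  proof (rule Limsup_bounded)
    show "eventually (\<lambda>i. (\<integral>\<^sup>+\<omega>. W N (g i) \<omega> \<partial>M) \<le> ennreal (e N)) sequentially"
      using eventually_ge_at_top[of N]
    proof eventually_elim
      fix i assume "N \<le> i"
      then have "min N (g i) = N" using g(1)[of i] by simp
      then show "(\<integral>\<^sup>+\<omega>. W N (g i) \<omega> \<partial>M) \<le> ennreal (e N)" using EW[of N "g i"] by simp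
    qed
  qed
  finally show ?thesis .
qed

theorem Lp_limit_Y: "Lp_limit M CC TN p X Y"
  unfolding Lp_limit_def
proof
  have "Lp_norm M TN p Y \<le> ennreal (2 * (2 ^ n * (max 0 (B0 0) + e 0)) powr (1 / n))"
  proof (rule Lp_norm_bound[OF prob_space_axioms p, where W = "\<lambda>\<omega>. ennreal (2 ^ n) * (W0 0 \<omega> + WY 0 \<omega>)"])
    show "AE \<omega> in M. maj n (Y \<omega>) (ennreal (2 ^ n) * (W0 0 \<omega> + WY 0 \<omega>))"
      using W0[of 0] WY_maj[of 0] by eventually_elim (rule maj_diff)
    have "(\<integral>\<^sup>+\<omega>. ennreal (2 ^ n) * (W0 0 \<omega> + WY 0 \<omega>) \<partial>M) = ennreal (2 ^ n) * ((\<integral>\<^sup>+\<omega>. W0 0 \<omega> \<partial>M) + (\<integral>\<^sup>+\<omega>. WY 0 \<omega> \<partial>M))"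
      by (simp add: nn_integral_cmult nn_integral_add)
    also have "\<dots> \<le> ennreal (2 ^ n) * (ennreal (max 0 (B0 0)) + ennreal (e 0))"
      using EW0[of 0] by (intro mult_left_mono add_mono EWY) (auto intro: order_trans ennreal_leI)
    also have "\<dots> = ennreal (2 ^ n * (max 0 (B0 0) + e 0))"
      using e_pos[of 0] by (subst ennreal_plus[symmetric], simp, simp) (rule ennreal_mult[symmetric], auto)
    finally show "(\<integral>\<^sup>+\<omega>. ennreal (2 ^ n) * (W0 0 \<omega> + WY 0 \<omega>) \<partial>M) \<le> ennreal (2 ^ n * (max 0 (B0 0) + e 0))" .
    show "0 < 2 ^ n * (max 0 (B0 0) + e 0)" using e_pos[of 0] by (intro mult_pos_pos add_nonneg_pos) auto
  qed simp
  then have "Lp_norm M TN p Y < \<top>" by (rule le_less_trans) simp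
  then show "Y \<in> Lp M CC TN p" using Y_strongly_measurable Y_CT unfolding Lp_def by blast
  show "(\<lambda>N. Lp_norm M TN p (\<lambda>\<omega>. X N \<omega> - Y \<omega>)) \<longlonglongrightarrow> 0"
  proof (rule tendsto_sandwich[OF _ _ tendsto_const])
    show "(\<lambda>N. ennreal (2 * e N powr (1 / n))) \<longlonglongrightarrow> 0"
      using tendsto_ennrealI[OF root_tendsto] by simp
    show "eventually (\<lambda>N. Lp_norm M TN p (\<lambda>\<omega>. X N \<omega> - Y \<omega>) \<le> ennreal (2 * e N powr (1 / n))) sequentially"
      by (intro always_eventually allI Lp_norm_bound[OF prob_space_axioms p WY_measurable WY_maj EWY e_pos])
  qed simp
qed

end


section \<open>A countable dense family of paths\<close>

definition rat_poly :: "rat list \<Rightarrow> real \<Rightarrow> real" where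
  "rat_poly c t = (\<Sum>i<length c. of_rat (c ! i) * t ^ i)"

text \<open>Weierstrass approximation followed by a perturbation of the coefficients.\<close>

lemma rat_poly_approx:
  assumes f: "continuous_on {0..T} f" and e: "e > 0"
  shows "\<exists>c. \<forall>t\<in>{0..T}. \<bar>rat_poly c t - f t\<bar> < e"
proof -
  obtain g where g: "real_polynomial_function g" "\<And>t. t \<in> {0..T} \<Longrightarrow> \<bar>f t - g t\<bar> < e / 2"
    using Stone_Weierstrass_real_polynomial_function[OF compact_Icc f, of "e / 2"] e by auto
  obtain a n where a: "g = (\<lambda>t. \<Sum>i\<le>n. a i * t ^ i)" using g(1) real_polynomial_function_imp_sum by blast
  define B where "B = (\<Sum>i\<le>n. \<bar>T\<bar> ^ i)"
  have B: "B \<ge> 0" unfolding B_def by (intro sum_nonneg) auto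
  define \<delta> where "\<delta> = e / 2 / (B + 1)"
  have \<delta>: "\<delta> > 0" "\<delta> * B < e / 2"
  proof -
    show "\<delta> > 0" using e B by (simp add: \<delta>_def)
    have "e / 2 * B < e / 2 * (B + 1)" using e by (intro mult_strict_left_mono) auto
    then show "\<delta> * B < e / 2" using B by (simp add: \<delta>_def field_simps)
  qed
  have "\<forall>i. \<exists>r. \<bar>of_rat r - a i\<bar> < \<delta>"
  proof
    fix i
    obtain r where "a i - \<delta> < of_rat r" "of_rat r < a i + \<delta>" using of_rat_dense[of "a i - \<delta>" "a i + \<delta>"] \<delta>(1) by auto
    then show "\<exists>r. \<bar>of_rat r - a i\<bar> < \<delta>" by (intro exI[of _ r]) auto
  qed
  then obtain r where r: "\<And>i. \<bar>of_rat (r i) - a i\<bar> < \<delta>" by metis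
  have "\<bar>rat_poly (map r [0..<Suc n]) t - f t\<bar> < e" if t: "t \<in> {0..T}" for t
  proof -
    have "rat_poly (map r [0..<Suc n]) t = (\<Sum>i\<le>n. of_rat (r i) * t ^ i)"
      unfolding rat_poly_def lessThan_Suc_atMost[symmetric] by (intro sum.cong) (auto simp del: upt_Suc)
    then have "\<bar>rat_poly (map r [0..<Suc n]) t - g t\<bar> = \<bar>\<Sum>i\<le>n. (of_rat (r i) - a i) * t ^ i\<bar>"
      by (simp add: a sum_subtractf left_diff_distrib)
    also have "\<dots> \<le> (\<Sum>i\<le>n. \<delta> * \<bar>T\<bar> ^ i)"
    proof (rule order_trans[OF sum_abs], rule sum_mono)
      fix i
      have "\<bar>(of_rat (r i) - a i) * t ^ i\<bar> = \<bar>of_rat (r i) - a i\<bar> * \<bar>t\<bar> ^ i" by (simp add: abs_mult power_abs)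
      also have "\<dots> \<le> \<delta> * \<bar>T\<bar> ^ i" using r[of i] t \<delta> by (intro mult_mono power_mono) auto
      finally show "\<bar>(of_rat (r i) - a i) * t ^ i\<bar> \<le> \<delta> * \<bar>T\<bar> ^ i" .
    qed
    also have "\<dots> < e / 2" using \<delta>(2) by (simp add: B_def sum_distrib_left)
    finally show ?thesis using g(2)[OF t] by linarith
  qed
  then show ?thesis by blast
qed

text \<open>Codes of paths with finitely many nonzero Fourier coefficients, each a polynomial in time with complex
  rational coefficients. They form a countable type.\<close>

type_synonym path_code = "((int \<times> int) \<times> (rat list \<times> rat list)) list"

definition coded_path :: "path_code \<Rightarrow> real \<Rightarrow> int \<times> int \<Rightarrow> complex" where
  "coded_path L t n = (case map_of L n of None \<Rightarrow> 0 | Some (c, d) \<Rightarrow> Complex (rat_poly c t) (rat_poly d t))"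

lemma coded_path_support: "n \<notin> fst ` set L \<Longrightarrow> coded_path L t n = 0"
  unfolding coded_path_def by (simp add: map_of_eq_None_iff[THEN iffD2])

lemma continuous_rat_poly: "continuous_on A (rat_poly c)"
  unfolding rat_poly_def[abs_def] by (intro continuous_intros)

lemma coded_path_continuous: "continuous_on A (\<lambda>t. coded_path L t n)"
proof (cases "map_of L n")
  case None
  then show ?thesis by (simp add: coded_path_def)
next
  case (Some cd)
  then have "(\<lambda>t. coded_path L t n) = (\<lambda>t. of_real (rat_poly (fst cd) t) + \<i> * of_real (rat_poly (snd cd) t))"
    by (auto simp: coded_path_def Complex_eq split: prod.splits)
  then show ?thesis by (simp only:) (intro continuous_intros continuous_rat_poly)
qed

lemma coded_path_dense:
  assumes S: "finite S" and u: "\<And>n. n \<in> S \<Longrightarrow> continuous_on {0..T} (\<lambda>t. u t n)" and e: "e > 0"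
  shows "\<exists>L. fst ` set L = S \<and> (\<forall>t\<in>{0..T}. \<forall>n\<in>S. cmod (coded_path L t n - u t n) < e)"
proof -
  have "\<exists>cd. \<forall>t\<in>{0..T}. cmod (Complex (rat_poly (fst cd) t) (rat_poly (snd cd) t) - u t n) < e" if n: "n \<in> S" for n
  proof -
    have "continuous_on {0..T} (\<lambda>t. Re (u t n))" "continuous_on {0..T} (\<lambda>t. Im (u t n))"
      using u[OF n] by (auto intro: continuous_intros)
    then obtain c d where cd: "\<forall>t\<in>{0..T}. \<bar>rat_poly c t - Re (u t n)\<bar> < e / 2" "\<forall>t\<in>{0..T}. \<bar>rat_poly d t - Im (u t n)\<bar> < e / 2"
      using rat_poly_approx[of T "\<lambda>t. Re (u t n)" "e / 2"] rat_poly_approx[of T "\<lambda>t. Im (u t n)" "e / 2"] e by auto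
    have "cmod (Complex (rat_poly c t) (rat_poly d t) - u t n) < e" if t: "t \<in> {0..T}" for t
    proof -
      have "cmod (Complex (rat_poly c t) (rat_poly d t) - u t n) \<le> \<bar>rat_poly c t - Re (u t n)\<bar> + \<bar>rat_poly d t - Im (u t n)\<bar>"
        using cmod_le[of "Complex (rat_poly c t) (rat_poly d t) - u t n"] by simp
      then show ?thesis using cd t by fastforce
    qed
    then show ?thesis by (intro exI[of _ "(c, d)"]) simp
  qed
  then obtain cd where cd: "\<And>n t. n \<in> S \<Longrightarrow> t \<in> {0..T} \<Longrightarrow> cmod (Complex (rat_poly (fst (cd n)) t) (rat_poly (snd (cd n)) t) - u t n) < e"
    by metis
  obtain xs where xs: "set xs = S" using finite_list[OF S] by blast
  let ?L = "map (\<lambda>n. (n, cd n)) xs"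
  have "map_of ?L n = Some (cd n)" if "n \<in> S" for n
    using that xs by (simp add: map_of_map_restrict)
  then have eq: "coded_path ?L t n = Complex (rat_poly (fst (cd n)) t) (rat_poly (snd (cd n)) t)" if "n \<in> S" for n t
    using that by (simp add: coded_path_def case_prod_beta)
  show ?thesis
  proof (intro exI[of _ ?L] conjI ballI)
    show "fst ` set ?L = S" using xs by (simp add: image_image)
    show "cmod (coded_path ?L t n - u t n) < e" if "t \<in> {0..T}" "n \<in> S" for t n
      unfolding eq[OF that(2)] by (rule cd[OF that(2,1)])
  qed
qed

lemma rat_sup_dense:
  fixes f :: "real \<Rightarrow> real"
  assumes f: "continuous_on UNIV f" and le: "\<And>r :: rat. ennreal (f (of_rat r)) \<le> b"
  shows "ennreal (f t) \<le> b"
proof (rule ccontr)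
  assume "\<not> ?thesis"
  then have lt: "b < ennreal (f t)" by simp
  then have "b \<noteq> \<top>" by (metis not_top_less)
  then obtain c where c: "b = ennreal c" "c \<ge> 0" by (cases b) auto
  with lt have "c < f t" by (metis ennreal_leI not_le)
  have "open {s. c < f s}" using f by (intro open_Collect_less continuous_intros) auto
  then obtain d where d: "d > 0" "\<And>s. dist s t < d \<Longrightarrow> c < f s" using \<open>c < f t\<close> unfolding open_dist by blast
  obtain r where "t < of_rat r" "of_rat r < t + d" using of_rat_dense[of t "t + d"] d(1) by auto
  then have "c < f (of_rat r)" by (intro d(2)) (simp add: dist_real_def)
  then have "ennreal c < ennreal (f (of_rat r))" using c(2) by (intro ennreal_lessI) auto
  then show False using le[of r] c(1) by simp
qed

section \<open>Convergence of the truncated Wick monomials\<close>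

text \<open>The coefficients of the field are \<open>cutoff N n * Z n t\<close>, where the cutoff is the only thing that depends on \<open>N\<close>.\<close>

locale truncated_field = ou M \<phi>\<^sub>0 \<beta> a\<^sub>1 a\<^sub>2 Z + CT_space \<phi>\<^sub>0 \<epsilon> T
  for M :: "'w measure" and \<phi>\<^sub>0 \<beta> a\<^sub>1 a\<^sub>2 Z \<epsilon> T +
  fixes \<gamma> :: real and \<rho> :: "real \<times> real \<Rightarrow> real" and k l :: nat
  assumes gamma: "\<gamma> > 0" and rho_smooth: "smooth \<rho>"
    and rho_one: "\<And>\<xi>. norm \<xi> \<le> 1/2 \<Longrightarrow> \<rho> \<xi> = 1" and rho_zero: "\<And>\<xi>. norm \<xi> \<ge> 1 \<Longrightarrow> \<rho> \<xi> = 0"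
begin

definition cutoff :: "nat \<Rightarrow> int \<times> int \<Rightarrow> complex" where
  "cutoff N n = of_real (if norm (freq n) \<le> real N then sqrt (2 * \<gamma>) * \<rho> (freq n /\<^sub>R real N) else 0)"

lemma cutoff_low:
  assumes "2 * norm (freq n) \<le> real N" "N > 0"
  shows "cutoff N n = of_real (sqrt (2 * \<gamma>))"
proof -
  have "norm (freq n /\<^sub>R real N) = norm (freq n) / real N" by (simp add: divide_inverse mult.commute)
  also have "\<dots> \<le> 1 / 2" using assms by (simp add: divide_le_eq)
  finally have "\<rho> (freq n /\<^sub>R real N) = 1" by (rule rho_one)
  moreover have "norm (freq n) \<le> real N" using assms norm_ge_zero[of "freq n"] by linarith
  ultimately show ?thesis unfolding cutoff_def by simp
qed

lemma cutoff_bounded: "\<exists>R\<ge>1. \<forall>N n. cmod (cutoff N n) \<le> R"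
proof -
  have "Ck 0 \<rho>" using rho_smooth unfolding smooth_def by blast
  then have "continuous_on (cball 0 1) \<rho>" unfolding Ck.simps by (rule continuous_on_subset) simp
  then have "bounded (\<rho> ` cball 0 1)"
    by (intro compact_imp_bounded compact_continuous_image compact_cball)
  then obtain B where B: "\<forall>y\<in>\<rho> ` cball 0 1. norm y \<le> B" unfolding bounded_iff by blast
  have le: "\<bar>\<rho> \<xi>\<bar> \<le> max B 0" for \<xi>
  proof (cases "norm \<xi> \<le> 1")
    case True
    then have "\<xi> \<in> cball 0 1" by (simp only: mem_cball_0)
    from B[THEN bspec, OF imageI, OF this] show ?thesis by simp
  next
    case False
    then have "\<rho> \<xi> = 0" by (intro rho_zero) linarith
    then show ?thesis by simp
  qed
  have "cmod (cutoff N n) \<le> max 1 (sqrt (2 * \<gamma>) * max B 0)" for N n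
  proof -
    have "cmod (cutoff N n) \<le> sqrt (2 * \<gamma>) * \<bar>\<rho> (freq n /\<^sub>R real N)\<bar>"
    proof (cases "norm (freq n) \<le> real N")
      case True
      then show ?thesis unfolding cutoff_def norm_of_real using gamma by (simp only: if_True abs_mult) simp
    next
      case False
      then show ?thesis unfolding cutoff_def using gamma by simp
    qed
    also have "\<dots> \<le> sqrt (2 * \<gamma>) * max B 0" using gamma by (intro mult_left_mono le) auto
    finally show ?thesis by simp
  qed
  then show ?thesis by (intro exI[of _ "max 1 (sqrt (2 * \<gamma>) * max B 0)"] conjI max.cobounded1) blast
qed

definition freq_ball :: "nat \<Rightarrow> (int \<times> int) set" where "freq_ball N = {n. norm (freq n) \<le> real N}"

lemma finite_freq_ball' [simp]: "finite (freq_ball N)"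
  unfolding freq_ball_def by (rule finite_freq_ball)

lemma freq_ball_mono: "N \<le> N' \<Longrightarrow> freq_ball N \<subseteq> freq_ball N'"
  unfolding freq_ball_def by auto

lemma Psi_eq:
  assumes B: "finite B" "freq_ball N \<subseteq> B"
  shows "Psi \<gamma> \<rho> Z N x t \<omega> = (\<Sum>n\<in>B. cutoff N n * wave n x * Z n t \<omega>)"
proof -
  have "Psi \<gamma> \<rho> Z N x t \<omega> = (\<Sum>n\<in>freq_ball N. cutoff N n * wave n x * Z n t \<omega>)"
    unfolding Psi_def sum_distrib_left freq_ball_def by (intro sum.cong refl) (simp add: cutoff_def)
  also have "\<dots> = (\<Sum>n\<in>B. cutoff N n * wave n x * Z n t \<omega>)"
    using B by (intro sum.mono_neutral_left) (auto simp: cutoff_def freq_ball_def)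
  finally show ?thesis .
qed

text \<open>As waves have modulus 1, the variance depends neither on time nor on space.\<close>

lemma sigma_N_eq:
  assumes B: "finite B" "freq_ball N \<subseteq> B"
  shows "sigma_N M \<gamma> \<rho> Z N x t = sig B (cutoff N)"
proof -
  have "sigma_N M \<gamma> \<rho> Z N x t = (\<Sum>n\<in>B. (cmod (cutoff N n * wave n x))\<^sup>2 * var n)"
    unfolding sigma_N_def Psi_eq[OF B]
    by (rule second_moment[where ft = "ker t"]) (auto simp: B wiener ker_norm var_nonneg)
  then show ?thesis by (simp add: sig_def norm_mult)
qed

text \<open>The zero mode always survives the cutoff. Positivity is what allows the Laguerre form to be replaced by
  the Hermite form.\<close>

lemma sig_cutoff_pos:
  assumes B: "finite B" "freq_ball N \<subseteq> B" and N: "N > 0"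
  shows "sig B (cutoff N) > 0"
proof -
  have "0 \<in> B" using B by (auto simp: freq_ball_def)
  have c: "cutoff N 0 = of_real (sqrt (2 * \<gamma>))" using N by (intro cutoff_low) auto
  have v: "var 0 > 0" using a1 by (simp add: var_def)
  have "0 < (cmod (cutoff N 0))\<^sup>2 * var 0" unfolding c using gamma v by simp
  also have "\<dots> \<le> sig B (cutoff N)"
    unfolding sig_def using \<open>0 \<in> B\<close> B(1) by (intro member_le_sum) (auto simp: var_nonneg)
  finally show ?thesis .
qed

lemma wick_monomial_eq:
  assumes B: "finite B" "freq_ball N \<subseteq> B" and N: "N > 0"
  shows "wick_monomial M \<gamma> \<rho> Z k l N \<omega> t = wcoef k l B (cutoff N) t \<omega>"
  unfolding wick_monomial_def wcoef_def sigma_N_eq[OF B] wick_eq_chermite[OF sig_cutoff_pos[OF B N]] Psi_eq[OF B] wick_field_def[abs_def] ..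

lemma wick_coef_le:
  fixes w :: "int \<times> int \<Rightarrow> complex"
  assumes w: "\<And>n. cmod (w n) \<le> R" and R: "R \<ge> 1" and \<tau>: "length \<tau> = d"
  shows "cmod (wick_coef k l w \<tau>) \<le> R ^ d"
proof -
  have "cmod (prod_list (map (\<lambda>q. if snd q then w (fst q) else cnj (w (fst q))) \<tau>)) \<le> R ^ length \<tau>" for \<tau> :: "((int \<times> int) \<times> bool) list"
  proof (induction \<tau>)
    case (Cons q \<tau>)
    have c: "cmod (if snd q then w (fst q) else cnj (w (fst q))) \<le> R" using w by simp
    show ?case
      unfolding list.map prod_list.Cons length_Cons power_Suc norm_mult
      by (intro mult_mono c Cons.IH) (use R in auto)
  qed simp
  then show ?thesis using R \<tau> by (auto simp: wick_coef_def)
qed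

lemma wt_powr_ge1: "\<kappa> > 0 \<Longrightarrow> 1 \<le> wt n powr (- \<kappa>)"
  using powr_mono2'[of "- \<kappa>" "wt n" 1] wt_pos[of n] wt_le1[of n] by simp

lemma prod_wt_ge:
  assumes \<kappa>: "\<kappa> > 0" and q: "q \<in> set \<tau>"
  shows "wt (fst q) powr (- \<kappa>) \<le> prod_list (map (\<lambda>q. wt (fst q) powr (- \<kappa>)) \<tau>)"
  using q
proof (induction \<tau>)
  case (Cons p \<tau>)
  let ?P = "prod_list (map (\<lambda>q. wt (fst q) powr (- \<kappa>)) \<tau>)"
  have P1: "1 \<le> ?P"
    by (induction \<tau>) (auto intro: order_trans[OF _ mult_mono[of 1 _ 1]] wt_powr_ge1[OF \<kappa>])
  show ?case
  proof (cases "q \<in> set \<tau>")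
    case True
    then show ?thesis using Cons.IH wt_powr_ge1[OF \<kappa>, of "fst p"] P1 mult_mono[of 1 "wt (fst p) powr (- \<kappa>)" "wt (fst q) powr (- \<kappa>)" ?P] by simp
  next
    case False
    then have "p = q" using Cons.prems by simp
    then show ?thesis using mult_left_mono[OF P1, of "wt (fst q) powr (- \<kappa>)"] by simp
  qed
qed simp

lemma prod_wt_ge1: "\<kappa> > 0 \<Longrightarrow> 1 \<le> prod_list (map (\<lambda>q. wt (fst q) powr (- \<kappa>)) \<tau>)"
  by (induction \<tau>) (auto intro: order_trans[OF _ mult_mono[of 1 _ 1]] wt_powr_ge1)

text \<open>If all frequencies are at most \<open>m / 2\<close>, both cutoffs are constant there and the difference vanishes.
  Otherwise some frequency exceeds \<open>m / 2\<close>, and a negative power of its weight absorbs a power of \<open>m\<close>.\<close>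

lemma wick_coef_cutoff_diff:
  assumes R: "R \<ge> 1" "\<And>N n. cmod (cutoff N n) \<le> R" and \<kappa>: "\<kappa> > 0" and \<tau>: "length \<tau> = d"
    and m: "0 < m" "m \<le> N" "m \<le> N'"
  shows "(cmod (wick_coef k l (cutoff N) \<tau> - wick_coef k l (cutoff N') \<tau>))\<^sup>2
     \<le> (2 * R ^ d)\<^sup>2 * (4 / (real m)\<^sup>2) powr \<kappa> * prod_list (map (\<lambda>q. wt (fst q) powr (- \<kappa>)) \<tau>)"
proof (cases "\<forall>q\<in>set \<tau>. 2 * norm (freq (fst q)) \<le> real m")
  case True
  have "cutoff N (fst q) = cutoff N' (fst q)" if "q \<in> set \<tau>" for q
    using True that m by (subst (1 2) cutoff_low) fastforce+
  then have "map (\<lambda>q. if snd q then cutoff N (fst q) else cnj (cutoff N (fst q))) \<tau> = map (\<lambda>q. if snd q then cutoff N' (fst q) else cnj (cutoff N' (fst q))) \<tau>"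
    by (intro map_cong refl) simp
  then have "wick_coef k l (cutoff N) \<tau> = wick_coef k l (cutoff N') \<tau>" unfolding wick_coef_def by (simp only:)
  moreover have "0 \<le> prod_list (map (\<lambda>q. wt (fst q) powr (- \<kappa>)) \<tau>)" using prod_wt_ge1[OF \<kappa>, of \<tau>] by linarith
  ultimately show ?thesis by simp
next
  case False
  then obtain q where q: "q \<in> set \<tau>" "real m < 2 * norm (freq (fst q))" by force
  have "(real m)\<^sup>2 \<le> (2 * norm (freq (fst q)))\<^sup>2" using q(2) by (intro power_mono) auto
  then have wt: "wt (fst q) \<le> 4 / (real m)\<^sup>2" using m unfolding wt_def by (simp add: divide_simps add_pos_nonneg power_mult_distrib)
  have "(4 / (real m)\<^sup>2) powr \<kappa> * (4 / (real m)\<^sup>2) powr (- \<kappa>) = 1" using m by (simp add: powr_add[symmetric])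
  moreover have "(4 / (real m)\<^sup>2) powr (- \<kappa>) \<le> wt (fst q) powr (- \<kappa>)" using wt_pos[of "fst q"] wt \<kappa> by (intro powr_mono2') auto
  then have "(4 / (real m)\<^sup>2) powr (- \<kappa>) \<le> prod_list (map (\<lambda>q. wt (fst q) powr (- \<kappa>)) \<tau>)" using prod_wt_ge[OF \<kappa> q(1)] by linarith
  ultimately have 1: "1 \<le> (4 / (real m)\<^sup>2) powr \<kappa> * prod_list (map (\<lambda>q. wt (fst q) powr (- \<kappa>)) \<tau>)"
    by (metis mult_left_mono powr_ge_zero)
  have "cmod (wick_coef k l (cutoff N) \<tau> - wick_coef k l (cutoff N') \<tau>) \<le> 2 * R ^ d"
    using norm_triangle_ineq4[of "wick_coef k l (cutoff N) \<tau>" "wick_coef k l (cutoff N') \<tau>"]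
      wick_coef_le[of "cutoff N" R \<tau> d, OF R(2) R(1) \<tau>] wick_coef_le[of "cutoff N'" R \<tau> d, OF R(2) R(1) \<tau>] by linarith
  then have "(cmod (wick_coef k l (cutoff N) \<tau> - wick_coef k l (cutoff N') \<tau>))\<^sup>2 \<le> (2 * R ^ d)\<^sup>2" by (intro power_mono) auto
  also have "\<dots> \<le> (2 * R ^ d)\<^sup>2 * ((4 / (real m)\<^sup>2) powr \<kappa> * prod_list (map (\<lambda>q. wt (fst q) powr (- \<kappa>)) \<tau>))"
    using mult_left_mono[OF 1, of "(2 * R ^ d)\<^sup>2"] by simp
  finally show ?thesis by (simp only: mult.assoc)
qed

abbreviation X :: "nat \<Rightarrow> 'w \<Rightarrow> real \<Rightarrow> int \<times> int \<Rightarrow> complex" where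
  "X N \<equiv> wick_monomial M \<gamma> \<rho> Z k l (Suc N)"

definition supp :: "nat \<Rightarrow> (int \<times> int) set" where
  "supp N = (\<lambda>i. nu (snd i)) ` wick_index k l (freq_ball (Suc N))"

lemma finite_supp [simp]: "finite (supp N)"
  unfolding supp_def by simp

lemma X_coeff: "X N \<omega> t n = (\<Sum>i\<in>wick_index k l (freq_ball (Suc N)). if nu (snd i) = n
    then wick_amp k l (cutoff (Suc N)) (sig (freq_ball (Suc N)) (cutoff (Suc N))) (\<lambda>n. Z n t \<omega>) i else 0)"
  unfolding wick_monomial_eq[OF finite_freq_ball' order_refl zero_less_Suc] wcoef_def wick_field_trig[OF finite_freq_ball']
  by (rule fourier_coeff_trig_poly) simp

lemma X_support: "n \<notin> supp N \<Longrightarrow> X N \<omega> t n = 0"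
  unfolding X_coeff supp_def by (intro sum.neutral) auto

lemma X_measurable [measurable]: "(\<lambda>\<omega>. X N \<omega> t n) \<in> borel_measurable M"
  unfolding X_coeff
proof (rule borel_measurable_sum)
  fix i assume "i \<in> wick_index k l (freq_ball (Suc N))"
  then show "(\<lambda>\<omega>. if nu (snd i) = n then wick_amp k l (cutoff (Suc N)) (sig (freq_ball (Suc N)) (cutoff (Suc N))) (\<lambda>n. Z n t \<omega>) i else 0) \<in> borel_measurable M"
    by (cases "nu (snd i) = n") (simp_all add: measurable_wick_amp)
qed

lemma X_continuous:
  assumes "\<forall>n. continuous_on UNIV (\<lambda>t. Z n t \<omega>)"
  shows "continuous_on UNIV (\<lambda>t. X N \<omega> t n)"
  unfolding X_coeff
proof (rule continuous_on_sum)
  fix i assume "i \<in> wick_index k l (freq_ball (Suc N))"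
  moreover have "((\<lambda>t. Z n t \<omega>) \<longlongrightarrow> Z n s \<omega>) (at s within UNIV)" for n s
    using assms[THEN spec, of n] unfolding continuous_on_def by blast
  ultimately have "continuous_on UNIV (\<lambda>t. wick_amp k l (cutoff (Suc N)) (sig (freq_ball (Suc N)) (cutoff (Suc N))) (\<lambda>n. Z n t \<omega>) i)"
    unfolding continuous_on_def by (intro ballI tendsto_wick_amp[OF _ tendsto_const])
  then show "continuous_on UNIV (\<lambda>t. if nu (snd i) = n then wick_amp k l (cutoff (Suc N)) (sig (freq_ball (Suc N)) (cutoff (Suc N))) (\<lambda>n. Z n t \<omega>) i else 0)"
    by (cases "nu (snd i) = n") simp_all
qed

lemma X_CT: "AE \<omega> in M. X N \<omega> \<in> CC"
  using Z_continuous
proof eventually_elim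
  fix \<omega> assume c: "\<forall>n. continuous_on UNIV (\<lambda>t. Z n t \<omega>)"
  show "X N \<omega> \<in> CC"
    by (rule CT_finite_support[OF finite_supp X_support continuous_on_subset[OF X_continuous[OF c]]]) (assumption, simp)
qed

lemma coded_path_CT: "coded_path L \<in> CC"
  by (rule CT_finite_support[of "fst ` set L"]) (auto simp: coded_path_support intro: coded_path_continuous)

text \<open>Extends paths from \<open>[0, T]\<close> to the real line, where the rationals are dense.\<close>

definition clip :: "real \<Rightarrow> real" where "clip r = max 0 (min T r)"

lemma clip_in: "clip r \<in> {0..T}" and clip_id: "t \<in> {0..T} \<Longrightarrow> clip t = t"
  using T0 by (auto simp: clip_def)

lemma clip_continuous: "continuous_on A clip"
  unfolding clip_def[abs_def] by (intro continuous_intros)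

definition coeff_dist :: "path_code \<Rightarrow> nat \<Rightarrow> 'w \<Rightarrow> real \<Rightarrow> real" where
  "coeff_dist L N \<omega> t = 2 * K * (\<Sum>n\<in>fst ` set L \<union> supp N. cmod (coded_path L t n - X N \<omega> t n))"

text \<open>By continuity the supremum over rational times is the supremum over all times; being countable, it is
  measurable.\<close>

definition path_dist :: "path_code \<Rightarrow> nat \<Rightarrow> 'w \<Rightarrow> ennreal" where
  "path_dist L N \<omega> = (SUP r :: rat. ennreal (coeff_dist L N \<omega> (clip (of_rat r))))"

lemma path_dist_measurable [measurable]: "path_dist L N \<in> borel_measurable M"
  unfolding path_dist_def coeff_dist_def by measurable

lemma path_dist_bound: "AE \<omega> in M. \<forall>L. TN (coded_path L - X N \<omega>) \<le> path_dist L N \<omega>"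
  using Z_continuous
proof eventually_elim
  fix \<omega> assume c: "\<forall>n. continuous_on UNIV (\<lambda>t. Z n t \<omega>)"
  show "\<forall>L. TN (coded_path L - X N \<omega>) \<le> path_dist L N \<omega>"
  proof
    fix L
    show "TN (coded_path L - X N \<omega>) \<le> path_dist L N \<omega>"
      unfolding TN_le_iff
    proof
      fix t assume t: "t \<in> {0..T}"
      have "CN (coded_path L t - X N \<omega> t) \<le> ennreal (2 * K * (\<Sum>n\<in>fst ` set L \<union> supp N. cmod ((coded_path L t - X N \<omega> t) n)))"
        by (rule CN_finite_support) (simp_all add: coded_path_support X_support)
      also have "\<dots> = ennreal (coeff_dist L N \<omega> t)" unfolding coeff_dist_def minus_apply ..
      also have "\<dots> = ennreal (coeff_dist L N \<omega> (clip t))" by (simp only: clip_id[OF t])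
      also have "\<dots> \<le> path_dist L N \<omega>"
      proof (rule rat_sup_dense[where f = "\<lambda>t. coeff_dist L N \<omega> (clip t)" and t = t])
        have "continuous_on UNIV (coeff_dist L N \<omega>)"
          unfolding coeff_dist_def[abs_def] by (intro continuous_intros coded_path_continuous X_continuous c)
        then show "continuous_on UNIV (\<lambda>t. coeff_dist L N \<omega> (clip t))"
          by (intro continuous_on_compose2[OF _ clip_continuous]) auto
        show "ennreal (coeff_dist L N \<omega> (clip (of_rat r))) \<le> path_dist L N \<omega>" for r :: rat
          unfolding path_dist_def by (rule SUP_upper) simp
      qed
      finally show "CN ((coded_path L - X N \<omega>) t) \<le> path_dist L N \<omega>" by (simp only: path_diff)
    qed
  qed
qed

lemma path_dist_small: "AE \<omega> in M. \<forall>e>0. \<exists>L. path_dist L N \<omega> < e"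
  using Z_continuous
proof eventually_elim
  fix \<omega> assume c: "\<forall>n. continuous_on UNIV (\<lambda>t. Z n t \<omega>)"
  show "\<forall>e>0. \<exists>L. path_dist L N \<omega> < e"
  proof (intro allI impI)
    fix e :: ennreal assume "e > 0"
    obtain e' where e': "e' > 0" "ennreal e' < e"
    proof (cases e)
      case (real r)
      then have "r > 0" using \<open>e > 0\<close> by simp
      then show ?thesis using real by (intro that[of "r / 2"]) (auto simp: ennreal_less_iff)
    next
      case top
      then show ?thesis by (intro that[of 1]) auto
    qed
    define \<delta> where "\<delta> = e' / (2 * K * (real (card (supp N)) + 1))"
    have \<delta>: "\<delta> > 0" using e' K(1) by (auto simp: \<delta>_def intro!: divide_pos_pos mult_pos_pos)
    have "\<exists>L. fst ` set L = supp N \<and> (\<forall>t\<in>{0..T}. \<forall>n\<in>supp N. cmod (coded_path L t n - X N \<omega> t n) < \<delta>)"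
      by (rule coded_path_dense[OF finite_supp continuous_on_subset[OF X_continuous[OF c] subset_UNIV] \<delta>])
    then obtain L where L: "fst ` set L = supp N" "\<And>t n. t \<in> {0..T} \<Longrightarrow> n \<in> supp N \<Longrightarrow> cmod (coded_path L t n - X N \<omega> t n) < \<delta>"
      by blast
    have le: "coeff_dist L N \<omega> t \<le> e'" if t: "t \<in> {0..T}" for t
    proof -
      have "(\<Sum>n\<in>supp N. cmod (coded_path L t n - X N \<omega> t n)) \<le> (\<Sum>n\<in>supp N. \<delta>)"
        using L(2)[OF t] by (intro sum_mono less_imp_le)
      also have "\<dots> \<le> (real (card (supp N)) + 1) * \<delta>" using \<delta> by simp
      finally have "coeff_dist L N \<omega> t \<le> 2 * K * ((real (card (supp N)) + 1) * \<delta>)"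
        unfolding coeff_dist_def L(1) using K(1) by (simp add: mult_left_mono)
      also have "\<dots> = e'" using K(1) by (simp add: \<delta>_def)
      finally show ?thesis .
    qed
    have "path_dist L N \<omega> \<le> ennreal e'"
      unfolding path_dist_def by (intro SUP_least ennreal_leI le clip_in)
    then show "\<exists>L. path_dist L N \<omega> < e" using e'(2) by (intro exI[of _ L]) (rule le_less_trans)
  qed
qed

text \<open>Truncations \<open>N\<close> and \<open>N'\<close> are written over the larger ball of frequencies, so that the moment bound for
  differences applies with a \<open>\<Lambda>\<close> that tends to 0 with the smaller of the two.\<close>

theorem convergence:
  assumes p: "p \<ge> 1"
  shows "Lp_Cauchy M CC TN p X \<and> (\<exists>Y. Lp_limit M CC TN p X Y)"
proof -
  obtain R where R: "R \<ge> 1" "\<And>N n. cmod (cutoff N n) \<le> R" using cutoff_bounded by blast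
  obtain q C \<kappa> where q: "0 < q" "p \<le> 2 * real q" and C: "0 \<le> C" and \<kappa>: "0 < \<kappa>"
    and mom0: "(\<forall>B w1 w2 u \<Lambda>. finite B \<longrightarrow> 0 \<le> \<Lambda> \<longrightarrow>
     (\<forall>\<tau>\<in>tuples (B \<times> UNIV) (k + l). (cmod (wick_coef k l w1 \<tau> - u * wick_coef k l w2 \<tau>))\<^sup>2 \<le> \<Lambda> * prod_list (map (\<lambda>q. wt (fst q) powr (- \<kappa>)) \<tau>)) \<longrightarrow>
     (\<exists>W\<in>borel_measurable M. (\<integral>\<^sup>+\<omega>. W \<omega> \<partial>M) \<le> ennreal (C * \<Lambda> ^ q) \<and>
       (AE \<omega> in M. \<forall>t\<in>{0..T}. \<forall>j x. ennreal ((2 powr (real j * - \<epsilon>) * cmod (LP_block \<phi>\<^sub>0 j (dcoef k l B w1 w2 u t \<omega>) x)) ^ (2 * q)) \<le> W \<omega>)))"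
    using sup_moment[OF \<epsilon> T0, of p k l] by (elim exE conjE) (rule that)
  have mom: "\<exists>W. W \<in> borel_measurable M \<and> (\<integral>\<^sup>+\<omega>. W \<omega> \<partial>M) \<le> ennreal (C * \<Lambda> ^ q) \<and>
       (AE \<omega> in M. \<forall>t\<in>{0..T}. \<forall>j x. ennreal ((2 powr (real j * - \<epsilon>) * cmod (LP_block \<phi>\<^sub>0 j (dcoef k l B w1 w2 u t \<omega>) x)) ^ (2 * q)) \<le> W \<omega>)"
    if "finite B" "0 \<le> \<Lambda>" "\<And>\<tau>. \<tau> \<in> tuples (B \<times> UNIV) (k + l) \<Longrightarrow>
      (cmod (wick_coef k l w1 \<tau> - u * wick_coef k l w2 \<tau>))\<^sup>2 \<le> \<Lambda> * prod_list (map (\<lambda>q. wt (fst q) powr (- \<kappa>)) \<tau>)"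
    for B w1 w2 u \<Lambda>
    unfolding Bex_def[symmetric]
    by (rule mom0[THEN spec, THEN spec, THEN spec, THEN spec, THEN spec, THEN mp, OF that(1), THEN mp, OF that(2), THEN mp])
       (intro ballI that(3))
  define \<Lambda> where "\<Lambda> m = (2 * R ^ (k + l))\<^sup>2 * (4 / (real m)\<^sup>2) powr \<kappa>" for m :: nat
  have \<Lambda>: "\<Lambda> m \<ge> 0" for m by (simp add: \<Lambda>_def)
  define P where "P N N' W \<longleftrightarrow> W \<in> borel_measurable M \<and> (\<integral>\<^sup>+\<omega>. W \<omega> \<partial>M) \<le> ennreal (C * \<Lambda> (Suc (min N N')) ^ q) \<and>
      (AE \<omega> in M. maj (2 * q) (X N \<omega> - X N' \<omega>) (W \<omega>))" for N N' W
  have ex: "\<exists>W. P N N' W" for N N'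
  proof -
    let ?B = "freq_ball (Suc (max N N'))"
    have sub: "freq_ball (Suc N) \<subseteq> ?B" "freq_ball (Suc N') \<subseteq> ?B" by (auto intro!: freq_ball_mono)
    have eq: "(X N \<omega> - X N' \<omega>) t = dcoef k l ?B (cutoff (Suc N)) (cutoff (Suc N')) 1 t \<omega>" for \<omega> t
      unfolding path_diff wick_monomial_eq[OF finite_freq_ball' sub(1) zero_less_Suc] wick_monomial_eq[OF finite_freq_ball' sub(2) zero_less_Suc] dcoef_def by simp
    have co: "(cmod (wick_coef k l (cutoff (Suc N)) \<tau> - 1 * wick_coef k l (cutoff (Suc N')) \<tau>))\<^sup>2
        \<le> \<Lambda> (Suc (min N N')) * prod_list (map (\<lambda>q. wt (fst q) powr (- \<kappa>)) \<tau>)"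
      if "\<tau> \<in> tuples (?B \<times> UNIV) (k + l)" for \<tau>
      unfolding mult_1_left \<Lambda>_def using that by (intro wick_coef_cutoff_diff[OF R \<kappa>]) (simp_all add: tuples_def)
    show ?thesis
      unfolding P_def maj_def norm_wb eq by (rule mom[OF finite_freq_ball' \<Lambda> co])
  qed
  define W where "W N N' = (SOME W. P N N' W)" for N N'
  have "P N N' (W N N')" for N N' unfolding W_def by (rule someI_ex[OF ex])
  then have W: "W N N' \<in> borel_measurable M" "(\<integral>\<^sup>+\<omega>. W N N' \<omega> \<partial>M) \<le> ennreal (C * \<Lambda> (Suc (min N N')) ^ q)"
    "AE \<omega> in M. maj (2 * q) (X N \<omega> - X N' \<omega>) (W N N' \<omega>)" for N N' unfolding P_def by blast+
  define P0 where "P0 N W \<longleftrightarrow> W \<in> borel_measurable M \<and> (\<integral>\<^sup>+\<omega>. W \<omega> \<partial>M) \<le> ennreal (C * ((R ^ (k + l))\<^sup>2) ^ q) \<and>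
      (AE \<omega> in M. maj (2 * q) (X N \<omega>) (W \<omega>))" for N W
  have ex0: "\<exists>W. P0 N W" for N
  proof -
    let ?B = "freq_ball (Suc N)"
    have eq: "X N \<omega> t = dcoef k l ?B (cutoff (Suc N)) (cutoff (Suc N)) 0 t \<omega>" for \<omega> t
      unfolding wick_monomial_eq[OF finite_freq_ball' order_refl zero_less_Suc] dcoef_def by (simp add: fun_eq_iff)
    have co: "(cmod (wick_coef k l (cutoff (Suc N)) \<tau> - 0 * wick_coef k l (cutoff (Suc N)) \<tau>))\<^sup>2 \<le> (R ^ (k + l))\<^sup>2 * prod_list (map (\<lambda>q. wt (fst q) powr (- \<kappa>)) \<tau>)"
      if \<tau>: "\<tau> \<in> tuples (?B \<times> UNIV) (k + l)" for \<tau>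
    proof -
      have "cmod (wick_coef k l (cutoff (Suc N)) \<tau>) \<le> R ^ (k + l)"
        using \<tau> by (intro wick_coef_le R) (simp add: tuples_def)
      then have "(cmod (wick_coef k l (cutoff (Suc N)) \<tau>))\<^sup>2 \<le> (R ^ (k + l))\<^sup>2" by (intro power_mono) auto
      also have "\<dots> \<le> (R ^ (k + l))\<^sup>2 * prod_list (map (\<lambda>q. wt (fst q) powr (- \<kappa>)) \<tau>)"
        using mult_left_mono[OF prod_wt_ge1[OF \<kappa>, of \<tau>], of "(R ^ (k + l))\<^sup>2"] by simp
      finally show ?thesis by simp
    qed
    show ?thesis
      unfolding P0_def maj_def norm_wb eq by (rule mom[OF finite_freq_ball' zero_le_power2 co])
  qed
  define W0 where "W0 N = (SOME W. P0 N W)" for N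
  have "P0 N (W0 N)" for N unfolding W0_def by (rule someI_ex[OF ex0])
  then have W0: "W0 N \<in> borel_measurable M" "(\<integral>\<^sup>+\<omega>. W0 N \<omega> \<partial>M) \<le> ennreal (C * ((R ^ (k + l))\<^sup>2) ^ q)"
    "AE \<omega> in M. maj (2 * q) (X N \<omega>) (W0 N \<omega>)" for N unfolding P0_def by blast+
  (* the second term only makes the bound positive *)
  define e where "e N = C * \<Lambda> (Suc N) ^ q + 1 / real (Suc N)" for N
  have e_pos: "e N > 0" for N using C \<Lambda>[of "Suc N"] by (simp add: e_def add_nonneg_pos)
  have "(\<lambda>N. 4 * (inverse (real (Suc N)))\<^sup>2) \<longlonglongrightarrow> 4 * 0\<^sup>2"
    by (intro tendsto_mult tendsto_power tendsto_const LIMSEQ_inverse_real_of_nat)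
  then have "(\<lambda>N. 4 / (real (Suc N))\<^sup>2) \<longlonglongrightarrow> 0"
    by (simp add: power_inverse divide_inverse del: of_nat_Suc)
  then have "(\<lambda>N. (4 / (real (Suc N))\<^sup>2) powr \<kappa>) \<longlonglongrightarrow> 0 powr \<kappa>"
    using \<kappa> by (intro tendsto_powr') (auto intro!: tendsto_const)
  then have "(\<lambda>N. (4 / (real (Suc N))\<^sup>2) powr \<kappa>) \<longlonglongrightarrow> 0" using \<kappa> by simp
  then have "(\<lambda>N. \<Lambda> (Suc N)) \<longlonglongrightarrow> 0" unfolding \<Lambda>_def by (rule tendsto_mult_right_zero)
  then have "(\<lambda>N. \<Lambda> (Suc N) ^ q) \<longlonglongrightarrow> 0 ^ q" by (rule tendsto_power)
  then have "(\<lambda>N. C * \<Lambda> (Suc N) ^ q + 1 / real (Suc N)) \<longlonglongrightarrow> C * 0 ^ q + 0"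
    by (intro tendsto_add tendsto_mult tendsto_const LIMSEQ_inverse_real_of_nat[unfolded inverse_eq_divide])
  then have e: "e \<longlonglongrightarrow> 0" unfolding e_def[abs_def] using zero_power[OF q(1), where 'a = real] by simp
  let ?D = "\<lambda>i. coded_path (from_nat i)" and ?G = "\<lambda>N i. path_dist (from_nat i) N"
  interpret L: Lp_cauchy_data \<phi>\<^sub>0 \<epsilon> T M X "2 * q" p W W0 e "\<lambda>N. C * ((R ^ (k + l))\<^sup>2) ^ q" ?D ?G
  proof (unfold_locales, goal_cases)
    case (7 N N')
    have "C * \<Lambda> (Suc (min N N')) ^ q \<le> e (min N N')" by (simp add: e_def)
    then show ?case using W(2)[of N N'] by (meson ennreal_leI order_trans)
  next
    case (14 N)
    show ?case using path_dist_bound[of N] by eventually_elim blast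
  next
    case (15 N)
    show ?case using path_dist_small[of N]
    proof eventually_elim
      fix \<omega> assume *: "\<forall>e>0. \<exists>L. path_dist L N \<omega> < e"
      show "\<forall>e>0. \<exists>i. path_dist (from_nat i) N \<omega> < e"
      proof (intro allI impI)
        fix e :: ennreal assume "e > 0"
        then obtain L where "path_dist L N \<omega> < e" using * by blast
        then show "\<exists>i. path_dist (from_nat i) N \<omega> < e" by (intro exI[of _ "to_nat L"]) simp
      qed
    qed
  next
    case 1 then show ?case by (rule p)
  next
    case 2 then show ?case using q by simp
  next
    case 3 then show ?case by (rule X_CT)
  next
    case 4 then show ?case by (rule W(1))
  next
    case 5 then show ?case by (rule W0(1))
  next
    case 6 then show ?case by (rule W(3))
  next
    case 8 then show ?case by (rule e)
  next
    case 9 then show ?case by (rule e_pos)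
  next
    case 10 then show ?case by (rule W0(3))
  next
    case 11 then show ?case by (rule W0(2))
  next
    case 12 then show ?case by (rule coded_path_CT)
  next
    case 13 then show ?case by (rule path_dist_measurable)
  qed
  show ?thesis using L.X_Cauchy L.Lp_limit_Y by blast
qed

end

theorem proposition1p1:
  fixes M :: "'w measure"
    and \<beta> Z :: "int \<times> int \<Rightarrow> real \<Rightarrow> 'w \<Rightarrow> complex"
    and \<phi>\<^sub>0 \<rho> :: "real \<times> real \<Rightarrow> real"
    and a\<^sub>1 a\<^sub>2 \<gamma> T p \<epsilon> :: real
    and k l :: nat
  assumes "a\<^sub>1 > 0" and "\<gamma> > 0"
    and "smooth \<phi>\<^sub>0"
    and "\<And>\<xi>. norm \<xi> \<le> 5/8 \<Longrightarrow> \<phi>\<^sub>0 \<xi> = 1" and "\<And>\<xi>. norm \<xi> \<ge> 8/5 \<Longrightarrow> \<phi>\<^sub>0 \<xi> = 0"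
    and "smooth \<rho>"
    and "\<And>\<xi>. norm \<xi> \<le> 1/2 \<Longrightarrow> \<rho> \<xi> = 1" and "\<And>\<xi>. norm \<xi> \<ge> 1 \<Longrightarrow> \<rho> \<xi> = 0"
    and "prob_space M"
    and "\<And>n. complex_BM M (\<beta> n)"
    and "prob_space.indep_vars M (\<lambda>_. PiM UNIV (\<lambda>_::real. borel)) (\<lambda>n \<omega> t. \<beta> n t \<omega>) UNIV"
    and "\<And>n. OU_process M (\<beta> n) (decay_rate a\<^sub>1 a\<^sub>2 n) (Z n)"
    and "T > 0" and "p \<ge> 1" and "\<epsilon> > 0"
  shows "Lp_Cauchy M (CT \<phi>\<^sub>0 (- \<epsilon>) T) (CT_norm \<phi>\<^sub>0 (- \<epsilon>) T) p
           (\<lambda>N. wick_monomial M \<gamma> \<rho> Z l k (Suc N))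
       \<and> (\<exists>Y. Lp_limit M (CT \<phi>\<^sub>0 (- \<epsilon>) T) (CT_norm \<phi>\<^sub>0 (- \<epsilon>) T) p
           (\<lambda>N. wick_monomial M \<gamma> \<rho> Z l k (Suc N)) Y)
       \<and> (\<forall>Y. Lp_limit M (CT \<phi>\<^sub>0 (- \<epsilon>) T) (CT_norm \<phi>\<^sub>0 (- \<epsilon>) T) p
           (\<lambda>N. wick_monomial M \<gamma> \<rho> Z l k (Suc N)) Y \<longrightarrow>
           (AE \<omega> in M. Y \<omega> \<in> CT \<phi>\<^sub>0 (- \<epsilon>) T))"
proof -
  interpret prob_space M by fact
  interpret F: truncated_field M \<phi>\<^sub>0 \<beta> a\<^sub>1 a\<^sub>2 Z \<epsilon> T \<gamma> \<rho> l k
    by unfold_locales (use assms in auto)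
  show ?thesis
    using F.convergence[OF \<open>p \<ge> 1\<close>] by (auto simp: Lp_limit_def Lp_def)
qed

end
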